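(* Let $1\le l\le d$, $T>0$, $\mathrm{x}_0\in\mathbb{R}^d$, $\mathrm{a}\in\mathbb{R}^l$, and let $\sigma_0,\sigma_1,\dots,\sigma_m$ be smooth vector fields on $\mathbb{R}^d$, bounded with bounded derivatives of all orders, satisfying the weak Hörmander condition at $\mathrm{x}_0$. Let $\mathrm{h}_0\in\mathcal{K}_{\mathrm{a}}^{\min}$ be a minimizing control such that the deterministic Malliavin covariance matrix $C(\mathrm{h}_0)$ is invertible, and let $\mathrm{p}_0=\mathrm{p}_0(\mathrm{h}_0)\in\mathcal{T}_{\mathrm{x}_0}^*\mathbb{R}^d$ be the associated covector. Then the following are equivalent: (iii) $\mathrm{h}_0$ is a non-degenerate minimum of the energy $I:=\tfrac12\|\cdot\|_H^2\big|_{\mathcal{K}_{\mathrm{a}}}$, in the sense that $I''(\mathrm{h}_0)[\mathrm{k},\mathrm{k}]>0$ for all $0\ne\mathrm{k}\in\mathcal{T}_{\mathrm{h}_0}\mathcal{K}_{\mathrm{a}}\subset H$; (iii') $\mathrm{x}_0$ is non-focal for $N_{\mathrm{a}}=(\mathrm{a},\cdot)$ along $\mathrm{h}_0$, in the sense that, with $(\mathrm{x}_T,\mathrm{p}_T):=\mathrm{H}_{T\leftarrow0}(\mathrm{x}_0,\mathrm{p}_0(\mathrm{h}_0))\in\mathcal{T}^*\mathbb{R}^d$, the $d\times d$ matrix $$\partial_{(\mathfrak{z},\mathfrak{q})}\big|_{(\mathfrak{z},\mathfrak{q})=(0,0)}\ \pi\mathrm{H}_{0\leftarrow T}\Bigl(\mathrm{x}_T+\begin{pmatrix}0\\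 \mathfrak{z}\end{pmatrix},\ \mathrm{p}_T+(\mathfrak{q},0)\Bigr),\qquad(\mathfrak{z},\mathfrak{q})\in\mathbb{R}^{d-l}\times\mathbb{R}^l\cong\mathbb{R}^d,$$ is non-degenerate.
   Context: Weak Hörmander condition at $\mathrm{x}_0$: the span at $\mathrm{x}_0$ of $\sigma_1,\dots,\sigma_m$ and all iterated Lie brackets of $\sigma_0,\dots,\sigma_m$ is $\mathbb{R}^d$. $\Pi_l(x^1,\dots,x^d)=(x^1,\dots,x^l)$; $N_{\mathrm{a}}=\{\mathrm{x}\in\mathbb{R}^d:\Pi_l\mathrm{x}=\mathrm{a}\}$. $H$ is the Cameron–Martin space of absolutely continuous $\mathrm{h}=(h^1,\dots,h^m):[0,T]\to\mathbb{R}^m$, $\mathrm{h}(0)=0$, $\dot{\mathrm{h}}\in L^2$, $\|\mathrm{h}\|_H^2=\sum_i\int_0^T|\dot h^i_t|^2dt$. $\phi_t(\mathrm{h})=\phi_t^{\mathrm{h}}(\mathrm{x}_0)$ solves $d\phi_t=\sigma_0(\phi_t)dt+\sum_{i=1}^m\sigma_i(\phi_t)dh_t^i$, $\phi_0=\mathrm{x}_0$. $\mathcal{K}_{\mathrm{a}}=\{\mathrm{h}\in H:\Pi_l\phi_T(\mathrm{h})=\mathrm{a}\}$; $\mathcal{K}_{\mathrm{a}}^{\min}$ is the set of $\mathrm{h}\in\mathcal{K}_{\mathrm{a}}$ minimizing $\tfrac12\|\mathrm{h}\|_H^2$ over $\mathcal{K}_{\mathrm{a}}$. $C(\mathrm{h})=(\langle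 D\phi_T^i(\mathrm{h}),D\phi_T^j(\mathrm{h})\rangle_H)_{1\le i,j\le d}$ with $D$ the Fréchet derivative in $\mathrm{h}$. When $C(\mathrm{h}_0)$ is invertible, $\mathcal{K}_{\mathrm{a}}$ is, near $\mathrm{h}_0$, a Hilbert submanifold of $H$ with tangent space $\mathcal{T}_{\mathrm{h}_0}\mathcal{K}_{\mathrm{a}}=\ker D(\Pi_l\circ\phi_T)(\mathrm{h}_0)$; $I''(\mathrm{h}_0)$ is the Hessian of $I$ at its critical point $\mathrm{h}_0$, i.e. $I''(\mathrm{h}_0)[\mathrm{k},\mathrm{k}]=\frac{d^2}{dt^2}|_{t=0}I(c(t))$ for any smooth curve $c$ in $\mathcal{K}_{\mathrm{a}}$ with $c(0)=\mathrm{h}_0$, $\dot c(0)=\mathrm{k}$. Hamiltonian $\mathcal{H}(\mathrm{x},\mathrm{p})=\langle\mathrm{p},\sigma_0(\mathrm{x})\rangle+\tfrac12\sum_{i=1}^m\langle\mathrm{p},\sigma_i(\mathrm{x})\rangle^2$ on $\mathcal{T}^*\mathbb{R}^d\cong\mathbb{R}^d\oplus\mathbb{R}^d$; $\mathrm{H}_{t\leftarrow s}$ is the (complete) flow from time $s$ to time $t$ of $(\partial_{\mathrm{p}}\mathcal{H},-\partial_{\mathrm{x}}\mathcal{H})$; $\pi(\mathrm{x},\mathrm{p})=\mathrm{x}$. Associated covector: $\mathrm{p}_0(\mathrm{h}_0)$ is the unique element of $\mathcal{T}^*_{\mathrm{x}_0}\mathbb{R}^d$ such that $\phi_t^{\mathrm{h}_0}(\mathrm{x}_0)=\pi\mathrm{H}_{t\leftarrow0}(\mathrm{x}_0,\mathrm{p}_0)$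 for $0\le t\le T$ (it exists and is unique under the stated assumptions). *)

theory Defs
  imports "HOL-Analysis.Analysis"
begin

type_synonym 'd rvec = "(real, 'd) vec"
type_synonym 'd vfield = "'d rvec \<Rightarrow> 'd rvec"
type_synonym 'm rpath = "real \<Rightarrow> 'm rvec"

section \<open>Vector fields\<close>

primrec iter_dir_deriv ::
  "'a::real_normed_vector list \<Rightarrow> ('a \<Rightarrow> 'b::real_normed_vector) \<Rightarrow> 'a \<Rightarrow> 'b" where
  "iter_dir_deriv [] f = f"
| "iter_dir_deriv (v # vs) f = (\<lambda>x. frechet_derivative (iter_dir_deriv vs f) (at x) v)"

text \<open>All iterated directional derivatives, the function itself included (empty list),
  exist in the Frechet sense and are bounded.\<close>

definition Cb_infinity :: "('a::real_normed_vector \<Rightarrow> 'b::real_normed_vector) \<Rightarrow> bool" where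
  "Cb_infinity f \<longleftrightarrow>
     (\<forall>vs. (\<forall>x. iter_dir_deriv vs f differentiable (at x)) \<and> bounded (range (iter_dir_deriv vs f)))"

definition lie_bracket ::
  "('a::real_normed_vector \<Rightarrow> 'a) \<Rightarrow> ('a \<Rightarrow> 'a) \<Rightarrow> 'a \<Rightarrow> 'a" where
  "lie_bracket V W = (\<lambda>x. frechet_derivative W (at x) (V x) - frechet_derivative V (at x) (W x))"

inductive_set bracket_closure ::
  "('a::real_normed_vector \<Rightarrow> 'a) \<Rightarrow> ('m \<Rightarrow> 'a \<Rightarrow> 'a) \<Rightarrow> ('a \<Rightarrow> 'a) set"
  for \<sigma>\<^sub>0 and \<sigma> where
  drift: "\<sigma>\<^sub>0 \<in> bracket_closure \<sigma>\<^sub>0 \<sigma>"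
| diffusion: "\<sigma> i \<in> bracket_closure \<sigma>\<^sub>0 \<sigma>"
| bracket: "V \<in> bracket_closure \<sigma>\<^sub>0 \<sigma> \<Longrightarrow> W \<in> bracket_closure \<sigma>\<^sub>0 \<sigma> \<Longrightarrow>
    lie_bracket V W \<in> bracket_closure \<sigma>\<^sub>0 \<sigma>"

text \<open>The drift itself is not in the spanning set; it enters only through brackets.\<close>

definition weak_hoermander ::
  "('a::real_normed_vector \<Rightarrow> 'a) \<Rightarrow> ('m::finite \<Rightarrow> 'a \<Rightarrow> 'a) \<Rightarrow> 'a \<Rightarrow> bool" where
  "weak_hoermander \<sigma>\<^sub>0 \<sigma> x\<^sub>0 \<longleftrightarrow>
     span ({\<sigma> i x\<^sub>0 | i. True} \<union>
           {lie_bracket V W x\<^sub>0 | V W.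
              V \<in> bracket_closure \<sigma>\<^sub>0 \<sigma> \<and> W \<in> bracket_closure \<sigma>\<^sub>0 \<sigma>}) = UNIV"

section \<open>The Cameron--Martin space\<close>

definition absolutely_continuous_on ::
  "real set \<Rightarrow> (real \<Rightarrow> 'a::real_normed_vector) \<Rightarrow> bool" where
  "absolutely_continuous_on S f \<longleftrightarrow>
     (\<forall>\<epsilon>>0. \<exists>\<delta>>0. \<forall>D U. D division_of U \<and> U \<subseteq> S \<and> (\<Sum>J\<in>D. measure lborel J) < \<delta> \<longrightarrow>
        (\<Sum>J\<in>D. norm (f (Sup J) - f (Inf J))) < \<epsilon>)"

abbreviation path_deriv :: "(real \<Rightarrow> 'a::real_normed_vector) \<Rightarrow> real \<Rightarrow> 'a" where
  "path_deriv h t \<equiv> vector_derivative h (at t)"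

text \<open>Paths on \<open>{0..T}\<close> are represented by functions that vanish outside \<open>{0..T}\<close>, so that equal
  paths are equal functions.\<close>

definition CM :: "real \<Rightarrow> 'm::finite rpath set" where
  "CM T = {h. (\<forall>t. t \<notin> {0..T} \<longrightarrow> h t = 0) \<and> h 0 = 0 \<and> absolutely_continuous_on {0..T} h \<and>
              (\<lambda>t. (norm (path_deriv h t))\<^sup>2) absolutely_integrable_on {0..T}}"

definition cm_inner :: "real \<Rightarrow> 'm::finite rpath \<Rightarrow> 'm rpath \<Rightarrow> real" where
  "cm_inner T h k = integral {0..T} (\<lambda>t. path_deriv h t \<bullet> path_deriv k t)"

definition cm_norm :: "real \<Rightarrow> 'm::finite rpath \<Rightarrow> real" where
  "cm_norm T h = sqrt (cm_inner T h h)"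

definition energy :: "real \<Rightarrow> 'm::finite rpath \<Rightarrow> real" where
  "energy T h = (cm_norm T h)\<^sup>2 / 2"

text \<open>Frechet derivatives on the Hilbert space \<^term>\<open>CM T\<close>, which depends on the real number
  \<open>T\<close> and is hence a carrier set rather than a type.\<close>

definition cm_has_derivative ::
  "real \<Rightarrow> ('m::finite rpath \<Rightarrow> 'b::real_normed_vector) \<Rightarrow> ('m rpath \<Rightarrow> 'b) \<Rightarrow>
   'm rpath \<Rightarrow> bool" where
  "cm_has_derivative T F A h \<longleftrightarrow>
     (\<forall>k\<in>CM T. \<forall>k'\<in>CM T. A (\<lambda>t. k t + k' t) = A k + A k') \<and>
     (\<forall>r. \<forall>k\<in>CM T. A (\<lambda>t. r *\<^sub>R k t) = r *\<^sub>R A k) \<and>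
     (\<exists>B. \<forall>k\<in>CM T. norm (A k) \<le> B * cm_norm T k) \<and>
     (\<forall>\<epsilon>>0. \<exists>\<delta>>0. \<forall>k\<in>CM T. cm_norm T k < \<delta> \<longrightarrow>
        norm (F (\<lambda>t. h t + k t) - F h - A k) \<le> \<epsilon> * cm_norm T k)"

definition cm_derivative ::
  "real \<Rightarrow> ('m::finite rpath \<Rightarrow> 'b::real_normed_vector) \<Rightarrow> 'm rpath \<Rightarrow> 'm rpath \<Rightarrow> 'b" where
  "cm_derivative T F h = (SOME A. cm_has_derivative T F A h)"

text \<open>The Riesz representative of the derivative of a real-valued functional.\<close>

definition cm_gradient ::
  "real \<Rightarrow> ('m::finite rpath \<Rightarrow> real) \<Rightarrow> 'm rpath \<Rightarrow> 'm rpath" where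
  "cm_gradient T F h =
     (THE g. g \<in> CM T \<and> (\<forall>k\<in>CM T. cm_derivative T F h k = cm_inner T g k))"

definition cm_curve_has_derivative ::
  "real \<Rightarrow> (real \<Rightarrow> 'm::finite rpath) \<Rightarrow> 'm rpath \<Rightarrow> real \<Rightarrow> bool" where
  "cm_curve_has_derivative T c k s \<longleftrightarrow>
     ((\<lambda>r. cm_norm T (\<lambda>t. (1 / (r - s)) *\<^sub>R (c r t - c s t) - k t)) \<longlongrightarrow> 0) (at s)"

definition cm_smooth_curve :: "real \<Rightarrow> real set \<Rightarrow> (real \<Rightarrow> 'm::finite rpath) \<Rightarrow> bool" where
  "cm_smooth_curve T S c \<longleftrightarrow>
     (\<exists>C. C 0 = c \<and> (\<forall>n. \<forall>s\<in>S. C n s \<in> CM T \<and>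
        cm_curve_has_derivative T (C n) (C (Suc n) s) s))"

section \<open>The controlled equation\<close>

definition control_solution ::
  "'d::finite vfield \<Rightarrow> ('m::finite \<Rightarrow> 'd vfield) \<Rightarrow> real \<Rightarrow> 'd rvec \<Rightarrow>
   'm rpath \<Rightarrow> (real \<Rightarrow> 'd rvec) \<Rightarrow> bool" where
  "control_solution \<sigma>\<^sub>0 \<sigma> T x\<^sub>0 h y \<longleftrightarrow>
     continuous_on {0..T} y \<and>
     (\<forall>t\<in>{0..T}. ((\<lambda>s. \<sigma>\<^sub>0 (y s) + (\<Sum>i\<in>UNIV. (path_deriv h s $ i) *\<^sub>R \<sigma> i (y s)))
        has_integral (y t - x\<^sub>0)) {0..t})"

definition control_flow ::
  "'d::finite vfield \<Rightarrow> ('m::finite \<Rightarrow> 'd vfield) \<Rightarrow> real \<Rightarrow> 'd rvec \<Rightarrow>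
   real \<Rightarrow> 'm rpath \<Rightarrow> 'd rvec" where
  "control_flow \<sigma>\<^sub>0 \<sigma> T x\<^sub>0 t h = (THE x. \<exists>y. control_solution \<sigma>\<^sub>0 \<sigma> T x\<^sub>0 h y \<and> x = y t)"

definition malliavin_matrix ::
  "'d::finite vfield \<Rightarrow> ('m::finite \<Rightarrow> 'd vfield) \<Rightarrow> real \<Rightarrow> 'd rvec \<Rightarrow>
   'm rpath \<Rightarrow> real ^ 'd ^ 'd" where
  "malliavin_matrix \<sigma>\<^sub>0 \<sigma> T x\<^sub>0 h =
     (\<chi> i j. cm_inner T (cm_gradient T (\<lambda>k. control_flow \<sigma>\<^sub>0 \<sigma> T x\<^sub>0 T k $ i) h)
                        (cm_gradient T (\<lambda>k. control_flow \<sigma>\<^sub>0 \<sigma> T x\<^sub>0 T k $ j) h))"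

section \<open>Projection and admissible controls\<close>

text \<open>With \<^term>\<open>CARD('l) \<le> CARD('d)\<close>, \<open>lead_index\<close> is the order embedding of \<open>'l\<close> onto the
  first \<^term>\<open>CARD('l)\<close> indices of \<open>'d\<close>.\<close>

definition lead_index :: "'l::{finite,linorder} \<Rightarrow> 'd::{finite,linorder}" where
  "lead_index i = (THE j. card {..<j} = card {..<i})"

definition proj_lead :: "'d::{finite,linorder} rvec \<Rightarrow> 'l::{finite,linorder} rvec" where
  "proj_lead x = (\<chi> i. x $ lead_index i)"

definition admissible ::
  "'d::{finite,linorder} vfield \<Rightarrow> ('m::finite \<Rightarrow> 'd vfield) \<Rightarrow> real \<Rightarrow>
   'd rvec \<Rightarrow> 'l::{finite,linorder} rvec \<Rightarrow> 'm rpath set" where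
  "admissible \<sigma>\<^sub>0 \<sigma> T x\<^sub>0 a = {h \<in> CM T. proj_lead (control_flow \<sigma>\<^sub>0 \<sigma> T x\<^sub>0 T h) = a}"

definition minimizing ::
  "'d::{finite,linorder} vfield \<Rightarrow> ('m::finite \<Rightarrow> 'd vfield) \<Rightarrow> real \<Rightarrow>
   'd rvec \<Rightarrow> 'l::{finite,linorder} rvec \<Rightarrow> 'm rpath set" where
  "minimizing \<sigma>\<^sub>0 \<sigma> T x\<^sub>0 a =
     {h \<in> admissible \<sigma>\<^sub>0 \<sigma> T x\<^sub>0 a. \<forall>k\<in>admissible \<sigma>\<^sub>0 \<sigma> T x\<^sub>0 a. energy T h \<le> energy T k}"

text \<open>The tangent space at \<open>h\<close> of the set of controls with the given projected endpoint.
  The type of \<open>a\<close> only serves to fix the target dimension of the projection.\<close>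

definition admissible_tangent ::
  "'d::{finite,linorder} vfield \<Rightarrow> ('m::finite \<Rightarrow> 'd vfield) \<Rightarrow> real \<Rightarrow>
   'd rvec \<Rightarrow> 'l::{finite,linorder} rvec \<Rightarrow> 'm rpath \<Rightarrow> 'm rpath set" where
  "admissible_tangent \<sigma>\<^sub>0 \<sigma> T x\<^sub>0 a h =
     {k \<in> CM T. cm_derivative T
        (\<lambda>h. proj_lead (control_flow \<sigma>\<^sub>0 \<sigma> T x\<^sub>0 T h) :: 'l rvec) h k = 0}"

text \<open>The Hessian on the diagonal: the common value, over all smooth curves \<open>c\<close> in \<open>K\<close> with
  \<open>c 0 = h\<close> and velocity \<open>k\<close> at \<open>0\<close>, of the second derivative of the energy along \<open>c\<close>.\<close>

definition energy_hessian ::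
  "real \<Rightarrow> 'm::finite rpath set \<Rightarrow> 'm rpath \<Rightarrow> 'm rpath \<Rightarrow> real" where
  "energy_hessian T K h k =
     (THE r. \<forall>c. (\<exists>\<epsilon>>0. cm_smooth_curve T {-\<epsilon><..<\<epsilon>} c \<and> c ` {-\<epsilon><..<\<epsilon>} \<subseteq> K) \<and>
                 c 0 = h \<and> cm_curve_has_derivative T c k 0 \<longrightarrow>
                 deriv (deriv (\<lambda>s. energy T (c s))) 0 = r)"

section \<open>The Hamiltonian flow\<close>

definition hamiltonian ::
  "'d::finite vfield \<Rightarrow> ('m::finite \<Rightarrow> 'd vfield) \<Rightarrow> 'd rvec \<Rightarrow> 'd rvec \<Rightarrow> real"
  where
  "hamiltonian \<sigma>\<^sub>0 \<sigma> x p = p \<bullet> \<sigma>\<^sub>0 x + (\<Sum>i\<in>UNIV. (p \<bullet> \<sigma> i x)\<^sup>2) / 2"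

definition grad :: "('a::real_inner \<Rightarrow> real) \<Rightarrow> 'a \<Rightarrow> 'a" where
  "grad f x = (THE v. GDERIV f x :> v)"

definition hamiltonian_field ::
  "'d::finite vfield \<Rightarrow> ('m::finite \<Rightarrow> 'd vfield) \<Rightarrow>
   'd rvec \<times> 'd rvec \<Rightarrow> 'd rvec \<times> 'd rvec" where
  "hamiltonian_field \<sigma>\<^sub>0 \<sigma> = (\<lambda>(x, p).
     (grad (\<lambda>q. hamiltonian \<sigma>\<^sub>0 \<sigma> x q) p, - grad (\<lambda>y. hamiltonian \<sigma>\<^sub>0 \<sigma> y p) x))"

definition hamiltonian_orbit ::
  "'d::finite vfield \<Rightarrow> ('m::finite \<Rightarrow> 'd vfield) \<Rightarrow> real \<Rightarrow> real \<Rightarrow>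
   'd rvec \<times> 'd rvec \<Rightarrow> (real \<Rightarrow> 'd rvec \<times> 'd rvec) \<Rightarrow> bool" where
  "hamiltonian_orbit \<sigma>\<^sub>0 \<sigma> t s z \<zeta> \<longleftrightarrow>
     \<zeta> s = z \<and>
     (\<forall>r\<in>closed_segment s t. (\<zeta> has_vector_derivative hamiltonian_field \<sigma>\<^sub>0 \<sigma> (\<zeta> r))
        (at r within closed_segment s t))"

text \<open>\<open>hamiltonian_flow \<sigma>\<^sub>0 \<sigma> t s\<close> is the flow from time \<open>s\<close> to time \<open>t\<close>. Boundedness
  of the vector fields does not exclude explosion of the covector, so completeness is not built in:
  a value is meaningful only at points of \<open>hamiltonian_dom\<close>.\<close>

definition hamiltonian_dom ::
  "'d::finite vfield \<Rightarrow> ('m::finite \<Rightarrow> 'd vfield) \<Rightarrow> real \<Rightarrow> real \<Rightarrow>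
   ('d rvec \<times> 'd rvec) set" where
  "hamiltonian_dom \<sigma>\<^sub>0 \<sigma> t s = {z. \<exists>\<zeta>. hamiltonian_orbit \<sigma>\<^sub>0 \<sigma> t s z \<zeta>}"

definition hamiltonian_flow ::
  "'d::finite vfield \<Rightarrow> ('m::finite \<Rightarrow> 'd vfield) \<Rightarrow> real \<Rightarrow> real \<Rightarrow>
   'd rvec \<times> 'd rvec \<Rightarrow> 'd rvec \<times> 'd rvec" where
  "hamiltonian_flow \<sigma>\<^sub>0 \<sigma> t s z = (THE w. \<exists>\<zeta>. hamiltonian_orbit \<sigma>\<^sub>0 \<sigma> t s z \<zeta> \<and> w = \<zeta> t)"

definition associated_covector ::
  "'d::finite vfield \<Rightarrow> ('m::finite \<Rightarrow> 'd vfield) \<Rightarrow> real \<Rightarrow> 'd rvec \<Rightarrow>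
   'm rpath \<Rightarrow> 'd rvec" where
  "associated_covector \<sigma>\<^sub>0 \<sigma> T x\<^sub>0 h =
     (THE p. \<forall>t\<in>{0..T}. (x\<^sub>0, p) \<in> hamiltonian_dom \<sigma>\<^sub>0 \<sigma> t 0 \<and>
        control_flow \<sigma>\<^sub>0 \<sigma> T x\<^sub>0 t h = fst (hamiltonian_flow \<sigma>\<^sub>0 \<sigma> t 0 (x\<^sub>0, p)))"

text \<open>For an index set \<open>L\<close>, the pair of variations \<open>(z, q)\<close> is encoded in one vector \<open>w\<close>:
  its components in \<open>L\<close> are \<open>q\<close>, the others are \<open>z\<close>. Thus \<^term>\<open>restrict_coords (- L) w\<close> is
  the vector \<open>(0, z)\<close> and \<^term>\<open>restrict_coords L w\<close> the covector \<open>(q, 0)\<close>.\<close>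

definition restrict_coords :: "'d::finite set \<Rightarrow> 'd rvec \<Rightarrow> 'd rvec" where
  "restrict_coords L w = (\<chi> i. if i \<in> L then w $ i else 0)"

definition focal_matrix ::
  "'d::finite vfield \<Rightarrow> ('m::finite \<Rightarrow> 'd vfield) \<Rightarrow> real \<Rightarrow>
   'd set \<Rightarrow> ('d rvec \<times> 'd rvec) \<Rightarrow> real ^ 'd ^ 'd" where
  "focal_matrix \<sigma>\<^sub>0 \<sigma> T L = (\<lambda>(x, p).
     jacobian (\<lambda>w. fst (hamiltonian_flow \<sigma>\<^sub>0 \<sigma> 0 T
       (x + restrict_coords (- L) w, p + restrict_coords L w))) (at 0))"

end

(*
  Let h be the minimizing control and r the Lagrange multiplier of the endpoint constraint: the final
  value of the covector p solving the adjoint equation along the orbit of h, so that h' = <p, sigma_i(x)>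
  and (x, p) is the Hamiltonian orbit of the associated covector. Expanding the energy and <r, phi_T> to
  second order identifies the Hessian with a quadratic form Q(k) = |k|^2 - <r, D^2 phi_T(h)[k, k]> on the
  tangent space, since invertibility of the Malliavin matrix makes every tangent vector the velocity
  of a smooth admissible curve. Minimality gives Q >= 0, so Q is degenerate exactly when it has a null
  vector, i.e. a tangent k with Q(k, .) = 0 on the tangent space. By the linear adjoint equation, such a k
  corresponds to a solution of the linearised Hamiltonian system with vanishing position part at time 0
  and conormal/tangential boundary values at time T, i.e. to a kernel vector of the focal matrix.
*)
theory Submission
 imports Defs
begin

text \<open>The Hessian is defined through smooth curves inside the constraint set, so curves with a
  prescribed velocity have to be produced. An inverse function argument corrects the ray h + s k by
  finitely many fixed directions along which the projected endpoint can be steered. This gives a C^1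
  correction only; its higher derivatives come from a class of functions that contains all
  coefficients and is closed under differentiation. The multiplier lives on the leading coordinates,
  hence <r, phi_T> is constant on the constraint set; subtracting it from the energy removes the
  linear term, and so the acceleration of the curve never enters the Hessian. Controls are merely
  square integrable in time: equations are kept in integrated form, densities are compared almost
  everywhere, and the Gronwall and Picard estimates carry L2 coefficients. Only after the critical
  point equation is inserted does the extremal solve an autonomous C^1 system. The Hamiltonian field
  is quadratic in the covector and may explode, so its flow is differentiated only near the
  reference orbit.\<close>

notation scaleR (infixr "*R" 75)

section \<open>Absolutely continuous functions are indefinite integrals\<close>

lemma absolutely_continuous_on_imp_continuous_on:
 fixes f :: "real => 'a::real_normed_vector"
 assumes "absolutely_continuous_on {a..b} f"
 shows "continuous_on {a..b} f"
proof (rule continuous_onI)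
 fix x e :: real assume x: "x : {a..b}" and e: "e > 0"
 obtain d where d: "d > 0" "!!D U. D division_of U ==> U \<subseteq> {a..b} ==> (SUM J:D. measure lborel J) < d ==>
    (SUM J:D. norm (f (Sup J) - f (Inf J))) < e"
  using assms e unfolding absolutely_continuous_on_def by meson
 show "EX d>0. ALL x':{a..b}. dist x' x < d --> dist (f x') (f x) <= e"
 proof (intro exI conjI ballI impI)
  fix y assume y: "y : {a..b}" "dist y x < d"
  have "{{min x y..max x y}} division_of {min x y..max x y}"
   using division_of_self[of "min x y" "max x y"] by simp
  moreover have "{min x y..max x y} \<subseteq> {a..b}" using x y by auto
  moreover have "(SUM J:{{min x y..max x y}}. measure lborel J) < d"
   using y by (auto simp: dist_real_def min_def max_def)
  ultimately have "(SUM J:{{min x y..max x y}}. norm (f (Sup J) - f (Inf J))) < e" by (rule d(2))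
  then show "dist (f y) (f x) <= e"
   by (auto simp: min_def max_def dist_norm norm_minus_commute split: if_splits)
 qed (use d in auto)
qed

lemma real_division_of_interval:
 fixes D :: "real set set"
 assumes "D division_of U" "J : D"
 shows "J = {Inf J..Sup J}" "Inf J <= Sup J" "measure lborel J = Sup J - Inf J"
proof -
 obtain a b where "J = cbox a b" "J ~= {}" using division_ofD(3,4)[OF assms] by blast
 then have *: "J = {a..b}" "a <= b" by auto
 then show "J = {Inf J..Sup J}" "Inf J <= Sup J" "measure lborel J = Sup J - Inf J" by auto
qed

text \<open>The increments of an increasing \<open>F\<close> are the masses of a measure. This
  Lebesgue-Stieltjes measure is absolutely continuous with respect to Lebesgue measure, and its
  Radon-Nikodym density is the integrand.\<close>

lemma mono_absolutely_continuous_indefinite_integral: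
 fixes F :: "real => real"
 assumes T: "a <= b" and mono: "!!x y. a <= x ==> x <= y ==> y <= b ==> F x <= F y"
  and ac: "absolutely_continuous_on {a..b} F"
 obtains g where "g absolutely_integrable_on {a..b}"
  "!!t. t : {a..b} ==> (g has_integral F t - F a) {a..t}"
proof -
 \<comment> \<open>\<open>G\<close> is \<open>F\<close> frozen outside \<open>{a..b}\<close>:
   monotone and continuous on the whole line, as a Stieltjes measure requires, with no mass
   outside.\<close>
 define c where "c t = max a (min t b)" for t
 define G where "G t = F (c t)" for t
 have c: "c t : {a..b}" "continuous_on UNIV c" "mono c" "!!t. t : {a..b} ==> c t = t" for t
  using T unfolding c_def by (auto intro!: continuous_intros monoI)
 have contF: "continuous_on {a..b} F"
  using ac by (rule absolutely_continuous_on_imp_continuous_on)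
 have contG: "continuous_on UNIV G"
  unfolding G_def using c by (intro continuous_on_compose2[OF contF]) auto
 have monoG: "x <= y ==> G x <= G y" for x y
  unfolding G_def using c mono by (auto simp: mono_def)
 define nu where "nu = interval_measure G"
 have Icc: "emeasure nu {x..y} = ennreal (G y - G x)" if "x <= y" for x y
  unfolding nu_def using emeasure_interval_measure_Icc[OF that monoG contG] by simp
 have sets[simp, measurable_cong]: "sets nu = sets borel" unfolding nu_def by simp
 have "{..a} = (UN n::nat. {a - real n..a})"
 proof (intro equalityI subsetI)
  fix x assume "x : {..a}"
  then obtain n :: nat where "a - x <= real n" by (meson real_arch_simple)
  with \<open>x : {..a}\<close> show "x : (UN n::nat. {a - real n..a})" by (auto intro!: exI[of _ n])
 qed auto
 moreover have "{a - real n..a} : null_sets nu" for n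
  using Icc[of "a - real n" a] T by (auto simp: null_sets_def G_def c_def)
 ultimately have na: "{..a} : null_sets nu" by auto
 have "{b..} = (UN n::nat. {b..b + real n})"
 proof (intro equalityI subsetI)
  fix x assume "x : {b..}"
  then obtain n :: nat where "x - b <= real n" by (meson real_arch_simple)
  with \<open>x : {b..}\<close> show "x : (UN n::nat. {b..b + real n})" by (auto intro!: exI[of _ n])
 qed auto
 moreover have "{b..b + real n} : null_sets nu" for n
  using Icc[of b "b + real n"] T by (auto simp: null_sets_def G_def c_def)
 ultimately have nb: "{b..} : null_sets nu" by auto
 \<comment> \<open>The part of \<open>N\<close> in the open interval lies in an open set of Lebesgue
   measure below \<open>d\<close>. Writing that set as a countable union of boxes and passing to the
   limit over finite subunions brings in the epsilon-delta condition, which speaks of finite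
   divisions only.\<close>
 have small: "emeasure nu N = 0" if N: "N : null_sets lborel" for N
 proof -
  define N' where "N' = N \<inter> {a<..<b}"
  have Nb: "N : sets borel" using N by auto
  then have N'b: "N' : sets borel" unfolding N'_def by auto
  have N'0: "emeasure lborel N' = 0"
   using N unfolding N'_def by (metis Int_lower1 null_setsD1 null_setsD2 emeasure_mono le_zero_eq)
  have "emeasure nu N' <= ennreal e" if e: "e > 0" for e
  proof -
   obtain d where d: "d > 0" "!!D U. D division_of U ==> U \<subseteq> {a..b} ==> (SUM J:D. measure lborel J) < d ==>
     (SUM J:D. norm (F (Sup J) - F (Inf J))) < e"
    using ac e unfolding absolutely_continuous_on_def by meson
   obtain U0 where U0: "open U0" "N' \<subseteq> U0" "emeasure lborel (U0 - N') < ennreal d"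
    using outer_regular_lborel[OF N'b, of d] d by auto
   define U where "U = U0 \<inter> {a<..<b}"
   have U: "open U" "N' \<subseteq> U" "U \<subseteq> {a..b}" unfolding U_def using U0 N'_def by auto
   have U0b: "U0 : sets borel" using U0 by auto
   have "emeasure lborel U <= emeasure lborel U0"
    using U0b unfolding U_def by (intro emeasure_mono) auto
   also have "... <= emeasure lborel (U0 - N') + emeasure lborel N'"
   proof -
    have "emeasure lborel U0 = emeasure lborel ((U0 - N') \<union> N')" using U0(2) by (simp add: Un_absorb2)
    also have "... <= emeasure lborel (U0 - N') + emeasure lborel N'"
     using N'b U0b by (intro emeasure_subadditive) auto
    finally show ?thesis .
   qed
   also have "... < ennreal d" using U0 N'0 by simp
   finally have Ud: "emeasure lborel U < ennreal d" .
   obtain Dc where Dc: "countable Dc" "!!X. X : Dc ==> EX x y. X = cbox x y" "\<Union>Dc = U"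
    using open_countable_Union_open_cbox[OF U(1)] by metis
   \<comment> \<open>The boxes may overlap, so their union is first rewritten as a division.\<close>
   have fin: "emeasure nu (\<Union>Fc) <= ennreal e" if F: "finite Fc" "Fc \<subseteq> Dc" for Fc
   proof -
    obtain p where p: "p division_of \<Union>Fc"
     using elementary_unions_intervals[of Fc] F Dc(2) by (meson subsetD)
    note I = real_division_of_interval[OF p]
    have sub: "\<Union>Fc \<subseteq> U" using F Dc by auto
    have subp: "J \<subseteq> {a..b}" if "J : p" for J using division_ofD(2)[OF p that] sub U by auto
    have "(SUM J:p. measure lborel J) = measure lborel (\<Union>Fc)"
    proof -
     have "J : sets lborel" if "J : p" for J using I(1)[OF that] by (metis atLeastAtMost_borel sets_lborel)
     moreover have "\<Union>Fc : sets lborel"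
      using F Dc(2) by (auto intro!: borel_closed closed_Union; metis closed_cbox subsetD)
     ultimately show ?thesis using content_division[OF p] by (simp cong: sum.cong)
    qed
    also have "ennreal ... <= emeasure lborel (\<Union>Fc)" by (simp add: Sigma_Algebra.measure_def ennreal_enn2real_if)
    also have "... <= emeasure lborel U" using sub U by (intro emeasure_mono) auto
    also have "... < ennreal d" by (rule Ud)
    finally have "(SUM J:p. measure lborel J) < d"
     using d by (simp add: ennreal_less_iff sum_nonneg)
    then have lt: "(SUM J:p. norm (F (Sup J) - F (Inf J))) < e"
     using d(2)[OF p] sub U by auto
    have "emeasure nu (\<Union>Fc) = emeasure nu (UN J:p. J)" using division_ofD(6)[OF p] by simp
    also have "... <= (SUM J:p. emeasure nu J)"
    proof (rule emeasure_subadditive_finite)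
     show "(%J. J) ` p \<subseteq> sets nu" using I(1) by (auto; metis atLeastAtMost_borel)
    qed (use division_ofD(1)[OF p] in auto)
    also have "... <= (SUM J:p. ennreal (norm (F (Sup J) - F (Inf J))))"
    proof (rule sum_mono)
     fix J assume J: "J : p"
     have "Sup J : {a..b}" "Inf J : {a..b}" using subp[OF J] I[OF J]
      by (metis atLeastAtMost_iff order_refl subsetD)+
     then show "emeasure nu J <= ennreal (norm (F (Sup J) - F (Inf J)))"
      using I[OF J] Icc[of "Inf J" "Sup J"] c(4) by (simp add: G_def ennreal_leI)
    qed
    also have "... = ennreal (SUM J:p. norm (F (Sup J) - F (Inf J)))" by (simp add: sum_ennreal)
    also have "... <= ennreal e" using lt by (simp add: ennreal_leI)
    finally show ?thesis .
   qed
   have "emeasure nu U <= ennreal e"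
   proof (cases "Dc = {}")
    case True then show ?thesis using Dc by auto
   next
    case False
    define B where "B = from_nat_into Dc"
    have B: "range B = Dc" unfolding B_def using False Dc(1) by (simp add: range_from_nat_into)
    define C where "C n = (UN i:{..n}. B i)" for n
    have CU: "(UN n. C n) = U" unfolding C_def using B Dc(3) by (auto; blast)
    have Bb: "B i : sets borel" for i
    proof -
     have "B i : Dc" using B by blast
     then obtain x y where "B i = cbox x y" using Dc(2) by blast
     then show ?thesis by simp
    qed
    have "incseq C" unfolding C_def incseq_def by (intro allI impI UN_mono) auto
    moreover have "range C \<subseteq> sets nu" unfolding C_def using Bb by auto
    ultimately have "(SUP n. emeasure nu (C n)) = emeasure nu (UN n. C n)"
     by (intro SUP_emeasure_incseq)
    moreover have "emeasure nu (C n) <= ennreal e" for n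
     unfolding C_def using fin[of "B ` {..n}"] B by auto
    ultimately show ?thesis using CU by (metis SUP_least)
   qed
   moreover have "emeasure nu N' <= emeasure nu U" using U by (intro emeasure_mono) auto
   ultimately show ?thesis by simp
  qed
  then have "emeasure nu N' = 0"
   by (metis ennreal_le_epsilon add.left_neutral le_zero_eq)
  then have "N' : null_sets nu" using N'b by auto
  then have "N' \<union> {..a} \<union> {b..} : null_sets nu" using na nb by auto
  moreover have "N \<subseteq> N' \<union> {..a} \<union> {b..}" unfolding N'_def by auto
  ultimately have "N : null_sets nu" using Nb by (metis null_sets_subset sets)
  then show ?thesis by auto
 qed
 have "absolutely_continuous lborel nu"
  unfolding absolutely_continuous_def using small by (auto simp: null_sets_def)
 then obtain f where f: "f : borel_measurable lborel" "density lborel f = nu"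
  using sigma_finite_measure.Radon_Nikodym[OF sigma_finite_lborel, of nu] by auto
 have fb[measurable]: "f : borel_measurable borel" using f by simp
 have nn: "(\<integral>\<^sup>+x. f x * indicator {a..t} x \<partial>lborel) = ennreal (F t - F a)" if "t : {a..b}" for t
 proof -
  have "emeasure nu {a..t} = (\<integral>\<^sup>+x. f x * indicator {a..t} x \<partial>lborel)"
   unfolding f(2)[symmetric] by (rule emeasure_density) auto
  then show ?thesis using Icc[of a t] that c(4) T by (auto simp: G_def)
 qed
 \<comment> \<open>The density takes extended values; its integral over \<open>{a..b}\<close> is
   finite, so it is finite almost everywhere there and \<open>enn2real\<close> changes nothing that
   matters.\<close>
 have "AE x in lborel. f x * indicator {a..b} x ~= \<infinity>"
  using nn[of b] T by (intro nn_integral_PInf_AE) auto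
 then have ae: "AE x in lborel. x : {a..b} --> ennreal (enn2real (f x)) = f x"
  by (rule AE_mp, intro AE_I2 impI) (auto simp: ennreal_enn2real_if split: split_indicator)
 define g where "g x = enn2real (f x)" for x
 have hi: "(g has_integral F t - F a) {a..t}" if t: "t : {a..b}" for t
 proof -
  have "((%x. g x * indicator {a..t} x) has_integral F t - F a) UNIV"
  proof (rule nn_integral_has_integral)
   have "(\<integral>\<^sup>+x. ennreal (g x * indicator {a..t} x) \<partial>lborel) = (\<integral>\<^sup>+x. f x * indicator {a..t} x \<partial>lborel)"
    using ae t by (intro nn_integral_cong_AE) (auto simp: g_def split: split_indicator)
   then show "(\<integral>\<^sup>+x. ennreal (g x * indicator {a..t} x) \<partial>lborel) = ennreal (F t - F a)"
    using nn[OF t] by simp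
  qed (use mono[of a t] t T in \<open>auto simp: g_def\<close>)
  moreover have "(%x. if x : {a..t} then g x else 0) = (%x. g x * indicator {a..t} x)"
   by (auto simp: fun_eq_iff)
  ultimately show ?thesis
   using has_integral_restrict_UNIV[of "{a..t}" g "F t - F a"] by simp
 qed
 show ?thesis
 proof
  show "g absolutely_integrable_on {a..b}"
   using hi[of b] T by (intro nonnegative_absolutely_integrable_1) (auto simp: g_def)
 qed (use hi in auto)
qed

section \<open>Positive variation and the Jordan decomposition\<close>

lemma division_split_sum:
 fixes f :: "real => real"
 assumes D: "D division_of \<Union>D" and sub: "\<Union>D \<subseteq> {s..t}" and c: "s <= c" "c <= t"
 obtains D1 D2 where "D1 division_of \<Union>D1" "\<Union>D1 \<subseteq> {s..c}" "D2 division_of \<Union>D2" "\<Union>D2 \<subseteq> {c..t}"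
  "(SUM J:D. f (Sup J) - f (Inf J)) = (SUM J:D1. f (Sup J) - f (Inf J)) + (SUM J:D2. f (Sup J) - f (Inf J))"
proof -
 note I = real_division_of_interval[OF D]
 have fD: "finite D" using D by auto
 have key: "EX E. E division_of \<Union>E & \<Union>E \<subseteq> {l..u} &
  (SUM J:D. f (max l (min (Sup J) u)) - f (max l (min (Inf J) u))) = (SUM J:E. f (Sup J) - f (Inf J))"
  if lu: "l <= u" for l u
 proof -
  \<comment> \<open>Clamping both endpoints restricts every interval to \<open>{l..u}\<close>.
    Intervals that shrink to a point are discarded: they contribute zero, and several of them could
    have the same image under \<open>h\<close>.\<close>
  define cl where "cl x = max l (min x u)" for x
  define D' where "D' = {J : D. cl (Inf J) < cl (Sup J)}"
  define h where "h J = {cl (Inf J)..cl (Sup J)}" for J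
  have hJ: "h J = J \<inter> {l..u}" if "J : D'" for J
  proof -
   have "J : D" using that unfolding D'_def by simp
   then obtain x y where J: "J = {x..y}" "x <= y" using I(1,2)[of J] by blast
   then have "Inf J = x" "Sup J = y" by auto
   then have "h J = {cl x..cl y}" "cl x < cl y" using that unfolding D'_def h_def by auto
   then show ?thesis using J lu unfolding cl_def by (auto simp: max_def min_def split: if_splits)
  qed
  have hp: "Inf (h J) = cl (Inf J)" "Sup (h J) = cl (Sup J)" "interior (h J) ~= {}" if "J : D'" for J
   using that unfolding D'_def h_def by auto
  have inter: "interior (h J) \<inter> interior (h K) = {}" if "J : D'" "K : D'" "J ~= K" for J K
  proof -
   have "interior (h J) \<subseteq> interior J" "interior (h K) \<subseteq> interior K"
    using hJ that by (auto intro!: interior_mono)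
   then show ?thesis using division_ofD(5)[OF D, of J K] that unfolding D'_def by blast
  qed
  have inj: "inj_on h D'" by (rule inj_onI) (metis inter hp(3) Int_absorb)
  have "h ` D' division_of \<Union>(h ` D')"
  proof (rule division_ofI)
   show "finite (h ` D')" using fD unfolding D'_def by auto
   fix K assume "K : h ` D'"
   then obtain J where J: "J : D'" "K = h J" by auto
   show "K ~= {}" using J hp(3) by fastforce
   show "EX a b. K = cbox a b" using J unfolding h_def by auto
   fix K2 assume "K2 : h ` D'" "K ~= K2"
   then show "interior K \<inter> interior K2 = {}" using inter J by auto
  qed auto
  moreover have "\<Union>(h ` D') \<subseteq> {l..u}" using hJ by auto
  moreover have "(SUM J:D. f (cl (Sup J)) - f (cl (Inf J))) = (SUM J:D'. f (cl (Sup J)) - f (cl (Inf J)))"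
  proof (rule sum.mono_neutral_right[OF fD])
   show "ALL J:D - D'. f (cl (Sup J)) - f (cl (Inf J)) = 0"
   proof
    fix J assume "J : D - D'"
    then have "cl (Inf J) = cl (Sup J)" using I(2)[of J] unfolding D'_def cl_def by (auto simp: max_def min_def split: if_splits)
    then show "f (cl (Sup J)) - f (cl (Inf J)) = 0" by simp
   qed
  qed (auto simp: D'_def)
  moreover have "... = (SUM J:h ` D'. f (Sup J) - f (Inf J))"
   by (subst sum.reindex[OF inj]) (simp add: hp)
  ultimately show ?thesis unfolding cl_def by metis
 qed
 obtain D1 where D1: "D1 division_of \<Union>D1" "\<Union>D1 \<subseteq> {s..c}"
  "(SUM J:D. f (max s (min (Sup J) c)) - f (max s (min (Inf J) c))) = (SUM J:D1. f (Sup J) - f (Inf J))"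
  using key[OF c(1)] by blast
 obtain D2 where D2: "D2 division_of \<Union>D2" "\<Union>D2 \<subseteq> {c..t}"
  "(SUM J:D. f (max c (min (Sup J) t)) - f (max c (min (Inf J) t))) = (SUM J:D2. f (Sup J) - f (Inf J))"
  using key[OF c(2)] by blast
 have "(SUM J:D. f (Sup J) - f (Inf J)) = (SUM J:D. (f (max s (min (Sup J) c)) - f (max s (min (Inf J) c)))
   + (f (max c (min (Sup J) t)) - f (max c (min (Inf J) t))))"
 proof (rule sum.cong[OF refl])
  fix J assume J: "J : D"
  have "Inf J : {s..t}" "Sup J : {s..t}" using I[OF J] J sub
   by (metis UnionI atLeastAtMost_iff order_refl subsetD)+
  then show "f (Sup J) - f (Inf J) = (f (max s (min (Sup J) c)) - f (max s (min (Inf J) c)))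
   + (f (max c (min (Sup J) t)) - f (max c (min (Inf J) t)))"
   using c by (auto simp: max_def min_def)
 qed
 then show ?thesis using that[OF D1(1,2) D2(1,2)] D1(3) D2(3) by (simp add: sum.distrib)
qed

text \<open>A degenerate interval can belong to two chunks without violating disjointness of
  interiors. It is then counted once on the left and twice on the right of the sum formula, which is
  harmless because \<open>ph\<close> vanishes on it.\<close>

lemma division_Union_chunks:
 fixes D :: "'i => real set set"
 assumes fin: "finite Ic" and D: "!!i. i : Ic ==> D i division_of \<Union>(D i)"
  and dis: "!!i j. i : Ic ==> j : Ic ==> i ~= j ==> interior (\<Union>(D i)) \<inter> interior (\<Union>(D j)) = {}"
  and z: "!!J::real set. Inf J = Sup J ==> ph J = (0::real)"
 shows "(UN i:Ic. D i) division_of \<Union>(UN i:Ic. D i)"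
  "(SUM J:(UN i:Ic. D i). ph J) = (SUM i:Ic. SUM J:D i. ph J)"
proof -
 have inter: "interior J \<inter> interior K = {}" if "i : Ic" "j : Ic" "i ~= j" "J : D i" "K : D j" for i j J K
 proof -
  have "interior J \<subseteq> interior (\<Union>(D i))" "interior K \<subseteq> interior (\<Union>(D j))"
   using that by (auto intro!: interior_mono)
  then show ?thesis using dis that by blast
 qed
 show "(UN i:Ic. D i) division_of \<Union>(UN i:Ic. D i)"
 proof (rule division_ofI)
  show "finite (UN i:Ic. D i)" using fin D by auto
  fix J assume "J : (UN i:Ic. D i)"
  then obtain i where i: "i : Ic" "J : D i" by auto
  show "J ~= {}" "EX a b. J = cbox a b" using division_ofD(3,4)[OF D[OF i(1)] i(2)] by auto
  fix K assume "K : (UN i:Ic. D i)" "J ~= K"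
  then obtain j where j: "j : Ic" "K : D j" by auto
  show "interior J \<inter> interior K = {}"
   using division_ofD(5)[OF D[OF i(1)] i(2)] inter i j \<open>J ~= K\<close> by (cases "i = j") auto
 qed auto
 show "(SUM J:(UN i:Ic. D i). ph J) = (SUM i:Ic. SUM J:D i. ph J)"
 proof -
  show ?thesis
   using fin D inter
  proof (induction Ic rule: finite_induct)
   case empty then show ?case by simp
  next
   case (insert i Ic)
   have f: "finite (D i)" "finite (UN j:Ic. D j)" using insert by auto
   have z0: "ALL J:D i \<inter> (UN j:Ic. D j). ph J = 0"
   proof
    fix J assume J: "J : D i \<inter> (UN j:Ic. D j)"
    then obtain j where j: "j : Ic" "J : D j" by auto
    have "interior J \<inter> interior J = {}"
     using insert.prems(2)[of i j J J] insert.hyps j J by auto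
    moreover have "J = {Inf J..Sup J}" "Inf J <= Sup J"
     using real_division_of_interval[OF insert.prems(1)[of i], of J] J by auto
    ultimately have "Inf J = Sup J" by (metis interior_atLeastAtMost_real Int_absorb greaterThanLessThan_empty_iff2 greaterThanLessThan_empty_iff antisym)
    then show "ph J = 0" by (rule z)
   qed
   have "(SUM J:D i \<union> (UN j:Ic. D j). ph J) = (SUM J:D i. ph J) + (SUM J:(UN j:Ic. D j). ph J)"
    using sum.union_inter_neutral[OF f z0] .
   moreover have "(SUM J:(UN j:Ic. D j). ph J) = (SUM i:Ic. SUM J:D i. ph J)"
    by (rule insert.IH; rule insert.prems) auto
   ultimately show ?case using insert.hyps by simp
  qed
 qed
qed

text \<open>\<open>P t\<close> is the positive variation on \<open>{a..t}\<close>, the supremum of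
  the signed increments of \<open>f\<close> over finite families of nonoverlapping intervals. Both
  \<open>P\<close> and \<open>P - f\<close> increase, and absolute continuity passes from
  \<open>f\<close> to \<open>P\<close>.\<close>

lemma absolutely_continuous_decompose:
 fixes f :: "real => real"
 assumes ab: "a <= b" and ac: "absolutely_continuous_on {a..b} f"
 obtains P where "!!x y. a <= x ==> x <= y ==> y <= b ==> P x <= P y & f y - f x <= P y - P x"
  "absolutely_continuous_on {a..b} P"
proof -
 define S where "S s t = {(SUM J:D. f (Sup J) - f (Inf J)) | D. D division_of \<Union>D & \<Union>D \<subseteq> {s..t}}" for s t
 define bdd where "bdd s t C \<longleftrightarrow> (ALL x:S s t. x <= C)" for s t C
 have Smono: "S s t \<subseteq> S s' t'" if "s' <= s" "t <= t'" for s s' t t'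
  unfolding S_def using that by clarify (metis (no_types, lifting) atLeastatMost_subset_iff order_trans)
 \<comment> \<open>The empty division makes the set nonempty and the supremum nonnegative.\<close>
 have S0: "0 : S s t" for s t unfolding S_def by (rule CollectI, rule exI[of _ "{}"]) (auto simp: division_of_def)
 have split: "bdd s t (C + C')" if sct: "s <= c" "c <= t" "bdd s c C" "bdd c t C'" for s c t C C'
  unfolding bdd_def
 proof
  fix x assume "x : S s t"
  then obtain D where D: "D division_of \<Union>D" "\<Union>D \<subseteq> {s..t}" "x = (SUM J:D. f (Sup J) - f (Inf J))"
   unfolding S_def by blast
  obtain D1 D2 where *: "D1 division_of \<Union>D1" "\<Union>D1 \<subseteq> {s..c}" "D2 division_of \<Union>D2" "\<Union>D2 \<subseteq> {c..t}"
   "(SUM J:D. f (Sup J) - f (Inf J)) = (SUM J:D1. f (Sup J) - f (Inf J)) + (SUM J:D2. f (Sup J) - f (Inf J))"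
   by (rule division_split_sum[OF D(1,2) sct(1,2), of f])
  then have "(SUM J:D1. f (Sup J) - f (Inf J)) : S s c" "(SUM J:D2. f (Sup J) - f (Inf J)) : S c t"
   unfolding S_def by blast+
  then show "x <= C + C'" using sct(3,4) *(5) D(3) unfolding bdd_def by fastforce
 qed
 obtain d where d: "d > 0" "!!D U. D division_of U ==> U \<subseteq> {a..b} ==> (SUM J:D. measure lborel J) < d ==>
    (SUM J:D. norm (f (Sup J) - f (Inf J))) < 1"
  using ac unfolding absolutely_continuous_on_def by (meson zero_less_one)
 have sum_le: "(SUM J:D. f (Sup J) - f (Inf J)) <= (SUM J:D. norm (f (Sup J) - f (Inf J)))" for D
  by (intro sum_mono) auto
 have meas: "(SUM J:D. measure lborel J) <= t - s" if "D division_of \<Union>D" "\<Union>D \<subseteq> {s..t}" "s <= t" for D s t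
  using subadditive_content_division[OF that(1), of s t] that by auto
 have b1: "bdd s t 1" if "a <= s" "s <= t" "t <= b" "t - s < d" for s t
  unfolding bdd_def
 proof
  fix x assume "x : S s t"
  then obtain D where D: "D division_of \<Union>D" "\<Union>D \<subseteq> {s..t}" "x = (SUM J:D. f (Sup J) - f (Inf J))"
   unfolding S_def by blast
  have "(SUM J:D. norm (f (Sup J) - f (Inf J))) < 1"
   using D that meas[OF D(1,2) that(2)] by (intro d(2)[OF D(1)]) auto
  then show "x <= 1" using D(3) sum_le[of D] by linarith
 qed
 \<comment> \<open>Each step shorter than \<open>d\<close> adds at most 1, so the variation on a
   compact interval is bounded by the number of steps.\<close>
 have bn: "bdd a t (real n)" if "a <= t" "t <= b" "t - a < real n * d" for n t
  using that
 proof (induction n arbitrary: t)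
  case 0 then show ?case by simp
 next
  case (Suc n)
  show ?case
  proof (cases "t - a < d")
   case True
   then have "bdd a t 1" using b1 Suc by auto
   then show ?thesis unfolding bdd_def by fastforce
  next
   case False
   obtain c where c: "max (t - d) a < c" "c <= t" "c < real n * d + a"
   proof -
    have "max (t - d) a < min t (real n * d + a) | n = 0"
    proof (cases n)
     case (Suc m)
     then have "0 < real n * d" using d by simp
     then show ?thesis using Suc.prems False d Suc by (auto simp: algebra_simps)
    qed auto
    then show ?thesis
    proof
     assume "max (t - d) a < min t (real n * d + a)"
     then obtain c where "max (t - d) a < c" "c < min t (real n * d + a)" using dense by blast
     then show ?thesis using that[of c] by auto
    next
     assume "n = 0" then show ?thesis using Suc.prems False by simp
    qed
   qed
   have "bdd a c (real n)" using Suc.IH[of c] c Suc.prems by auto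
   moreover have "bdd c t 1" using b1[of c t] c Suc.prems by auto
   ultimately have "bdd a t (real n + 1)" using c by (intro split) auto
   then show ?thesis by (simp add: add.commute)
  qed
 qed
 obtain n :: nat where "(b - a) / d < real n" using reals_Archimedean2 by blast
 then have "bdd a b (real n)" using bn[of b n] ab d by (auto simp: field_simps)
 then have bdda: "bdd_above (S s t)" if "a <= s" "t <= b" for s t
 proof -
  have "S s t \<subseteq> S a b" using that by (intro Smono)
  then show ?thesis using \<open>bdd a b (real n)\<close> unfolding bdd_def bdd_above_def by blast
 qed
 define W where "W s t = Sup (S s t)" for s t
 have WI: "x <= W s t" if "x : S s t" "a <= s" "t <= b" for x s t
  unfolding W_def using cSup_upper[OF that(1) bdda[OF that(2,3)]] .
 have Wle: "W s t <= C" if "bdd s t C" for s t C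
  unfolding W_def using that S0[of s t] unfolding bdd_def by (intro cSup_least) auto
 have Wsplit: "W a t <= W a s + W s t" if "a <= s" "s <= t" "t <= b" for s t
  using that by (intro Wle split[of a s t]) (auto simp: bdd_def intro!: WI)
 have near: "EX D. D division_of \<Union>D & \<Union>D \<subseteq> {s..t} & W s t - e < (SUM J:D. f (Sup J) - f (Inf J))"
  if "e > 0" "a <= s" "t <= b" for e s t
 proof -
  have "EX x:S s t. W s t - e < x"
   using less_cSup_iff[OF _ bdda[OF that(2,3)], of "W s t - e"] S0[of s t] that(1) unfolding W_def by auto
  then show ?thesis unfolding S_def by blast
 qed
 define P where "P t = W a t" for t
 have mono: "P x <= P y" "f y - f x <= P y - P x" if xy: "a <= x" "x <= y" "y <= b" for x y
 proof -
  show "P x <= P y" unfolding P_def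
  proof (rule Wle)
   show "bdd a x (W a y)" unfolding bdd_def
   proof
    fix v assume "v : S a x"
    then have "v : S a y" using Smono[of a a x y] xy by auto
    then show "v <= W a y" using xy by (intro WI) auto
   qed
  qed
  show "f y - f x <= P y - P x"
  proof (rule field_le_epsilon)
   fix e :: real assume e: "e > 0"
   obtain D where D: "D division_of \<Union>D" "\<Union>D \<subseteq> {a..x}" "W a x - e < (SUM J:D. f (Sup J) - f (Inf J))"
    using near[OF e, of a x] xy by auto
   \<comment> \<open>A near-optimal division of \<open>{a..x}\<close> is extended by the single
     interval \<open>{x..y}\<close>; the type \<open>bool\<close> indexes the two chunks.\<close>
   define DD where "DD i = (if i then D else {{x..y}})" for i
   have 1: "DD i division_of \<Union>(DD i)" for i
    unfolding DD_def using D(1) division_of_self[of x y] xy by auto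
   have 2: "interior (\<Union>(DD i)) \<inter> interior (\<Union>(DD j)) = {}" if "i ~= j" for i j
   proof -
    have "interior (\<Union>D) \<subseteq> interior {a..x}" using D(2) by (rule interior_mono)
    then have "interior (\<Union>D) \<inter> {x<..<y} = {}" by auto
    then show ?thesis using that unfolding DD_def by auto
   qed
   note ch = division_Union_chunks[of "UNIV :: bool set" DD "%J. f (Sup J) - f (Inf J)", OF _ 1 2]
   have U: "\<Union>(UN i:UNIV. DD i) \<subseteq> {a..y}" using D(2) xy by (auto simp: DD_def UNIV_bool)
   have "(SUM J:(UN i:UNIV. DD i). f (Sup J) - f (Inf J)) : S a y"
    using ch(1) U unfolding S_def by auto
   then have "(SUM J:(UN i:UNIV. DD i). f (Sup J) - f (Inf J)) <= W a y"
    using xy by (intro WI) auto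
   moreover have "(SUM J:(UN i:UNIV. DD i). f (Sup J) - f (Inf J)) = (SUM J:D. f (Sup J) - f (Inf J)) + (f y - f x)"
    using ch(2) xy by (simp add: UNIV_bool DD_def)
   ultimately show "f y - f x <= P y - P x + e" using D(3) unfolding P_def by linarith
  qed
 qed
 have "absolutely_continuous_on {a..b} P"
  unfolding absolutely_continuous_on_def
 proof (intro allI impI)
  fix e :: real assume e: "e > 0"
  obtain d where d: "d > 0" "!!D U. D division_of U ==> U \<subseteq> {a..b} ==> (SUM J:D. measure lborel J) < d ==>
    (SUM J:D. norm (f (Sup J) - f (Inf J))) < e/2"
   using ac e unfolding absolutely_continuous_on_def by (meson half_gt_zero)
  have "(SUM J:D. norm (P (Sup J) - P (Inf J))) < e"
   if D: "D division_of U" "U \<subseteq> {a..b}" "(SUM J:D. measure lborel J) < d" for D U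
  proof -
   note I = real_division_of_interval[OF D(1)]
   have J: "a <= Inf J" "Inf J <= Sup J" "Sup J <= b" if "J : D" for J
    using I[OF that] division_ofD(2)[OF D(1) that] D(2)
    by (metis atLeastAtMost_iff order_refl subsetD)+
   have fD: "finite D" using D by auto
   \<comment> \<open>The error of the near-optimal divisions is shared among the intervals of
     \<open>D\<close>; the added 1 guards against an empty \<open>D\<close>.\<close>
   define eta where "eta = e / (2 * (real (card D) + 1))"
   have eta: "eta > 0" unfolding eta_def using e by (simp add: divide_pos_pos)
   have "ALL J:D. EX E. E division_of \<Union>E & \<Union>E \<subseteq> {Inf J..Sup J} &
     W (Inf J) (Sup J) - eta < (SUM K:E. f (Sup K) - f (Inf K))"
    using near[OF eta] J by blast
   from bchoice[OF this]
   obtain DD where DD: "!!J. J : D ==> DD J division_of \<Union>(DD J)" "!!J. J : D ==> \<Union>(DD J) \<subseteq> {Inf J..Sup J}"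
    "!!J. J : D ==> W (Inf J) (Sup J) - eta < (SUM K:DD J. f (Sup K) - f (Inf K))"
    by blast
   have 2: "interior (\<Union>(DD i)) \<inter> interior (\<Union>(DD j)) = {}" if "i : D" "j : D" "i ~= j" for i j
   proof -
    have "interior (\<Union>(DD i)) \<subseteq> interior i" "interior (\<Union>(DD j)) \<subseteq> interior j"
     using DD(2)[OF that(1)] DD(2)[OF that(2)] I(1)[OF that(1)] I(1)[OF that(2)] by (metis interior_mono)+
    then show ?thesis using division_ofD(5)[OF D(1) that] by blast
   qed
   note ch = division_Union_chunks[where D=DD, OF fD DD(1) 2]
   define E where "E = (UN J:D. DD J)"
   have E: "E division_of \<Union>E" unfolding E_def using ch(1)[where ph="%_. 0"] by simp
   have EU: "\<Union>E \<subseteq> {a..b}" using DD(2) J unfolding E_def by fastforce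
   have "(SUM J:E. measure lborel J) = (SUM J:D. SUM K:DD J. Sup K - Inf K)"
   proof -
    have "(SUM J:E. measure lborel J) = (SUM J:E. Sup J - Inf J)"
     by (intro sum.cong refl real_division_of_interval(3)[OF E])
    then show ?thesis using ch(2)[where ph="%J. Sup J - Inf J"] unfolding E_def by simp
   qed
   also have "... <= (SUM J:D. measure lborel J)"
   proof (rule sum_mono)
    fix J assume "J : D"
    then show "(SUM K:DD J. Sup K - Inf K) <= measure lborel J"
     using meas[OF DD(1,2), of J] J(2) I(3) real_division_of_interval(3)[OF DD(1), of J]
     by (simp cong: sum.cong)
   qed
   finally have "(SUM J:E. norm (f (Sup J) - f (Inf J))) < e/2"
    using d(2)[OF E EU] D(3) by linarith
   then have small: "(SUM J:E. f (Sup J) - f (Inf J)) < e/2" using sum_le[of E] by linarith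
   have "(SUM J:D. norm (P (Sup J) - P (Inf J))) <= (SUM J:D. (SUM K:DD J. f (Sup K) - f (Inf K)) + eta)"
   proof (rule sum_mono)
    fix j assume j: "j : D"
    have "P (Sup j) - P (Inf j) <= W (Inf j) (Sup j)" unfolding P_def using Wsplit[OF J[OF j]] by linarith
    then show "norm (P (Sup j) - P (Inf j)) <= (SUM K:DD j. f (Sup K) - f (Inf K)) + eta"
     using mono(1)[OF J[OF j]] DD(3)[OF j] by auto
   qed
   also have "... = (SUM J:E. f (Sup J) - f (Inf J)) + real (card D) * eta"
    using ch(2)[where ph="%J. f (Sup J) - f (Inf J)"] unfolding E_def by (simp add: sum.distrib)
   also have "... < e/2 + e/2"
   proof -
    have "real (card D) * eta <= e/2" unfolding eta_def using e by (simp add: field_simps)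
    then show ?thesis using small by linarith
   qed
   finally show ?thesis by simp
  qed
  then show "EX de>0. ALL D U. D division_of U & U \<subseteq> {a..b} & (SUM J:D. measure lborel J) < de -->
       (SUM J:D. norm (P (Sup J) - P (Inf J))) < e"
   using d(1) by blast
 qed
 then show ?thesis using that mono by blast
qed

lemma absolutely_continuous_on_diff:
 fixes f g :: "real => 'a::real_normed_vector"
 assumes "absolutely_continuous_on S f" "absolutely_continuous_on S g"
 shows "absolutely_continuous_on S (%t. f t - g t)"
 unfolding absolutely_continuous_on_def
proof (intro allI impI)
 fix e :: real assume e: "e > 0"
 obtain d1 where d1: "d1 > 0" "!!D U. D division_of U ==> U \<subseteq> S ==> (SUM J:D. measure lborel J) < d1 ==>
    (SUM J:D. norm (f (Sup J) - f (Inf J))) < e/2"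
  using assms(1) e unfolding absolutely_continuous_on_def by (meson half_gt_zero)
 obtain d2 where d2: "d2 > 0" "!!D U. D division_of U ==> U \<subseteq> S ==> (SUM J:D. measure lborel J) < d2 ==>
    (SUM J:D. norm (g (Sup J) - g (Inf J))) < e/2"
  using assms(2) e unfolding absolutely_continuous_on_def by (meson half_gt_zero)
 have "(SUM J:D. norm ((f (Sup J) - g (Sup J)) - (f (Inf J) - g (Inf J)))) < e"
  if D: "D division_of U" "U \<subseteq> S" "(SUM J:D. measure lborel J) < min d1 d2" for D U
 proof -
  have "(SUM J:D. norm ((f (Sup J) - g (Sup J)) - (f (Inf J) - g (Inf J))))
    <= (SUM J:D. norm (f (Sup J) - f (Inf J)) + norm (g (Sup J) - g (Inf J)))"
  proof (rule sum_mono)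
   fix J
   have "(f (Sup J) - g (Sup J)) - (f (Inf J) - g (Inf J)) = (f (Sup J) - f (Inf J)) - (g (Sup J) - g (Inf J))"
    by simp
   then show "norm ((f (Sup J) - g (Sup J)) - (f (Inf J) - g (Inf J))) <= norm (f (Sup J) - f (Inf J)) + norm (g (Sup J) - g (Inf J))"
    using norm_triangle_ineq4 by metis
  qed
  also have "... < e/2 + e/2"
   unfolding sum.distrib using d1(2)[OF D(1,2)] d2(2)[OF D(1,2)] D(3) by (intro add_strict_mono) auto
  finally show ?thesis by simp
 qed
 then show "EX de>0. ALL D U. D division_of U & U \<subseteq> S & (SUM J:D. measure lborel J) < de -->
   (SUM J:D. norm ((f (Sup J) - g (Sup J)) - (f (Inf J) - g (Inf J)))) < e"
  using d1(1) d2(1) by (meson min_less_iff_conj)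
qed

text \<open>\<open>f = P - (P - f)\<close> is a difference of increasing absolutely continuous
  functions.\<close>

lemma absolutely_continuous_indefinite_integral_real:
 fixes f :: "real => real"
 assumes ab: "a <= b" and ac: "absolutely_continuous_on {a..b} f"
 obtains g where "g absolutely_integrable_on {a..b}"
  "!!t. t : {a..b} ==> (g has_integral f t - f a) {a..t}"
proof -
 obtain P where P: "!!x y. a <= x ==> x <= y ==> y <= b ==> P x <= P y & f y - f x <= P y - P x"
  "absolutely_continuous_on {a..b} P" using absolutely_continuous_decompose[OF assms] by blast
 obtain g1 where g1: "g1 absolutely_integrable_on {a..b}" "!!t. t : {a..b} ==> (g1 has_integral P t - P a) {a..t}"
  using mono_absolutely_continuous_indefinite_integral[OF ab _ P(2)] P(1) by blast
 have "absolutely_continuous_on {a..b} (%t. P t - f t)" using P(2) ac by (rule absolutely_continuous_on_diff)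
 moreover have "P x - f x <= P y - f y" if "a <= x" "x <= y" "y <= b" for x y using P(1)[OF that] by simp
 ultimately obtain g2 where g2: "g2 absolutely_integrable_on {a..b}"
   "!!t. t : {a..b} ==> (g2 has_integral (P t - f t) - (P a - f a)) {a..t}"
  using mono_absolutely_continuous_indefinite_integral[OF ab, of "%t. P t - f t"] by blast
 show ?thesis
 proof
  show "(%x. g1 x - g2 x) absolutely_integrable_on {a..b}" using g1 g2 by (intro set_integral_diff)
  show "((%x. g1 x - g2 x) has_integral f t - f a) {a..t}" if "t : {a..b}" for t
   using has_integral_diff[OF g1(2)[OF that] g2(2)[OF that]] by (simp add: algebra_simps)
 qed
qed

theorem absolutely_continuous_indefinite_integral:
 fixes f :: "real => 'a::euclidean_space"
 assumes ab: "a <= b" and ac: "absolutely_continuous_on {a..b} f"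
 obtains g where "g absolutely_integrable_on {a..b}"
  "!!t. t : {a..b} ==> (g has_integral f t - f a) {a..t}"
proof -
 have "absolutely_continuous_on {a..b} (%t. f t \<bullet> i)" if i: "i : Basis" for i
  unfolding absolutely_continuous_on_def
 proof (intro allI impI)
  fix e :: real assume e: "e > 0"
  obtain d1 where d1: "d1 > 0" "!!D U. D division_of U ==> U \<subseteq> {a..b} ==> (SUM J:D. measure lborel J) < d1 ==>
    (SUM J:D. norm (f (Sup J) - f (Inf J))) < e"
   using ac e unfolding absolutely_continuous_on_def by meson
  have le: "(SUM J:D. norm (f (Sup J) \<bullet> i - f (Inf J) \<bullet> i)) <= (SUM J:D. norm (f (Sup J) - f (Inf J)))" for D
   using i by (intro sum_mono) (simp add: Basis_le_norm flip: inner_diff_left)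
  show "EX de>0. ALL D U. D division_of U & U \<subseteq> {a..b} & (SUM J:D. measure lborel J) < de -->
    (SUM J:D. norm (f (Sup J) \<bullet> i - f (Inf J) \<bullet> i)) < e"
   using d1 le by (meson order_le_less_trans)
 qed
 then have "EX g. g absolutely_integrable_on {a..b} & (ALL t:{a..b}. (g has_integral f t \<bullet> i - f a \<bullet> i) {a..t})"
  if "i : Basis" for i
  using absolutely_continuous_indefinite_integral_real[OF ab, of "%t. f t \<bullet> i"] that by metis
 then obtain G where G: "!!i. i : Basis ==> G i absolutely_integrable_on {a..b}"
  "!!i t. i : Basis ==> t : {a..b} ==> (G i has_integral f t \<bullet> i - f a \<bullet> i) {a..t}" by metis
 show ?thesis
 proof
  show "(%t. SUM i:Basis. G i t *R i) absolutely_integrable_on {a..b}"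
   using G(1) by (intro absolutely_integrable_sum absolutely_integrable_scaleR_right) auto
  show "((%t. SUM i:Basis. G i t *R i) has_integral f t - f a) {a..t}" if "t : {a..b}" for t
  proof -
   have "((%t. SUM i:Basis. G i t *R i) has_integral (SUM i:Basis. (f t \<bullet> i - f a \<bullet> i) *R i)) {a..t}"
    using G(2) that by (intro has_integral_sum has_integral_scaleR_left) auto
   moreover have "(SUM i:Basis. (f t \<bullet> i - f a \<bullet> i) *R i) = f t - f a"
    by (simp add: euclidean_representation flip: inner_diff_left)
   ultimately show ?thesis by simp
  qed
 qed
qed

text \<open>Lebesgue differentiation enters as convergence of averages over intervals to the right
  of a point. The left difference quotient is the right average of the reflected function, so the
  exceptional set is the union of one null set with the reflection of another.\<close>

lemma indefinite_integral_has_vector_derivative_ae: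
 fixes f :: "real => 'b::euclidean_space"
 assumes f: "f absolutely_integrable_on {a..b}"
 obtains N where "negligible N"
  "!!t. t : {a<..<b} - N ==> ((%t. integral {a..t} f) has_vector_derivative f t) (at t)"
proof -
 define F where "F x = (if x : {a..b} then f x else 0)" for x
 have "F integrable_on UNIV"
  unfolding F_def integrable_restrict_UNIV using f by (simp add: absolutely_integrable_on_def)
 then have Fi: "F integrable_on cbox x y" for x y by (rule integrable_on_subcbox) auto
 have Fi': "(%x. F (-x)) integrable_on cbox x y" for x y
  using Fi[of "-y" "-x"] by (metis Fi integrable_reflect add.inverse_inverse)
 obtain N1 where N1: "negligible N1" "!!x e. x ~: N1 ==> 0 < e ==> EX d>0. ALL h. 0 < h & h < d -->
   norm (integral (cbox x (x + h *R One)) F /\<^sub>R h ^ DIM(real) - F x) < e"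
  using integrable_ccontinuous_explicit[OF Fi] by metis
 obtain N2 where N2: "negligible N2" "!!x e. x ~: N2 ==> 0 < e ==> EX d>0. ALL h. 0 < h & h < d -->
   norm (integral (cbox x (x + h *R One)) (%x. F (-x)) /\<^sub>R h ^ DIM(real) - F (-x)) < e"
  using integrable_ccontinuous_explicit[OF Fi'] by metis
 have neg: "negligible (N1 \<union> uminus ` N2)"
  using N1 N2 by (intro negligible_Un negligible_differentiable_image_negligible)
   (auto intro!: derivative_intros)
 show ?thesis
 proof (rule that[OF neg])
  fix t assume t: "t : {a<..<b} - (N1 \<union> uminus ` N2)"
  define I where "I t = integral {a..t} f" for t
  have IF: "I y - I x = integral {x..y} F" if "a <= x" "x <= y" "y <= b" for x y
  proof -
   have "f integrable_on {a..y}" using f that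
    by (meson absolutely_integrable_on_def integrable_on_subinterval atLeastatMost_subset_iff order_refl)
   then have "integral {a..x} f + integral {x..y} f = integral {a..y} f"
    using that by (intro Henstock_Kurzweil_Integration.integral_combine) auto
   moreover have "integral {x..y} f = integral {x..y} F"
    using that by (intro Henstock_Kurzweil_Integration.integral_cong) (auto simp: F_def)
   ultimately show ?thesis unfolding I_def by (simp add: algebra_simps)
  qed
  have tN: "t ~: N1" "- t ~: N2" using t by force+
  have "(I has_vector_derivative f t) (at t)"
   unfolding has_vector_derivative_def has_derivative_at_within tendsto_iff
  proof (intro conjI allI impI)
   show "bounded_linear (%x. x *R f t)" by (rule bounded_linear_scaleR_left)
   fix e :: real assume e: "e > 0"
   obtain d1 where d1: "d1 > 0" "!!h. 0 < h ==> h < d1 ==> norm (integral {t..t + h} F /\<^sub>R h - f t) < e"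
    using N1(2)[OF tN(1) e] t by (auto simp: F_def)
   obtain d2 where d2: "d2 > 0" "!!h. 0 < h ==> h < d2 ==> norm (integral {-t..-t + h} (%x. F (-x)) /\<^sub>R h - f t) < e"
    using N2(2)[OF tN(2) e] t by (auto simp: F_def)
   define d where "d = Min {d1, d2, t - a, b - t}"
   have d: "d > 0" "d <= d1" "d <= d2" "d <= t - a" "d <= b - t" unfolding d_def using d1 d2 t by auto
   show "\<forall>\<^sub>F y in at t. dist ((I y - I t - (y - t) *R f t) /\<^sub>R norm (y - t)) 0 < e"
    unfolding eventually_at
   proof (intro exI conjI ballI impI)
    fix y assume y: "y ~= t & dist y t < d"
    show "dist ((I y - I t - (y - t) *R f t) /\<^sub>R norm (y - t)) 0 < e"
    proof (cases "y > t")
     case True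
     then have h: "0 < y - t" "y - t < d" using y by (auto simp: dist_real_def)
     have "norm (integral {t..t + (y - t)} F /\<^sub>R (y - t) - f t) < e"
      using h d by (intro d1(2)) auto
     moreover have "I y - I t = integral {t..y} F" using IF[of t y] h d t by auto
     moreover have "(integral {t..y} F - (y - t) *R f t) /\<^sub>R norm (y - t) = integral {t..y} F /\<^sub>R (y - t) - f t"
      using h by (simp add: scaleR_diff_right)
     ultimately show ?thesis by simp
    next
     case False
     then have h: "0 < t - y" "t - y < d" using y by (auto simp: dist_real_def)
     have "integral {-t..-y} (%x. F (-x)) = integral {y..t} F"
      using Henstock_Kurzweil_Integration.integral_reflect_real[of t y F] by simp
     then have "norm (integral {y..t} F /\<^sub>R (t - y) - f t) < e"
      using d2(2)[of "t - y"] h d by auto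
     moreover have "I t - I y = integral {y..t} F" using IF[of y t] h d t by auto
     then have "I y - I t = - integral {y..t} F" by (metis minus_diff_eq)
     moreover have "(- integral {y..t} F - (y - t) *R f t) /\<^sub>R norm (y - t) = - (integral {y..t} F /\<^sub>R (t - y) - f t)"
     proof -
      have "(y - t) *R f t = - ((t - y) *R f t)" by (simp add: algebra_simps)
      then show ?thesis using h by (simp add: scaleR_diff_right scaleR_add_right)
     qed
     ultimately show ?thesis by (simp del: minus_diff_eq)
    qed
   qed (use d in auto)
  qed
  then show "((%t. integral {a..t} f) has_vector_derivative f t) (at t)" unfolding I_def .
 qed
qed

section \<open>Square-integrable functions and indefinite integrals\<close>

definition L2 :: "real => (real => 'a::euclidean_space) => bool" where
 "L2 T f \<longleftrightarrow> f : borel_measurable (lebesgue_on {0..T}) & (%t. (norm (f t))^2) integrable_on {0..T}"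

definition n2 :: "real => (real => 'a::euclidean_space) => real" where
 "n2 T f = sqrt (integral {0..T} (%t. (norm (f t))^2))"

text \<open>The form in which the differential equations are stated: \<open>F\<close> has density
  \<open>f\<close> on \<open>{0..T}\<close>. No pointwise derivative is claimed, which suits
  densities known only up to null sets; the value \<open>F 0\<close> is free.\<close>

definition indef :: "real => (real => 'a::euclidean_space) => (real => 'a) => bool" where
 "indef T f F \<longleftrightarrow> f absolutely_integrable_on {0..T} &
  (ALL t:{0..T}. (f has_integral F t - F 0) {0..t})"

lemma measurable_bilinear:
 fixes B :: "'a::euclidean_space => 'b::euclidean_space => 'c::euclidean_space"
 assumes "bounded_bilinear B" "f : borel_measurable M" "g : borel_measurable M"
 shows "(%t. B (f t) (g t)) : borel_measurable M"
 using assms(2,3)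
 by (rule borel_measurable_continuous_Pair)
  (intro bounded_bilinear.continuous_on[OF assms(1)] continuous_intros)

lemma continuous_on_measurable_lebesgue:
 fixes f :: "real => 'a::euclidean_space"
 shows "continuous_on {a..b} f ==> f : borel_measurable (lebesgue_on {a..b})"
 by (rule continuous_imp_measurable_on_sets_lebesgue) auto

lemma L2_measurable: "L2 T f ==> f : borel_measurable (lebesgue_on {0..T})"
 by (simp add: L2_def)

lemma L2_norm_integrable: "L2 T f ==> (%t. (norm (f t))^2) integrable_on {0..T}"
 by (simp add: L2_def)

lemma L2I:
 fixes f :: "real => 'a::euclidean_space"
 assumes "f : borel_measurable (lebesgue_on {0..T})" "g integrable_on {0..T}"
  "!!t. t : {0..T} ==> (norm (f t))^2 <= g t"
 shows "L2 T f"
 unfolding L2_def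
proof
 show "(%t. (norm (f t))^2) integrable_on {0..T}"
  using assms by (intro measurable_bounded_by_integrable_imp_integrable_real[OF _ assms(2)]) auto
qed (use assms in auto)

lemma L2_continuous_on:
 fixes f :: "real => 'a::euclidean_space"
 assumes "continuous_on {0..T} f"
 shows "L2 T f"
 unfolding L2_def using assms
 by (auto intro!: continuous_on_measurable_lebesgue integrable_continuous_real continuous_intros)

lemma L2_const[simp]: "L2 T (%t. c)"
 by (rule L2_continuous_on) auto

lemma L2_bilinear_absolutely_integrable:
 fixes B :: "'a::euclidean_space => 'b::euclidean_space => 'c::euclidean_space"
 assumes B: "bounded_bilinear B" and f: "L2 T f" and g: "L2 T g"
 shows "(%t. B (f t) (g t)) absolutely_integrable_on {0..T}"
proof -
 obtain K where K: "K > 0" "!!a b. norm (B a b) <= norm a * norm b * K"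
  using bounded_bilinear.pos_bounded[OF B] by blast
 show ?thesis
 proof (rule measurable_bounded_by_integrable_imp_absolutely_integrable)
  show "(%t. B (f t) (g t)) : borel_measurable (lebesgue_on {0..T})"
   by (rule measurable_bilinear[OF B L2_measurable[OF f] L2_measurable[OF g]])
  show "(%t. ((norm (f t))^2 + (norm (g t))^2) * K) integrable_on {0..T}"
   using f g by (intro integrable_on_mult_left integrable_add) (auto simp: L2_def)
  show "norm (B (f t) (g t)) <= ((norm (f t))^2 + (norm (g t))^2) * K" for t
  proof -
   have "norm (f t) * norm (g t) <= (norm (f t))^2 + (norm (g t))^2"
    using sum_squares_bound[of "norm (f t)" "norm (g t)"] mult_nonneg_nonneg[OF norm_ge_zero norm_ge_zero, of "f t" "g t"]
    by linarith
   then show ?thesis using K by (meson mult_right_mono order_trans less_imp_le)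
  qed
 qed auto
qed

lemma L2_abs_integrable: "L2 T f ==> f absolutely_integrable_on {0..T}"
 using L2_bilinear_absolutely_integrable[OF bounded_bilinear_scaleR, of T "%_. 1" f] by simp

lemma L2_bounded_linear:
 fixes h :: "'a::euclidean_space => 'b::euclidean_space"
 assumes h: "bounded_linear h" and f: "L2 T f"
 shows "L2 T (%t. h (f t))"
proof -
 obtain K where K: "K > 0" "!!a. norm (h a) <= norm a * K" using bounded_linear.pos_bounded[OF h] by blast
 show ?thesis
 proof (rule L2I)
  show "(%t. h (f t)) : borel_measurable (lebesgue_on {0..T})"
   using L2_measurable[OF f] h
   by (intro measurable_compose[OF L2_measurable[OF f]] borel_measurable_continuous_onI linear_continuous_on)
  show "(%t. (norm (f t))^2 * K^2) integrable_on {0..T}"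
   using f by (intro integrable_on_mult_left) (auto simp: L2_def)
  show "(norm (h (f t)))^2 <= (norm (f t))^2 * K^2" for t
   using power_mono[OF K(2) norm_ge_zero, of "f t" 2] by (simp add: power_mult_distrib)
 qed
qed

lemma L2_bilinear_continuous:
 fixes B :: "'a::euclidean_space => 'b::euclidean_space => 'c::euclidean_space"
 assumes B: "bounded_bilinear B" and f: "L2 T f" and g: "continuous_on {0..T} g"
 shows "L2 T (%t. B (f t) (g t))"
proof -
 obtain K where K: "K > 0" "!!a b. norm (B a b) <= norm a * norm b * K"
  using bounded_bilinear.pos_bounded[OF B] by blast
 have "bounded (g ` {0..T})" using g by (intro compact_imp_bounded compact_continuous_image) auto
 then obtain M where M: "M > 0" "!!t. t : {0..T} ==> norm (g t) <= M" unfolding bounded_pos by auto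
 show ?thesis
 proof (rule L2I)
  show "(%t. B (f t) (g t)) : borel_measurable (lebesgue_on {0..T})"
   by (rule measurable_bilinear[OF B L2_measurable[OF f] continuous_on_measurable_lebesgue[OF g]])
  show "(%t. (norm (f t))^2 * (M * K)^2) integrable_on {0..T}"
   using f by (intro integrable_on_mult_left) (auto simp: L2_def)
  fix t assume "t : {0..T}"
  then have "norm (f t) * norm (g t) * K <= norm (f t) * M * K"
   using M K by (intro mult_right_mono mult_left_mono) auto
  with K(2)[of "f t" "g t"] have "norm (B (f t) (g t)) <= norm (f t) * (M * K)" by (simp add: mult.assoc)
  from power_mono[OF this norm_ge_zero, of 2]
  show "(norm (B (f t) (g t)))^2 <= (norm (f t))^2 * (M * K)^2" by (simp add: power_mult_distrib)
 qed
qed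

lemma bounded_bilinear_flip: "bounded_bilinear B ==> bounded_bilinear (%x y. B y x)"
 by (rule bounded_bilinear.flip)

lemma L2_continuous_bilinear:
 fixes B :: "'a::euclidean_space => 'b::euclidean_space => 'c::euclidean_space"
 assumes B: "bounded_bilinear B" and f: "continuous_on {0..T} f" and g: "L2 T g"
 shows "L2 T (%t. B (f t) (g t))"
 using L2_bilinear_continuous[OF bounded_bilinear_flip[OF B] g f] .

lemma L2_scaleR: "L2 T f ==> L2 T (%t. c *R f t)"
 by (rule L2_bounded_linear[OF bounded_linear_scaleR_right])

lemma L2_add:
 assumes f: "L2 T f" and g: "L2 T g"
 shows "L2 T (%t. f t + g t)"
proof (rule L2I)
 show "(%t. f t + g t) : borel_measurable (lebesgue_on {0..T})"
  using assms by (intro borel_measurable_add L2_measurable)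
 show "(%t. 2 * (norm (f t))^2 + 2 * (norm (g t))^2) integrable_on {0..T}"
  using f g by (intro integrable_on_mult_right integrable_add) (auto simp: L2_def)
 show "(norm (f t + g t))^2 <= 2 * (norm (f t))^2 + 2 * (norm (g t))^2" for t
 proof -
  have "(norm (f t + g t))^2 <= (norm (f t) + norm (g t))^2"
   by (intro power_mono norm_triangle_ineq) auto
  also have "... <= 2 * (norm (f t))^2 + 2 * (norm (g t))^2"
   using sum_squares_bound[of "norm (f t)" "norm (g t)"] by (simp add: power2_sum)
  finally show ?thesis .
 qed
qed

lemma L2_minus: "L2 T f ==> L2 T (%t. - f t)"
 using L2_scaleR[of T f "-1"] by simp

lemma L2_diff: "L2 T f ==> L2 T g ==> L2 T (%t. f t - g t)"
 using L2_add[of T f "%t. - g t"] L2_minus by auto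

lemma L2_sum: "(!!i. i : I ==> L2 T (f i)) ==> L2 T (%t. SUM i:I. f i t)"
 by (induction I rule: infinite_finite_induct) (auto intro: L2_add)

lemma L2_vec_nth: "L2 T f ==> L2 T (%t. f t $ i)"
 for f :: "real => (real, 'n::finite) vec"
 by (rule L2_bounded_linear[OF bounded_linear_vec_nth])

lemma L2_norm: "L2 T f ==> L2 T (%t. norm (f t))"
 unfolding L2_def by (auto intro: borel_measurable_norm)

lemma L2_scaleR_fun:
 fixes w :: "real => real"
 shows "L2 T w ==> continuous_on {0..T} f ==> L2 T (%t. w t *R f t)"
 by (rule L2_bilinear_continuous[OF bounded_bilinear_scaleR])

lemma L2_mono: "L2 T f ==> t <= T ==> L2 t f"
 unfolding L2_def
proof (elim conjE, intro conjI)
 assume m: "f : borel_measurable (lebesgue_on {0..T})" and t: "t <= T"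
 show "f : borel_measurable (lebesgue_on {0..t})"
  by (rule measurable_restrict_mono[OF m]) (use t in auto)
 assume "(%t. (norm (f t))^2) integrable_on {0..T}"
 then show "(%t. (norm (f t))^2) integrable_on {0..t}"
  by (rule integrable_on_subinterval) (use t in auto)
qed

lemma n2_nonneg[simp]: "0 <= n2 T f"
 unfolding n2_def by (cases "(%t. (norm (f t))^2) integrable_on {0..T}")
  (auto intro!: Henstock_Kurzweil_Integration.integral_nonneg simp: not_integrable_integral)

lemma n2_power2: "(n2 T f)^2 = integral {0..T} (%t. (norm (f t))^2)"
proof -
 have "0 <= integral {0..T} (%t. (norm (f t))^2)"
  by (cases "(%t. (norm (f t))^2) integrable_on {0..T}")
   (auto intro!: Henstock_Kurzweil_Integration.integral_nonneg simp: not_integrable_integral)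
 then show ?thesis unfolding n2_def by simp
qed

lemma n2_mono: "L2 T f ==> t <= T ==> n2 t f <= n2 T f"
 unfolding n2_def using L2_norm_integrable[of T f] L2_norm_integrable[OF L2_mono[of T f t]]
 by (intro real_sqrt_le_mono integral_subset_le) auto

text \<open>Discriminant argument: the minimum over \<open>x\<close> is attained at
  \<open>x = B / C\<close>.\<close>

lemma square_le_of_quadratic_nonneg:
 fixes A B C :: real
 assumes "!!x. 0 <= A - 2 * x * B + x^2 * C" "0 <= A" "0 <= C"
 shows "B^2 <= A * C"
proof (cases "C = 0")
 case True
 have "B = 0"
 proof (rule ccontr)
  assume B: "B ~= 0"
  \<comment> \<open>With \<open>C = 0\<close>, this \<open>x\<close> would make the expression equal
    to -1.\<close>
  show False using assms(1)[of "(A + 1) / (2 * B)"] True B assms(2) by (simp add: field_simps)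
 qed
 then show ?thesis using True by simp
next
 case False
 then have C: "C > 0" using assms(3) by simp
 have "0 <= (A - 2 * (B / C) * B + (B / C)^2 * C) * C"
  using assms(1)[of "B / C"] C by (intro mult_nonneg_nonneg) auto
 also have "... = A * C - B^2" using C by (simp add: field_simps power2_eq_square)
 finally show ?thesis by simp
qed

lemma L2_mult_integrable: "L2 T f ==> L2 T g ==> (%t. f t * g t) integrable_on {0..T}"
 for f g :: "real => real"
 using L2_bilinear_absolutely_integrable[OF bounded_bilinear_mult] absolutely_integrable_on_def by blast

lemma L2_Cauchy_Schwarz:
 assumes f: "L2 T f" and g: "L2 T g"
 shows "integral {0..T} (%t. norm (f t) * norm (g t)) <= n2 T f * n2 T g"
proof -
 have i: "(%t. (norm (f t))^2) integrable_on {0..T}" "(%t. (norm (g t))^2) integrable_on {0..T}"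
  "(%t. norm (f t) * norm (g t)) integrable_on {0..T}"
  using f g L2_mult_integrable[OF L2_norm[OF f] L2_norm[OF g]] by (auto simp: L2_def)
 have "(integral {0..T} (%t. norm (f t) * norm (g t)))^2 <=
  integral {0..T} (%t. (norm (f t))^2) * integral {0..T} (%t. (norm (g t))^2)"
 proof (rule square_le_of_quadratic_nonneg)
  fix x :: real
  have "((%t. (norm (f t))^2 - (2 * x) * (norm (f t) * norm (g t)) + x^2 * (norm (g t))^2) has_integral
    integral {0..T} (%t. (norm (f t))^2) - (2 * x) * integral {0..T} (%t. norm (f t) * norm (g t)) +
    x^2 * integral {0..T} (%t. (norm (g t))^2)) {0..T}"
   by (intro has_integral_add has_integral_diff has_integral_mult_right integrable_integral i)
  moreover have "0 <= (norm (f t))^2 - (2 * x) * (norm (f t) * norm (g t)) + x^2 * (norm (g t))^2" for t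
   using zero_le_power2[of "norm (f t) - x * norm (g t)"]
   by (simp add: power2_diff power_mult_distrib algebra_simps)
  ultimately show "0 <= integral {0..T} (%t. (norm (f t))^2) - 2 * x * integral {0..T} (%t. norm (f t) * norm (g t)) +
    x^2 * integral {0..T} (%t. (norm (g t))^2)"
   by (rule has_integral_nonneg)
 qed (auto intro!: Henstock_Kurzweil_Integration.integral_nonneg i)
 then show ?thesis unfolding n2_power2[symmetric] power_mult_distrib[symmetric]
  by (rule power2_le_imp_le) auto
qed

lemma L2_integral_bound:
 fixes e :: "real => 'c::euclidean_space"
 assumes f: "L2 T f" and g: "L2 T g" and t: "t <= T" and c: "c >= 0"
  and e: "e integrable_on {0..t}" "!!s. s : {0..t} ==> norm (e s) <= c * (norm (f s) * norm (g s))"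
 shows "norm (integral {0..t} e) <= c * (n2 T f * n2 T g)"
proof -
 note f' = L2_mono[OF f t] and g' = L2_mono[OF g t]
 have i: "(%s. norm (f s) * norm (g s)) integrable_on {0..t}"
  by (rule L2_mult_integrable[OF L2_norm[OF f'] L2_norm[OF g']])
 have "norm (integral {0..t} e) <= integral {0..t} (%s. c * (norm (f s) * norm (g s)))"
  using e i by (intro integral_norm_bound_integral integrable_on_mult_right) auto
 also have "... = c * integral {0..t} (%s. norm (f s) * norm (g s))" by simp
 also have "... <= c * (n2 t f * n2 t g)" using L2_Cauchy_Schwarz[OF f' g'] c by (rule mult_left_mono)
 also have "... <= c * (n2 T f * n2 T g)"
  using n2_mono[OF f t] n2_mono[OF g t] c by (intro mult_left_mono mult_mono) auto
 finally show ?thesis .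
qed

lemma n2_scaleR: "n2 T (%t. c *R f t) = \<bar>c\<bar> * n2 T f"
 unfolding n2_def by (simp add: power_mult_distrib real_sqrt_mult)

lemma n2_cong: "(!!t. t : {0..T} ==> norm (f t) = norm (g t)) ==> n2 T f = n2 T g"
 unfolding n2_def by (metis (mono_tags, lifting) Henstock_Kurzweil_Integration.integral_cong)

lemma n2_norm[simp]: "n2 T (%t. norm (f t)) = n2 T f"
 unfolding n2_def by simp

lemma n2_triangle:
 assumes f: "L2 T f" and g: "L2 T g"
 shows "n2 T (%t. f t + g t) <= n2 T f + n2 T g"
proof -
 have i: "(%t. (norm (f t))^2) integrable_on {0..T}" "(%t. (norm (g t))^2) integrable_on {0..T}"
  "(%t. norm (f t) * norm (g t)) integrable_on {0..T}"
  using f g L2_mult_integrable[OF L2_norm[OF f] L2_norm[OF g]] by (auto simp: L2_def)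
 have "(n2 T (%t. f t + g t))^2 <= integral {0..T} (%t. (norm (f t))^2 + 2 * (norm (f t) * norm (g t)) + (norm (g t))^2)"
  unfolding n2_power2
 proof (rule integral_le)
  show "(%t. (norm (f t + g t))^2) integrable_on {0..T}" using L2_add[OF f g] by (simp add: L2_def)
  show "(norm (f t + g t))^2 <= (norm (f t))^2 + 2 * (norm (f t) * norm (g t)) + (norm (g t))^2" for t
   using power_mono[OF norm_triangle_ineq[of "f t" "g t"] norm_ge_zero, of 2] by (simp add: power2_sum)
 qed (intro integrable_add integrable_on_mult_right i)
 also have "... = (n2 T f)^2 + 2 * integral {0..T} (%t. norm (f t) * norm (g t)) + (n2 T g)^2"
  unfolding n2_power2
  by (intro integral_unique has_integral_add has_integral_mult_right integrable_integral i)
 also have "... <= (n2 T f + n2 T g)^2"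
  using L2_Cauchy_Schwarz[OF f g] by (simp add: power2_sum)
 finally show ?thesis by (rule power2_le_imp_le) (simp add: n2_nonneg)
qed

lemma n2_triangle_diff:
 "L2 T f ==> L2 T g ==> n2 T f <= n2 T g + n2 T (%t. f t - g t)"
 using n2_triangle[of T g "%t. f t - g t"] L2_diff[of T f g] by simp

section \<open>Calculus of indefinite integrals\<close>

lemma indef_integral:
 assumes "f absolutely_integrable_on {0..T}"
 shows "indef T f (%t. c + integral {0..t} f)"
 unfolding indef_def
proof (intro conjI ballI)
 fix t assume "t : {0..T}"
 then have "f integrable_on {0..t}"
  using assms by (auto simp: absolutely_integrable_on_def intro: integrable_on_subinterval)
 then show "(f has_integral (c + integral {0..t} f) - (c + integral {0..0} f)) {0..t}"
  by (simp add: has_integral_integral)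
qed (use assms in auto)

lemma indefI:
 assumes "f absolutely_integrable_on {0..T}" "!!t. t : {0..T} ==> F t = c + integral {0..t} f"
 shows "indef T f F"
proof -
 note * = indef_integral[OF assms(1), of c]
 show ?thesis
 proof (cases "T >= 0")
  case True
  then show ?thesis using * assms(2) unfolding indef_def by simp
 qed (use assms in \<open>auto simp: indef_def\<close>)
qed

lemma indefD: "indef T f F ==> t : {0..T} ==> F t = F 0 + integral {0..t} f"
 unfolding indef_def by (metis add.commute diff_add_cancel integral_unique)

lemma indef_has_integral: "indef T f F ==> t : {0..T} ==> (f has_integral F t - F 0) {0..t}"
 unfolding indef_def by blast

lemma indef_absolutely_integrable: "indef T f F ==> f absolutely_integrable_on {0..T}"
 unfolding indef_def by blast

lemma indef_integrable: "indef T f F ==> f integrable_on {0..T}"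
 unfolding indef_def by (auto simp: absolutely_integrable_on_def)

lemma indef_continuous_on: "indef T f F ==> continuous_on {0..T} F"
proof -
 assume *: "indef T f F"
 have "continuous_on {0..T} (%t. F 0 + integral {0..t} f)"
  using indef_integrable[OF *] by (intro continuous_intros indefinite_integral_continuous_1)
 then show ?thesis by (rule continuous_on_eq) (simp add: indefD[OF *, symmetric])
qed

lemma indef_diff_integral:
 assumes "indef T f F" "0 <= s" "s <= t" "t <= T"
 shows "(f has_integral F t - F s) {s..t}"
proof -
 have i: "f integrable_on {0..t}" using indef_integrable[OF assms(1)] assms
  by (auto intro: integrable_on_subinterval)
 have "integral {0..s} f + integral {s..t} f = integral {0..t} f"
  using assms i by (intro Henstock_Kurzweil_Integration.integral_combine) auto
 moreover have "f integrable_on {s..t}" using i assms by (auto intro: integrable_on_subinterval)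
 ultimately show ?thesis
  using indefD[OF assms(1), of s] indefD[OF assms(1), of t] assms
  by (simp add: has_integral_iff algebra_simps)
qed

lemma indef_const: "indef T (%t. 0) (%t. c)"
 unfolding indef_def by auto

lemma indef_add: "indef T f F ==> indef T g G ==> indef T (%t. f t + g t) (%t. F t + G t)"
 unfolding indef_def by (auto simp: add_diff_add intro!: has_integral_add)

lemma indef_bounded_linear:
 assumes h: "bounded_linear h" and F: "indef T f F"
 shows "indef T (%t. h (f t)) (%t. h (F t))"
 unfolding indef_def
proof (intro conjI ballI)
 show "(%t. h (f t)) absolutely_integrable_on {0..T}"
  using absolutely_integrable_linear[OF indef_absolutely_integrable[OF F] h] by (simp add: o_def)
 show "((%t. h (f t)) has_integral h (F t) - h (F 0)) {0..t}" if "t : {0..T}" for t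
  using has_integral_linear[OF indef_has_integral[OF F that] h]
  by (simp add: o_def bounded_linear.linear[OF h] linear_diff)
qed

lemma indef_scaleR: "indef T f F ==> indef T (%t. c *R f t) (%t. c *R F t)"
 by (rule indef_bounded_linear[OF bounded_linear_scaleR_right])

lemma indef_minus: "indef T f F ==> indef T (%t. - f t) (%t. - F t)"
 using indef_scaleR[of T f F "-1"] by simp

lemma indef_diff: "indef T f F ==> indef T g G ==> indef T (%t. f t - g t) (%t. F t - G t)"
 using indef_add[of T f F "%t. - g t" "%t. - G t"] indef_minus by auto

lemma indef_cong:
 assumes "indef T f F" "!!t. t : {0..T} ==> f t = g t" "!!t. t : {0..T} ==> F t = G t"
 shows "indef T g G"
proof (cases "T >= 0")
 case True
 show ?thesis unfolding indef_def
 proof (intro conjI ballI)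
  show "g absolutely_integrable_on {0..T}"
   by (rule absolutely_integrable_spike[OF indef_absolutely_integrable[OF assms(1)], of "{}"]) (use assms(2) in auto)
  fix t assume t: "t : {0..T}"
  have "(g has_integral F t - F 0) {0..t}"
   using indef_has_integral[OF assms(1) t] assms(2) t by (subst has_integral_cong[symmetric, of _ f]) auto
  then show "(g has_integral G t - G 0) {0..t}" using assms(3) t True by simp
 qed
qed (auto simp: indef_def)

lemma indef_spike:
 assumes "indef T f F" "negligible N" "!!t. t : {0..T} - N ==> g t = f t"
 shows "indef T g F"
 unfolding indef_def
proof (intro conjI ballI)
 show "g absolutely_integrable_on {0..T}"
  using absolutely_integrable_spike[OF indef_absolutely_integrable[OF assms(1)] assms(2), of g] assms(3) by auto
 fix t assume t: "t : {0..T}"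
 show "(g has_integral F t - F 0) {0..t}"
  by (rule has_integral_spike[OF assms(2) _ indef_has_integral[OF assms(1) t]]) (use t assms(3) in auto)
qed

text \<open>Cut \<open>{0..t}\<close> into equal pieces shorter than the \<open>d\<close> that
  belongs to \<open>e\<close>. The increments add up to at most \<open>e\<close> times the integral
  of \<open>m\<close>, and \<open>e\<close> is arbitrary.\<close>

lemma small_increments_imp_constant:
 fixes P :: "real => 'a::real_normed_vector"
 assumes m: "m integrable_on {0..T}" and t: "t : {0..T}"
  and small: "!!e. e > 0 ==> EX d>0. ALL r s. 0 <= r --> r <= s --> s <= T --> s - r < d -->
   norm (P s - P r) <= e * integral {r..s} m"
 shows "P t = P 0"
proof -
 have mi: "m integrable_on {r..s}" if "0 <= r" "s <= T" for r s
  using m that by (auto intro: integrable_on_subinterval)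
 have bnd: "norm (P t - P 0) <= e * integral {0..t} m" if "e > 0" for e
 proof -
  obtain d where d: "d > 0" "!!r s. 0 <= r ==> r <= s ==> s <= T ==> s - r < d ==>
   norm (P s - P r) <= e * integral {r..s} m" using small[OF \<open>e > 0\<close>] by blast
  obtain n :: nat where n: "t / d < real n" using reals_Archimedean2 by blast
  have n0: "real n > 0" using n t d by (meson atLeastAtMost_iff divide_nonneg_pos order_le_less_trans)
  define h where "h = t / real n"
  have h: "0 <= h" "h < d" "real n * h = t" unfolding h_def using n t d n0 by (auto simp: field_simps)
  have "norm (P (real i * h) - P 0) <= e * integral {0..real i * h} m" if "i <= n" for i
   using that
  proof (induction i)
   case (Suc i)
   have le: "real i * h <= real (Suc i) * h" "real (Suc i) * h <= T"
    using Suc.prems h t mult_right_mono[of "real (Suc i)" "real n" h] by (auto simp: algebra_simps)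
   have "norm (P (real (Suc i) * h) - P (real i * h)) <= e * integral {real i * h..real (Suc i) * h} m"
    using h le by (intro d(2)) (auto simp: algebra_simps)
   moreover have "integral {0..real i * h} m + integral {real i * h..real (Suc i) * h} m = integral {0..real (Suc i) * h} m"
    using h le mi by (intro Henstock_Kurzweil_Integration.integral_combine) auto
   then have "e * integral {0..real (Suc i) * h} m = e * integral {0..real i * h} m + e * integral {real i * h..real (Suc i) * h} m"
    by (metis distrib_left)
   moreover have "norm (P (real i * h) - P 0) <= e * integral {0..real i * h} m" using Suc by simp
   ultimately have "norm (P (real (Suc i) * h) - P (real i * h)) + norm (P (real i * h) - P 0) <= e * integral {0..real (Suc i) * h} m"
    by linarith
   then show ?case by (smt (verit) norm_triangle_ineq diff_add_cancel add_diff_eq)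
  qed simp
  from this[of n] show ?thesis using h by simp
 qed
 show ?thesis
 proof (rule ccontr)
  assume ne: "P t ~= P 0"
  define I where "I = integral {0..t} m"
  have "norm (P t - P 0) <= (norm (P t - P 0) / (2 * (\<bar>I\<bar> + 1))) * I"
   unfolding I_def by (rule bnd) (use ne in \<open>auto intro!: divide_pos_pos\<close>)
  also have "... <= (norm (P t - P 0) / (2 * (\<bar>I\<bar> + 1))) * (\<bar>I\<bar> + 1)"
   by (intro mult_left_mono) auto
  also have "... = norm (P t - P 0) / 2" by (simp add: field_simps)
  finally show False using ne by simp
 qed
qed

text \<open>Integration by parts without differentiability: over a short interval the increment of
 the difference of both sides is dominated by the modulus of continuity times the integral of
 the densities.\<close>

lemma indef_bilinear:
 fixes B :: "'a::euclidean_space => 'b::euclidean_space => 'c::euclidean_space"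
 assumes B: "bounded_bilinear B" and F: "indef T f F" and G: "indef T g G"
 shows "indef T (%t. B (f t) (G t) + B (F t) (g t)) (%t. B (F t) (G t))"
proof -
 interpret bounded_bilinear B by (rule B)
 obtain K where K: "K > 0" "!!a b. norm (B a b) <= norm a * norm b * K" using pos_bounded by blast
 note cF = indef_continuous_on[OF F] and cG = indef_continuous_on[OF G]
 note aF = indef_absolutely_integrable[OF F] and aG = indef_absolutely_integrable[OF G]
 have prod: "(%t. B' (p t) (q t)) absolutely_integrable_on {0..T}"
  if B': "bounded_bilinear B'" and p: "p absolutely_integrable_on {0..T}" and q: "continuous_on {0..T} q"
  for B' :: "'x::euclidean_space => 'y::euclidean_space => 'c" and p q
 proof -
  obtain K where K: "K > 0" "!!a b. norm (B' a b) <= norm a * norm b * K"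
   using bounded_bilinear.pos_bounded[OF B'] by blast
  have "bounded (q ` {0..T})" using q by (intro compact_imp_bounded compact_continuous_image) auto
  then obtain M where M: "M > 0" "!!t. t : {0..T} ==> norm (q t) <= M" unfolding bounded_pos by auto
  show ?thesis
  proof (rule measurable_bounded_by_integrable_imp_absolutely_integrable)
   show "(%t. B' (p t) (q t)) : borel_measurable (lebesgue_on {0..T})"
    using p by (intro measurable_bilinear[OF B'] continuous_on_measurable_lebesgue q
     absolutely_integrable_imp_borel_measurable) auto
   show "(%t. norm (p t) * (M * K)) integrable_on {0..T}"
    using p by (intro integrable_on_mult_left) (auto simp: absolutely_integrable_on_def)
   fix t assume "t : {0..T}"
   then have "norm (p t) * norm (q t) * K <= norm (p t) * M * K"
    using M K by (intro mult_right_mono mult_left_mono) auto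
   with K(2)[of "p t" "q t"] show "norm (B' (p t) (q t)) <= norm (p t) * (M * K)" by (simp add: mult.assoc)
  qed auto
 qed
 have a1: "(%t. B (f t) (G t)) absolutely_integrable_on {0..T}" by (rule prod[OF B aF cG])
 have a2: "(%t. B (F t) (g t)) absolutely_integrable_on {0..T}"
  by (rule prod[OF bounded_bilinear_flip[OF B] aG cF])
 define k where "k t = B (f t) (G t) + B (F t) (g t)" for t
 have ak: "k absolutely_integrable_on {0..T}" unfolding k_def using a1 a2 by (rule set_integral_add)
 have ki: "k integrable_on {r..s}" if "0 <= r" "s <= T" for r s
  using ak that by (auto simp: absolutely_integrable_on_def intro: integrable_on_subinterval)
 define P where "P t = B (F t) (G t) - integral {0..t} k" for t
 define m where "m t = (norm (f t) + norm (g t)) * K" for t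
 have m: "m integrable_on {0..T}" unfolding m_def using aF aG
  by (intro integrable_on_mult_left integrable_add) (auto simp: absolutely_integrable_on_def)
 have "P t = P 0" if t: "t : {0..T}" for t
 proof (rule small_increments_imp_constant[OF m t])
  fix e :: real assume e: "e > 0"
  have "uniformly_continuous_on {0..T} F" "uniformly_continuous_on {0..T} G"
   using cF cG by (auto intro: compact_uniformly_continuous)
  then obtain d1 d2 where d1: "d1 > 0" "!!x y. x : {0..T} ==> y : {0..T} ==> dist y x < d1 ==> dist (F y) (F x) < e"
   and d2: "d2 > 0" "!!x y. x : {0..T} ==> y : {0..T} ==> dist y x < d2 ==> dist (G y) (G x) < e"
   unfolding uniformly_continuous_on_def using e by metis
  have "norm (P s - P r) <= e * integral {r..s} m"
   if rs: "0 <= r" "r <= s" "s <= T" "s - r < min d1 d2" for r s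
  proof -
   have comb: "integral {0..r} k + integral {r..s} k = integral {0..s} k"
    using rs ki by (intro Henstock_Kurzweil_Integration.integral_combine) auto
   have "(f has_integral F s - F r) {r..s}" "(g has_integral G s - G r) {r..s}"
    using indef_diff_integral[OF F] indef_diff_integral[OF G] rs by auto
   \<comment> \<open>\<open>G\<close> is frozen at the right end and \<open>F\<close> at the left
     end: the two integrals add up to the exact increment of \<open>B (F x) (G x)\<close>, and only
     the oscillation of \<open>F\<close> and \<open>G\<close> separates them from the integral of
     \<open>k\<close>.\<close>
   then have "((%x. B (f x) (G s)) has_integral B (F s - F r) (G s)) {r..s}"
    "((%x. B (F r) (g x)) has_integral B (F r) (G s - G r)) {r..s}"
    using has_integral_linear[of f _ _ "%x. B x (G s)", OF _ bounded_linear_left]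
     has_integral_linear[of g _ _ "B (F r)", OF _ bounded_linear_right]
    by (simp_all add: o_def)
   then have "((%x. B (f x) (G s) + B (F r) (g x) - k x) has_integral
     B (F s - F r) (G s) + B (F r) (G s - G r) - integral {r..s} k) {r..s}"
    using ki[of r s] rs by (intro has_integral_diff has_integral_add integrable_integral) auto
   moreover have "B (F s - F r) (G s) + B (F r) (G s - G r) - integral {r..s} k = P s - P r"
    unfolding P_def using comb by (simp add: diff_left diff_right algebra_simps flip: comb)
   ultimately have hi: "((%x. B (f x) (G s) + B (F r) (g x) - k x) has_integral P s - P r) {r..s}" by simp
   have mrs: "m integrable_on {r..s}" using m rs by (auto intro: integrable_on_subinterval)
   have "norm (P s - P r) <= integral {r..s} (%x. e * m x)"
    unfolding integral_unique[OF hi, symmetric]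
   proof (rule integral_norm_bound_integral)
    fix x assume x: "x : {r..s}"
    have "B (f x) (G s) + B (F r) (g x) - k x = B (f x) (G s - G x) + B (F r - F x) (g x)"
     unfolding k_def by (simp add: diff_left diff_right)
    also have "norm ... <= norm (f x) * norm (G s - G x) * K + norm (F r - F x) * norm (g x) * K"
     using K(2) norm_triangle_ineq add_mono order_trans by metis
    also have "... <= norm (f x) * e * K + e * norm (g x) * K"
     using d1(2)[of x r] d2(2)[of x s] x rs K
     by (intro add_mono mult_right_mono mult_left_mono) (auto simp: dist_norm norm_minus_commute)
    finally show "norm (B (f x) (G s) + B (F r) (g x) - k x) <= e * m x"
     unfolding m_def by (simp add: algebra_simps)
   qed (use hi mrs in \<open>auto intro: integrable_on_mult_right\<close>)
   then show ?thesis by simp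
  qed
  then show "EX d>0. ALL r s. 0 <= r --> r <= s --> s <= T --> s - r < d --> norm (P s - P r) <= e * integral {r..s} m"
   using d1(1) d2(1) by (intro exI[of _ "min d1 d2"]) auto
 qed
 note PP = this
 have "indef T k (%t. B (F t) (G t))"
 proof (intro indefI[OF ak, where c="B (F 0) (G 0)"])
  fix t assume "t : {0..T}"
  then have "P t = P 0" by (rule PP)
  then show "B (F t) (G t) = B (F 0) (G 0) + integral {0..t} k" unfolding P_def by (simp add: diff_eq_eq)
 qed
 then show ?thesis unfolding k_def .
qed

section \<open>Gronwall's inequality and Picard iteration with square-integrable Lipschitz constants\<close>

lemma gronwall:
 fixes f :: "real => real"
 assumes f: "continuous_on {0..T} f" and B: "B >= 0" and t: "t : {0..T}"
  and le: "!!t. t : {0..T} ==> f t <= A + B * integral {0..t} f"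
 shows "f t <= A * exp (B * t)"
proof -
 define I where "I t = integral {0..t} f" for t
 define u where "u t = exp (- B * t) * (A + B * I t)" for t
 have dI: "(I has_real_derivative f x) (at x within {0..T})" if "x : {0..T}" for x
  unfolding I_def using integral_has_real_derivative[OF f that] .
 have cI: "continuous_on {0..T} I"
  using dI by (meson DERIV_continuous continuous_on_eq_continuous_within)
 have "u t <= u 0"
 proof (rule DERIV_nonpos_imp_decreasing_open[of 0 t u])
  show "0 <= t" using t by simp
  show "continuous_on {0..t} u"
   unfolding u_def using t by (intro continuous_intros continuous_on_subset[OF cI]) auto
  fix x assume x: "0 < x" "x < t"
  have "(I has_real_derivative f x) (at x)"
   using dI[of x] at_within_interior[of x "{0..T}"] x t by (auto simp: interior_atLeastAtMost_real)
  then have "(u has_real_derivative (- B * exp (- B * x) * (A + B * I x) + exp (- B * x) * (B * f x))) (at x)"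
   unfolding u_def by (auto intro!: derivative_eq_intros simp: algebra_simps)
  moreover have "- B * exp (- B * x) * (A + B * I x) + exp (- B * x) * (B * f x)
    = - (B * exp (- B * x)) * ((A + B * I x) - f x)" by (simp add: algebra_simps)
  moreover have "- (B * exp (- B * x)) * ((A + B * I x) - f x) <= 0"
  proof -
   have "f x <= A + B * I x" unfolding I_def using x t by (intro le) auto
   then have "0 <= (B * exp (- B * x)) * ((A + B * I x) - f x)" using B by (intro mult_nonneg_nonneg) auto
   then show ?thesis by simp
  qed
  ultimately show "EX y. (u has_real_derivative y) (at x) & y <= 0" by metis
 qed
 then have "exp (- B * t) * (A + B * I t) <= A" unfolding u_def I_def by simp
 then have "exp (B * t) * (exp (- B * t) * (A + B * I t)) <= exp (B * t) * A"
  by (intro mult_left_mono) auto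
 then have "A + B * I t <= A * exp (B * t)"
  by (simp add: mult.assoc[symmetric] exp_add[symmetric] mult.commute)
 then show ?thesis using le[OF t] unfolding I_def by linarith
qed

text \<open>The constant of \<open>gronwall_L2\<close>. Squaring the hypothesis and applying
  Cauchy-Schwarz gives \<open>f^2 <= 2 a^2 + 2 N^2 int f^2\<close> with \<open>N = n2 T l\<close>;
  the classical inequality and a square root leave the factor
  \<open>sqrt 2 * exp (N^2 T)\<close>.\<close>

definition gw :: "real => (real => real) => real" where
 "gw T l = sqrt 2 * exp ((n2 T l)^2 * \<bar>T\<bar>)"

lemma gw_pos: "gw T l > 0"
 unfolding gw_def by simp

lemma gronwall_L2:
 fixes f l :: "real => real"
 assumes l: "L2 T l" and f: "continuous_on {0..T} f" "!!t. t : {0..T} ==> 0 <= f t" and a: "a >= 0"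
  and le: "!!t. t : {0..T} ==> f t <= a + integral {0..t} (%s. l s * f s)" and t: "t : {0..T}"
 shows "f t <= a * gw T l"
proof -
 define N where "N = n2 T l"
 have "(f t)^2 <= 2 * a^2 + (2 * N^2) * integral {0..t} (%s. (f s)^2)" if t: "t : {0..T}" for t
 proof -
  have ct: "continuous_on {0..t} f" using f t by (auto intro: continuous_on_subset)
  have L: "L2 t l" "L2 t f" using L2_mono[OF l] L2_continuous_on[OF ct] t by auto
  have "integral {0..t} (%s. l s * f s) <= integral {0..t} (%s. norm (l s) * norm (f s))"
   using L by (intro integral_le L2_mult_integrable L2_norm) (auto simp: abs_mult[symmetric])
  also have "... <= n2 t l * n2 t f" by (rule L2_Cauchy_Schwarz[OF L])
  also have "... <= N * n2 t f" unfolding N_def using n2_mono[OF l] t by (intro mult_right_mono) auto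
  finally have "f t <= a + N * n2 t f" using le[OF t] by linarith
  then have "(f t)^2 <= (a + N * n2 t f)^2" using f(2)[OF t] by (intro power_mono) auto
  also have "... <= 2 * a^2 + 2 * (N * n2 t f)^2"
   using sum_squares_bound[of a "N * n2 t f"] by (simp add: power2_sum)
  also have "... = 2 * a^2 + (2 * N^2) * integral {0..t} (%s. (f s)^2)"
   by (simp add: power_mult_distrib n2_power2)
  finally show ?thesis .
 qed
 then have "(f t)^2 <= 2 * a^2 * exp ((2 * N^2) * t)"
  using f(1) t by (intro gronwall[where T=T]) (auto intro!: continuous_intros)
 also have "... <= 2 * a^2 * exp ((2 * N^2) * \<bar>T\<bar>)"
  using t by (intro mult_left_mono) (auto intro!: mult_left_mono)
 also have "... = (a * gw T l)^2"
  unfolding gw_def N_def by (simp add: power_mult_distrib exp_double[symmetric] mult.assoc)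
 finally show ?thesis using a gw_pos[of T l] by (intro power2_le_imp_le[of "f t"]) auto
qed

text \<open>Common form of the later stability and uniqueness arguments: \<open>y\<close> is
  typically a difference of two solutions, \<open>l\<close> the Lipschitz coefficient, and
  \<open>m\<close> a forcing that only has to be integrable.\<close>

lemma gronwall_indef:
 fixes y :: "real => 'a::euclidean_space"
 assumes l: "L2 T l" and y: "indef T f y"
  and e: "!!s. s : {0..T} ==> norm (f s) <= l s * norm (y s) + m s"
  and m: "m integrable_on {0..T}" "!!s. s : {0..T} ==> 0 <= m s"
  and a: "norm (y 0) + integral {0..T} m <= a" and t: "t : {0..T}"
 shows "norm (y t) <= a * gw T l"
proof -
 have cy: "continuous_on {0..T} (%s. norm (y s))" by (intro continuous_intros indef_continuous_on[OF y])
 have m0: "0 <= integral {0..T} m" using m by (intro Henstock_Kurzweil_Integration.integral_nonneg)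
 show ?thesis
 proof (rule gronwall_L2[OF l cy _ _ _ t])
  show "0 <= a" using a m0 norm_ge_zero[of "y 0"] by linarith
  fix t assume t: "t : {0..T}"
  have i1: "(%s. l s * norm (y s)) integrable_on {0..t}"
   using L2_mult_integrable[OF l L2_continuous_on[OF cy]] t by (auto intro: integrable_on_subinterval)
  have i2: "m integrable_on {0..t}" using m t by (auto intro: integrable_on_subinterval)
  have "norm (integral {0..t} f) <= integral {0..t} (%s. l s * norm (y s) + m s)"
   using indef_has_integral[OF y t] e t
   by (intro integral_norm_bound_integral integrable_add i1 i2) auto
  also have "... = integral {0..t} (%s. l s * norm (y s)) + integral {0..t} m"
   by (intro Henstock_Kurzweil_Integration.integral_add i1 i2)
  also have "integral {0..t} m <= integral {0..T} m"
   using m t i2 by (intro integral_subset_le) auto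
  finally have "norm (integral {0..t} f) <= integral {0..t} (%s. l s * norm (y s)) + integral {0..T} m" by simp
  moreover have "norm (y t) <= norm (y 0) + norm (integral {0..t} f)"
   using indefD[OF y t] norm_triangle_ineq by metis
  ultimately show "norm (y t) <= a + integral {0..t} (%s. l s * norm (y s))" using a by linarith
 qed auto
qed

lemma L1_le_n2:
 assumes "L2 T f" "T >= 0"
 shows "integral {0..T} (%s. norm (f s)) <= sqrt T * n2 T f"
 using L2_Cauchy_Schwarz[OF L2_const[of T "1::real"] assms(1)] assms(2) by (simp add: n2_def[of T "%_. 1"])

text \<open>Weighting by \<open>exp (- lam * t)\<close> makes the integral map a contraction on the
  whole interval at once; as \<open>l\<close> is only square integrable, the weight is estimated by
  Cauchy-Schwarz and not by a supremum of \<open>l\<close>. Composition with the clamp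
  \<open>c\<close> lets bounded continuous functions on the line stand for paths on
  \<open>{0..T}\<close>.\<close>

lemma picard_L2:
 fixes g :: "real => 'e::euclidean_space => 'e"
 assumes T: "T >= 0" and l: "L2 T l" and y0: "continuous_on {0..T} y0"
  and int: "!!y. continuous_on {0..T} y ==> (%s. g s (y s)) absolutely_integrable_on {0..T}"
  and lip: "!!s x y. s : {0..T} ==> norm (g s x - g s y) <= l s * norm (x - y)"
 obtains y where "continuous_on {0..T} y" "!!t. t : {0..T} ==> y t = y0 t + integral {0..t} (%s. g s (y s))"
proof -
 define N where "N = n2 T l"
 \<comment> \<open>Chosen so that \<open>N / sqrt (2 * lam) <= 1/2\<close>, the contraction factor;
   the added 1 keeps \<open>lam\<close> positive when \<open>N = 0\<close>.\<close>
 define lam where "lam = 2 * N^2 + 1"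
 have lam: "lam > 0" unfolding lam_def by (simp add: add_nonneg_pos)
 define c where "c t = max 0 (min t T)" for t
 have c: "c t : {0..T}" "continuous_on UNIV c" "!!t. t : {0..T} ==> c t = t" for t
  using T unfolding c_def by (auto intro!: continuous_intros)
 define G where "G x s = g s (exp (lam * s) *R x s)" for x s
 define Ps where "Ps x t = exp (- lam * t) *R (y0 t + integral {0..t} (G x))" for x t
 have cont: "continuous_on S (apply_bcontfun x)" for S and x :: "real \<Rightarrow>\<^sub>C 'e"
  using apply_bcontfun[of x] by (auto simp: bcontfun_def intro: continuous_on_subset)
 have Gi: "G (apply_bcontfun x) integrable_on {0..T}" for x :: "real \<Rightarrow>\<^sub>C 'e"
 proof -
  have "continuous_on {0..T} (%s. exp (lam * s) *R apply_bcontfun x s)" by (intro continuous_intros cont)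
  from int[OF this] show ?thesis unfolding G_def by (auto simp: absolutely_integrable_on_def)
 qed
 have cPs: "continuous_on {0..T} (Ps (apply_bcontfun x))" for x :: "real \<Rightarrow>\<^sub>C 'e"
  unfolding Ps_def by (intro continuous_intros y0 indefinite_integral_continuous_1 Gi)
 have mem: "(%t. Ps (apply_bcontfun x) (c t)) : bcontfun" for x :: "real \<Rightarrow>\<^sub>C 'e"
  unfolding bcontfun_def
 proof (rule CollectI, intro conjI)
  show "continuous_on UNIV (%t. Ps (apply_bcontfun x) (c t))"
   using c by (intro continuous_on_compose2[OF cPs]) auto
  have "bounded (Ps (apply_bcontfun x) ` {0..T})"
   using cPs by (intro compact_imp_bounded compact_continuous_image) auto
  then show "bounded (range (%t. Ps (apply_bcontfun x) (c t)))"
   by (rule bounded_subset) (use c in auto)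
 qed
 define Ph where "Ph x = Bcontfun (%t. Ps (apply_bcontfun x) (c t))" for x
 have Ph: "apply_bcontfun (Ph x) t = Ps (apply_bcontfun x) (c t)" for x t
  unfolding Ph_def using Bcontfun_inverse[OF mem] by simp
 have contr: "dist (Ph x) (Ph z) <= 1/2 * dist x z" for x z
 proof (rule dist_bound)
  fix t0
  define t where "t = c t0"
  have t: "t : {0..T}" unfolding t_def by (rule c)
  define D where "D = dist x z"
  have D: "norm (apply_bcontfun x s - apply_bcontfun z s) <= D" for s
   unfolding D_def using dist_bounded[of x s z] by (simp add: dist_norm)
  have sub: "G (apply_bcontfun y) integrable_on {0..t}" for y
   by (rule integrable_on_subinterval[OF Gi]) (use t in auto)
  have le: "L2 T (%s. exp (lam * s))" by (intro L2_continuous_on continuous_intros)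
  have n2e: "n2 t (%s. exp (lam * s)) <= exp (lam * t) / sqrt (2 * lam)"
  proof -
   have "((%s. exp (2 * lam * s)) has_integral exp (2 * lam * t) / (2 * lam) - exp (2 * lam * 0) / (2 * lam)) {0..t}"
    using lam t by (intro fundamental_theorem_of_calculus)
     (auto intro!: derivative_eq_intros simp: has_real_derivative_iff_has_vector_derivative[symmetric])
   then have "integral {0..t} (%s. (norm (exp (lam * s)))^2) <= exp (2 * lam * t) / (2 * lam)"
    using lam by (simp add: exp_double[symmetric] mult.assoc integral_unique)
   then have "n2 t (%s. exp (lam * s)) <= sqrt (exp (2 * lam * t) / (2 * lam))"
    unfolding n2_def by (rule real_sqrt_le_mono)
   also have "... = exp (lam * t) / sqrt (2 * lam)"
    by (simp add: real_sqrt_divide exp_double mult.assoc)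
   finally show ?thesis .
  qed
  have "norm (integral {0..t} (%s. G (apply_bcontfun x) s - G (apply_bcontfun z) s)) <= D * (n2 t l * n2 t (%s. exp (lam * s)))"
  proof (rule L2_integral_bound[where f=l and g="%s. exp (lam * s)" and T=t])
   show "L2 t l" "L2 t (%s. exp (lam * s))" using L2_mono[OF l] L2_mono[OF le] t by auto
   show "0 <= D" unfolding D_def by simp
   show "(%s. G (apply_bcontfun x) s - G (apply_bcontfun z) s) integrable_on {0..t}"
    using sub by (intro integrable_diff)
   fix s assume s: "s : {0..t}"
   have "norm (G (apply_bcontfun x) s - G (apply_bcontfun z) s) <=
     l s * norm (exp (lam * s) *R apply_bcontfun x s - exp (lam * s) *R apply_bcontfun z s)"
    unfolding G_def using s t by (intro lip) auto
   also have "... = l s * (exp (lam * s) * norm (apply_bcontfun x s - apply_bcontfun z s))"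
    by (simp flip: scaleR_diff_right)
   also have "... <= \<bar>l s\<bar> * (exp (lam * s) * D)"
    using D by (intro mult_mono mult_left_mono) auto
   finally show "norm (G (apply_bcontfun x) s - G (apply_bcontfun z) s) <= D * (norm (l s) * norm (exp (lam * s)))"
    by (simp add: mult_ac)
  qed simp
  also have "... <= D * (N * (exp (lam * t) / sqrt (2 * lam)))"
   unfolding N_def D_def using n2_mono[OF l] n2e t lam by (intro mult_left_mono mult_mono) auto
  finally have b: "norm (integral {0..t} (G (apply_bcontfun x)) - integral {0..t} (G (apply_bcontfun z))) <=
   D * (N * (exp (lam * t) / sqrt (2 * lam)))"
   using sub by (simp add: Henstock_Kurzweil_Integration.integral_diff)
  have "N <= sqrt (2 * lam) / 2"
  proof -
   have "2 * N <= sqrt (2 * lam)" unfolding lam_def by (rule real_le_rsqrt) (simp add: power_mult_distrib)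
   then show ?thesis by simp
  qed
  then have half: "N / sqrt (2 * lam) <= 1/2" using lam by (simp add: field_simps)
  have "dist (apply_bcontfun (Ph x) t0) (apply_bcontfun (Ph z) t0)
   = exp (- lam * t) * norm (integral {0..t} (G (apply_bcontfun x)) - integral {0..t} (G (apply_bcontfun z)))"
   unfolding Ph t_def[symmetric] Ps_def by (simp add: dist_norm flip: scaleR_diff_right)
  also have "... <= exp (- lam * t) * (D * (N * (exp (lam * t) / sqrt (2 * lam))))"
   using b by (intro mult_left_mono) auto
  also have "... = D * (N / sqrt (2 * lam))" by (simp add: exp_minus field_simps)
  also have "... <= D * (1/2)" using half unfolding D_def by (intro mult_left_mono) auto
  finally show "dist (apply_bcontfun (Ph x) t0) (apply_bcontfun (Ph z) t0) <= 1/2 * dist x z"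
   unfolding D_def by simp
 qed
 have "EX! x. Ph x = x"
  by (rule banach_fix_type[of "1/2"]) (use contr in auto)
 then obtain x where x: "Ph x = x" by blast
 define y where "y t = exp (lam * t) *R apply_bcontfun x t" for t
 show ?thesis
 proof
  show "continuous_on {0..T} y" unfolding y_def by (intro continuous_intros cont)
  fix t assume t: "t : {0..T}"
  have "apply_bcontfun x t = Ps (apply_bcontfun x) t" using Ph[of x t] x c(3)[OF t] by simp
  then show "y t = y0 t + integral {0..t} (%s. g s (y s))"
   unfolding y_def Ps_def G_def by (simp add: exp_minus)
 qed
qed

section \<open>Smooth vector fields with bounded derivatives\<close>

lemma iter_dir_deriv_append: "iter_dir_deriv us (iter_dir_deriv vs f) = iter_dir_deriv (us @ vs) f"
 by (induction us) auto

lemma Cb_infinity_iter: "Cb_infinity f ==> Cb_infinity (iter_dir_deriv vs f)"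
 unfolding Cb_infinity_def iter_dir_deriv_append by blast

lemma Cb_infinity_has_derivative:
 "Cb_infinity f ==> (f has_derivative frechet_derivative f (at x)) (at x)"
 unfolding Cb_infinity_def by (metis frechet_derivative_works iter_dir_deriv.simps(1))

lemma Cb_infinity_linear: "Cb_infinity f ==> linear (frechet_derivative f (at x))"
 using Cb_infinity_has_derivative has_derivative_linear by blast

lemma Cb_infinity_bounded: "Cb_infinity f ==> EX C>0. ALL x. norm (f x) <= C"
 unfolding Cb_infinity_def by (metis bounded_pos iter_dir_deriv.simps(1) rangeI)

lemma Cb_infinity_continuous_on: "Cb_infinity f ==> continuous_on S f"
 by (meson Cb_infinity_has_derivative continuous_at_imp_continuous_on has_derivative_continuous)

lemma Cb_infinity_dir: "Cb_infinity f ==> Cb_infinity (%x. frechet_derivative f (at x) v)"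
 using Cb_infinity_iter[of f "[v]"] by simp

text \<open>The class is defined by derivatives along fixed vectors. Expansion in the finite basis
  turns bounds for these into bounds that are uniform in the direction \<open>v\<close>.\<close>

lemma Cb_infinity_expand:
 fixes f :: "'a::euclidean_space => 'b::real_normed_vector"
 assumes "Cb_infinity f"
 shows "frechet_derivative f (at x) v = (SUM b:Basis. (v \<bullet> b) *R frechet_derivative f (at x) b)"
proof -
 interpret linear "frechet_derivative f (at x)" by (rule Cb_infinity_linear[OF assms])
 have "frechet_derivative f (at x) (SUM b:Basis. (v \<bullet> b) *R b) = (SUM b:Basis. (v \<bullet> b) *R frechet_derivative f (at x) b)"
  by (simp add: sum scale)
 then show ?thesis by (simp add: euclidean_representation)
qed

lemma Cb_infinity_derivative_bound:
 fixes f :: "'a::euclidean_space => 'b::real_normed_vector"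
 assumes "Cb_infinity f"
 shows "EX C>0. ALL x v. norm (frechet_derivative f (at x) v) <= C * norm v"
proof -
 have "EX C>0. ALL x. norm (frechet_derivative f (at x) b) <= C" for b
  using Cb_infinity_bounded[OF Cb_infinity_dir[OF assms]] .
 then obtain C where C: "!!b. C b > 0" "!!b x. norm (frechet_derivative f (at x) b) <= C b" by metis
 have "norm (frechet_derivative f (at x) v) <= (SUM b:Basis. C b) * norm v" for x v
 proof -
  have "norm (frechet_derivative f (at x) v) <= (SUM b:Basis. norm ((v \<bullet> b) *R frechet_derivative f (at x) b))"
   by (subst Cb_infinity_expand[OF assms]) (rule norm_sum)
  also have "... <= (SUM b:Basis. C b * norm v)"
  proof (rule sum_mono)
   fix b :: 'a assume "b : Basis"
   then have "\<bar>v \<bullet> b\<bar> * norm (frechet_derivative f (at x) b) <= norm v * C b"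
    using C Basis_le_norm by (intro mult_mono) auto
   then show "norm ((v \<bullet> b) *R frechet_derivative f (at x) b) <= C b * norm v" by (simp add: mult.commute)
  qed
  finally show ?thesis by (simp add: sum_distrib_right)
 qed
 moreover have "(SUM b:Basis. C b) > 0" using C by (intro sum_pos) auto
 ultimately show ?thesis by blast
qed

lemma Cb_infinity_lipschitz:
 fixes f :: "'a::euclidean_space => 'b::real_normed_vector"
 assumes f: "Cb_infinity f"
 shows "EX C>0. ALL x y. norm (f x - f y) <= C * norm (x - y)"
proof -
 obtain C where C: "C > 0" "!!x v. norm (frechet_derivative f (at x) v) <= C * norm v"
  using Cb_infinity_derivative_bound[OF f] by blast
 have "norm (f x - f y) <= C * norm (x - y)" for x y
  by (rule differentiable_bound[of UNIV f "%x. frechet_derivative f (at x)"])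
   (use C Cb_infinity_has_derivative[OF f] in \<open>auto intro!: onorm_bound\<close>)
 then show ?thesis using C by blast
qed

lemma Cb_infinity_derivative_lipschitz:
 fixes f :: "'a::euclidean_space => 'b::real_normed_vector"
 assumes f: "Cb_infinity f"
 shows "EX C>0. ALL x y v. norm (frechet_derivative f (at x) v - frechet_derivative f (at y) v) <= C * norm (x - y) * norm v"
proof -
 have "EX C>0. ALL x y. norm (frechet_derivative f (at x) b - frechet_derivative f (at y) b) <= C * norm (x - y)" for b
  using Cb_infinity_lipschitz[OF Cb_infinity_dir[OF f]] .
 then obtain C where C: "!!b. C b > 0"
  "!!b x y. norm (frechet_derivative f (at x) b - frechet_derivative f (at y) b) <= C b * norm (x - y)" by metis
 have "norm (frechet_derivative f (at x) v - frechet_derivative f (at y) v) <= (SUM b:Basis. C b) * norm (x - y) * norm v" for x y v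
 proof -
  have "frechet_derivative f (at x) v - frechet_derivative f (at y) v =
   (SUM b:Basis. (v \<bullet> b) *R (frechet_derivative f (at x) b - frechet_derivative f (at y) b))"
   by (subst (1 2) Cb_infinity_expand[OF f]) (simp add: sum_subtractf scaleR_diff_right)
  also have "norm ... <= (SUM b:Basis. norm ((v \<bullet> b) *R (frechet_derivative f (at x) b - frechet_derivative f (at y) b)))"
   by (rule norm_sum)
  also have "... <= (SUM b:Basis. C b * norm (x - y) * norm v)"
  proof (rule sum_mono)
   fix b :: 'a assume "b : Basis"
   then have "\<bar>v \<bullet> b\<bar> * norm (frechet_derivative f (at x) b - frechet_derivative f (at y) b) <= norm v * (C b * norm (x - y))"
    using C Basis_le_norm by (intro mult_mono) auto
   then show "norm ((v \<bullet> b) *R (frechet_derivative f (at x) b - frechet_derivative f (at y) b)) <= C b * norm (x - y) * norm v"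
    by (simp add: mult.commute)
  qed
  finally show ?thesis by (simp add: sum_distrib_right)
 qed
 moreover have "(SUM b:Basis. C b) > 0" using C by (intro sum_pos) auto
 ultimately show ?thesis by blast
qed

lemma Cb_infinity_taylor1:
 fixes f :: "'a::euclidean_space => 'b::real_normed_vector"
 assumes f: "Cb_infinity f"
 shows "EX C>0. ALL x z. norm (f z - f x - frechet_derivative f (at x) (z - x)) <= C * (norm (z - x))^2"
proof -
 obtain C where C: "C > 0" "!!x y v. norm (frechet_derivative f (at x) v - frechet_derivative f (at y) v) <= C * norm (x - y) * norm v"
  using Cb_infinity_derivative_lipschitz[OF f] by blast
 have "norm (f z - f x - frechet_derivative f (at x) (z - x)) <= C * (norm (z - x))^2" for x z
 proof -
  define L where "L = frechet_derivative f (at x)"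
  have L: "linear L" unfolding L_def by (rule Cb_infinity_linear[OF f])
  have bL: "bounded_linear L" unfolding L_def using Cb_infinity_has_derivative[OF f] has_derivative_bounded_linear by blast
  have "norm ((f z - L z) - (f x - L x)) <= C * norm (z - x) * norm (z - x)"
  proof (rule differentiable_bound[of "closed_segment x z" "%u. f u - L u" "%u v. frechet_derivative f (at u) v - L v"])
   fix u assume u: "u : closed_segment x z"
   show "((%u. f u - L u) has_derivative (%v. frechet_derivative f (at u) v - L v)) (at u within closed_segment x z)"
    by (intro has_derivative_diff has_derivative_at_withinI[OF Cb_infinity_has_derivative[OF f]]
      bounded_linear_imp_has_derivative bL)
   show "onorm (%v. frechet_derivative f (at u) v - L v) <= C * norm (z - x)"
   proof (rule onorm_bound)
    fix v :: 'a
    have "norm (u - x) <= norm (z - x)" using segment_bound1[OF u] by (simp add: norm_minus_commute)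
    then have "C * norm (u - x) * norm v <= C * norm (z - x) * norm v"
     using C by (intro mult_right_mono mult_left_mono) auto
    then show "norm (frechet_derivative f (at u) v - L v) <= C * norm (z - x) * norm v"
     unfolding L_def using C(2)[of u v x] by linarith
   qed (use C in auto)
  qed auto
  then show ?thesis unfolding L_def[symmetric] by (simp add: linear_diff[OF L] power2_eq_square algebra_simps)
 qed
 then show ?thesis using C by blast
qed

text \<open>Iterated directional derivatives commute with a bounded linear map. Together with
  closure under sums this reaches matrix-valued maps built column by column.\<close>

lemma Cb_infinity_bounded_linear:
 fixes f :: "'a::euclidean_space => 'b::real_normed_vector"
 assumes f: "Cb_infinity f" and L: "bounded_linear L"
 shows "Cb_infinity (%x. L (f x))"
proof -
 have D: "iter_dir_deriv vs f differentiable (at x)" for vs x using f unfolding Cb_infinity_def by blast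
 have der: "((%y. L (iter_dir_deriv vs f y)) has_derivative (%v. L (frechet_derivative (iter_dir_deriv vs f) (at x) v))) (at x)" for vs x
  using D[of vs x] by (intro bounded_linear.has_derivative[OF L]) (simp add: frechet_derivative_works)
 have eq: "iter_dir_deriv vs (%x. L (f x)) = (%x. L (iter_dir_deriv vs f x))" for vs
 proof (induction vs)
  case (Cons v vs)
  show ?case
  proof
   fix x
   have "frechet_derivative (%y. L (iter_dir_deriv vs f y)) (at x) = (%v. L (frechet_derivative (iter_dir_deriv vs f) (at x) v))"
    using frechet_derivative_at[OF der, symmetric] .
   then show "iter_dir_deriv (v # vs) (%x. L (f x)) x = L (iter_dir_deriv (v # vs) f x)"
    using Cons by simp
  qed
 qed simp
 show ?thesis unfolding Cb_infinity_def eq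
 proof (intro allI conjI)
  show "(%x. L (iter_dir_deriv vs f x)) differentiable (at x)" for vs x
   using der differentiable_def by blast
  show "bounded (range (%x. L (iter_dir_deriv vs f x)))" for vs
   using bounded_linear_image[OF _ L, of "range (iter_dir_deriv vs f)"] f
   unfolding Cb_infinity_def by (simp add: image_image)
 qed
qed

lemma Cb_infinity_sum:
 fixes f :: "'i => 'a::euclidean_space => 'b::real_normed_vector"
 assumes f: "!!i. i : I ==> Cb_infinity (f i)" and I: "finite I"
 shows "Cb_infinity (%x. SUM i:I. f i x)"
proof -
 have D: "iter_dir_deriv vs (f i) differentiable (at x)" if "i : I" for vs x i using f[OF that] unfolding Cb_infinity_def by blast
 have der: "((%y. SUM i:I. iter_dir_deriv vs (f i) y) has_derivative (%v. SUM i:I. frechet_derivative (iter_dir_deriv vs (f i)) (at x) v)) (at x)" for vs x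
  using D[of _ vs x] by (intro has_derivative_sum) (simp add: frechet_derivative_works)
 have eq: "iter_dir_deriv vs (%x. SUM i:I. f i x) = (%x. SUM i:I. iter_dir_deriv vs (f i) x)" for vs
 proof (induction vs)
  case (Cons v vs)
  show ?case
  proof
   fix x
   have "frechet_derivative (%y. SUM i:I. iter_dir_deriv vs (f i) y) (at x) = (%v. SUM i:I. frechet_derivative (iter_dir_deriv vs (f i)) (at x) v)"
    using frechet_derivative_at[OF der, symmetric] .
   then show "iter_dir_deriv (v # vs) (%x. SUM i:I. f i x) x = (SUM i:I. iter_dir_deriv (v # vs) (f i) x)"
    using Cons by simp
  qed
 qed simp
 show ?thesis unfolding Cb_infinity_def eq
 proof (intro allI conjI)
  show "(%x. SUM i:I. iter_dir_deriv vs (f i) x) differentiable (at x)" for vs x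
   using der differentiable_def by blast
  show "bounded (range (%x. SUM i:I. iter_dir_deriv vs (f i) x))" for vs
  proof -
   have "EX C. ALL x. norm (iter_dir_deriv vs (f i) x) <= C" if "i : I" for i
    using f[OF that] unfolding Cb_infinity_def bounded_iff by auto
   then obtain C where "!!i x. i : I ==> norm (iter_dir_deriv vs (f i) x) <= C i" by metis
   then have "norm (SUM i:I. iter_dir_deriv vs (f i) x) <= (SUM i:I. C i)" for x by (intro sum_norm_le) auto
   then show ?thesis unfolding bounded_iff by blast
  qed
 qed
qed

section \<open>Matrix-valued first and second derivatives\<close>

lemma bilinear_mv: "bounded_bilinear (%(A::real^'n^'m) v. A *v v)"
proof (subst bilinear_conv_bounded_bilinear[symmetric])
 show "bilinear (%(A::real^'n^'m) v. A *v v)"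
  unfolding bilinear_def linear_iff
  by (simp add: vec_eq_iff matrix_vector_mult_def sum.distrib algebra_simps sum_distrib_left)
qed

lemma bilinear_vm: "bounded_bilinear (%v (A::real^'n^'m). v v* A)"
proof (subst bilinear_conv_bounded_bilinear[symmetric])
 show "bilinear (%v (A::real^'n^'m). v v* A)"
  unfolding bilinear_def linear_iff
  by (simp add: vec_eq_iff vector_matrix_mult_def sum.distrib algebra_simps sum_distrib_left)
qed

lemma bilinear_mm: "bounded_bilinear (%(A::real^'n^'m) (B::real^'k^'n). A ** B)"
proof (subst bilinear_conv_bounded_bilinear[symmetric])
 show "bilinear (%(A::real^'n^'m) (B::real^'k^'n). A ** B)"
  unfolding bilinear_def linear_iff
  by (simp add: vec_eq_iff matrix_matrix_mult_def sum.distrib algebra_simps sum_distrib_left)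
qed

definition Dm :: "(real^'n::finite => real^'m::finite) => real^'n => real^'n^'m" where
 "Dm f x = matrix (frechet_derivative f (at x))"

text \<open>\<open>D2m f x v *v w\<close> is the second derivative of \<open>f\<close> at
  \<open>x\<close> in the directions \<open>v\<close> and \<open>w\<close>; \<open>D2m f x\<close>
  itself is the derivative of the Jacobian.\<close>

definition D2m :: "(real^'n::finite => real^'m::finite) => real^'n => real^'n => real^'n^'m" where
 "D2m f x v = frechet_derivative (Dm f) (at x) v"

lemma Dm_mult: "Cb_infinity f ==> Dm f x *v v = frechet_derivative f (at x) v"
 unfolding Dm_def by (rule matrix_vector_mul(2)[OF Cb_infinity_linear, THEN fun_cong])

lemma Dm_nth: "Dm f x $ a $ b = frechet_derivative f (at x) (axis b 1) $ a"
 unfolding Dm_def matrix_def by simp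

lemma Dm_has_derivative: "Cb_infinity f ==> (f has_derivative (%v. Dm f x *v v)) (at x)"
proof -
 assume f: "Cb_infinity f"
 have "frechet_derivative f (at x) = (%v. Dm f x *v v)" using Dm_mult[OF f] by simp
 then show ?thesis using Cb_infinity_has_derivative[OF f, of x] by simp
qed

text \<open>The Jacobian is the sum of its columns, placed by the linear embeddings
  \<open>L b\<close>, and each column is a directional derivative of \<open>f\<close>.\<close>

lemma Cb_infinity_Dm:
 fixes f :: "real^'n::finite => real^'m::finite"
 assumes f: "Cb_infinity f"
 shows "Cb_infinity (Dm f)"
proof -
 define L :: "'n => real^'m => real^'n^'m" where "L b y = (\<chi> a b'. if b' = b then y $ a else 0)" for b y
 have L: "bounded_linear (L b)" for b
 proof -
  have "linear (L b)" unfolding L_def by (rule linearI) (auto simp: vec_eq_iff)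
  then show ?thesis using linear_conv_bounded_linear by blast
 qed
 have eq: "Dm f = (%x. SUM b:UNIV. L b (frechet_derivative f (at x) (axis b 1)))"
 proof
  fix x
  have "(SUM b:UNIV. L b (frechet_derivative f (at x) (axis b 1))) $ a $ b' = Dm f x $ a $ b'" for a b'
  proof -
   have "(SUM b:UNIV. L b (frechet_derivative f (at x) (axis b 1))) $ a $ b' =
     (SUM b:UNIV. if b' = b then frechet_derivative f (at x) (axis b 1) $ a else 0)"
    by (simp add: L_def)
   also have "... = Dm f x $ a $ b'" by (simp add: Dm_nth)
   finally show ?thesis .
  qed
  then show "Dm f x = (SUM b:UNIV. L b (frechet_derivative f (at x) (axis b 1)))" by (simp add: vec_eq_iff)
 qed
 show ?thesis unfolding eq
  by (intro Cb_infinity_sum, rule Cb_infinity_bounded_linear[OF Cb_infinity_dir[OF f] L]) simp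
qed

lemma D2m_has_derivative: "Cb_infinity f ==> (Dm f has_derivative D2m f x) (at x)"
proof -
 assume "Cb_infinity f"
 then have "(Dm f has_derivative frechet_derivative (Dm f) (at x)) (at x)"
  by (intro Cb_infinity_has_derivative Cb_infinity_Dm)
 then show ?thesis unfolding D2m_def[abs_def] .
qed

lemma D2m_linear: "Cb_infinity f ==> linear (D2m f x)"
 using D2m_has_derivative has_derivative_linear by blast

lemma Cb_infinity_D2m: "Cb_infinity f ==> Cb_infinity (%x. D2m f x v)"
 unfolding D2m_def by (intro Cb_infinity_dir Cb_infinity_Dm)

lemma vector_derivative_bound_interval:
 fixes f :: "real => 'a::real_normed_vector"
 assumes "a <= b" "!!t. t : {a..b} ==> (f has_vector_derivative f' t) (at t)"
  "!!t. t : {a..b} ==> norm (f' t) <= B"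
 shows "norm (f b - f a) <= B * (b - a)"
proof -
 have "norm (f b - f a) <= B * norm (b - a)"
 proof (rule differentiable_bound[of "{a..b}" f "%t h. h *R f' t"])
  fix t assume t: "t : {a..b}"
  show "(f has_derivative (%h. h *R f' t)) (at t within {a..b})"
   using assms(2)[OF t] unfolding has_vector_derivative_def by (rule has_derivative_at_withinI)
  have "0 <= B" using assms(3)[OF t] norm_ge_zero order_trans by blast
  then show "onorm (%h. h *R f' t) <= B"
   using assms(3)[OF t] by (intro onorm_bound) (auto simp: mult.commute[of B] intro!: mult_left_mono)
 qed (use assms in auto)
 then show ?thesis using assms(1) by simp
qed

lemma has_vector_derivative_along_line:
 assumes "(f has_derivative f') (at (x + t *R v))"
 shows "((%t. f (x + t *R v)) has_vector_derivative f' v) (at t)"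
proof -
 have "((%t. x + t *R v) has_derivative (%h. h *R v)) (at t)" by (auto intro!: derivative_eq_intros)
 from has_derivative_compose[OF this assms]
 have "((%t. f (x + t *R v)) has_derivative (%h. f' (h *R v))) (at t)" .
 moreover have "f' (h *R v) = h *R f' v" for h
  using has_derivative_linear[OF assms] by (simp add: linear_scale)
 ultimately show ?thesis unfolding has_vector_derivative_def by simp
qed

text \<open>Along the segment, the derivative of \<open>ps\<close> is the first-order Taylor
  remainder of \<open>Dm f\<close> applied to \<open>d\<close>, hence of size
  \<open>(norm d)^3\<close>.\<close>

lemma Cb_infinity_taylor2:
 fixes f :: "real^'n::finite => real^'m::finite"
 assumes f: "Cb_infinity f"
 obtains C where "C > 0" "!!x d. norm (f (x + d) - f x - Dm f x *v d - (1/2) *R (D2m f x d *v d)) <= C * (norm d)^3"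
proof -
 obtain C where C: "C > 0" "!!x z. norm (Dm f z - Dm f x - D2m f x (z - x)) <= C * (norm (z - x))^2"
  using Cb_infinity_taylor1[OF Cb_infinity_Dm[OF f]] unfolding D2m_def by blast
 obtain K where K: "K > 0" "!!(A::real^'n^'m) v. norm (A *v v) <= norm A * norm v * K"
  using bounded_bilinear.pos_bounded[OF bilinear_mv] by blast
 show ?thesis
 proof (rule that[of "C * K"])
  fix x d :: "real^'n"
  define ps where "ps t = f (x + t *R d) - t *R (Dm f x *v d) - (t^2/2) *R (D2m f x d *v d)" for t
  define ps' where "ps' t = Dm f (x + t *R d) *v d - (Dm f x *v d) - t *R (D2m f x d *v d)" for t
  have "norm (ps 1 - ps 0) <= (C * (norm d)^2 * norm d * K) * (1 - 0)"
  proof (rule vector_derivative_bound_interval)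
   fix t :: real assume t: "t : {0..1}"
   have "((%t. f (x + t *R d)) has_vector_derivative Dm f (x + t *R d) *v d) (at t)"
    by (rule has_vector_derivative_along_line[OF Dm_has_derivative[OF f]])
   moreover have "((%t. (t^2/2) *R (D2m f x d *v d)) has_vector_derivative t *R (D2m f x d *v d)) (at t)"
    by (auto intro!: derivative_eq_intros simp: has_vector_derivative_def)
   moreover have "((%t. t *R (Dm f x *v d)) has_vector_derivative (Dm f x *v d)) (at t)"
    by (auto intro!: derivative_eq_intros simp: has_vector_derivative_def)
   ultimately show "(ps has_vector_derivative ps' t) (at t)"
    unfolding ps_def ps'_def by (intro has_vector_derivative_diff)
   have "ps' t = (Dm f (x + t *R d) - Dm f x - D2m f x (t *R d)) *v d"
    unfolding ps'_def using linear_scale[OF D2m_linear[OF f], of x t d]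
    by (simp add: matrix_vector_mult_diff_rdistrib scaleR_matrix_vector_assoc)
   also have "norm ... <= norm (Dm f (x + t *R d) - Dm f x - D2m f x (t *R d)) * norm d * K" by (rule K)
   also have "... <= (C * (norm (t *R d))^2) * norm d * K"
    using C(2)[of "x + t *R d" x] K by (intro mult_right_mono) auto
   also have "... <= (C * (norm d)^2) * norm d * K"
   proof -
    have "norm (t *R d) <= norm d" using t mult_left_le_one_le[of "norm d" t] by simp
    then show ?thesis using C K by (intro mult_right_mono mult_left_mono power_mono) auto
   qed
   finally show "norm (ps' t) <= C * (norm d)^2 * norm d * K" .
  qed auto
  then show "norm (f (x + d) - f x - Dm f x *v d - (1/2) *R (D2m f x d *v d)) <= C * K * (norm d)^3"
   unfolding ps_def by (simp add: algebra_simps power3_eq_cube power2_eq_square)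
 qed (use C K in auto)
qed

text \<open>Bundles all bounds so that a single constant can serve every field. Each clause has a
  right-hand side \<open>C * b\<close> with \<open>b\<close> nonnegative, hence the factor 1:
  enlarging the constant is then the same argument throughout.\<close>

definition C3_bound :: "(real^'n::finite => real^'m::finite) => real => bool" where
 "C3_bound f C \<longleftrightarrow> (ALL x. norm (f x) <= C * 1) & (ALL x. norm (Dm f x) <= C * 1) &
  (ALL x y. norm (f x - f y) <= C * norm (x - y)) & (ALL x y. norm (Dm f x - Dm f y) <= C * norm (x - y)) &
  (ALL x z. norm (f z - f x - Dm f x *v (z - x)) <= C * (norm (z - x))^2) &
  (ALL x v w. norm (D2m f x v *v w) <= C * (norm v * norm w)) & (ALL x v. norm (Dm f x *v v) <= C * norm v) &
  (ALL x d. norm (f (x + d) - f x - Dm f x *v d - (1/2) *R (D2m f x d *v d)) <= C * (norm d)^3)"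

lemma Cb_infinity_C3_bound:
 fixes f :: "real^'n::finite => real^'m::finite"
 assumes f: "Cb_infinity f"
 obtains C where "C > 0" "!!C'. C' >= C ==> C3_bound f C'"
proof -
 note Df = Cb_infinity_Dm[OF f]
 obtain C1 where C1: "C1 > 0" "!!x. norm (f x) <= C1" using Cb_infinity_bounded[OF f] by blast
 obtain C2 where C2: "C2 > 0" "!!x. norm (Dm f x) <= C2" using Cb_infinity_bounded[OF Df] by blast
 obtain C3 where C3: "C3 > 0" "!!x v. norm (D2m f x v) <= C3 * norm v"
  using Cb_infinity_derivative_bound[OF Df] unfolding D2m_def by blast
 obtain C4 where C4: "C4 > 0" "!!x y. norm (f x - f y) <= C4 * norm (x - y)" using Cb_infinity_lipschitz[OF f] by blast
 obtain C5 where C5: "C5 > 0" "!!x y. norm (Dm f x - Dm f y) <= C5 * norm (x - y)" using Cb_infinity_lipschitz[OF Df] by blast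
 obtain C6 where C6: "C6 > 0" "!!x z. norm (f z - f x - Dm f x *v (z - x)) <= C6 * (norm (z - x))^2"
  using Cb_infinity_taylor1[OF f] unfolding Dm_mult[OF f] by blast
 obtain C7 where C7: "C7 > 0" "!!x d. norm (f (x + d) - f x - Dm f x *v d - (1/2) *R (D2m f x d *v d)) <= C7 * (norm d)^3"
  using Cb_infinity_taylor2[OF f] by blast
 obtain C8 where C8: "C8 > 0" "!!x v. norm (Dm f x *v v) <= C8 * norm v"
  using Cb_infinity_derivative_bound[OF f] unfolding Dm_mult[OF f] by blast
 obtain K where K: "K > 0" "!!(A::real^'n^'m) v. norm (A *v v) <= norm A * norm v * K"
  using bounded_bilinear.pos_bounded[OF bilinear_mv] by blast
 define C where "C = C1 + C2 + C4 + C5 + C6 + C7 + C8 + C3 * K"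
 have D2: "norm (D2m f x v *v w) <= (C3 * K) * (norm v * norm w)" for x v w
 proof -
  have "norm (D2m f x v *v w) <= norm (D2m f x v) * norm w * K" by (rule K)
  also have "... <= (C3 * norm v) * norm w * K" using C3(2) K by (intro mult_right_mono) auto
  finally show ?thesis by (simp add: mult_ac)
 qed
 have pos: "C3 * K > 0" using C3 K by simp
 note all = C1(1) C2(1) C4(1) C5(1) C6(1) C7(1) C8(1) pos
 show ?thesis
 proof (rule that[of C])
  show "C > 0" using all unfolding C_def by linarith
  fix C' assume "C' >= C"
  then have le: "C1 <= C'" "C2 <= C'" "C4 <= C'" "C5 <= C'" "C6 <= C'" "C7 <= C'" "C8 <= C'" "C3 * K <= C'"
   using all unfolding C_def by linarith+
  have up: "a <= C' * b" if "a <= c * b" "c <= C'" "b >= 0" for a b c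
   using that mult_right_mono[of c C' b] by linarith
  have C12: "norm (f x) <= C1 * 1" "norm (Dm f x) <= C2 * 1" for x using C1 C2 by auto
  show "C3_bound f C'" unfolding C3_bound_def
   by (intro conjI allI up[OF C12(1) le(1)] up[OF C12(2) le(2)] up[OF C4(2) le(3)] up[OF C5(2) le(4)] up[OF C6(2) le(5)]
    up[OF D2 le(8)] up[OF C8(2) le(7)] up[OF C7(2) le(6)]) simp_all
 qed
qed

text \<open>The second difference over the parallelogram with sides \<open>h v\<close> and
  \<open>h w\<close> is symmetric in \<open>v\<close> and \<open>w\<close>, and it equals
  \<open>h^2\<close> times either mixed derivative up to an error of order
  \<open>h^3\<close>.\<close>

lemma D2m_symmetric:
 fixes f :: "real^'n::finite => real^'m::finite"
 assumes f: "Cb_infinity f"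
 shows "D2m f x v *v w = D2m f x w *v v"
proof -
 obtain C where C: "C > 0" "!!x z. norm (Dm f z - Dm f x - D2m f x (z - x)) <= C * (norm (z - x))^2"
  "!!x y v. norm (D2m f x v - D2m f y v) <= C * norm (x - y) * norm v"
 proof -
  obtain C1 where C1: "C1 > 0" "!!x z. norm (Dm f z - Dm f x - D2m f x (z - x)) <= C1 * (norm (z - x))^2"
   using Cb_infinity_taylor1[OF Cb_infinity_Dm[OF f]] unfolding D2m_def by blast
  obtain C2 where C2: "C2 > 0" "!!x y v. norm (D2m f x v - D2m f y v) <= C2 * norm (x - y) * norm v"
   using Cb_infinity_derivative_lipschitz[OF Cb_infinity_Dm[OF f]] unfolding D2m_def by blast
  have "norm (Dm f z - Dm f x - D2m f x (z - x)) <= (C1 + C2) * (norm (z - x))^2" for x z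
   by (rule order_trans[OF C1(2)]) (use C2(1) in \<open>simp add: mult_right_mono\<close>)
  moreover have "norm (D2m f x v - D2m f y v) <= (C1 + C2) * norm (x - y) * norm v" for x y v
   by (rule order_trans[OF C2(2)]) (use C1(1) in \<open>intro mult_right_mono, auto\<close>)
  ultimately show ?thesis using that[of "C1 + C2"] C1(1) C2(1) by simp
 qed
 obtain K where K: "K > 0" "!!(A::real^'n^'m) v. norm (A *v v) <= norm A * norm v * K"
  using bounded_bilinear.pos_bounded[OF bilinear_mv] by blast
 \<comment> \<open>The first summand bounds the Taylor remainder of \<open>Dm f\<close> in direction
   \<open>v\<close>, the second the motion of the base point along \<open>w\<close>.\<close>
 define M where "M v w = (C * (norm v)^2 + C * norm w * norm v) * norm w * K" for v w :: "real^'n"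
 have key: "norm (f (x + h *R v + h *R w) - f (x + h *R w) - f (x + h *R v) + f x - h^2 *R (D2m f x v *v w)) <= M v w * h^3"
  if h: "0 < h" for h v w
 proof -
  define ph where "ph t = f (x + h *R v + t *R w) - f (x + t *R w) - t *R (h *R (D2m f x v *v w))" for t
  define ph' where "ph' t = Dm f (x + h *R v + t *R w) *v w - Dm f (x + t *R w) *v w - h *R (D2m f x v *v w)" for t
  have "norm (ph h - ph 0) <= (M v w * h^2) * (h - 0)"
  proof (rule vector_derivative_bound_interval)
   fix t assume t: "t : {0..h}"
   show "(ph has_vector_derivative ph' t) (at t)"
    unfolding ph_def ph'_def
    by (intro has_vector_derivative_diff has_vector_derivative_along_line[OF Dm_has_derivative[OF f]])
     (auto intro!: derivative_eq_intros simp: has_vector_derivative_def)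
   have "ph' t = ((Dm f (x + t *R w + h *R v) - Dm f (x + t *R w) - D2m f (x + t *R w) (h *R v))
     + (D2m f (x + t *R w) (h *R v) - D2m f x (h *R v))) *v w"
    unfolding ph'_def using linear_scale[OF D2m_linear[OF f], of x h v]
    by (simp add: matrix_vector_mult_diff_rdistrib matrix_vector_mult_add_rdistrib scaleR_matrix_vector_assoc add_ac)
   also have "norm ... <= norm ((Dm f (x + t *R w + h *R v) - Dm f (x + t *R w) - D2m f (x + t *R w) (h *R v))
     + (D2m f (x + t *R w) (h *R v) - D2m f x (h *R v))) * norm w * K" by (rule K)
   also have "... <= (C * (norm (h *R v))^2 + C * norm (t *R w) * norm (h *R v)) * norm w * K"
   proof (intro mult_right_mono norm_triangle_le add_mono)
    show "norm (Dm f (x + t *R w + h *R v) - Dm f (x + t *R w) - D2m f (x + t *R w) (h *R v)) <= C * (norm (h *R v))^2"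
     using C(2)[of "x + t *R w + h *R v" "x + t *R w"] by simp
    show "norm (D2m f (x + t *R w) (h *R v) - D2m f x (h *R v)) <= C * norm (t *R w) * norm (h *R v)"
     using C(3)[of "x + t *R w" "h *R v" x] by simp
   qed (use K in auto)
   also have "... <= (C * (norm (h *R v))^2 + C * (h * norm w) * norm (h *R v)) * norm w * K"
    using t C K by (intro mult_right_mono add_left_mono mult_left_mono) (auto intro: mult_right_mono)
   also have "... = M v w * h^2" using h unfolding M_def by (simp add: power_mult_distrib power2_eq_square algebra_simps)
   finally show "norm (ph' t) <= M v w * h^2" .
  qed (use h in auto)
  then show ?thesis unfolding ph_def by (simp add: algebra_simps power3_eq_cube power2_eq_square)
 qed
 have M0: "M v w >= 0" for v w unfolding M_def using C K by auto
 have "norm (D2m f x v *v w - D2m f x w *v v) <= (M v w + M w v) * h" if h: "h > 0" for h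
 proof -
  define A where "A = f (x + h *R v + h *R w) - f (x + h *R w) - f (x + h *R v) + f x"
  have 1: "norm (A - h^2 *R (D2m f x v *v w)) <= M v w * h^3" unfolding A_def by (rule key[OF h])
  have 2: "norm (A - h^2 *R (D2m f x w *v v)) <= M w v * h^3"
   unfolding A_def using key[OF h, of w v] by (simp add: add_ac diff_diff_eq)
  have "h^2 *R (D2m f x v *v w - D2m f x w *v v) = (A - h^2 *R (D2m f x w *v v)) - (A - h^2 *R (D2m f x v *v w))"
   by (simp add: algebra_simps)
  then have "norm (h^2 *R (D2m f x v *v w - D2m f x w *v v)) <= M w v * h^3 + M v w * h^3"
   using 1 2 norm_triangle_ineq4[of "A - h^2 *R (D2m f x w *v v)" "A - h^2 *R (D2m f x v *v w)"] by simp
  then have "h^2 * norm (D2m f x v *v w - D2m f x w *v v) <= h^2 * ((M v w + M w v) * h)"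
  proof -
   assume le: "norm (h^2 *R (D2m f x v *v w - D2m f x w *v v)) <= M w v * h^3 + M v w * h^3"
   have "M w v * h^3 + M v w * h^3 = h^2 * ((M v w + M w v) * h)"
    by (simp add: algebra_simps power3_eq_cube power2_eq_square)
   then show ?thesis using le by simp
  qed
  then show ?thesis using h by simp
 qed
 note D = this
 have "norm (D2m f x v *v w - D2m f x w *v v) <= 0 + e" if "e > 0" for e
 proof -
  have p: "M v w + M w v + 1 > 0" using M0[of v w] M0[of w v] by linarith
  have "norm (D2m f x v *v w - D2m f x w *v v) <= (M v w + M w v) * (e / (M v w + M w v + 1))"
   using D[of "e / (M v w + M w v + 1)"] that p by simp
  also have "... <= e" using p that by (simp add: field_simps)
  finally show ?thesis by simp
 qed
 then have "norm (D2m f x v *v w - D2m f x w *v v) <= 0" by (rule field_le_epsilon)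
 then show ?thesis by simp
qed

section \<open>Linear equations\<close>

lemma linear_ode_ex:
 fixes B :: "'a::euclidean_space => 'e::euclidean_space => 'e"
 assumes T: "T >= 0" and B: "bounded_bilinear B" and A: "L2 T A"
 obtains Y where "indef T (%s. B (A s) (Y s)) Y" "Y 0 = Y0"
proof -
 obtain K where K: "K > 0" "!!a b. norm (B a b) <= norm a * norm b * K"
  using bounded_bilinear.pos_bounded[OF B] by blast
 have int: "(%s. B (A s) (y s)) absolutely_integrable_on {0..T}" if "continuous_on {0..T} y" for y
  by (intro L2_abs_integrable L2_bilinear_continuous[OF B A that])
 have l: "L2 T (%s. K *R norm (A s))" by (intro L2_scaleR L2_norm A)
 have lip: "norm (B (A s) x - B (A s) y) <= (K *R norm (A s)) * norm (x - y)" for s x y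
  using K(2)[of "A s" "x - y"] by (simp add: bounded_bilinear.diff_right[OF B] mult_ac)
 obtain Y where Y: "continuous_on {0..T} Y" "!!t. t : {0..T} ==> Y t = Y0 + integral {0..t} (%s. B (A s) (Y s))"
  using picard_L2[OF T l continuous_on_const int lip] by blast
 have "indef T (%s. B (A s) (Y s)) Y" using indefI[OF int[OF Y(1)] Y(2)] .
 moreover have "Y 0 = Y0" using Y(2)[of 0] T by simp
 ultimately show ?thesis using that by blast
qed

text \<open>Uniqueness is the case \<open>A = A'\<close>.\<close>

lemma linear_ode_perturb:
 fixes B :: "'a::euclidean_space => 'e::euclidean_space => 'e"
 assumes T: "T >= 0" and B: "!!a b. norm (B a b) <= norm a * norm b * K" "bounded_bilinear B" and K: "K > 0"
  and A: "L2 T A" and A': "L2 T A'"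
  and Y: "indef T (%s. B (A s) (Y s)) Y" and Z: "indef T (%s. B (A' s) (Z s)) Z" and 0: "Y 0 = Z 0"
  and M: "!!s. s : {0..T} ==> norm (Y s) <= M" and t: "t : {0..T}"
 shows "norm (Z t - Y t) <= (K * M * sqrt T * n2 T (%s. A' s - A s)) * gw T (%s. K *R norm (A' s))"
proof (rule gronwall_indef[where m="%s. K * M * norm (A' s - A s)", OF _ indef_diff[OF Z Y] _ _ _ _ t])
 have AA: "L2 T (%s. A' s - A s)" by (rule L2_diff[OF A' A])
 have i: "(%s. norm (A' s - A s)) integrable_on {0..T}"
  using L2_abs_integrable[OF AA] by (auto simp: absolutely_integrable_on_def)
 have M0: "M >= 0" using M[OF t] norm_ge_zero order_trans by blast
 show "L2 T (%s. K *R norm (A' s))" by (intro L2_scaleR L2_norm A')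
 show "(%s. K * M * norm (A' s - A s)) integrable_on {0..T}" by (intro integrable_on_mult_right i)
 show "0 <= K * M * norm (A' s - A s)" for s using K M0 by simp
 have "integral {0..T} (%s. norm (A' s - A s)) <= sqrt T * n2 T (%s. A' s - A s)" by (rule L1_le_n2[OF AA T])
 then have "K * M * integral {0..T} (%s. norm (A' s - A s)) <= K * M * (sqrt T * n2 T (%s. A' s - A s))"
  using K M0 by (intro mult_left_mono) auto
 then show "norm (Z 0 - Y 0) + integral {0..T} (%s. K * M * norm (A' s - A s)) <= K * M * sqrt T * n2 T (%s. A' s - A s)"
  using 0 by (simp add: mult.assoc)
 fix s assume s: "s : {0..T}"
 have "B (A' s) (Z s) - B (A s) (Y s) = B (A' s) (Z s - Y s) + B (A' s - A s) (Y s)"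
  by (simp add: bounded_bilinear.diff_right[OF B(2)] bounded_bilinear.diff_left[OF B(2)])
 also have "norm ... <= norm (A' s) * norm (Z s - Y s) * K + norm (A' s - A s) * norm (Y s) * K"
  by (intro norm_triangle_le add_mono B)
 also have "... <= norm (A' s) * norm (Z s - Y s) * K + norm (A' s - A s) * M * K"
  using M[OF s] K by (intro add_left_mono mult_right_mono mult_left_mono) auto
 finally show "norm (B (A' s) (Z s) - B (A s) (Y s)) <= (K *R norm (A' s)) * norm (Z s - Y s) + K * M * norm (A' s - A s)"
  by (simp add: mult_ac)
qed

lemma linear_ode_unique:
 fixes B :: "'a::euclidean_space => 'e::euclidean_space => 'e"
 assumes B: "bounded_bilinear B" and A: "L2 T A"
  and Y: "indef T (%s. B (A s) (Y s)) Y" and Z: "indef T (%s. B (A s) (Z s)) Z" and 0: "Y 0 = Z 0"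
  and t: "t : {0..T}"
 shows "Z t = Y t"
proof -
 obtain K where K: "K > 0" "!!a b. norm (B a b) <= norm a * norm b * K"
  using bounded_bilinear.pos_bounded[OF B] by blast
 have "bounded (Y ` {0..T})" using indef_continuous_on[OF Y] by (intro compact_imp_bounded compact_continuous_image) auto
 then obtain M where M: "!!t. t : {0..T} ==> norm (Y t) <= M" unfolding bounded_pos by blast
 have "norm (Z t - Y t) <= (K * M * sqrt T * n2 T (%s. A s - A s)) * gw T (%s. K *R norm (A s))"
  using t by (intro linear_ode_perturb[OF _ K(2) B K(1) A A Y Z 0 M t]) auto
 then show ?thesis by (simp add: n2_def)
qed

section \<open>Fundamental matrices and variation of constants\<close>

definition fund :: "real => (real => real^'d^'d) => real => real^'d::finite^'d" where
 "fund T A = (SOME J. indef T (%s. A s ** J s) J & J 0 = mat 1)"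

text \<open>The inverse of \<open>fund\<close>, introduced by its own equation
  \<open>K' = - K A\<close>: that it inverts \<open>fund\<close> follows from the product rule, with
  no differentiation of an inverse matrix.\<close>

definition cofund :: "real => (real => real^'d^'d) => real => real^'d::finite^'d" where
 "cofund T A = (SOME K. indef T (%s. - (K s ** A s)) K & K 0 = mat 1)"

lemma bounded_bilinear_minus_flip_matrix: "bounded_bilinear (%(A::real^'d^'d) (K::real^'d^'d). - (K ** A))"
proof (subst bilinear_conv_bounded_bilinear[symmetric])
 show "bilinear (%(A::real^'d^'d) (K::real^'d^'d). - (K ** A))"
  unfolding bilinear_def linear_iff
  by (simp add: vec_eq_iff matrix_matrix_mult_def sum.distrib algebra_simps sum_distrib_left)
qed

lemma fund:
 assumes "T >= 0" "L2 T A"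
 shows "indef T (%s. A s ** fund T A s) (fund T A)" "fund T A 0 = mat 1"
proof -
 have "EX J. indef T (%s. A s ** J s) J & J 0 = mat 1"
  using linear_ode_ex[OF assms(1) bilinear_mm assms(2), of "mat 1"] by blast
 from someI_ex[OF this] show "indef T (%s. A s ** fund T A s) (fund T A)" "fund T A 0 = mat 1"
  unfolding fund_def by auto
qed

lemma cofund:
 assumes "T >= 0" "L2 T A"
 shows "indef T (%s. - (cofund T A s ** A s)) (cofund T A)" "cofund T A 0 = mat 1"
proof -
 have "EX J. indef T (%s. - (J s ** A s)) J & J 0 = mat 1"
  using linear_ode_ex[OF assms(1) bounded_bilinear_minus_flip_matrix assms(2), of "mat 1"] by blast
 from someI_ex[OF this] show "indef T (%s. - (cofund T A s ** A s)) (cofund T A)" "cofund T A 0 = mat 1"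
  unfolding cofund_def by auto
qed

lemma indef_zero_imp_constant:
 assumes "indef T f F" "!!s. s : {0..T} ==> f s = 0" "t : {0..T}"
 shows "F t = F 0"
proof -
 have "integral {0..t} f = integral {0..t} (%s. 0)"
  using assms by (intro Henstock_Kurzweil_Integration.integral_cong) auto
 then show ?thesis using indefD[OF assms(1,3)] by simp
qed

lemma matrix_minus_left: "(- A) ** (B::real^'n^'m) = - ((A::real^'m^'k) ** B)"
 by (simp add: vec_eq_iff matrix_matrix_mult_def sum_negf)

lemma cofund_mult_fund:
 assumes T: "T >= 0" and A: "L2 T A" and t: "t : {0..T}"
 shows "cofund T A t ** fund T A t = mat 1" "fund T A t ** cofund T A t = mat 1"
proof -
 note J = fund[OF T A] and K = cofund[OF T A]
 have "cofund T A t ** fund T A t = cofund T A 0 ** fund T A 0"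
  by (rule indef_zero_imp_constant[OF indef_bilinear[OF bilinear_mm K(1) J(1)] _ t])
   (simp add: matrix_minus_left matrix_mul_assoc)
 then show 1: "cofund T A t ** fund T A t = mat 1" by (simp add: J K)
 then show "fund T A t ** cofund T A t = mat 1" using matrix_left_right_inverse by blast
qed

text \<open>Variation of constants: by the product rule the bracket contributes
  \<open>J K b\<close>, and \<open>J K\<close> is the identity.\<close>

lemma linear_inhomogeneous_solution:
 assumes T: "T >= 0" and A: "L2 T A" and b: "L2 T b"
  and v: "!!t. v t = fund T A t *v (v0 + integral {0..t} (%s. cofund T A s *v b s))"
 shows "indef T (%s. A s *v v s + b s) v" "v 0 = v0"
proof -
 have "L2 T (%s. cofund T A s *v b s)"
  by (rule L2_continuous_bilinear[OF bilinear_mv indef_continuous_on[OF cofund(1)[OF T A]] b])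
 then have I: "indef T (%s. cofund T A s *v b s) (%t. v0 + integral {0..t} (%s. cofund T A s *v b s))"
  by (intro indef_integral L2_abs_integrable)
 show "indef T (%s. A s *v v s + b s) v"
  by (rule indef_cong[OF indef_bilinear[OF bilinear_mv fund(1)[OF T A] I]])
   (simp_all add: v matrix_vector_mul_assoc[symmetric], simp add: matrix_vector_mul_assoc cofund_mult_fund[OF T A])
 show "v 0 = v0" by (simp add: v fund[OF T A])
qed

section \<open>Controlled systems\<close>

lemma norm_lincomb_le:
 fixes w :: "real^'j::finite" and F :: "'j => 'e::real_normed_vector"
 assumes "!!j. norm (F j) <= C"
 shows "norm (SUM j:UNIV. w $ j *R F j) <= norm w * (real CARD('j) * C)"
proof -
 have "norm (SUM j:UNIV. w $ j *R F j) <= (SUM j:(UNIV::'j set). norm w * C)"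
  by (rule sum_norm_le) (auto intro!: mult_mono assms component_le_norm_cart)
 then show ?thesis by (simp add: mult_ac)
qed

lemma L2_lincomb:
 fixes w :: "real => real^'j::finite" and F :: "'j => real => 'e::euclidean_space"
 assumes "L2 T w" "!!j. continuous_on {0..T} (F j)"
 shows "L2 T (%s. SUM j:UNIV. w s $ j *R F j s)"
 by (intro L2_sum L2_scaleR_fun L2_vec_nth assms)

lemma n2_le_mult:
 assumes "L2 T f" "L2 T g" "C >= 0" "!!t. t : {0..T} ==> norm (f t) <= C * norm (g t)"
 shows "n2 T f <= C * n2 T g"
proof -
 have "(n2 T f)^2 <= integral {0..T} (%t. C^2 * (norm (g t))^2)"
  unfolding n2_power2
 proof (rule integral_le)
  show "(norm (f t))^2 <= C^2 * (norm (g t))^2" if "t : {0..T}" for t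
   using power_mono[OF assms(4)[OF that] norm_ge_zero, of 2] by (simp add: power_mult_distrib)
 qed (use assms in \<open>auto simp: L2_def intro!: integrable_on_mult_right\<close>)
 also have "... = (C * n2 T g)^2" by (simp add: power_mult_distrib n2_power2)
 finally show ?thesis using assms(3) by (intro power2_le_imp_le[of "n2 T f"]) auto
qed

text \<open>Driftless form \<open>x' = sum_j w_j S_j(x)\<close>. A drift is accommodated as one more
  field with constant weight, so the right-hand side is linear in \<open>w\<close> and one set of
  estimates covers everything.\<close>

locale control_system =
 fixes S :: "'j::finite => 'd::finite vfield" and x0 :: "'d rvec" and T :: real
 assumes Cb: "!!j. Cb_infinity (S j)" and T: "T > 0"
begin

lemma T0: "T >= 0" using T by simp

definition CS :: real where "CS = (SOME C. C > 0 & (ALL j. C3_bound (S j) C))"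

lemma CS:
 shows CS_pos: "CS > 0" and S_bound: "norm (S j x) <= CS" and DS_bound: "norm (Dm (S j) x) <= CS"
  and S_lipschitz: "norm (S j x - S j y) <= CS * norm (x - y)"
  and DS_lipschitz: "norm (Dm (S j) x - Dm (S j) y) <= CS * norm (x - y)"
  and S_taylor1: "norm (S j z - S j x - Dm (S j) x *v (z - x)) <= CS * (norm (z - x))^2"
  and D2S_bound: "norm (D2m (S j) x v *v w) <= CS * norm v * norm w"
  and DS_mult_bound: "norm (Dm (S j) x *v v) <= CS * norm v"
  and S_taylor2: "norm (S j (x + d) - S j x - Dm (S j) x *v d - (1/2) *R (D2m (S j) x d *v d)) <= CS * (norm d)^3"
proof -
 have "EX C>0. ALL C'>=C. C3_bound (S j) C'" for j by (rule Cb_infinity_C3_bound[OF Cb[of j]]) blast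
 then obtain C where C: "!!j. C j > 0" "!!j C'. C j <= C' ==> C3_bound (S j) C'" by metis
 have "C j <= (SUM j:UNIV. C j)" for j using C(1) by (intro member_le_sum) (auto intro: less_imp_le)
 moreover have "(SUM j:UNIV. C j) > 0" using C(1) by (intro sum_pos) auto
 ultimately have "EX C. C > 0 & (ALL j. C3_bound (S j) C)" using C(2) by blast
 from someI_ex[OF this] have "CS > 0" "C3_bound (S j) CS" for j unfolding CS_def by auto
 then show "CS > 0" "norm (S j x) <= CS" "norm (Dm (S j) x) <= CS"
  "norm (S j x - S j y) <= CS * norm (x - y)" "norm (Dm (S j) x - Dm (S j) y) <= CS * norm (x - y)"
  "norm (S j z - S j x - Dm (S j) x *v (z - x)) <= CS * (norm (z - x))^2"
  "norm (D2m (S j) x v *v w) <= CS * norm v * norm w" "norm (Dm (S j) x *v v) <= CS * norm v"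
  "norm (S j (x + d) - S j x - Dm (S j) x *v d - (1/2) *R (D2m (S j) x d *v d)) <= CS * (norm d)^3"
  unfolding C3_bound_def mult_1_right mult.assoc by blast+
qed

definition Cn :: real where "Cn = real CARD('j) * CS"

lemma Cn_pos: "Cn > 0"
 unfolding Cn_def using CS_pos by simp

lemma S_continuous_on: "continuous_on A (S j)"
 by (rule Cb_infinity_continuous_on[OF Cb])

lemma DS_continuous_on: "continuous_on A (Dm (S j))"
 by (rule Cb_infinity_continuous_on[OF Cb_infinity_Dm[OF Cb]])

definition fld :: "(real => real^'j) => real => 'd rvec => 'd rvec" where
 "fld w s x = (SUM j:UNIV. w s $ j *R S j x)"

definition dfld :: "(real => real^'j) => real => 'd rvec => real^'d^'d" where
 "dfld w s x = (SUM j:UNIV. w s $ j *R Dm (S j) x)"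

lemma fld_add: "fld (%s. w s + eta s) s x = fld w s x + fld eta s x"
 unfolding fld_def by (simp add: scaleR_add_left sum.distrib)

lemma fld_scaleR: "fld (%s. c *R eta s) s x = c *R fld eta s x"
 unfolding fld_def by (simp add: scaleR_sum_right)

lemma dfld_add: "dfld (%s. w s + eta s) s x = dfld w s x + dfld eta s x"
 unfolding dfld_def by (simp add: scaleR_add_left sum.distrib)

lemma dfld_mult: "dfld w s x *v v = (SUM j:UNIV. w s $ j *R (Dm (S j) x *v v))"
 unfolding dfld_def
 by (simp add: bounded_bilinear.sum_left[OF bilinear_mv] scaleR_matrix_vector_assoc)

lemma fld_bound: "norm (fld w s x) <= norm (w s) * Cn"
 unfolding fld_def Cn_def by (intro norm_lincomb_le S_bound)

lemma dfld_bound: "norm (dfld w s x) <= norm (w s) * Cn"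
 unfolding dfld_def Cn_def by (intro norm_lincomb_le DS_bound)

lemma fld_lipschitz: "norm (fld w s x - fld w s y) <= norm (w s) * Cn * norm (x - y)"
proof -
 have "fld w s x - fld w s y = (SUM j:UNIV. w s $ j *R (S j x - S j y))"
  unfolding fld_def by (simp add: scaleR_diff_right sum_subtractf)
 also have "norm ... <= norm (w s) * (real CARD('j) * (CS * norm (x - y)))"
  by (intro norm_lincomb_le S_lipschitz)
 finally show ?thesis unfolding Cn_def by (simp add: mult.assoc)
qed

lemma dfld_lipschitz: "norm (dfld w s x - dfld w s y) <= norm (w s) * Cn * norm (x - y)"
proof -
 have "dfld w s x - dfld w s y = (SUM j:UNIV. w s $ j *R (Dm (S j) x - Dm (S j) y))"
  unfolding dfld_def by (simp add: scaleR_diff_right sum_subtractf)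
 also have "norm ... <= norm (w s) * (real CARD('j) * (CS * norm (x - y)))"
  by (intro norm_lincomb_le DS_lipschitz)
 finally show ?thesis unfolding Cn_def by (simp add: mult.assoc)
qed

lemma fld_taylor: "norm (fld w s z - fld w s x - dfld w s x *v (z - x)) <= norm (w s) * Cn * (norm (z - x))^2"
proof -
 have "fld w s z - fld w s x - dfld w s x *v (z - x) = (SUM j:UNIV. w s $ j *R (S j z - S j x - Dm (S j) x *v (z - x)))"
  unfolding fld_def dfld_mult by (simp add: scaleR_diff_right sum_subtractf)
 also have "norm ... <= norm (w s) * (real CARD('j) * (CS * (norm (z - x))^2))"
  by (intro norm_lincomb_le S_taylor1)
 finally show ?thesis unfolding Cn_def by (simp add: mult.assoc)
qed

lemma L2_fld: "L2 T w ==> continuous_on {0..T} y ==> L2 T (%s. fld w s (y s))"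
 unfolding fld_def by (intro L2_lincomb continuous_on_compose2[OF S_continuous_on[of UNIV]]) auto

lemma L2_dfld: "L2 T w ==> continuous_on {0..T} y ==> L2 T (%s. dfld w s (y s))"
 unfolding dfld_def by (intro L2_lincomb continuous_on_compose2[OF DS_continuous_on[of UNIV]]) auto

definition Xp :: "(real => real^'j) => real => 'd rvec" where
 "Xp w = (SOME y. indef T (%s. fld w s (y s)) y & y 0 = x0)"

lemma Xp:
 assumes w: "L2 T w"
 shows "indef T (%s. fld w s (Xp w s)) (Xp w)" "Xp w 0 = x0"
proof -
 have l: "L2 T (%s. Cn *R norm (w s))" by (intro L2_scaleR L2_norm w)
 have int: "(%s. fld w s (y s)) absolutely_integrable_on {0..T}" if "continuous_on {0..T} y" for y
  by (intro L2_abs_integrable L2_fld w that)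
 have lip: "norm (fld w s x - fld w s y) <= (Cn *R norm (w s)) * norm (x - y)" for s x y
  using fld_lipschitz[of w s x y] by (simp add: mult.commute)
 obtain Y where Y: "continuous_on {0..T} Y" "!!t. t : {0..T} ==> Y t = x0 + integral {0..t} (%s. fld w s (Y s))"
  using picard_L2[OF T0 l continuous_on_const int lip] by blast
 have "indef T (%s. fld w s (Y s)) Y" using indefI[OF int[OF Y(1)] Y(2)] .
 moreover have "Y 0 = x0" using Y(2)[of 0] T by simp
 ultimately have "EX y. indef T (%s. fld w s (y s)) y & y 0 = x0" by blast
 from someI_ex[OF this] show "indef T (%s. fld w s (Xp w s)) (Xp w)" "Xp w 0 = x0" unfolding Xp_def by auto
qed

lemma Xp_continuous_on: "L2 T w ==> continuous_on {0..T} (Xp w)"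
 by (rule indef_continuous_on[OF Xp(1)])

definition XL :: "(real => real^'j) => real" where
 "XL w = Cn * sqrt T * gw T (%s. Cn *R norm (w s))"

lemma XL_nonneg: "XL w >= 0"
 unfolding XL_def using Cn_pos T gw_pos by (simp add: less_imp_le)

text \<open>Comparison with an arbitrary solution \<open>y\<close>, and not with
  \<open>Xp w\<close>, makes uniqueness the case \<open>eta = 0\<close>. Since the fields are
  bounded, the \<open>eta\<close> term is a forcing with a bound independent of \<open>z\<close>,
  and the Gronwall factor inside \<open>XL\<close> depends on the control only through
  \<open>w\<close>.\<close>

lemma solution_stability:
 assumes w: "L2 T w" and eta: "L2 T eta"
  and y: "indef T (%s. fld w s (y s)) y" "y 0 = x0"
  and z: "indef T (%s. fld w s (z s) + fld eta s (z s)) z" "z 0 = x0" and t: "t : {0..T}"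
 shows "norm (z t - y t) <= XL w * n2 T eta"
proof -
 have i: "(%s. norm (eta s)) integrable_on {0..T}"
  using L2_abs_integrable[OF eta] by (auto simp: absolutely_integrable_on_def)
 have "norm (z t - y t) <= (Cn * (sqrt T * n2 T eta)) * gw T (%s. Cn *R norm (w s))"
 proof (rule gronwall_indef[where m="%s. Cn * norm (eta s)", OF _ indef_diff[OF z(1) y(1)] _ _ _ _ t])
  show "L2 T (%s. Cn *R norm (w s))" by (intro L2_scaleR L2_norm w)
  show "(%s. Cn * norm (eta s)) integrable_on {0..T}" by (intro integrable_on_mult_right i)
  show "0 <= Cn * norm (eta s)" for s using Cn_pos by simp
  show "norm (z 0 - y 0) + integral {0..T} (%s. Cn * norm (eta s)) <= Cn * (sqrt T * n2 T eta)"
   using y z L1_le_n2[OF eta T0] Cn_pos by simp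
  fix s
  have "fld w s (z s) + fld eta s (z s) - fld w s (y s) = (fld w s (z s) - fld w s (y s)) + fld eta s (z s)" by simp
  also have "norm ... <= norm (w s) * Cn * norm (z s - y s) + norm (eta s) * Cn"
   by (intro norm_triangle_le add_mono fld_lipschitz fld_bound)
  finally show "norm (fld w s (z s) + fld eta s (z s) - fld w s (y s)) <= (Cn *R norm (w s)) * norm (z s - y s) + Cn * norm (eta s)"
   by (simp add: mult_ac)
 qed
 then show ?thesis unfolding XL_def by (simp add: mult_ac)
qed

lemma Xp_unique:
 assumes "L2 T w" "indef T (%s. fld w s (y s)) y" "y 0 = x0" "t : {0..T}"
 shows "y t = Xp w t"
 using solution_stability[where eta="%_. 0" and z=y, OF assms(1) L2_const Xp[OF assms(1)] _ assms(3,4)] assms(2)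
 by (simp add: fld_def n2_def)

lemma Xp_diff_bound:
 assumes w: "L2 T w" and eta: "L2 T eta" and t: "t : {0..T}"
 shows "norm (Xp (%s. w s + eta s) t - Xp w t) <= XL w * n2 T eta"
 using solution_stability[OF w eta Xp[OF w] _ _ t] Xp[OF L2_add[OF w eta]] by (simp add: fld_add)

section \<open>The linearised equation along a solution\<close>

definition Am :: "(real => real^'j) => real => real^'d^'d" where
 "Am w s = dfld w s (Xp w s)"

lemma L2_Am: "L2 T w ==> L2 T (Am w)"
 unfolding Am_def[abs_def] by (intro L2_dfld Xp_continuous_on)

definition Jm :: "(real => real^'j) => real => real^'d^'d" where "Jm w = fund T (Am w)"
definition Km :: "(real => real^'j) => real => real^'d^'d" where "Km w = cofund T (Am w)"

lemma Jm: "L2 T w ==> indef T (%s. Am w s ** Jm w s) (Jm w)" "L2 T w ==> Jm w 0 = mat 1"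
 unfolding Jm_def using fund[OF T0 L2_Am] by auto

lemma Km: "L2 T w ==> indef T (%s. - (Km w s ** Am w s)) (Km w)" "L2 T w ==> Km w 0 = mat 1"
 unfolding Km_def using cofund[OF T0 L2_Am] by auto

lemma Km_Jm: "L2 T w ==> t : {0..T} ==> Km w t ** Jm w t = mat 1"
 and Jm_Km: "L2 T w ==> t : {0..T} ==> Jm w t ** Km w t = mat 1"
 unfolding Km_def Jm_def using cofund_mult_fund[OF T0 L2_Am] by auto

lemma Jm_continuous_on: "L2 T w ==> continuous_on {0..T} (Jm w)"
 by (rule indef_continuous_on[OF Jm(1)])

lemma Km_continuous_on: "L2 T w ==> continuous_on {0..T} (Km w)"
 by (rule indef_continuous_on[OF Km(1)])

text \<open>The first variation of the solution in the direction \<open>eta\<close>, written out by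
  variation of constants: visibly linear in \<open>eta\<close>, and explicit enough to pass to
  limits in \<open>w\<close>.\<close>

definition Vp :: "(real => real^'j) => (real => real^'j) => real => 'd rvec" where
 "Vp w eta t = Jm w t *v integral {0..t} (%s. Km w s *v fld eta s (Xp w s))"

lemma Vp:
 assumes w: "L2 T w" and eta: "L2 T eta"
 shows "indef T (%s. Am w s *v Vp w eta s + fld eta s (Xp w s)) (Vp w eta)" "Vp w eta 0 = 0"
 using linear_inhomogeneous_solution[OF T0 L2_Am[OF w] L2_fld[OF eta Xp_continuous_on[OF w]], of "Vp w eta" 0]
 unfolding Vp_def Jm_def Km_def by auto

lemma Vp_continuous_on: "L2 T w ==> L2 T eta ==> continuous_on {0..T} (Vp w eta)"
 by (rule indef_continuous_on[OF Vp(1)])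

lemma L2_Km_fld: "L2 T w ==> L2 T eta ==> L2 T (%s. Km w s *v fld eta s (Xp w s))"
 by (intro L2_continuous_bilinear[OF bilinear_mv] Km_continuous_on L2_fld Xp_continuous_on)

lemma Km_fld_integrable:
 assumes "L2 T w" "L2 T eta" "t : {0..T}"
 shows "(%s. Km w s *v fld eta s (Xp w s)) integrable_on {0..t}"
 using L2_abs_integrable[OF L2_Km_fld[OF assms(1,2)]] assms(3)
 by (auto simp: absolutely_integrable_on_def intro: integrable_on_subinterval)

lemma Vp_add:
 assumes "L2 T w" "L2 T eta" "L2 T th" "t : {0..T}"
 shows "Vp w (%s. eta s + th s) t = Vp w eta t + Vp w th t"
proof -
 have "integral {0..t} (%s. Km w s *v fld eta s (Xp w s) + Km w s *v fld th s (Xp w s)) =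
  integral {0..t} (%s. Km w s *v fld eta s (Xp w s)) + integral {0..t} (%s. Km w s *v fld th s (Xp w s))"
  by (intro Henstock_Kurzweil_Integration.integral_add Km_fld_integrable assms)
 then show ?thesis unfolding Vp_def fld_add matrix_vector_right_distrib by (simp add: matrix_vector_right_distrib)
qed

lemma Vp_scaleR: "Vp w (%s. c *R eta s) t = c *R Vp w eta t"
 unfolding Vp_def fld_scaleR
 by (simp add: bounded_bilinear.scaleR_right[OF bilinear_mv])

definition KM :: real where
 "KM = (SOME K. K > 0 & (ALL (A::real^'d^'d) v. norm (A *v v) <= norm A * norm v * K))"

lemma KM: "KM > 0" "norm (A *v v) <= norm A * norm v * KM" for A :: "real^'d^'d"
proof -
 have "EX K. K > 0 & (ALL (A::real^'d^'d) v. norm (A *v v) <= norm A * norm v * K)"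
  using bounded_bilinear.pos_bounded[OF bilinear_mv] by blast
 from someI_ex[OF this] show "KM > 0" "norm (A *v v) <= norm A * norm v * KM" unfolding KM_def by auto
qed

definition VL :: "(real => real^'j) => real" where
 "VL w = Cn * sqrt T * gw T (%s. norm (Am w s) * KM)"

lemma VL_nonneg: "VL w >= 0"
 unfolding VL_def using Cn_pos T gw_pos by (simp add: less_imp_le)

lemma linear_equation_bound:
 assumes w: "L2 T w" and v: "indef T (%s. Am w s *v v s + b s) v" "v 0 = 0"
  and b: "!!s. s : {0..T} ==> norm (b s) <= m s" and m: "L2 T m" "n2 T m <= M" and t: "t : {0..T}"
 shows "norm (v t) <= sqrt T * M * gw T (%s. norm (Am w s) * KM)"
proof -
 have m0: "0 <= m s" if "s : {0..T}" for s using b[OF that] norm_ge_zero order_trans by blast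
 have i: "m integrable_on {0..T}"
  using L2_abs_integrable[OF m(1)] by (auto simp: absolutely_integrable_on_def)
 show ?thesis
 proof (rule gronwall_indef[where m=m, OF _ v(1) _ i m0 _ t])
  show "L2 T (%s. norm (Am w s) * KM)" using L2_scaleR[OF L2_norm[OF L2_Am[OF w]], of KM] by (simp add: mult.commute)
  have "integral {0..T} m = integral {0..T} (%s. norm (m s))"
   using m0 by (intro Henstock_Kurzweil_Integration.integral_cong) auto
  also have "... <= sqrt T * n2 T m" by (rule L1_le_n2[OF m(1) T0])
  also have "... <= sqrt T * M" using m(2) T by (intro mult_left_mono) auto
  finally show "norm (v 0) + integral {0..T} m <= sqrt T * M" using v by simp
  fix s assume s: "s : {0..T}"
  show "norm (Am w s *v v s + b s) <= norm (Am w s) * KM * norm (v s) + m s"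
   using KM(2)[of "Am w s" "v s"] b[OF s] by (intro norm_triangle_le) (simp add: mult_ac)
 qed
qed

lemma Vp_bound:
 assumes w: "L2 T w" and eta: "L2 T eta" and t: "t : {0..T}"
 shows "norm (Vp w eta t) <= VL w * n2 T eta"
proof -
 have "norm (Vp w eta t) <= sqrt T * (Cn * n2 T eta) * gw T (%s. norm (Am w s) * KM)"
 proof (rule linear_equation_bound[OF w Vp[OF w eta] _ _ _ t])
  show "norm (fld eta s (Xp w s)) <= Cn *R norm (eta s)" for s using fld_bound[of eta s "Xp w s"] by (simp add: mult.commute)
  show "L2 T (%s. Cn *R norm (eta s))" by (intro L2_scaleR L2_norm eta)
  show "n2 T (%s. Cn *R norm (eta s)) <= Cn * n2 T eta" using Cn_pos by (simp only: n2_scaleR n2_norm abs_of_pos)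
 qed
 then show ?thesis unfolding VL_def by (simp add: mult_ac)
qed

text \<open>The remainder \<open>rho\<close> solves the linearised equation with zero initial value
  and forcing \<open>b\<close>. Its two parts, the Taylor remainder of the field with weights
  \<open>w\<close> and the increment of the field with weights \<open>eta\<close>, are both
  quadratic in \<open>n2 T eta\<close>.\<close>

lemma Xp_derivative_bound:
 assumes w: "L2 T w"
 obtains C where "C > 0" "!!eta t. L2 T eta ==> t : {0..T} ==>
  norm (Xp (%s. w s + eta s) t - Xp w t - Vp w eta t) <= C * (n2 T eta)^2"
proof -
 define g where "g = gw T (%s. norm (Am w s) * KM)"
 define C where "C = sqrt T * (Cn * (XL w)^2 * n2 T w + Cn * XL w) * g"
 have g: "g > 0" unfolding g_def by (rule gw_pos)
 have C0: "C >= 0" unfolding C_def using T Cn_pos XL_nonneg[of w] g by simp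
 have "norm (Xp (%s. w s + eta s) t - Xp w t - Vp w eta t) <= C * (n2 T eta)^2"
  if eta: "L2 T eta" and t: "t : {0..T}" for eta t
 proof -
  define z where "z = Xp (%s. w s + eta s)"
  define x where "x = Xp w"
  define N where "N = n2 T eta"
  have N: "N >= 0" unfolding N_def by simp
  have z: "indef T (%s. fld w s (z s) + fld eta s (z s)) z" "z 0 = x0"
   unfolding z_def using Xp[OF L2_add[OF w eta]] by (simp_all add: fld_add)
  have x: "indef T (%s. fld w s (x s)) x" "x 0 = x0" unfolding x_def using Xp[OF w] by auto
  have d: "norm (z s - x s) <= XL w * N" if "s : {0..T}" for s
   unfolding z_def x_def N_def by (rule Xp_diff_bound[OF w eta that])
  define rho where "rho t = z t - x t - Vp w eta t" for t
  define b where "b s = (fld w s (z s) - fld w s (x s) - dfld w s (x s) *v (z s - x s)) + (fld eta s (z s) - fld eta s (x s))" for s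
  have "indef T (%s. fld w s (z s) + fld eta s (z s) - fld w s (x s) - (Am w s *v Vp w eta s + fld eta s (Xp w s))) rho"
   unfolding rho_def by (intro indef_diff z x Vp w eta)
  then have rho: "indef T (%s. Am w s *v rho s + b s) rho"
   by (rule indef_cong) (auto simp: rho_def b_def Am_def x_def[symmetric] matrix_vector_mult_diff_distrib)
  have "rho 0 = 0" unfolding rho_def using z x Vp[OF w eta] by simp
  define m where "m s = (Cn * (XL w * N)^2) *R norm (w s) + (Cn * (XL w * N)) *R norm (eta s)" for s
  have "norm (rho t) <= sqrt T * ((Cn * (XL w * N)^2) * n2 T w + (Cn * (XL w * N)) * N) * g"
   unfolding g_def
  proof (rule linear_equation_bound[OF w rho \<open>rho 0 = 0\<close> _ _ _ t])
   show "L2 T m" unfolding m_def by (intro L2_add L2_scaleR L2_norm w eta)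
   have "n2 T m <= n2 T (%s. (Cn * (XL w * N)^2) *R norm (w s)) + n2 T (%s. (Cn * (XL w * N)) *R norm (eta s))"
    unfolding m_def by (intro n2_triangle L2_scaleR L2_norm w eta)
   also have "... = (Cn * (XL w * N)^2) * n2 T w + (Cn * (XL w * N)) * N"
    unfolding n2_scaleR n2_norm N_def[symmetric] using Cn_pos XL_nonneg[of w] N by simp
   finally show "n2 T m <= (Cn * (XL w * N)^2) * n2 T w + (Cn * (XL w * N)) * N" .
   fix s assume s: "s : {0..T}"
   have "norm (b s) <= norm (w s) * Cn * (norm (z s - x s))^2 + norm (eta s) * Cn * norm (z s - x s)"
    unfolding b_def by (intro norm_triangle_le add_mono fld_taylor fld_lipschitz)
   also have "... <= norm (w s) * Cn * (XL w * N)^2 + norm (eta s) * Cn * (XL w * N)"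
    using d[OF s] Cn_pos by (intro add_mono mult_left_mono power_mono) auto
   finally show "norm (b s) <= m s" unfolding m_def by (simp add: mult_ac)
  qed
  also have "... = C * N^2" unfolding C_def by (simp add: power_mult_distrib power2_eq_square algebra_simps)
  finally show ?thesis unfolding rho_def z_def x_def N_def .
 qed
 then have "norm (Xp (%s. w s + eta s) t - Xp w t - Vp w eta t) <= (C + 1) * (n2 T eta)^2"
  if "L2 T eta" "t : {0..T}" for eta t using that by (fastforce simp: algebra_simps intro: order_trans)
 then show ?thesis using that[of "C + 1"] C0 by simp
qed

section \<open>Dependence of the fundamental matrices on the control\<close>

lemma Am_diff_bound:
 assumes w: "L2 T w"
 obtains C where "C > 0" "!!eta. L2 T eta ==> n2 T (%s. Am (%s. w s + eta s) s - Am w s) <= C * n2 T eta"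
proof -
 define C where "C = Cn * XL w * n2 T w + Cn"
 have "n2 T (%s. Am (%s. w s + eta s) s - Am w s) <= C * n2 T eta" if eta: "L2 T eta" for eta
 proof -
  note weta = L2_add[OF w eta]
  define N where "N = n2 T eta"
  define m where "m s = (Cn * (XL w * N)) *R norm (w s) + Cn *R norm (eta s)" for s
  have m: "L2 T m" unfolding m_def by (intro L2_add L2_scaleR L2_norm w eta)
  have "n2 T (%s. Am (%s. w s + eta s) s - Am w s) <= 1 * n2 T m"
  proof (rule n2_le_mult[OF L2_diff[OF L2_Am[OF weta] L2_Am[OF w]] m])
   fix s assume s: "s : {0..T}"
   have "Am (%s. w s + eta s) s - Am w s = (dfld w s (Xp (%s. w s + eta s) s) - dfld w s (Xp w s)) + dfld eta s (Xp (%s. w s + eta s) s)"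
    unfolding Am_def dfld_add by simp
   also have "norm ... <= norm (w s) * Cn * norm (Xp (%s. w s + eta s) s - Xp w s) + norm (eta s) * Cn"
    by (intro norm_triangle_le add_mono dfld_lipschitz dfld_bound)
   also have "... <= norm (w s) * Cn * (XL w * N) + norm (eta s) * Cn"
    using Xp_diff_bound[OF w eta s] Cn_pos unfolding N_def by (intro add_mono mult_left_mono) auto
   also have "... = m s" unfolding m_def by (simp add: mult_ac)
   also have "... <= 1 * norm (m s)" by simp
   finally show "norm (Am (%s. w s + eta s) s - Am w s) <= 1 * norm (m s)" .
  qed simp
  also have "... <= n2 T (%s. (Cn * (XL w * N)) *R norm (w s)) + n2 T (%s. Cn *R norm (eta s))"
   unfolding m_def mult_1 by (intro n2_triangle L2_scaleR L2_norm w eta)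
  also have "... = C * n2 T eta" unfolding n2_scaleR n2_norm N_def C_def
   using Cn_pos XL_nonneg[of w] by (simp add: abs_mult algebra_simps)
  finally show ?thesis .
 qed
 moreover have "C > 0" unfolding C_def using Cn_pos XL_nonneg[of w] by (simp add: add_nonneg_pos)
 ultimately show ?thesis using that by blast
qed

text \<open>Stated for a bilinear \<open>B\<close> so that it covers \<open>Jm\<close> and
  \<open>Km\<close> alike. The restriction to \<open>n2 T eta <= 1\<close> keeps the Gronwall
  factor, which involves the perturbed coefficient, uniformly bounded.\<close>

lemma fundamental_perturb:
 assumes B: "bounded_bilinear B" and Y: "!!w. L2 T w ==> indef T (%s. B (Am w s) (Y w s)) (Y w)"
  and Y0: "!!w. L2 T w ==> Y w 0 = Y0" and w: "L2 T w"
 shows "EX C>0. ALL eta t. L2 T eta --> n2 T eta <= 1 --> t : {0..T} -->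
  norm (Y (%s. w s + eta s) t - Y w t :: real^'d^'d) <= C * n2 T eta"
proof -
 obtain K where K: "K > 0" "!!a b. norm (B a b) <= norm a * norm b * K"
  using bounded_bilinear.pos_bounded[OF B] by blast
 have "bounded (Y w ` {0..T})" using indef_continuous_on[OF Y[OF w]] by (intro compact_imp_bounded compact_continuous_image) auto
 then obtain M where M: "M > 0" "!!t. t : {0..T} ==> norm (Y w t) <= M" unfolding bounded_pos by auto
 obtain C1 where C1: "C1 > 0" "!!eta. L2 T eta ==> n2 T (%s. Am (%s. w s + eta s) s - Am w s) <= C1 * n2 T eta"
  using Am_diff_bound[OF w] by blast
 \<comment> \<open>The factor \<open>gw\<close>, with the norm of the perturbed coefficient replaced
   by a bound valid for all \<open>eta\<close> in the unit ball.\<close>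
 define g where "g = sqrt 2 * exp ((K * (n2 T (Am w) + C1))^2 * \<bar>T\<bar>)"
 have "norm (Y (%s. w s + eta s) t - Y w t) <= (K * M * sqrt T * C1 * g) * n2 T eta"
  if eta: "L2 T eta" "n2 T eta <= 1" and t: "t : {0..T}" for eta t
 proof -
  note weta = L2_add[OF w eta(1)]
  have "n2 T (Am (%s. w s + eta s)) <= n2 T (Am w) + n2 T (%s. Am (%s. w s + eta s) s - Am w s)"
   by (rule n2_triangle_diff[OF L2_Am[OF weta] L2_Am[OF w]])
  also have "... <= n2 T (Am w) + C1 * 1"
   using C1(2)[OF eta(1)] mult_left_mono[OF eta(2), of C1] C1(1) by linarith
  finally have n: "n2 T (Am (%s. w s + eta s)) <= n2 T (Am w) + C1" by simp
  have "(K * n2 T (Am (%s. w s + eta s)))^2 <= (K * (n2 T (Am w) + C1))^2"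
   using n K by (intro power_mono mult_left_mono) auto
  then have g: "gw T (%s. K *R norm (Am (%s. w s + eta s) s)) <= g"
   unfolding gw_def g_def n2_scaleR n2_norm using K by (auto intro!: mult_right_mono)
  have "norm (Y (%s. w s + eta s) t - Y w t) <=
   (K * M * sqrt T * n2 T (%s. Am (%s. w s + eta s) s - Am w s)) * gw T (%s. K *R norm (Am (%s. w s + eta s) s))"
   by (rule linear_ode_perturb[OF T0 K(2) B K(1) L2_Am[OF w] L2_Am[OF weta] Y[OF w] Y[OF weta] _ M(2) t])
    (simp_all add: Y0 w weta)
  also have "... <= (K * M * sqrt T * (C1 * n2 T eta)) * g"
   using K M T C1(2)[OF eta(1)] C1(1) g gw_pos by (intro mult_mono mult_left_mono) (auto intro: less_imp_le)
  finally show ?thesis by (simp add: mult_ac)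
 qed
 moreover have "K * M * sqrt T * C1 * g > 0" unfolding g_def using K M T C1 by simp
 ultimately show ?thesis by blast
qed

lemma Jm_diff_bound:
 "L2 T w ==> EX C>0. ALL eta t. L2 T eta --> n2 T eta <= 1 --> t : {0..T} -->
  norm (Jm (%s. w s + eta s) t - Jm w t) <= C * n2 T eta"
 by (rule fundamental_perturb[OF bilinear_mm Jm])

lemma Km_diff_bound:
 "L2 T w ==> EX C>0. ALL eta t. L2 T eta --> n2 T eta <= 1 --> t : {0..T} -->
  norm (Km (%s. w s + eta s) t - Km w t) <= C * n2 T eta"
 by (rule fundamental_perturb[OF bounded_bilinear_minus_flip_matrix Km])

end

section \<open>The Cameron--Martin space as a space of square-integrable functions\<close>

text \<open>Derivatives of paths are determined up to null sets only. Solutions, integrals and norms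
  do not see the difference; this is checked once for each notion.\<close>

definition aeq :: "real => (real => 'a) => (real => 'a) => bool" where
 "aeq T u v \<longleftrightarrow> (EX N. negligible N & (ALL t:{0..T} - N. u t = v t))"

lemma aeqI: "negligible N ==> (!!t. t : {0..T} - N ==> u t = v t) ==> aeq T u v"
 unfolding aeq_def by blast

lemma aeq_refl: "aeq T u u"
 unfolding aeq_def by (rule exI[of _ "{}"]) auto

lemma aeq_sym: "aeq T u v ==> aeq T v u"
 unfolding aeq_def by metis

lemma aeq_trans: "aeq T u v ==> aeq T v w ==> aeq T u w"
 unfolding aeq_def by (metis DiffD1 DiffD2 DiffI Un_iff negligible_Un)

lemma aeq_map: "aeq T u v ==> aeq T (%t. f t (u t)) (%t. f t (v t))"
 unfolding aeq_def by metis

lemma aeq_map2: "aeq T u v ==> aeq T u' v' ==> aeq T (%t. f t (u t) (u' t)) (%t. f t (v t) (v' t))"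
 unfolding aeq_def by (metis DiffD1 DiffD2 DiffI Un_iff negligible_Un)

lemma aeq_integral:
 fixes u v :: "real => 'a::euclidean_space"
 assumes "aeq T u v" "t <= T"
 shows "integral {0..t} u = integral {0..t} v"
proof -
 obtain N where N: "negligible N" "!!t. t : {0..T} - N ==> u t = v t" using assms(1) unfolding aeq_def by auto
 show ?thesis by (rule integral_spike[OF N(1)]) (use N(2) assms(2) in auto)
qed

lemma aeq_indef: "aeq T u v ==> indef T u F ==> indef T v F"
 unfolding aeq_def by (metis indef_spike)

lemma aeq_L2:
 assumes "aeq T u v" "L2 T u"
 shows "L2 T v"
proof -
 obtain N where N: "negligible N" "!!t. t : {0..T} - N ==> u t = v t" using assms(1) unfolding aeq_def by auto
 have "v absolutely_integrable_on {0..T}"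
  by (rule absolutely_integrable_spike[OF L2_abs_integrable[OF assms(2)] N(1)]) (use N(2) in auto)
 then have "v : borel_measurable (lebesgue_on {0..T})" by (rule absolutely_integrable_imp_borel_measurable) auto
 moreover have "(%t. (norm (v t))^2) integrable_on {0..T}"
  by (rule integrable_spike[OF L2_norm_integrable[OF assms(2)] N(1)]) (use N(2) in auto)
 ultimately show ?thesis unfolding L2_def by blast
qed

lemma aeq_n2: "aeq T u v ==> n2 T u = n2 T v"
 unfolding n2_def using aeq_integral[OF aeq_map[of T u v "%_ x. (norm x)^2"] order_refl] by simp

text \<open>Inverse of \<open>path_deriv\<close> up to null sets, extended by zero as membership in
  \<open>CM T\<close> demands. Square-integrable functions modulo \<open>aeq\<close> thereby
  represent the Cameron-Martin space.\<close>

definition mk :: "real => (real => 'a::euclidean_space) => real => 'a" where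
 "mk T u t = (if t : {0..T} then integral {0..t} u else 0)"

lemma aeq_mk: "aeq T u v ==> mk T u = mk T v"
 unfolding mk_def by (auto simp: fun_eq_iff intro: aeq_integral)

lemma mk_indef: "L2 T u ==> indef T u (mk T u)"
 using indef_cong[OF indef_integral[OF L2_abs_integrable, of T u 0]] by (simp add: mk_def)

text \<open>The endpoints join the exceptional set because \<open>path_deriv\<close> is a two-sided
  derivative while \<open>h\<close> is prescribed on \<open>{0..T}\<close> only.\<close>

lemma indef_path_deriv:
 assumes u: "indef T u F" and F: "!!t. t : {0..T} ==> F t = h t"
 shows "aeq T (path_deriv h) u"
proof -
 obtain N where N: "negligible N"
  "!!t. t : {0<..<T} - N ==> ((%t. integral {0..t} u) has_vector_derivative u t) (at t)"
  using indefinite_integral_has_vector_derivative_ae[OF indef_absolutely_integrable[OF u]] by blast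
 have "negligible (N \<union> {0, T})" using N(1) by simp
 then show ?thesis
 proof (rule aeqI)
  fix t assume t: "t : {0..T} - (N \<union> {0, T})"
  then have "((%t. F 0 + integral {0..t} u) has_vector_derivative u t) (at t)"
   using has_vector_derivative_add[OF has_vector_derivative_const N(2)[of t], of "F 0"] by auto
  then have "(h has_vector_derivative u t) (at t)"
  proof (rule has_vector_derivative_transform_within_open)
   show "open {0<..<T}" "t : {0<..<T}" using t by auto
   show "F 0 + integral {0..s} u = h s" if "s : {0<..<T}" for s
    using indefD[OF u, of s] F[of s] that by simp
  qed
  then show "path_deriv h t = u t" by (rule vector_derivative_at)
 qed
qed

lemma mk_path_deriv: "L2 T u ==> aeq T (path_deriv (mk T u)) u"
 by (rule indef_path_deriv[OF mk_indef]) auto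

text \<open>Here the theorem on absolutely continuous functions is spent: a path is the integral of
  a density, the density is almost everywhere its derivative, and so the path is recovered from
  \<open>path_deriv\<close>.\<close>

lemma CM_imp:
 assumes T: "T >= 0" and h: "h : CM T"
 shows "L2 T (path_deriv h)" "indef T (path_deriv h) h" "mk T (path_deriv h) = h"
proof -
 have h0: "h 0 = 0" and hz: "!!t. t ~: {0..T} ==> h t = 0" and ac: "absolutely_continuous_on {0..T} h"
  and sq: "(%t. (norm (path_deriv h t))^2) absolutely_integrable_on {0..T}"
  using h unfolding CM_def by auto
 obtain g where g: "g absolutely_integrable_on {0..T}" "!!t. t : {0..T} ==> (g has_integral h t - h 0) {0..t}"
  using absolutely_continuous_indefinite_integral[OF T ac] by blast
 have ig: "indef T g h" unfolding indef_def using g by blast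
 have ae: "aeq T (path_deriv h) g" by (rule indef_path_deriv[OF ig]) auto
 show id: "indef T (path_deriv h) h" by (rule aeq_indef[OF aeq_sym[OF ae] ig])
 show "L2 T (path_deriv h)"
  unfolding L2_def using absolutely_integrable_imp_borel_measurable[OF indef_absolutely_integrable[OF id]] sq
  by (auto simp: absolutely_integrable_on_def)
 show "mk T (path_deriv h) = h"
 proof
  fix t show "mk T (path_deriv h) t = h t" unfolding mk_def using indefD[OF id, of t] h0 hz[of t] by auto
 qed
qed

text \<open>Pointwise, \<open>norm u <= 1 / (2 * c) + (c / 2) * (norm u)^2\<close>, so the
  increments over a division are at most its length divided by \<open>2 * c\<close> plus
  \<open>c / 2\<close> times the squared norm of \<open>u\<close>. With \<open>c = e / N\<close> and
  length below \<open>c * e\<close>, each part accounts for half of \<open>e\<close>.\<close>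

lemma mk_absolutely_continuous:
 assumes u: "L2 T u"
 shows "absolutely_continuous_on {0..T} (mk T u)"
 unfolding absolutely_continuous_on_def
proof (intro allI impI)
 fix e :: real assume e: "e > 0"
 define N where "N = (n2 T u)^2 + 1"
 have N: "N > 0" unfolding N_def by (simp add: add_nonneg_pos)
 define c where "c = e / N"
 have c: "c > 0" unfolding c_def using e N by simp
 have i2: "(%t. (norm (u t))^2) integrable_on {0..T}" using u by (simp add: L2_def)
 have "(SUM J:D. norm (mk T u (Sup J) - mk T u (Inf J))) < e"
  if D: "D division_of U" "U \<subseteq> {0..T}" "(SUM J:D. measure lborel J) < c * e" for D U
 proof -
  note I = real_division_of_interval[OF D(1)]
  have iU: "(%t. (norm (u t))^2) integrable_on U"
   by (rule integrable_on_subdivision[OF D(1) i2 D(2)])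
  have "(SUM J:D. norm (mk T u (Sup J) - mk T u (Inf J))) <=
   (SUM J:D. measure lborel J / (2 * c) + (c / 2) * integral J (%t. (norm (u t))^2))"
  proof (rule sum_mono)
   fix J assume J: "J : D"
   define a b where "a = Inf J" and "b = Sup J"
   have ab: "J = {a..b}" "a <= b" "measure lborel J = b - a" using I[OF J] unfolding a_def b_def by auto
   have "{a..b} \<subseteq> {0..T}" using order_trans[OF division_ofD(2)[OF D(1) J] D(2)] ab(1) by simp
   then have r: "0 <= a" "b <= T" using ab(2) by auto
   have hi: "(u has_integral mk T u b - mk T u a) {a..b}"
    using indef_diff_integral[OF mk_indef[OF u]] r ab by auto
   have i2': "(%t. (norm (u t))^2) integrable_on {a..b}" using i2 r by (auto intro: integrable_on_subinterval)
   have "norm (mk T u b - mk T u a) <= integral {a..b} (%t. 1 / (2 * c) + (c / 2) * (norm (u t))^2)"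
    unfolding integral_unique[OF hi, symmetric]
   proof (rule integral_norm_bound_integral)
    show "u integrable_on {a..b}" using hi by blast
    show "(%t. 1 / (2 * c) + (c / 2) * (norm (u t))^2) integrable_on {a..b}"
     using i2' by (intro integrable_add integrable_on_mult_right) auto
    show "norm (u t) <= 1 / (2 * c) + (c / 2) * (norm (u t))^2" for t
    proof -
     have "0 <= (c * norm (u t) - 1)^2" by simp
     then have "2 * c * norm (u t) <= 1 + c^2 * (norm (u t))^2" by (simp add: power2_diff power_mult_distrib)
     then have "(2 * c * norm (u t)) / (2 * c) <= (1 + c^2 * (norm (u t))^2) / (2 * c)"
      using c by (intro divide_right_mono) auto
     then show ?thesis using c by (simp add: add_divide_distrib power2_eq_square)
    qed
   qed
   also have "... = (b - a) / (2 * c) + (c / 2) * integral {a..b} (%t. (norm (u t))^2)"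
    using i2' ab by (subst Henstock_Kurzweil_Integration.integral_add) (auto intro!: integrable_on_mult_right)
   finally show "norm (mk T u (Sup J) - mk T u (Inf J)) <= measure lborel J / (2 * c) + (c / 2) * integral J (%t. (norm (u t))^2)"
    using ab unfolding a_def[symmetric] b_def[symmetric] by simp
  qed
  also have "... = (SUM J:D. measure lborel J) / (2 * c) + (c / 2) * (SUM J:D. integral J (%t. (norm (u t))^2))"
   by (simp add: sum.distrib sum_divide_distrib sum_distrib_left)
  also have "(SUM J:D. integral J (%t. (norm (u t))^2)) = integral U (%t. (norm (u t))^2)"
   using integral_combine_division_topdown[OF iU D(1)] by simp
  also have "... <= (n2 T u)^2"
   unfolding n2_power2 using iU i2 D(2) by (intro integral_subset_le) auto
  finally have "(SUM J:D. norm (mk T u (Sup J) - mk T u (Inf J))) <=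
    (SUM J:D. measure lborel J) / (2 * c) + (c / 2) * (n2 T u)^2" using c by simp
  also have "... < e / 2 + e / 2"
  proof (rule add_less_le_mono)
   show "(SUM J:D. measure lborel J) / (2 * c) < e / 2" using D(3) c by (simp add: field_simps)
   have "(c / 2) * (n2 T u)^2 <= (c / 2) * N" unfolding N_def using c by (intro mult_left_mono) auto
   then show "(c / 2) * (n2 T u)^2 <= e / 2" unfolding c_def using N by simp
  qed
  finally show ?thesis by simp
 qed
 then show "EX de>0. ALL D U. D division_of U & U \<subseteq> {0..T} & (SUM J:D. measure lborel J) < de -->
   (SUM J:D. norm (mk T u (Sup J) - mk T u (Inf J))) < e"
  using c e by (intro exI[of _ "c * e"]) auto
qed

lemma mk_CM:
 fixes u :: "real => (real, 'm::finite) vec"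
 assumes u: "L2 T u"
 shows "mk T u : CM T"
proof -
 have "L2 T (path_deriv (mk T u))" by (rule aeq_L2[OF aeq_sym[OF mk_path_deriv[OF u]] u])
 then have "(%t. (norm (path_deriv (mk T u) t))^2) integrable_on {0..T}" by (simp add: L2_def)
 then have "(%t. (norm (path_deriv (mk T u) t))^2) absolutely_integrable_on {0..T}"
  by (intro nonnegative_absolutely_integrable_1) auto
 then show ?thesis unfolding CM_def using mk_absolutely_continuous[OF u] by (auto simp: mk_def)
qed

lemma cm_norm_eq_n2: "cm_norm T h = n2 T (path_deriv h)"
 unfolding cm_norm_def cm_inner_def n2_def by (simp add: power2_norm_eq_inner)

lemma cm_norm_nonneg[simp]: "0 <= cm_norm T h"
 unfolding cm_norm_eq_n2 by simp

lemma energy_eq: "energy T h = (n2 T (path_deriv h))^2 / 2"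
 unfolding energy_def cm_norm_eq_n2 by simp

lemma cm_norm_mk: "L2 T u ==> cm_norm T (mk T u) = n2 T u"
 unfolding cm_norm_eq_n2 by (rule aeq_n2[OF mk_path_deriv])

lemma CM_add:
 assumes "T >= 0" "h : CM T" "k : CM T"
 shows "(%t. h t + k t) : CM T" "aeq T (path_deriv (%t. h t + k t)) (%t. path_deriv h t + path_deriv k t)"
proof -
 note h = CM_imp[OF assms(1,2)] and k = CM_imp[OF assms(1,3)]
 have hk: "L2 T (%t. path_deriv h t + path_deriv k t)" by (intro L2_add h k)
 have eq: "(%t. h t + k t) = mk T (%t. path_deriv h t + path_deriv k t)"
 proof
  fix t show "h t + k t = mk T (%t. path_deriv h t + path_deriv k t) t"
  proof (cases "t : {0..T}")
   case True
   then have "path_deriv h integrable_on {0..t}" "path_deriv k integrable_on {0..t}"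
    using indef_has_integral[OF h(2)] indef_has_integral[OF k(2)] by auto
   then have "mk T (%t. path_deriv h t + path_deriv k t) t = mk T (path_deriv h) t + mk T (path_deriv k) t"
    unfolding mk_def using True by (simp add: Henstock_Kurzweil_Integration.integral_add)
   then show ?thesis using h(3) k(3) by simp
  qed (use assms(2,3) in \<open>auto simp: mk_def CM_def\<close>)
 qed
 show "(%t. h t + k t) : CM T" unfolding eq by (rule mk_CM[OF hk])
 show "aeq T (path_deriv (%t. h t + k t)) (%t. path_deriv h t + path_deriv k t)"
  unfolding eq by (rule mk_path_deriv[OF hk])
qed

lemma CM_scaleR:
 assumes "T >= 0" "h : CM T"
 shows "(%t. c *R h t) : CM T" "aeq T (path_deriv (%t. c *R h t)) (%t. c *R path_deriv h t)"
proof -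
 note h = CM_imp[OF assms(1,2)]
 have ch: "L2 T (%t. c *R path_deriv h t)" by (intro L2_scaleR h)
 have eq: "(%t. c *R h t) = mk T (%t. c *R path_deriv h t)"
 proof
  fix t show "c *R h t = mk T (%t. c *R path_deriv h t) t"
   using fun_cong[OF h(3), of t] assms(2) by (auto simp: mk_def CM_def)
 qed
 show "(%t. c *R h t) : CM T" unfolding eq by (rule mk_CM[OF ch])
 show "aeq T (path_deriv (%t. c *R h t)) (%t. c *R path_deriv h t)"
  unfolding eq by (rule mk_path_deriv[OF ch])
qed

lemma CM_diff:
 assumes "T >= 0" "h : CM T" "k : CM T"
 shows "(%t. h t - k t) : CM T" "aeq T (path_deriv (%t. h t - k t)) (%t. path_deriv h t - path_deriv k t)"
proof -
 note * = CM_scaleR[OF assms(1,3), of "-1"]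
 show "(%t. h t - k t) : CM T" using CM_add(1)[OF assms(1,2) *(1)] by simp
 have "aeq T (%t. path_deriv h t + path_deriv (%t. - 1 *R k t) t) (%t. path_deriv h t + - 1 *R path_deriv k t)"
  by (rule aeq_map[OF *(2)])
 from aeq_trans[OF CM_add(2)[OF assms(1,2) *(1)] this]
 show "aeq T (path_deriv (%t. h t - k t)) (%t. path_deriv h t - path_deriv k t)" by simp
qed

lemma CM_zero: "T >= 0 ==> (%t. 0) : CM T"
 using mk_CM[OF L2_const[of T 0]] by (simp add: mk_def[abs_def] cong: if_cong)

lemma CM_sum:
 assumes "T >= 0" "finite I" "!!i. i : I ==> h i : CM T"
 shows "(%t. SUM i:I. h i t) : CM T & aeq T (path_deriv (%t. SUM i:I. h i t)) (%t. SUM i:I. path_deriv (h i) t)"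
 using assms(2,3)
proof (induction I rule: finite_induct)
 case empty
 have "aeq T (path_deriv (%t. 0)) (%t. 0)"
  by (rule aeqI[of "{}"]) (auto intro: vector_derivative_at)
 then show ?case using CM_zero[OF assms(1)] by simp
next
 case (insert i I)
 have 1: "(%t. SUM i:I. h i t) : CM T" "aeq T (path_deriv (%t. SUM i:I. h i t)) (%t. SUM i:I. path_deriv (h i) t)"
  using insert by auto
 note a = CM_add[OF assms(1) insert.prems[of i] 1(1)]
 show ?case using a aeq_trans[OF a(2) aeq_map[OF 1(2), of "%t x. path_deriv (h i) t + x"]] insert by simp
qed

section \<open>Inner products of densities\<close>

definition ip :: "real => (real => 'a::euclidean_space) => (real => 'a) => real" where
 "ip T u v = integral {0..T} (%t. u t \<bullet> v t)"

lemma cm_inner_eq_ip: "cm_inner T h k = ip T (path_deriv h) (path_deriv k)"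
 unfolding cm_inner_def ip_def ..

lemma ip_integrable: "L2 T u ==> L2 T v ==> (%t. u t \<bullet> v t) integrable_on {0..T}"
 using L2_bilinear_absolutely_integrable[OF bounded_bilinear_inner] by (auto simp: absolutely_integrable_on_def)

lemma ip_add_left: "L2 T u ==> L2 T u' ==> L2 T v ==> ip T (%t. u t + u' t) v = ip T u v + ip T u' v"
 unfolding ip_def by (simp add: inner_add_left Henstock_Kurzweil_Integration.integral_add ip_integrable)

lemma ip_diff_left: "L2 T u ==> L2 T u' ==> L2 T v ==> ip T (%t. u t - u' t) v = ip T u v - ip T u' v"
 unfolding ip_def by (simp add: inner_diff_left Henstock_Kurzweil_Integration.integral_diff ip_integrable)

lemma ip_scaleR_left: "ip T (%t. c *R u t) v = c * ip T u v"
 unfolding ip_def by simp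

lemma ip_commute: "ip T u v = ip T v u"
 unfolding ip_def by (simp add: inner_commute)

lemma ip_self: "ip T u u = (n2 T u)^2"
 unfolding ip_def n2_power2 by (simp add: power2_norm_eq_inner)

lemma ip_aeq: "aeq T u u' ==> aeq T v v' ==> ip T u v = ip T u' v'"
 unfolding ip_def by (intro aeq_integral[OF aeq_map2]) auto

lemma ip_le:
 assumes "L2 T u" "L2 T v"
 shows "\<bar>ip T u v\<bar> <= n2 T u * n2 T v"
proof -
 have "norm (integral {0..T} (%t. u t \<bullet> v t)) <= 1 * (n2 T u * n2 T v)"
  by (rule L2_integral_bound[OF assms order_refl]) (auto intro: ip_integrable assms simp: Cauchy_Schwarz_ineq2)
 then show ?thesis unfolding ip_def by simp
qed

text \<open>The integral of \<open>(norm u)^2\<close> up to any time vanishes, and the density of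
  the zero function is zero almost everywhere.\<close>

lemma n2_zero_imp_aeq:
 assumes u: "L2 T u" and 0: "n2 T u = 0"
 shows "aeq T u (%_. 0)"
proof -
 have i: "(%t. (norm (u t))^2) integrable_on {0..T}" using u by (simp add: L2_def)
 have I: "integral {0..T} (%t. (norm (u t))^2) = 0" using 0 n2_power2[of T u] by simp
 have "integral {0..t} (%t. (norm (u t))^2) = 0" if t: "t : {0..T}" for t
 proof -
  have i': "(%t. (norm (u t))^2) integrable_on {0..t}" using i t by (auto intro: integrable_on_subinterval)
  have "integral {0..t} (%t. (norm (u t))^2) <= integral {0..T} (%t. (norm (u t))^2)"
   using t i i' by (intro integral_subset_le) auto
  moreover have "0 <= integral {0..t} (%t. (norm (u t))^2)"
   by (intro Henstock_Kurzweil_Integration.integral_nonneg i') auto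
  ultimately show ?thesis using I by simp
 qed
 then have "indef T (%t. (norm (u t))^2) (%t. 0)"
  using i by (intro indefI[where c=0] nonnegative_absolutely_integrable_1) auto
 then have "aeq T (path_deriv (%t. 0::real)) (%t. (norm (u t))^2)" by (rule indef_path_deriv) simp
 then obtain N where "negligible N" "ALL t:{0..T} - N. path_deriv (%t. 0::real) t = (norm (u t))^2" unfolding aeq_def by blast
 moreover have "path_deriv (%t. 0::real) t = 0" for t by (rule vector_derivative_at) simp
 ultimately show ?thesis by (intro aeqI[of N]) auto
qed

lemma CM_norm_zero:
 assumes "T >= 0" "k : CM T" "cm_norm T k = 0"
 shows "k = (%t. 0)"
proof -
 note k = CM_imp[OF assms(1,2)]
 have "aeq T (path_deriv k) (%_. 0)" using assms(3) k(1) unfolding cm_norm_eq_n2 by (intro n2_zero_imp_aeq)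
 from aeq_mk[OF this] show ?thesis using k(3) by (auto simp: mk_def fun_eq_iff)
qed

section \<open>Frechet derivatives on the Cameron--Martin space\<close>

lemma cm_norm_scaleR: "T >= 0 ==> h : CM T ==> cm_norm T (%t. c *R h t) = \<bar>c\<bar> * cm_norm T h"
 unfolding cm_norm_eq_n2 using aeq_n2[OF CM_scaleR(2)] by (simp add: n2_scaleR)

text \<open>Uniqueness makes the choice in \<open>cm_derivative\<close> harmless on
  \<open>CM T\<close>; off the carrier set the values of a derivative are unconstrained.\<close>

lemma cm_has_derivative_unique:
 fixes F :: "'m::finite rpath => 'b::real_normed_vector"
 assumes T: "T >= 0" and A: "cm_has_derivative T F A h" and B: "cm_has_derivative T F B h" and k: "k : CM T"
 shows "A k = B k"
proof -
 have "norm (A k - B k) <= 0 + e" if e: "e > 0" for e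
 proof -
  define N where "N = cm_norm T k + 1"
  have N: "N > 0" unfolding N_def by (simp add: add_nonneg_pos)
  define e' where "e' = e / (2 * N)"
  have e': "e' > 0" unfolding e'_def using e N by simp
  obtain d1 where d1: "d1 > 0" "!!k. k : CM T ==> cm_norm T k < d1 ==>
    norm (F (%t. h t + k t) - F h - A k) <= e' * cm_norm T k"
   using A e' unfolding cm_has_derivative_def by meson
  obtain d2 where d2: "d2 > 0" "!!k. k : CM T ==> cm_norm T k < d2 ==>
    norm (F (%t. h t + k t) - F h - B k) <= e' * cm_norm T k"
   using B e' unfolding cm_has_derivative_def by meson
  \<comment> \<open>Scales \<open>k\<close> into both neighbourhoods; \<open>N\<close> exceeds the
    norm of \<open>k\<close> by 1, so the quotient makes sense for \<open>k = 0\<close> as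
    well.\<close>
  define r where "r = min d1 d2 / (2 * N)"
  have r: "r > 0" unfolding r_def using d1 d2 N by simp
  define k' where "k' = (%t. r *R k t)"
  have k': "k' : CM T" "cm_norm T k' = r * cm_norm T k"
   unfolding k'_def using CM_scaleR(1)[OF T k] cm_norm_scaleR[OF T k, of r] r by auto
  have "r * cm_norm T k <= r * N" unfolding N_def using r by (intro mult_left_mono) auto
  also have "... = min d1 d2 / 2" unfolding r_def using N by simp
  also have "... < min d1 d2" using d1(1) d2(1) by (simp add: min_def)
  finally have small: "cm_norm T k' < d1" "cm_norm T k' < d2" using k'(2) by auto
  have "norm (A k' - B k') <= norm (F (%t. h t + k' t) - F h - B k') + norm (F (%t. h t + k' t) - F h - A k')"
   using norm_triangle_ineq4[of "F (%t. h t + k' t) - F h - B k'" "F (%t. h t + k' t) - F h - A k'"] by simp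
  also have "... <= e' * cm_norm T k' + e' * cm_norm T k'"
   using d1(2)[OF k'(1) small(1)] d2(2)[OF k'(1) small(2)] by simp
  finally have "norm (A k' - B k') <= r * (2 * e' * cm_norm T k)" unfolding k'(2) by (simp add: mult_ac)
  moreover have "A k' = r *R A k" "B k' = r *R B k"
   using A B k unfolding cm_has_derivative_def k'_def by auto
  ultimately have "r * norm (A k - B k) <= r * (2 * e' * cm_norm T k)"
   using r by (simp flip: scaleR_diff_right)
  then have "norm (A k - B k) <= 2 * e' * cm_norm T k" using r by simp
  also have "... <= 2 * e' * N" unfolding N_def using e' by (intro mult_left_mono) auto
  also have "... = e" unfolding e'_def using N by simp
  finally show ?thesis by simp
 qed
 then have "norm (A k - B k) <= 0" by (rule field_le_epsilon)
 then show ?thesis by simp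
qed

lemma cm_derivative_eq:
 assumes "T >= 0" "cm_has_derivative T F A h" "k : CM T"
 shows "cm_derivative T F h k = A k"
 unfolding cm_derivative_def using cm_has_derivative_unique[OF assms(1) someI[of "%A. cm_has_derivative T F A h", OF assms(2)] assms(2,3)] .

lemma cm_has_derivative_bounded_linear:
 fixes F :: "'m::finite rpath => 'b::real_normed_vector"
 assumes A: "cm_has_derivative T F A h" and L: "bounded_linear L"
 shows "cm_has_derivative T (%h. L (F h)) (%k. L (A k)) h"
proof -
 interpret L: bounded_linear L by (rule L)
 obtain K where K: "K > 0" "!!x. norm (L x) <= norm x * K" using L.pos_bounded by blast
 show ?thesis
  unfolding cm_has_derivative_def
 proof (intro conjI allI ballI impI)
  obtain B where B: "!!k. k : CM T ==> norm (A k) <= B * cm_norm T k"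
   using A unfolding cm_has_derivative_def by blast
  show "EX B. ALL k:CM T. norm (L (A k)) <= B * cm_norm T k"
  proof (intro exI ballI)
   fix k :: "'m rpath" assume "k : CM T"
   then have "norm (A k) * K <= (B * cm_norm T k) * K" using B K by (intro mult_right_mono) auto
   then show "norm (L (A k)) <= (B * K) * cm_norm T k" using K(2)[of "A k"] by (simp add: mult_ac)
  qed
  fix e :: real assume e: "e > 0"
  obtain d where d: "d > 0" "!!k. k : CM T ==> cm_norm T k < d ==>
    norm (F (%t. h t + k t) - F h - A k) <= (e / K) * cm_norm T k"
   using A divide_pos_pos[OF e K(1)] unfolding cm_has_derivative_def by meson
  show "EX d>0. ALL k:CM T. cm_norm T k < d -->
    norm (L (F (%t. h t + k t)) - L (F h) - L (A k)) <= e * cm_norm T k"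
  proof (intro exI conjI ballI impI)
   fix k :: "'m rpath" assume k: "k : CM T" "cm_norm T k < d"
   have "norm (L (F (%t. h t + k t) - F h - A k)) <= norm (F (%t. h t + k t) - F h - A k) * K" by (rule K)
   also have "... <= (e / K) * cm_norm T k * K" using d(2)[OF k] K by (intro mult_right_mono) auto
   finally show "norm (L (F (%t. h t + k t)) - L (F h) - L (A k)) <= e * cm_norm T k"
    using K by (simp add: L.diff)
  qed (rule d)
 qed (use A in \<open>auto simp: cm_has_derivative_def L.add L.scaleR\<close>)
qed

section \<open>The control problem\<close>

lemma sum_option: "(SUM j:(UNIV::'m::finite option set). f j) = f None + (SUM i:UNIV. f (Some i))"
 unfolding UNIV_option_conv by (simp add: sum.reindex)

text \<open>The drift is treated as one more controlled field, with index \<open>None\<close> and constant control 1.\<close>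

definition emb0 :: "(real => real^'m) => real => real^('m::finite option)" where
 "emb0 u s = (\<chi> j. case j of None => 0 | Some i => u s $ i)"

definition emb1 :: "(real => real^'m) => real => real^('m::finite option)" where
 "emb1 u s = (\<chi> j. case j of None => 1 | Some i => u s $ i)"

lemma emb1_add: "emb1 (%s. u s + v s) = (%s. emb1 u s + emb0 v s)"
 unfolding emb0_def emb1_def by (auto simp: fun_eq_iff vec_eq_iff split: option.split)

lemma emb0_add: "emb0 (%s. u s + v s) = (%s. emb0 u s + emb0 v s)"
 unfolding emb0_def by (auto simp: fun_eq_iff vec_eq_iff split: option.split)

lemma emb0_scaleR: "emb0 (%s. c *R v s) = (%s. c *R emb0 v s)"
 unfolding emb0_def by (auto simp: fun_eq_iff vec_eq_iff split: option.split)

lemma norm_emb0: "norm (emb0 u s) = norm (u s)"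
 unfolding norm_vec_def L2_set_def sum_option by (simp add: emb0_def)

lemma L2_emb0: "L2 T u ==> L2 T (emb0 u)"
proof -
 assume u: "L2 T u"
 define h :: "real^'a => real^('a option)" where "h x = (\<chi> j. case j of None => 0 | Some i => x $ i)" for x
 have "linear h" unfolding h_def by (rule linearI) (auto simp: vec_eq_iff split: option.split)
 then have "bounded_linear h" by (simp add: linear_conv_bounded_linear)
 from L2_bounded_linear[OF this u] show ?thesis unfolding h_def emb0_def .
qed

lemma L2_emb1: "L2 T u ==> L2 T (emb1 u)"
proof -
 assume u: "L2 T u"
 have "emb1 u = (%s. emb1 (%_. 0) 0 + emb0 u s)"
  unfolding emb0_def emb1_def by (auto simp: fun_eq_iff vec_eq_iff split: option.split)
 then show ?thesis using L2_add[OF L2_const L2_emb0[OF u], of "emb1 (%_. 0) 0"] by simp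
qed

lemma n2_emb0: "n2 T (emb0 u) = n2 T u"
 by (rule n2_cong) (rule norm_emb0)

lemma aeq_emb0: "aeq T u v ==> aeq T (emb0 u) (emb0 v)"
 unfolding emb0_def by (rule aeq_map)

lemma aeq_emb1: "aeq T u v ==> aeq T (emb1 u) (emb1 v)"
 unfolding emb1_def by (rule aeq_map)

section \<open>Invariance under null sets and the adjoint equation\<close>

context control_system
begin

lemma Xp_aeq: "L2 T w ==> aeq T w w' ==> t : {0..T} ==> Xp w t = Xp w' t"
proof -
 assume w: "L2 T w" and ae: "aeq T w w'" and t: "t : {0..T}"
 have "aeq T (%s. fld w s (Xp w s)) (%s. fld w' s (Xp w s))"
  unfolding fld_def by (rule aeq_map[OF ae])
 from aeq_indef[OF this Xp(1)[OF w]] show ?thesis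
  using Xp_unique[where w=w' and y="Xp w", OF aeq_L2[OF ae w] _ Xp(2)[OF w] t] by blast
qed

lemma Vp_aeq: "aeq T eta eta' ==> t <= T ==> Vp w eta t = Vp w eta' t"
proof -
 assume ae: "aeq T eta eta'" and t: "t <= T"
 have "aeq T (%s. Km w s *v fld eta s (Xp w s)) (%s. Km w s *v fld eta' s (Xp w s))"
  unfolding fld_def by (rule aeq_map[OF ae])
 from aeq_integral[OF this t] show ?thesis unfolding Vp_def by simp
qed

lemma Vp_sum:
 assumes w: "L2 T w" and t: "t : {0..T}" and eta: "!!i. i : I ==> L2 T (eta i)"
 shows "Vp w (%s. SUM i:I. eta i s) t = (SUM i:I. Vp w (eta i) t)"
 using eta
proof (induction I rule: infinite_finite_induct)
 case (insert i I)
 then show ?case using Vp_add[OF w, of "eta i" "%s. SUM i:I. eta i s" t] t by (simp add: L2_sum)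
qed (use Vp_scaleR[of w 0 "%_. 0" t] in auto)

text \<open>The covector \<open>rho\<close> given at time \<open>T\<close>, pulled back to time
  \<open>s\<close> by the Jacobian of the flow from \<open>s\<close> to \<open>T\<close>, which is
  \<open>Jm w T ** Km w s\<close>.\<close>

definition cov :: "(real => real^'j) => 'd rvec => real => 'd rvec" where
 "cov w rho s = (rho v* Jm w T) v* Km w s"

lemma cov_continuous_on: "L2 T w ==> continuous_on {0..T} (cov w rho)"
 unfolding cov_def[abs_def]
 by (intro bounded_bilinear.continuous_on[OF bilinear_vm] Km_continuous_on continuous_on_const)

lemma cov_T: "L2 T w ==> cov w rho T = rho"
 unfolding cov_def vector_matrix_mul_assoc using Jm_Km[of w T] T by simp

lemma cov_indef: "L2 T w ==> indef T (%s. - (cov w rho s v* Am w s)) (cov w rho)"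
proof -
 assume w: "L2 T w"
 have "bounded_linear (%K. (rho v* Jm w T) v* K)"
  by (rule bounded_bilinear.bounded_linear_right[OF bilinear_vm])
 from indef_bounded_linear[OF this Km(1)[OF w]]
 have *: "indef T (%s. (rho v* Jm w T) v* (- (Km w s ** Am w s))) (cov w rho)" unfolding cov_def[abs_def] .
 have "v v* (- A) = - (v v* A)" for v :: "'d rvec" and A :: "real^'d^'d"
  by (rule bounded_bilinear.minus_right[OF bilinear_vm])
 with * show ?thesis unfolding cov_def by (simp add: vector_matrix_mul_assoc matrix_mul_assoc)
qed

text \<open>The density of \<open>cov \<bullet> v\<close> is \<open>cov \<bullet> b\<close>, since
  the terms with \<open>Am\<close> cancel. Linear functionals of an endpoint thus become integrals
  against the forcing.\<close>

lemma cov_duality: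
 assumes w: "L2 T w" and v: "indef T (%s. Am w s *v v s + b s) v" "v 0 = 0"
 shows "((%s. cov w rho s \<bullet> b s) has_integral rho \<bullet> v T) {0..T}"
proof -
 have "indef T (%s. - (cov w rho s v* Am w s) \<bullet> v s + cov w rho s \<bullet> (Am w s *v v s + b s)) (%s. cov w rho s \<bullet> v s)"
  by (rule indef_bilinear[OF bounded_bilinear_inner cov_indef[OF w] v(1)])
 moreover have "- (cov w rho s v* Am w s) \<bullet> v s + cov w rho s \<bullet> (Am w s *v v s + b s) = cov w rho s \<bullet> b s" for s
  by (simp add: inner_add_right dot_lmul_matrix)
 ultimately have "indef T (%s. cov w rho s \<bullet> b s) (%s. cov w rho s \<bullet> v s)" by simp
 from indef_has_integral[OF this, of T] show ?thesis using T v(2) cov_T[OF w] by simp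
qed

end

locale control_problem =
 fixes sg0 :: "'d::finite vfield" and sg :: "'m::finite => 'd vfield" and x0 :: "'d rvec" and T :: real
 assumes Cb0: "Cb_infinity sg0" and Cbi: "!!i. Cb_infinity (sg i)" and T_pos: "T > 0"
begin

sublocale control_system "case_option sg0 sg" x0 T
 by unfold_locales (use Cb0 Cbi T_pos in \<open>auto split: option.split\<close>)

lemma fld_emb1: "fld (emb1 u) s x = sg0 x + (SUM i:UNIV. u s $ i *R sg i x)"
 unfolding fld_def sum_option by (simp add: emb1_def)

lemma fld_emb0: "fld (emb0 u) s x = (SUM i:UNIV. u s $ i *R sg i x)"
 unfolding fld_def sum_option by (simp add: emb0_def)

text \<open>Every \<open>control_solution\<close> is an indefinite integral whose initial value is
  supplied by the integral equation at time 0; uniqueness then resolves the description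
  operator.\<close>

lemma control_flow_eq:
 assumes h: "h : CM T" and t: "t : {0..T}"
 shows "control_flow sg0 sg T x0 t h = Xp (emb1 (path_deriv h)) t"
proof -
 define w where "w = emb1 (path_deriv h)"
 have w: "L2 T w" unfolding w_def by (intro L2_emb1 CM_imp[OF T0 h])
 have "control_solution sg0 sg T x0 h (Xp w)"
  unfolding control_solution_def fld_emb1[of "path_deriv h", symmetric] w_def[symmetric]
  using Xp_continuous_on[OF w] indef_has_integral[OF Xp(1)[OF w]] Xp(2)[OF w] by auto
 moreover have "y t = Xp w t" if y: "control_solution sg0 sg T x0 h y" for y
 proof -
  have c: "continuous_on {0..T} y" and hi: "!!t. t : {0..T} ==> ((%s. fld w s (y s)) has_integral (y t - x0)) {0..t}"
   using y unfolding control_solution_def fld_emb1[of "path_deriv h", symmetric] w_def[symmetric] by auto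
  have "((%s. fld w s (y s)) has_integral 0) {0..0}" using has_integral_refl(2)[of "%s. fld w s (y s)" 0] by simp
  moreover have "((%s. fld w s (y s)) has_integral (y 0 - x0)) {0..0}" using T by (intro hi) auto
  ultimately have "y 0 - x0 = 0" by (metis has_integral_unique)
  then have y0: "y 0 = x0" by simp
  have "indef T (%s. fld w s (y s)) y"
   unfolding indef_def using hi y0 L2_abs_integrable[OF L2_fld[OF w c]] by auto
  then show ?thesis using Xp_unique[where y=y, OF w _ y0 t] by blast
 qed
 ultimately show ?thesis unfolding control_flow_def w_def[symmetric]
 proof (intro the_equality)
  fix x assume "EX y. control_solution sg0 sg T x0 h y & x = y t"
  then show "x = Xp w t" using \<open>!!y. control_solution sg0 sg T x0 h y ==> y t = Xp w t\<close> by blast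
 qed blast
qed

lemma control_flow_add:
 assumes h: "h : CM T" and k: "k : CM T" and t: "t : {0..T}"
 shows "control_flow sg0 sg T x0 t (%t. h t + k t) = Xp (%s. emb1 (path_deriv h) s + emb0 (path_deriv k) s) t"
proof -
 have "aeq T (emb1 (path_deriv (%t. h t + k t))) (%s. emb1 (path_deriv h) s + emb0 (path_deriv k) s)"
  unfolding emb1_add[symmetric] by (intro aeq_emb1 CM_add[OF T0 h k])
 moreover have "L2 T (emb1 (path_deriv (%t. h t + k t)))"
  by (intro L2_emb1 CM_imp[OF T0 CM_add(1)[OF T0 h k]])
 ultimately show ?thesis using control_flow_eq[OF CM_add(1)[OF T0 h k] t] Xp_aeq[OF _ _ t] by simp
qed

lemma flow_has_derivative:
 assumes h: "h : CM T"
 shows "cm_has_derivative T (control_flow sg0 sg T x0 T) (%k. Vp (emb1 (path_deriv h)) (emb0 (path_deriv k)) T) h"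
proof -
 define w where "w = emb1 (path_deriv h)"
 have w: "L2 T w" unfolding w_def by (intro L2_emb1 CM_imp[OF T0 h])
 have T': "T : {0..T}" using T by simp
 have L: "L2 T (emb0 (path_deriv k))" if "k : CM T" for k by (intro L2_emb0 CM_imp[OF T0 that])
 obtain C where C: "C > 0" "!!eta t. L2 T eta ==> t : {0..T} ==>
  norm (Xp (%s. w s + eta s) t - Xp w t - Vp w eta t) <= C * (n2 T eta)^2"
  using Xp_derivative_bound[OF w] by blast
 show ?thesis
  unfolding cm_has_derivative_def w_def[symmetric]
 proof (intro conjI allI ballI impI)
  fix k k' :: "'m rpath" assume k: "k : CM T" and k': "k' : CM T"
  have "Vp w (emb0 (path_deriv (%t. k t + k' t))) T = Vp w (emb0 (%t. path_deriv k t + path_deriv k' t)) T"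
   by (intro Vp_aeq aeq_emb0 CM_add[OF T0 k k']) simp
  then show "Vp w (emb0 (path_deriv (%t. k t + k' t))) T = Vp w (emb0 (path_deriv k)) T + Vp w (emb0 (path_deriv k')) T"
   unfolding emb0_add using Vp_add[OF w L[OF k] L[OF k'] T'] by simp
 next
  fix r and k :: "'m rpath" assume k: "k : CM T"
  have "Vp w (emb0 (path_deriv (%t. r *R k t))) T = Vp w (emb0 (%t. r *R path_deriv k t)) T"
   by (intro Vp_aeq aeq_emb0 CM_scaleR[OF T0 k]) simp
  then show "Vp w (emb0 (path_deriv (%t. r *R k t))) T = r *R Vp w (emb0 (path_deriv k)) T"
   unfolding emb0_scaleR Vp_scaleR .
 next
  show "EX B. ALL k:CM T. norm (Vp w (emb0 (path_deriv k)) T) <= B * cm_norm T k"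
   using Vp_bound[OF w L T'] unfolding n2_emb0 cm_norm_eq_n2 by blast
 next
  fix e :: real assume e: "e > 0"
  show "EX de>0. ALL k:CM T. cm_norm T k < de -->
   norm (control_flow sg0 sg T x0 T (%t. h t + k t) - control_flow sg0 sg T x0 T h - Vp w (emb0 (path_deriv k)) T) <= e * cm_norm T k"
  proof (intro exI conjI ballI impI)
   show "e / C > 0" using e C by simp
   fix k :: "'m rpath" assume k: "k : CM T" "cm_norm T k < e / C"
   have "norm (control_flow sg0 sg T x0 T (%t. h t + k t) - control_flow sg0 sg T x0 T h - Vp w (emb0 (path_deriv k)) T)
    <= C * (cm_norm T k)^2"
    using C(2)[OF L[OF k(1)] T'] unfolding control_flow_add[OF h k(1) T'] control_flow_eq[OF h T'] n2_emb0 cm_norm_eq_n2 w_def .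
   also have "... = (C * cm_norm T k) * cm_norm T k" by (simp add: power2_eq_square)
   also have "... <= e * cm_norm T k" using k(2) C(1) by (intro mult_right_mono) (auto simp: field_simps)
   finally show "norm (control_flow sg0 sg T x0 T (%t. h t + k t) - control_flow sg0 sg T x0 T h - Vp w (emb0 (path_deriv k)) T) <= e * cm_norm T k" .
  qed
 qed
qed

text \<open>The gradient of \<open>rho \<bullet> phi_T\<close> with respect to the control: its
  components are \<open><p, sigma_i(x)>\<close> for the adjoint covector \<open>p\<close>. At a
  critical control it will equal the control itself.\<close>

definition gradc :: "(real => real^('m option)) => 'd rvec => real => real^'m" where
 "gradc w rho s = (\<chi> i. cov w rho s \<bullet> sg i (Xp w s))"

lemma sg_continuous_on: "continuous_on A (sg i)"
 using S_continuous_on[of A "Some i"] by simp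

lemma gradc_continuous_on: "L2 T w ==> continuous_on {0..T} (gradc w rho)"
 unfolding gradc_def[abs_def]
 by (intro continuous_on_vec_lambda continuous_on_inner cov_continuous_on
   continuous_on_compose2[OF sg_continuous_on[of UNIV]] Xp_continuous_on) auto

lemma L2_gradc: "L2 T w ==> L2 T (gradc w rho)"
 by (rule L2_continuous_on[OF gradc_continuous_on])

lemma Vp_T_inner:
 assumes w: "L2 T w" and u: "L2 T u"
 shows "rho \<bullet> Vp w (emb0 u) T = ip T u (gradc w rho)"
proof -
 have "((%s. cov w rho s \<bullet> fld (emb0 u) s (Xp w s)) has_integral rho \<bullet> Vp w (emb0 u) T) {0..T}"
  by (rule cov_duality[OF w Vp[OF w L2_emb0[OF u]]])
 moreover have "cov w rho s \<bullet> fld (emb0 u) s (Xp w s) = u s \<bullet> gradc w rho s" for s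
  unfolding fld_emb0 gradc_def inner_sum_right inner_vec_def[of "u s"] by (simp add: inner_real_def)
 ultimately show ?thesis unfolding ip_def by (simp add: integral_unique)
qed

lemma flow_component_has_derivative:
 assumes h: "h : CM T"
 shows "cm_has_derivative T (%k. control_flow sg0 sg T x0 T k $ i) (%k. Vp (emb1 (path_deriv h)) (emb0 (path_deriv k)) T $ i) h"
 by (rule cm_has_derivative_bounded_linear[OF flow_has_derivative[OF h] bounded_linear_vec_nth])

text \<open>The gradient is a Riesz representative; that there is no other follows by pairing the
  difference of two representatives with itself.\<close>

lemma flow_gradient:
 assumes h: "h : CM T"
 shows "cm_gradient T (%k. control_flow sg0 sg T x0 T k $ i) h = mk T (gradc (emb1 (path_deriv h)) (axis i 1))"
proof -
 define w where "w = emb1 (path_deriv h)"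
 have w: "L2 T w" unfolding w_def by (intro L2_emb1 CM_imp[OF T0 h])
 define g where "g = gradc w (axis i 1)"
 have g: "L2 T g" unfolding g_def by (rule L2_gradc[OF w])
 have der: "cm_derivative T (%k. control_flow sg0 sg T x0 T k $ i) h k = cm_inner T (mk T g) k" if k: "k : CM T" for k
 proof -
  have "cm_derivative T (%k. control_flow sg0 sg T x0 T k $ i) h k = Vp w (emb0 (path_deriv k)) T $ i"
   unfolding w_def by (rule cm_derivative_eq[OF T0 flow_component_has_derivative[OF h] k])
  also have "... = axis i 1 \<bullet> Vp w (emb0 (path_deriv k)) T" by (simp add: inner_axis')
  also have "... = ip T (path_deriv k) g" unfolding g_def by (rule Vp_T_inner[OF w CM_imp(1)[OF T0 k]])
  also have "... = cm_inner T (mk T g) k" unfolding cm_inner_eq_ip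
   by (subst ip_commute) (rule ip_aeq[OF aeq_sym[OF mk_path_deriv[OF g]] aeq_refl])
  finally show ?thesis .
 qed
 show ?thesis unfolding cm_gradient_def w_def[symmetric] g_def[symmetric]
 proof (rule the_equality)
  show "mk T g : CM T & (ALL k:CM T. cm_derivative T (%k. control_flow sg0 sg T x0 T k $ i) h k = cm_inner T (mk T g) k)"
   using mk_CM[OF g] der by blast
  fix g' assume g': "g' : CM T & (ALL k:CM T. cm_derivative T (%k. control_flow sg0 sg T x0 T k $ i) h k = cm_inner T g' k)"
  define d where "d = (%t. g' t - mk T g t)"
  have d: "d : CM T" "aeq T (path_deriv d) (%t. path_deriv g' t - path_deriv (mk T g) t)"
   unfolding d_def using CM_diff[OF T0 _ mk_CM[OF g]] g' by auto
  note L = CM_imp(1)[OF T0 d(1)] CM_imp(1)[OF T0 conjunct1[OF g']] CM_imp(1)[OF T0 mk_CM[OF g]]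
  have "cm_inner T g' d = cm_inner T (mk T g) d" using g' der d(1) by auto
  moreover have "cm_inner T d d = cm_inner T g' d - cm_inner T (mk T g) d"
   unfolding cm_inner_eq_ip using ip_aeq[OF d(2) aeq_refl] ip_diff_left[OF L(2,3,1)] by simp
  ultimately have "cm_norm T d = 0" unfolding cm_norm_def by simp
  from CM_norm_zero[OF T0 d(1) this] show "g' = mk T g" unfolding d_def by (auto simp: fun_eq_iff)
 qed
qed

text \<open>The Malliavin matrix is the Gram matrix of the gradients \<open>g i\<close>, and its
  column \<open>j\<close> is the endpoint variation produced by \<open>g j\<close>. Combining the
  \<open>g j\<close> with the entries of the inverse matrix gives directions that move the endpoint
  along the coordinate axes.\<close>

lemma malliavin_surjective:
 assumes h: "h : CM T" and inv: "invertible (malliavin_matrix sg0 sg T x0 h)"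
 obtains G where "!!a. L2 T (G a)" "!!a. Vp (emb1 (path_deriv h)) (emb0 (G a)) T = axis a 1"
proof -
 define w where "w = emb1 (path_deriv h)"
 have w: "L2 T w" unfolding w_def by (intro L2_emb1 CM_imp[OF T0 h])
 define g where "g i = gradc w (axis i 1)" for i
 have g: "L2 T (g i)" for i unfolding g_def by (rule L2_gradc[OF w])
 define C where "C = malliavin_matrix sg0 sg T x0 h"
 have Cij: "C $ i $ j = Vp w (emb0 (g j)) T $ i" for i j
 proof -
  have "C $ i $ j = cm_inner T (mk T (g i)) (mk T (g j))"
   unfolding C_def malliavin_matrix_def flow_gradient[OF h] g_def w_def by simp
  also have "... = ip T (g j) (g i)" unfolding cm_inner_eq_ip
   by (subst ip_commute) (intro ip_aeq mk_path_deriv g)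
  also have "... = axis i 1 \<bullet> Vp w (emb0 (g j)) T" using Vp_T_inner[OF w g, of "axis i 1" j] unfolding g_def by simp
  finally show ?thesis by (simp add: inner_axis')
 qed
 obtain M where M: "C ** M = mat 1" using inv unfolding C_def[symmetric] invertible_def by blast
 define G where "G a s = (SUM j:UNIV. (M $ j $ a) *R g j s)" for a s
 show ?thesis
 proof (rule that[of G])
  show "L2 T (G a)" for a unfolding G_def by (intro L2_sum L2_scaleR g)
  fix a
  have "emb0 (G a) = (%s. SUM j:UNIV. (M $ j $ a) *R emb0 (g j) s)"
   unfolding G_def emb0_def by (auto simp: fun_eq_iff vec_eq_iff split: option.split)
  then have "Vp w (emb0 (G a)) T = (SUM j:UNIV. Vp w (%s. (M $ j $ a) *R emb0 (g j) s) T)"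
   using Vp_sum[OF w, of T UNIV "%j s. (M $ j $ a) *R emb0 (g j) s"] T by (simp add: L2_scaleR L2_emb0 g)
  also have "... = (SUM j:UNIV. (M $ j $ a) *R Vp w (emb0 (g j)) T)" by (simp add: Vp_scaleR)
  finally have eq: "Vp w (emb0 (G a)) T = (SUM j:UNIV. (M $ j $ a) *R Vp w (emb0 (g j)) T)" .
  have "Vp w (emb0 (G a)) T $ i = (C ** M) $ i $ a" for i
   unfolding eq matrix_matrix_mult_def by (simp add: Cij mult.commute)
  then show "Vp (emb1 (path_deriv h)) (emb0 (G a)) T = axis a 1"
   unfolding w_def[symmetric] M by (simp add: vec_eq_iff mat_def axis_def)
 qed
qed

end

section \<open>Leading coordinates\<close>

lemma card_lessThan_inj:
 fixes i j :: "'a::{finite,linorder}"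
 shows "card {..<i} = card {..<j} ==> i = j"
 by (metis finite_code lessThan_strict_subset_iff linorder_neqE psubset_card_mono nat_neq_iff)

text \<open>Distinct elements have distinct ranks below \<open>CARD('a)\<close>, so by counting
  every rank occurs; this is what makes \<open>lead_index\<close> well defined.\<close>

lemma card_lessThan_surj:
 fixes n :: nat
 assumes "n < CARD('a::{finite,linorder})"
 obtains j :: "'a::{finite,linorder}" where "card {..<j} = n"
proof -
 have "inj (%j::'a. card {..<j})" by (rule injI) (rule card_lessThan_inj)
 moreover have sub: "range (%j::'a. card {..<j}) \<subseteq> {..<CARD('a)}"
 proof
  fix k assume "k : range (%j::'a. card {..<j})"
  then obtain j :: 'a where "k = card {..<j}" by auto
  moreover have "card {..<j} < CARD('a)" by (rule psubset_card_mono) auto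
  ultimately show "k : {..<CARD('a)}" by simp
 qed
 ultimately have "range (%j::'a. card {..<j}) = {..<CARD('a)}"
  by (intro card_subset_eq) (auto simp: card_image)
 then show ?thesis using assms that by (metis (mono_tags, lifting) imageE lessThan_iff)
qed

lemma inj_lead_index:
 assumes "CARD('l::{finite,linorder}) <= CARD('d::{finite,linorder})"
 shows "inj (lead_index :: 'l::{finite,linorder} => 'd::{finite,linorder})"
proof -
 have "card {..<lead_index i :: 'd} = card {..<i}" for i :: 'l
 proof -
  have "card {..<i} < CARD('l)" by (rule psubset_card_mono) auto
  then obtain j :: 'd where j: "card {..<j} = card {..<i}"
   using card_lessThan_surj[of "card {..<i}", where 'a='d] assms by (metis order_less_le_trans)
  then show ?thesis unfolding lead_index_def by (rule theI) (metis card_lessThan_inj j)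
 qed
 then show ?thesis by (metis card_lessThan_inj injI)
qed

lemma bounded_linear_proj_lead: "bounded_linear (proj_lead :: 'd::{finite,linorder} rvec => 'l::{finite,linorder} rvec)"
proof -
 have "linear (proj_lead :: 'd rvec => 'l rvec)" unfolding proj_lead_def by (rule linearI) (auto simp: vec_eq_iff)
 then show ?thesis by (simp add: linear_conv_bounded_linear)
qed

section \<open>Second-order expansion of the endpoint map\<close>

lemma norm_vec_lambda_le:
 fixes f :: "'j::finite => real"
 assumes "!!j. \<bar>f j\<bar> <= c"
 shows "norm (\<chi> j. f j) <= real CARD('j) * c"
proof -
 have "norm (\<chi> j. f j) <= (SUM j:UNIV. \<bar>(\<chi> j. f j) $ j\<bar>)" by (rule norm_le_l1_cart)
 also have "... <= (SUM j:(UNIV::'j set). c)" by (intro sum_mono) (simp add: assms)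
 finally show ?thesis by simp
qed

lemma n2_le_const:
 assumes f: "L2 T f" and T: "T >= 0" and c: "!!s. s : {0..T} ==> norm (f s) <= c"
 shows "n2 T f <= sqrt T * c"
proof -
 have c0: "c >= 0" using c[of 0] T norm_ge_zero order_trans by (metis atLeastAtMost_iff order_refl)
 have "n2 T f <= c * n2 T (%s. 1::real)"
  by (rule n2_le_mult[OF f L2_const c0]) (use c in auto)
 also have "n2 T (%s. 1::real) = sqrt T" unfolding n2_def using T by simp
 finally show ?thesis by (simp add: mult.commute)
qed

lemma ip_le_const:
 assumes "L2 T u" "L2 T f" "T >= 0" "!!s. s : {0..T} ==> norm (f s) <= c"
 shows "\<bar>ip T u f\<bar> <= n2 T u * (sqrt T * c)"
 using ip_le[OF assms(1,2)] mult_left_mono[OF n2_le_const[OF assms(2,3,4)] n2_nonneg[of T u]] by linarith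

lemma ip_add_right: "L2 T u ==> L2 T u' ==> L2 T v ==> ip T v (%t. u t + u' t) = ip T v u + ip T v u'"
 by (subst (1 2 3) ip_commute) (rule ip_add_left)

lemma ip_diff_right: "L2 T u ==> L2 T u' ==> L2 T v ==> ip T v (%t. u t - u' t) = ip T v u - ip T v u'"
 by (subst (1 2 3) ip_commute) (rule ip_diff_left)

lemma ip_scaleR_right: "ip T v (%t. c *R u t) = c * ip T v u"
 by (subst (1 2) ip_commute) (rule ip_scaleR_left)

lemma D2m_expand:
 assumes "Cb_infinity f"
 shows "D2m f x v = (SUM b:UNIV. v $ b *R D2m f x (axis b 1))"
proof -
 have "D2m f x (SUM b:UNIV. v $ b *R axis b 1) = (SUM b:UNIV. v $ b *R D2m f x (axis b 1))"
  using D2m_linear[OF assms, of x] by (simp add: linear_sum linear_scale)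
 then show ?thesis using basis_expansion[of v] by (simp add: scalar_mult_eq_scaleR)
qed

context control_system
begin

lemma D2S_continuous_on:
 assumes "continuous_on A x" "continuous_on A v"
 shows "continuous_on A (%s. D2m (S j) (x s) (v s))"
 by (subst D2m_expand[OF Cb])
  (intro continuous_intros continuous_on_compose2[OF Cb_infinity_continuous_on[OF Cb_infinity_D2m[OF Cb], of UNIV] assms(1)] assms(2), auto)

lemma DS_compose_continuous_on:
 assumes "continuous_on A x"
 shows "continuous_on A (%s. Dm (S j) (x s))"
 by (rule continuous_on_compose2[OF DS_continuous_on[of UNIV] assms]) auto

lemma S_compose_continuous_on:
 assumes "continuous_on A x"
 shows "continuous_on A (%s. S j (x s))"
 by (rule continuous_on_compose2[OF S_continuous_on[of UNIV] assms]) auto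

text \<open>Together with \<open>F1\<close> and \<open>F2\<close>: the data of order 0, 1 and 2 of
  the fields as seen by the covector, that is \<open><p, S_j>\<close>, \<open><p, DS_j y>\<close>
  and the second derivative of \<open>S_j\<close> in the directions \<open>y\<close>,
  \<open>y'\<close> paired with \<open>p\<close>. As vectors indexed by the fields they pair with a
  control through \<open>ip\<close>.\<close>

definition G0 :: "(real => real^'j) => 'd rvec => real => real^'j" where
 "G0 w rho s = (\<chi> j. cov w rho s \<bullet> S j (Xp w s))"

definition F1 :: "(real => real^'j) => 'd rvec => (real => 'd rvec) => real => real^'j" where
 "F1 w rho y s = (\<chi> j. cov w rho s \<bullet> (Dm (S j) (Xp w s) *v y s))"

definition F2 :: "(real => real^'j) => 'd rvec => (real => 'd rvec) => (real => 'd rvec) => real => real^'j" where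
 "F2 w rho y y' s = (\<chi> j. cov w rho s \<bullet> (D2m (S j) (Xp w s) (y s) *v y' s))"

lemma G0_continuous_on: "L2 T w ==> continuous_on {0..T} (G0 w rho)"
 unfolding G0_def[abs_def]
 by (intro continuous_on_vec_lambda continuous_on_inner cov_continuous_on S_compose_continuous_on Xp_continuous_on)

lemma F1_continuous_on: "L2 T w ==> continuous_on {0..T} y ==> continuous_on {0..T} (F1 w rho y)"
 unfolding F1_def[abs_def]
 by (intro continuous_on_vec_lambda continuous_on_inner cov_continuous_on DS_compose_continuous_on Xp_continuous_on
  bounded_bilinear.continuous_on[OF bilinear_mv])

lemma F2_continuous_on: "L2 T w ==> continuous_on {0..T} y ==> continuous_on {0..T} y' ==> continuous_on {0..T} (F2 w rho y y')"
 unfolding F2_def[abs_def]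
 by (intro continuous_on_vec_lambda continuous_on_inner cov_continuous_on D2S_continuous_on Xp_continuous_on
  bounded_bilinear.continuous_on[OF bilinear_mv])

lemma F1_add: "F1 w rho (%s. y s + z s) = (%s. F1 w rho y s + F1 w rho z s)"
 unfolding F1_def by (simp add: fun_eq_iff vec_eq_iff matrix_vector_right_distrib inner_add_right)

lemma F1_scaleR: "F1 w rho (%s. c *R y s) = (%s. c *R F1 w rho y s)"
 unfolding F1_def by (simp add: fun_eq_iff vec_eq_iff bounded_bilinear.scaleR_right[OF bilinear_mv])

lemma F2_add: "F2 w rho (%s. y s + z s) y' = (%s. F2 w rho y y' s + F2 w rho z y' s)"
 unfolding F2_def by (simp add: fun_eq_iff vec_eq_iff linear_add[OF D2m_linear[OF Cb]]
  matrix_vector_mult_add_rdistrib inner_add_right)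

lemma F2_scaleR: "F2 w rho (%s. c *R y s) y' = (%s. c *R F2 w rho y y' s)"
 unfolding F2_def by (simp add: fun_eq_iff vec_eq_iff linear_scale[OF D2m_linear[OF Cb]]
  bounded_bilinear.scaleR_left[OF bilinear_mv])

lemma F2_commute: "F2 w rho y y' = F2 w rho y' y"
 unfolding F2_def by (simp add: D2m_symmetric[OF Cb])

lemma F1_cong: "y s = z s ==> F1 w rho y s = F1 w rho z s"
 unfolding F1_def by simp

lemma F2_cong: "y s = z s ==> y' s = z' s ==> F2 w rho y y' s = F2 w rho z z' s"
 unfolding F2_def by simp

lemma cov_bounded:
 assumes "L2 T w"
 obtains M where "M > 0" "!!s. s : {0..T} ==> norm (cov w rho s) <= M"
proof -
 have "bounded (cov w rho ` {0..T})" using cov_continuous_on[OF assms] by (intro compact_imp_bounded compact_continuous_image) auto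
 then show ?thesis using that unfolding bounded_pos by blast
qed

text \<open>One constant for all orders. The last two bounds are the second and first order Taylor
  remainders of the fields, paired with the covector.\<close>

lemma F_bounds:
 assumes w: "L2 T w"
 obtains M where "M > 0"
  "!!y s. s : {0..T} ==> norm (F1 w rho y s) <= M * norm (y s)"
  "!!y y' s. s : {0..T} ==> norm (F2 w rho y y' s) <= M * norm (y s) * norm (y' s)"
  "!!z s. s : {0..T} ==> norm ((\<chi> j. cov w rho s \<bullet> (S j z - S j (Xp w s) - Dm (S j) (Xp w s) *v (z - Xp w s)))
    - (1/2) *R F2 w rho (%_. z - Xp w s) (%_. z - Xp w s) s) <= M * (norm (z - Xp w s))^3"
  "!!z s. s : {0..T} ==> norm ((\<chi> j. cov w rho s \<bullet> S j z) - G0 w rho s - F1 w rho (%_. z - Xp w s) s) <= M * (norm (z - Xp w s))^2"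
proof -
 obtain P where P: "P > 0" "!!s. s : {0..T} ==> norm (cov w rho s) <= P" using cov_bounded[OF w] by blast
 have inn: "\<bar>cov w rho s \<bullet> a\<bar> <= P * (CS * c)" if "s : {0..T}" "norm a <= CS * c" for s a c
  using Cauchy_Schwarz_ineq2[of "cov w rho s" a] mult_mono[OF P(2)[OF that(1)] that(2)] P by fastforce
 have vec: "norm (\<chi> j. cov w rho s \<bullet> a j) <= (real CARD('j) * P * CS) * c" if "s : {0..T}" "!!j. norm (a j) <= CS * c"
  for s c and a :: "'j => 'd rvec"
  using norm_vec_lambda_le[OF inn[OF that(1)], OF that(2)] by (simp add: mult.assoc)
 show ?thesis
 proof (rule that[of "real CARD('j) * P * CS"])
  show "real CARD('j) * P * CS > 0" using P CS_pos by simp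
  fix s :: real and y y' :: "real => 'd rvec" and z :: "'d rvec" assume s: "s : {0..T}"
  show "norm (F1 w rho y s) <= real CARD('j) * P * CS * norm (y s)"
   unfolding F1_def by (rule vec[OF s DS_mult_bound])
  show "norm (F2 w rho y y' s) <= real CARD('j) * P * CS * norm (y s) * norm (y' s)"
   unfolding F2_def using vec[OF s, of "%j. D2m (S j) (Xp w s) (y s) *v y' s" "norm (y s) * norm (y' s)"] D2S_bound
   by (simp add: mult.assoc)
  have e1: "(\<chi> j. cov w rho s \<bullet> (S j z - S j (Xp w s) - Dm (S j) (Xp w s) *v (z - Xp w s)))
    - (1/2) *R F2 w rho (%_. z - Xp w s) (%_. z - Xp w s) s =
   (\<chi> j. cov w rho s \<bullet> (S j z - S j (Xp w s) - Dm (S j) (Xp w s) *v (z - Xp w s) - (1/2) *R (D2m (S j) (Xp w s) (z - Xp w s) *v (z - Xp w s))))"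
   unfolding F2_def by (simp add: vec_eq_iff inner_diff_right)
  have n1: "norm (S j z - S j (Xp w s) - Dm (S j) (Xp w s) *v (z - Xp w s) - (1/2) *R (D2m (S j) (Xp w s) (z - Xp w s) *v (z - Xp w s)))
   <= CS * (norm (z - Xp w s))^3" for j
   using S_taylor2[of j "Xp w s" "z - Xp w s"] by simp
  show "norm ((\<chi> j. cov w rho s \<bullet> (S j z - S j (Xp w s) - Dm (S j) (Xp w s) *v (z - Xp w s)))
    - (1/2) *R F2 w rho (%_. z - Xp w s) (%_. z - Xp w s) s) <= real CARD('j) * P * CS * (norm (z - Xp w s))^3"
   unfolding e1 by (rule vec[OF s n1])
  have e2: "(\<chi> j. cov w rho s \<bullet> S j z) - G0 w rho s - F1 w rho (%_. z - Xp w s) s =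
   (\<chi> j. cov w rho s \<bullet> (S j z - S j (Xp w s) - Dm (S j) (Xp w s) *v (z - Xp w s)))"
   unfolding G0_def F1_def by (simp add: vec_eq_iff inner_diff_right)
  show "norm ((\<chi> j. cov w rho s \<bullet> S j z) - G0 w rho s - F1 w rho (%_. z - Xp w s) s) <= real CARD('j) * P * CS * (norm (z - Xp w s))^2"
   unfolding e2 by (rule vec[OF s S_taylor1])
 qed
qed

text \<open>The polarised second derivative of \<open>rho \<bullet> Xp w T\<close> in
  \<open>w\<close>. The adjoint covector has absorbed the second variation of the path, so only
  first variations \<open>Vp\<close> occur.\<close>

definition Rb :: "(real => real^'j) => 'd rvec => (real => real^'j) => (real => real^'j) => real" where
 "Rb w rho eta th = ip T w (F2 w rho (Vp w eta) (Vp w th)) + ip T eta (F1 w rho (Vp w th)) + ip T th (F1 w rho (Vp w eta))"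

lemma Rb_commute: "Rb w rho eta th = Rb w rho th eta"
 unfolding Rb_def using F2_commute[of w rho "Vp w eta"] by simp

lemma ip_cong: "(!!s. s : {0..T} ==> f s = g s) ==> ip T u f = ip T u g"
 unfolding ip_def by (intro Henstock_Kurzweil_Integration.integral_cong) auto

lemma Rb_add:
 assumes w: "L2 T w" and eta: "L2 T eta" and eta': "L2 T eta'" and th: "L2 T th"
 shows "Rb w rho (%s. eta s + eta' s) th = Rb w rho eta th + Rb w rho eta' th"
proof -
 note c = Vp_continuous_on[OF w]
 have "ip T w (F2 w rho (Vp w (%s. eta s + eta' s)) (Vp w th)) = ip T w (F2 w rho (%s. Vp w eta s + Vp w eta' s) (Vp w th))"
  by (intro ip_cong F2_cong Vp_add w eta eta' refl)
 also have "... = ip T w (F2 w rho (Vp w eta) (Vp w th)) + ip T w (F2 w rho (Vp w eta') (Vp w th))"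
  unfolding F2_add by (intro ip_add_right L2_continuous_on F2_continuous_on w c eta eta' th)
 finally have 1: "ip T w (F2 w rho (Vp w (%s. eta s + eta' s)) (Vp w th)) = ..." .
 have "ip T th (F1 w rho (Vp w (%s. eta s + eta' s))) = ip T th (F1 w rho (%s. Vp w eta s + Vp w eta' s))"
  by (intro ip_cong F1_cong Vp_add w eta eta')
 also have "... = ip T th (F1 w rho (Vp w eta)) + ip T th (F1 w rho (Vp w eta'))"
  unfolding F1_add by (intro ip_add_right L2_continuous_on F1_continuous_on w c eta eta' th)
 finally have 2: "ip T th (F1 w rho (Vp w (%s. eta s + eta' s))) = ..." .
 have 3: "ip T (%s. eta s + eta' s) (F1 w rho (Vp w th)) = ip T eta (F1 w rho (Vp w th)) + ip T eta' (F1 w rho (Vp w th))"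
  by (intro ip_add_left L2_continuous_on F1_continuous_on w c eta eta' th)
 show ?thesis unfolding Rb_def 1 2 3 by simp
qed

lemma Rb_scaleR: "Rb w rho (%s. c *R eta s) th = c * Rb w rho eta th"
proof -
 have V: "Vp w (%s. c *R eta s) = (%s. c *R Vp w eta s)" by (simp add: fun_eq_iff Vp_scaleR)
 show ?thesis unfolding Rb_def V F2_scaleR F1_scaleR ip_scaleR_left ip_scaleR_right by (simp add: algebra_simps)
qed

lemma Rb_aeq:
 assumes "aeq T eta eta'" "aeq T th th'"
 shows "Rb w rho eta th = Rb w rho eta' th'"
proof -
 have V: "Vp w eta s = Vp w eta' s" "Vp w th s = Vp w th' s" if "s : {0..T}" for s
  using Vp_aeq assms that by auto
 have "ip T w (F2 w rho (Vp w eta) (Vp w th)) = ip T w (F2 w rho (Vp w eta') (Vp w th'))"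
  by (intro ip_cong F2_cong V)
 moreover have "ip T eta (F1 w rho (Vp w th)) = ip T eta' (F1 w rho (Vp w th'))"
  using ip_cong[of "F1 w rho (Vp w th)" "F1 w rho (Vp w th')" eta] F1_cong V(2) ip_aeq[OF assms(1) aeq_refl] by metis
 moreover have "ip T th (F1 w rho (Vp w eta)) = ip T th' (F1 w rho (Vp w eta'))"
  using ip_cong[of "F1 w rho (Vp w eta)" "F1 w rho (Vp w eta')" th] F1_cong V(1) ip_aeq[OF assms(2) aeq_refl] by metis
 ultimately show ?thesis unfolding Rb_def by simp
qed

lemma Rb_bound:
 assumes w: "L2 T w"
 obtains C where "C > 0" "!!eta th. L2 T eta ==> L2 T th ==> \<bar>Rb w rho eta th\<bar> <= C * n2 T eta * n2 T th"
proof -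
 obtain M where M: "M > 0" "!!y s. s : {0..T} ==> norm (F1 w rho y s) <= M * norm (y s)"
  "!!y y' s. s : {0..T} ==> norm (F2 w rho y y' s) <= M * norm (y s) * norm (y' s)"
  by (rule F_bounds[OF w, of rho]) blast
 define V where "V = VL w"
 have V: "V >= 0" "!!eta s. L2 T eta ==> s : {0..T} ==> norm (Vp w eta s) <= V * n2 T eta"
  unfolding V_def using VL_nonneg Vp_bound[OF w] by auto
 define C where "C = n2 T w * (sqrt T * (M * V * V)) + 2 * (sqrt T * (M * V))"
 have C: "C >= 0" unfolding C_def using T M V by simp
 have bnd: "\<bar>Rb w rho eta th\<bar> <= C * n2 T eta * n2 T th" if eta: "L2 T eta" and th: "L2 T th" for eta th
 proof -
  note c = Vp_continuous_on[OF w eta] Vp_continuous_on[OF w th]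
  have f1: "\<bar>ip T eta (F1 w rho (Vp w th))\<bar> <= n2 T eta * (sqrt T * (M * (V * n2 T th)))"
   if eta: "L2 T eta" and th: "L2 T th" for eta th
  proof (rule ip_le_const[OF eta L2_continuous_on[OF F1_continuous_on[OF w Vp_continuous_on[OF w th]]] T0])
   fix s assume s: "s : {0..T}"
   show "norm (F1 w rho (Vp w th) s) <= M * (V * n2 T th)"
    using M(2)[OF s, of "Vp w th"] mult_left_mono[OF V(2)[OF th s], of M] M(1) by linarith
  qed
  have "\<bar>ip T w (F2 w rho (Vp w eta) (Vp w th))\<bar> <= n2 T w * (sqrt T * (M * (V * n2 T eta) * (V * n2 T th)))"
  proof (rule ip_le_const[OF w L2_continuous_on[OF F2_continuous_on[OF w c]] T0])
   fix s assume s: "s : {0..T}"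
   have "M * norm (Vp w eta s) * norm (Vp w th s) <= M * (V * n2 T eta) * (V * n2 T th)"
    using M(1) V(1) V(2)[OF eta s] V(2)[OF th s] by (intro mult_mono mult_left_mono) auto
   then show "norm (F2 w rho (Vp w eta) (Vp w th) s) <= M * (V * n2 T eta) * (V * n2 T th)"
    using M(3)[OF s, of "Vp w eta" "Vp w th"] by linarith
  qed
  then have "\<bar>Rb w rho eta th\<bar> <= n2 T w * (sqrt T * (M * (V * n2 T eta) * (V * n2 T th)))
    + n2 T eta * (sqrt T * (M * (V * n2 T th))) + n2 T th * (sqrt T * (M * (V * n2 T eta)))"
   unfolding Rb_def using f1[OF eta th] f1[OF th eta] by linarith
  also have "... = C * n2 T eta * n2 T th" unfolding C_def by (simp add: algebra_simps)
  finally show ?thesis .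
 qed
 have "\<bar>Rb w rho eta th\<bar> <= (C + 1) * n2 T eta * n2 T th" if "L2 T eta" "L2 T th" for eta th
 proof -
  have "C * n2 T eta * n2 T th <= (C + 1) * n2 T eta * n2 T th" by (intro mult_right_mono) auto
  then show ?thesis using bnd[OF that] by linarith
 qed
 then show ?thesis using that[of "C + 1"] C by simp
qed

text \<open>The exact increment \<open>de\<close> of the path solves the linearised equation with a
  nonlinear forcing, so duality turns \<open>rho \<bullet> de T\<close> into integrals before
  anything is expanded. Taylor expansion inside these integrals, followed by replacing
  \<open>de\<close> with \<open>Vp\<close>, leaves a cubic error.\<close>

lemma endpoint_second_order:
 assumes w: "L2 T w"
 obtains C where "C > 0" "!!eta. L2 T eta ==>
  \<bar>rho \<bullet> (Xp (%s. w s + eta s) T - Xp w T) - ip T eta (G0 w rho) - Rb w rho eta eta / 2\<bar> <= C * (n2 T eta)^3"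
proof -
 obtain M where M: "M > 0" "!!y s. s : {0..T} ==> norm (F1 w rho y s) <= M * norm (y s)"
  "!!y y' s. s : {0..T} ==> norm (F2 w rho y y' s) <= M * norm (y s) * norm (y' s)"
  "!!z s. s : {0..T} ==> norm ((\<chi> j. cov w rho s \<bullet> (S j z - S j (Xp w s) - Dm (S j) (Xp w s) *v (z - Xp w s)))
    - (1/2) *R F2 w rho (%_. z - Xp w s) (%_. z - Xp w s) s) <= M * (norm (z - Xp w s))^3"
  "!!z s. s : {0..T} ==> norm ((\<chi> j. cov w rho s \<bullet> S j z) - G0 w rho s - F1 w rho (%_. z - Xp w s) s) <= M * (norm (z - Xp w s))^2"
  by (rule F_bounds[OF w, of rho]) blast
 obtain D where D: "D > 0" "!!eta t. L2 T eta ==> t : {0..T} ==>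
  norm (Xp (%s. w s + eta s) t - Xp w t - Vp w eta t) <= D * (n2 T eta)^2"
  using Xp_derivative_bound[OF w] by blast
 define V where "V = VL w"
 have V: "V >= 0" "!!eta s. L2 T eta ==> s : {0..T} ==> norm (Vp w eta s) <= V * n2 T eta"
  unfolding V_def using VL_nonneg Vp_bound[OF w] by auto
 define X where "X = XL w"
 have X: "X >= 0" "!!eta s. L2 T eta ==> s : {0..T} ==> norm (Xp (%s. w s + eta s) s - Xp w s) <= X * n2 T eta"
  unfolding X_def using XL_nonneg Xp_diff_bound[OF w] by auto
 define c2 where "c2 = M * X^3 + M * D * (X + V)"
 define c1 where "c1 = M * X^2 + M * D"
 define C where "C = n2 T w * (sqrt T * c2) + sqrt T * c1"
 have C0: "C >= 0" unfolding C_def c1_def c2_def using T M X D V by simp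
 have bnd: "\<bar>rho \<bullet> (Xp (%s. w s + eta s) T - Xp w T) - ip T eta (G0 w rho) - Rb w rho eta eta / 2\<bar> <= C * (n2 T eta)^3"
  if eta: "L2 T eta" for eta
 proof -
  note weta = L2_add[OF w eta]
  define N where "N = n2 T eta"
  have N: "N >= 0" unfolding N_def by simp
  define z where "z = Xp (%s. w s + eta s)"
  define x where "x = Xp w"
  define v where "v = Vp w eta"
  define de where "de s = z s - x s" for s
  have cz: "continuous_on {0..T} z" "continuous_on {0..T} x" "continuous_on {0..T} v"
   unfolding z_def x_def v_def using Xp_continuous_on[OF weta] Xp_continuous_on[OF w] Vp_continuous_on[OF w eta] by auto
  have bde: "norm (de s) <= X * N" and bv: "norm (v s) <= V * N" and bd: "norm (de s - v s) <= D * N^2" if "s : {0..T}" for s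
   unfolding de_def z_def x_def v_def N_def using X(2)[OF eta that] V(2)[OF eta that] D(2)[OF eta that] by auto
  define E2 where "E2 s = (\<chi> j. cov w rho s \<bullet> (S j (z s) - S j (x s) - Dm (S j) (x s) *v de s))" for s
  define E1 where "E1 s = (\<chi> j. cov w rho s \<bullet> S j (z s))" for s
  have cE: "continuous_on {0..T} E2" "continuous_on {0..T} E1"
   unfolding E2_def E1_def de_def
   by (intro continuous_on_vec_lambda continuous_on_inner cov_continuous_on w continuous_on_diff
    S_compose_continuous_on DS_compose_continuous_on cz
    bounded_bilinear.continuous_on[OF bilinear_mv])+
  define b where "b s = fld w s (z s) - fld w s (x s) - dfld w s (x s) *v de s + fld eta s (z s)" for s
  have "indef T (%s. fld (%s. w s + eta s) s (z s) - fld w s (x s)) de"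
   unfolding de_def z_def x_def by (intro indef_diff Xp w weta)
  then have "indef T (%s. Am w s *v de s + b s) de"
   by (rule indef_cong) (auto simp: b_def Am_def x_def fld_add)
  moreover have "de 0 = 0" unfolding de_def z_def x_def using Xp(2)[OF w] Xp(2)[OF weta] by simp
  ultimately have "((%s. cov w rho s \<bullet> b s) has_integral rho \<bullet> de T) {0..T}" by (rule cov_duality[OF w])
  moreover have "cov w rho s \<bullet> b s = w s \<bullet> E2 s + eta s \<bullet> E1 s" for s
  proof -
   have "b s = (SUM j:UNIV. w s $ j *R (S j (z s) - S j (x s) - Dm (S j) (x s) *v de s)) + (SUM j:UNIV. eta s $ j *R S j (z s))"
    unfolding b_def dfld_mult fld_def by (simp add: scaleR_diff_right sum_subtractf)
   then show ?thesis unfolding E2_def E1_def inner_vec_def[of "w s"] inner_vec_def[of "eta s"]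
    by (simp add: inner_add_right inner_sum_right inner_real_def)
  qed
  ultimately have "((%s. w s \<bullet> E2 s + eta s \<bullet> E1 s) has_integral rho \<bullet> de T) {0..T}" by simp
  moreover have "((%s. w s \<bullet> E2 s + eta s \<bullet> E1 s) has_integral ip T w E2 + ip T eta E1) {0..T}"
   unfolding ip_def by (intro has_integral_add integrable_integral ip_integrable w eta L2_continuous_on cE)
  ultimately have total: "rho \<bullet> de T = ip T w E2 + ip T eta E1" by (rule has_integral_unique)
  \<comment> \<open>Error of the part paired with \<open>w\<close>, to be cubic; the error
    \<open>r1\<close> of the part paired with \<open>eta\<close> may be quadratic, because
    \<open>eta\<close> contributes one more factor.\<close>
  define r2 where "r2 s = E2 s - (1/2) *R F2 w rho v v s" for s
  define r1 where "r1 s = E1 s - G0 w rho s - F1 w rho v s" for s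
  note cF = F2_continuous_on[OF w cz(3) cz(3)] F1_continuous_on[OF w cz(3)] G0_continuous_on[OF w]
  have LF: "L2 T (F2 w rho v v)" "L2 T (F1 w rho v)" "L2 T (G0 w rho)" "L2 T E2" "L2 T E1"
   by (intro L2_continuous_on cF cE)+
  have Lr: "L2 T r2" "L2 T r1" unfolding r2_def r1_def by (intro L2_diff L2_scaleR LF)+
  have "ip T w r2 = ip T w E2 - (1/2) * ip T w (F2 w rho v v)"
   unfolding r2_def using ip_diff_right[OF LF(4) L2_scaleR[OF LF(1)] w, of "1/2"] by (simp only: ip_scaleR_right)
  moreover have "ip T eta r1 = ip T eta E1 - ip T eta (G0 w rho) - ip T eta (F1 w rho v)"
   unfolding r1_def using ip_diff_right[OF L2_diff[OF LF(5,3)] LF(2) eta] ip_diff_right[OF LF(5,3) eta] by simp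
  ultimately have eq: "rho \<bullet> de T - ip T eta (G0 w rho) - Rb w rho eta eta / 2 = ip T w r2 + ip T eta r1"
   unfolding total Rb_def v_def[symmetric] by (simp add: add_divide_distrib)
  have N3: "N^3 = N * N^2" by (simp add: power3_eq_cube power2_eq_square)
  have "\<bar>ip T w r2\<bar> <= n2 T w * (sqrt T * (c2 * N^3))"
  proof (rule ip_le_const[OF w Lr(1) T0])
   fix s assume s: "s : {0..T}"
   have d: "F2 w rho de de s - F2 w rho v v s = F2 w rho (%s. de s - v s) de s + F2 w rho (%s. de s - v s) v s"
   proof -
    have 1: "F2 w rho de de s = F2 w rho (%s. de s - v s) de s + F2 w rho v de s"
     using fun_cong[OF F2_add[of w rho "%s. de s - v s" v de], of s] by simp
    have 2: "F2 w rho de v s = F2 w rho (%s. de s - v s) v s + F2 w rho v v s"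
     using fun_cong[OF F2_add[of w rho "%s. de s - v s" v v], of s] by simp
    show ?thesis using 1 2 F2_commute[of w rho v de] by simp
   qed
   have "r2 s = (E2 s - (1/2) *R F2 w rho de de s) + (1/2) *R (F2 w rho de de s - F2 w rho v v s)"
    unfolding r2_def by (simp add: scaleR_diff_right)
   also have "norm ... <= M * (norm (de s))^3 + (1/2) * (M * norm (de s - v s) * norm (de s) + M * norm (de s - v s) * norm (v s))"
   proof (intro norm_triangle_le add_mono)
    show "norm (E2 s - (1/2) *R F2 w rho de de s) <= M * (norm (de s))^3"
     using M(4)[OF s, of "z s"] unfolding E2_def de_def x_def F2_def .
    have "norm (F2 w rho de de s - F2 w rho v v s) <= M * norm (de s - v s) * norm (de s) + M * norm (de s - v s) * norm (v s)"
     unfolding d by (intro norm_triangle_le add_mono M(3)[OF s])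
    then show "norm ((1/2) *R (F2 w rho de de s - F2 w rho v v s)) <= (1/2) * (M * norm (de s - v s) * norm (de s) + M * norm (de s - v s) * norm (v s))"
     by simp
   qed
   also have "... <= M * (X * N)^3 + 1 * (M * (D * N^2) * (X * N) + M * (D * N^2) * (V * N))"
    using M(1) bde[OF s] bv[OF s] bd[OF s] X(1) V(1) D(1) N
    by (intro add_mono mult_mono mult_left_mono power_mono) (auto intro!: add_nonneg_nonneg mult_nonneg_nonneg)
   also have "... = c2 * N^3" unfolding c2_def by (simp add: power_mult_distrib algebra_simps N3)
   finally show "norm (r2 s) <= c2 * N^3" .
  qed
  moreover have "\<bar>ip T eta r1\<bar> <= N * (sqrt T * (c1 * N^2))"
  proof (rule ip_le_const[OF eta Lr(2) T0, folded N_def])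
   fix s assume s: "s : {0..T}"
   have d: "F1 w rho de s = F1 w rho (%s. de s - v s) s + F1 w rho v s"
    using fun_cong[OF F1_add[of w rho "%s. de s - v s" v], of s] by simp
   have "r1 s = (E1 s - G0 w rho s - F1 w rho de s) + F1 w rho (%s. de s - v s) s"
    unfolding r1_def d by simp
   also have "norm ... <= M * (norm (de s))^2 + M * norm (de s - v s)"
   proof (intro norm_triangle_le add_mono M(2)[OF s])
    show "norm (E1 s - G0 w rho s - F1 w rho de s) <= M * (norm (de s))^2"
     using M(5)[OF s, of "z s"] unfolding E1_def de_def x_def F1_def .
   qed
   also have "... <= M * (X * N)^2 + M * (D * N^2)"
    using M(1) bde[OF s] bd[OF s] by (intro add_mono mult_left_mono power_mono) auto
   also have "... = c1 * N^2" unfolding c1_def by (simp add: power_mult_distrib algebra_simps)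
   finally show "norm (r1 s) <= c1 * N^2" .
  qed
  ultimately have "\<bar>rho \<bullet> de T - ip T eta (G0 w rho) - Rb w rho eta eta / 2\<bar> <= n2 T w * (sqrt T * (c2 * N^3)) + N * (sqrt T * (c1 * N^2))"
   unfolding eq by linarith
  also have "... = C * N^3" unfolding C_def N3 by (simp add: algebra_simps)
  finally show ?thesis unfolding de_def z_def x_def N_def .
 qed
 have "\<bar>rho \<bullet> (Xp (%s. w s + eta s) T - Xp w T) - ip T eta (G0 w rho) - Rb w rho eta eta / 2\<bar> <= (C + 1) * (n2 T eta)^3"
  if "L2 T eta" for eta
 proof -
  have "C * (n2 T eta)^3 <= (C + 1) * (n2 T eta)^3" by (intro mult_right_mono) auto
  then show ?thesis using bnd[OF that] by linarith
 qed
 then show ?thesis using that[of "C + 1"] C0 by simp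
qed

end

section \<open>The energy along a curve\<close>

text \<open>The limit of the quotients alone would not produce a second derivative; its existence is
  supplied by \<open>E1\<close>. Convergence forces \<open>E1 0 = 0\<close>, and l'Hopital's rule
  identifies \<open>L\<close> with \<open>D / 2\<close>.\<close>

lemma second_derivative_of_quadratic_limit:
 fixes E E1 :: "real => real"
 assumes d: "d > 0" and E: "!!s. \<bar>s\<bar> < d ==> (E has_real_derivative E1 s) (at s)"
  and E1: "(E1 has_real_derivative D) (at 0)"
  and lim: "((%s. (E s - E 0) / s^2) \<longlongrightarrow> L) (at 0)"
 shows "deriv (deriv E) 0 = 2 * L"
proof -
 have "((%s. (E s - E 0) / s^2 * s) \<longlongrightarrow> L * 0) (at 0)" by (intro tendsto_mult lim tendsto_ident_at)
 moreover have "\<forall>\<^sub>F s in at 0. (E s - E 0) / s^2 * s = (E s - E 0) / (s - 0)"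
  unfolding eventually_at_filter by (rule always_eventually) (simp add: power2_eq_square)
 ultimately have "((%s. (E s - E 0) / (s - 0)) \<longlongrightarrow> 0) (at 0)"
  using Lim_transform_eventually by fastforce
 moreover have "((%s. (E s - E 0) / (s - 0)) \<longlongrightarrow> E1 0) (at 0)"
  using E[of 0] d unfolding has_field_derivative_iff by simp
 ultimately have E10: "E1 0 = 0" using tendsto_unique[OF at_neq_bot] by blast
 have "((%s. (E s - E 0) / s^2) \<longlongrightarrow> D / 2) (at 0)"
 proof (rule lhopital[where f'=E1 and g'="%s. 2 * s"])
  have ev: "\<forall>\<^sub>F s in at 0. s ~= 0 & \<bar>s\<bar> < d"
   unfolding eventually_at using d by (auto simp: dist_real_def intro!: exI[of _ d])
  have "(E \<longlongrightarrow> E 0) (at 0)" using DERIV_isCont[OF E[of 0]] d by (simp add: isCont_def)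
  then show "((%s. E s - E 0) \<longlongrightarrow> 0) (at 0)" by (rule LIM_zero)
  have "((%s::real. s^2) \<longlongrightarrow> 0^2) (at 0)" by (intro tendsto_intros)
  then show "((%s::real. s^2) \<longlongrightarrow> 0) (at 0)" by simp
  show "\<forall>\<^sub>F s in at 0. s^2 ~= (0::real)" "\<forall>\<^sub>F s in at 0. 2 * s ~= (0::real)"
   using ev by (eventually_elim, simp)+
  show "\<forall>\<^sub>F s in at 0. ((%s. E s - E 0) has_real_derivative E1 s) (at s)"
   using ev by eventually_elim (auto intro!: derivative_eq_intros E)
  show "\<forall>\<^sub>F s in at 0. ((%s::real. s^2) has_real_derivative 2 * s) (at s)"
   by (intro always_eventually allI) (auto intro!: derivative_eq_intros)
  have "((%s. E1 s / s / 2) \<longlongrightarrow> D / 2) (at 0)"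
   using E1 E10 unfolding has_field_derivative_iff by (intro tendsto_divide) auto
  then show "((%s. E1 s / (2 * s)) \<longlongrightarrow> D / 2) (at 0)" by (simp add: mult.commute)
 qed
 then have "L = D / 2" using lim tendsto_unique[OF at_neq_bot] by blast
 moreover have "deriv (deriv E) 0 = D"
 proof (rule DERIV_imp_deriv)
  have "deriv E s = E1 s" if "\<bar>s\<bar> < d" for s using E[OF that] by (rule DERIV_imp_deriv)
  then have "\<forall>\<^sub>F s in nhds 0. deriv E s = E1 s" unfolding eventually_nhds_metric using d by (auto simp: dist_real_def)
  then show "(deriv E has_real_derivative D) (at 0)" using DERIV_cong_ev[OF refl _ refl] E1 by metis
 qed
 ultimately show ?thesis by simp
qed

section \<open>Inner products along curves\<close>

lemma cm_inner_add_left: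
 assumes T: "T >= 0" and "h : CM T" "h' : CM T" "k : CM T"
 shows "cm_inner T (%t. h t + h' t) k = cm_inner T h k + cm_inner T h' k"
 unfolding cm_inner_eq_ip using ip_aeq[OF CM_add(2)[OF T assms(2,3)] aeq_refl]
  ip_add_left[OF CM_imp(1)[OF T assms(2)] CM_imp(1)[OF T assms(3)] CM_imp(1)[OF T assms(4)]] by simp

lemma cm_inner_scaleR_left:
 assumes T: "T >= 0" and "h : CM T"
 shows "cm_inner T (%t. c *R h t) k = c * cm_inner T h k"
 unfolding cm_inner_eq_ip using ip_aeq[OF CM_scaleR(2)[OF T assms(2)] aeq_refl] by (simp add: ip_scaleR_left)

lemma cm_inner_commute: "cm_inner T h k = cm_inner T k h"
 unfolding cm_inner_eq_ip by (rule ip_commute)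

lemma cm_inner_self: "cm_inner T h h = (cm_norm T h)^2"
 unfolding cm_inner_eq_ip cm_norm_eq_n2 by (rule ip_self)

text \<open>Joint continuity of a bounded symmetric bilinear form with respect to \<open>n2\<close>;
  applied to \<open>ip\<close> and to the second variation.\<close>

lemma form_tendsto:
 fixes be :: "(real => 'a::euclidean_space) => (real => 'a) => real"
 assumes bnd: "!!u v. L2 T u ==> L2 T v ==> \<bar>be u v\<bar> <= B * n2 T u * n2 T v"
  and add: "!!u u' v. L2 T u ==> L2 T u' ==> L2 T v ==> be (%t. u t + u' t) v = be u v + be u' v"
  and com: "!!u v. be u v = be v u" and u: "L2 T u" and v: "L2 T v"
  and a: "\<forall>\<^sub>F r in F. L2 T (a r) & L2 T (b r)" "((%r. n2 T (a r)) \<longlongrightarrow> 0) F" "((%r. n2 T (b r)) \<longlongrightarrow> 0) F"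
 shows "((%r. be (%t. a r t + u t) (%t. b r t + v t)) \<longlongrightarrow> be u v) F"
proof (rule LIM_zero_cancel, rule Lim_null_comparison)
 have "((%r. B * n2 T (a r) * n2 T (b r) + B * n2 T (a r) * n2 T v + B * n2 T u * n2 T (b r)) \<longlongrightarrow> B * 0 * 0 + B * 0 * n2 T v + B * n2 T u * 0) F"
  by (intro tendsto_intros a)
 then show "((%r. B * n2 T (a r) * n2 T (b r) + B * n2 T (a r) * n2 T v + B * n2 T u * n2 T (b r)) \<longlongrightarrow> 0) F" by simp
 show "\<forall>\<^sub>F r in F. norm (be (%t. a r t + u t) (%t. b r t + v t) - be u v) <= B * n2 T (a r) * n2 T (b r) + B * n2 T (a r) * n2 T v + B * n2 T u * n2 T (b r)"
  using a(1)
 proof eventually_elim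
  case (elim r)
  have bv: "L2 T (%t. b r t + v t)" using elim v by (auto intro: L2_add)
  have "be (%t. a r t + u t) (%t. b r t + v t) = (be (b r) (a r) + be v (a r)) + (be (b r) u + be v u)"
   using add[of "a r" u "%t. b r t + v t"] add[of "b r" v "a r"] add[of "b r" v u] elim u v bv
    com[of "a r" "%t. b r t + v t"] com[of u "%t. b r t + v t"] by simp
  then have "be (%t. a r t + u t) (%t. b r t + v t) - be u v = be (a r) (b r) + be (a r) v + be u (b r)"
   by (simp add: com[of v] com[of "b r"])
  then show ?case using bnd[of "a r" "b r"] bnd[of "a r" v] bnd[of u "b r"] elim u v unfolding real_norm_def by linarith
 qed
qed

lemma cm_inner_tendsto:
 assumes T: "T >= 0" and uv: "u : CM T" "v : CM T" and a: "\<forall>\<^sub>F r in F. a r : CM T & b r : CM T"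
  "((%r. cm_norm T (a r)) \<longlongrightarrow> 0) F" "((%r. cm_norm T (b r)) \<longlongrightarrow> 0) F"
 shows "((%r. cm_inner T (%t. a r t + u t) (%t. b r t + v t)) \<longlongrightarrow> cm_inner T u v) F"
proof -
 have "((%r. ip T (%t. path_deriv (a r) t + path_deriv u t) (%t. path_deriv (b r) t + path_deriv v t)) \<longlongrightarrow> ip T (path_deriv u) (path_deriv v)) F"
 proof (rule form_tendsto[where B=1])
  show "\<forall>\<^sub>F r in F. L2 T (path_deriv (a r)) & L2 T (path_deriv (b r))"
   using a(1) by eventually_elim (auto intro: CM_imp(1)[OF T])
  show "\<bar>ip T x y\<bar> <= 1 * n2 T x * n2 T y" if "L2 T x" "L2 T y" for x y :: "real => real^'m" using ip_le[OF that] by simp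
 qed (use a(2,3) CM_imp(1)[OF T] uv in \<open>auto simp: cm_norm_eq_n2 intro: ip_add_left ip_commute\<close>)
 moreover have "\<forall>\<^sub>F r in F. ip T (%t. path_deriv (a r) t + path_deriv u t) (%t. path_deriv (b r) t + path_deriv v t)
   = cm_inner T (%t. a r t + u t) (%t. b r t + v t)"
  using a(1) by eventually_elim (auto simp: cm_inner_eq_ip intro!: ip_aeq aeq_sym[OF CM_add(2)[OF T]] uv)
 ultimately show ?thesis unfolding cm_inner_eq_ip[of T u v] by (rule Lim_transform_eventually)
qed

lemma cm_inner_curve_derivative:
 fixes c d :: "real => real => real^'m"
 assumes T: "T >= 0" and S: "open S" "s : S" and c: "!!r. r : S ==> c r : CM T" and d: "!!r. r : S ==> d r : CM T"
  and c': "c' : CM T" and d': "d' : CM T"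
  and dc: "cm_curve_has_derivative T c c' s" and dd: "cm_curve_has_derivative T d d' s"
 shows "((%r. cm_inner T (c r) (d r)) has_real_derivative (cm_inner T c' (d s) + cm_inner T (c s) d')) (at s)"
proof -
 define a where "a r = (%t. (1 / (r - s)) *R (c r t - c s t) - c' t)" for r
 define b where "b r = (%t. (1 / (r - s)) *R (d r t - d s t) - d' t)" for r
 have ab: "a r : CM T" "b r : CM T" if "r : S" for r
  unfolding a_def b_def by (intro CM_diff(1)[OF T] CM_scaleR(1)[OF T] c d c' d' that S)+
 have la: "((%r. cm_norm T (a r)) \<longlongrightarrow> 0) (at s)" and lb: "((%r. cm_norm T (b r)) \<longlongrightarrow> 0) (at s)"
  using dc dd unfolding cm_curve_has_derivative_def a_def b_def by auto
 \<comment> \<open>Exact expansion of the difference quotient, from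
   \<open>c r = c s + (r - s) A\<close> and \<open>d r = d s + (r - s) B\<close> with
   \<open>A\<close> and \<open>B\<close> the velocities plus vanishing errors. The summands 0 bring
   the terms into the shape of \<open>cm_inner_tendsto\<close>.\<close>
 have key: "cm_inner T (%t. a r t + c' t) (%t. 0 + d s t) + cm_inner T (%t. 0 + c s t) (%t. b r t + d' t)
   + (r - s) * cm_inner T (%t. a r t + c' t) (%t. b r t + d' t) = (cm_inner T (c r) (d r) - cm_inner T (c s) (d s)) / (r - s)"
  if r: "r : S" "r ~= s" for r
 proof -
  define A where "A = (%t. a r t + c' t)"
  define B where "B = (%t. b r t + d' t)"
  have A: "A : CM T" and B: "B : CM T" unfolding A_def B_def by (intro CM_add(1)[OF T] ab r c' d')+
  have cr: "c r = (%t. c s t + (r - s) *R A t)" unfolding A_def a_def using r by (auto simp: fun_eq_iff)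
  have dr: "d r = (%t. d s t + (r - s) *R B t)" unfolding B_def b_def using r by (auto simp: fun_eq_iff)
  note cs = c[OF S(2)] and ds = d[OF S(2)]
  have rA: "(%t. (r - s) *R A t) : CM T" and rB: "(%t. (r - s) *R B t) : CM T" by (intro CM_scaleR(1)[OF T] A B)+
  have addr: "cm_inner T x (%t. d s t + (r - s) *R B t) = cm_inner T x (d s) + (r - s) * cm_inner T x B" if "x : CM T" for x
   using cm_inner_add_left[OF T ds rB that] cm_inner_scaleR_left[OF T B, of "r - s" x] cm_inner_commute by metis
  have "cm_inner T (c r) (d r) = cm_inner T (c s) (d r) + (r - s) * cm_inner T A (d r)"
   using cm_inner_add_left[OF T cs rA d[OF r(1)]] cm_inner_scaleR_left[OF T A, of "r - s" "d r"] cr by simp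
  also have "... = cm_inner T (c s) (d s) + (r - s) * cm_inner T (c s) B + (r - s) * (cm_inner T A (d s) + (r - s) * cm_inner T A B)"
   unfolding dr addr[OF cs] addr[OF A] ..
  finally have "(cm_inner T (c r) (d r) - cm_inner T (c s) (d s)) / (r - s) = cm_inner T (c s) B + cm_inner T A (d s) + (r - s) * cm_inner T A B"
   using r by (simp add: field_simps)
  then show ?thesis unfolding A_def[symmetric] B_def[symmetric] by simp
 qed
 have ev: "\<forall>\<^sub>F r in at s. r : S & r ~= s" using S unfolding eventually_at_topological by auto
 have evab: "\<forall>\<^sub>F r in at s. a r : CM T & b r : CM T" "\<forall>\<^sub>F r in at s. a r : CM T & (%t. 0) : CM T"
  "\<forall>\<^sub>F r in at s. (%t. 0) : CM T & b r : CM T"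
  using ev ab CM_zero[OF T] by (auto elim!: eventually_mono)
 have z: "((%r. cm_norm T (%t. 0 :: real^'m)) \<longlongrightarrow> 0) (at s)"
  using cm_norm_scaleR[OF T c', of 0] by simp
 have "((%r. cm_inner T (%t. a r t + c' t) (%t. 0 + d s t) + cm_inner T (%t. 0 + c s t) (%t. b r t + d' t)
   + (r - s) * cm_inner T (%t. a r t + c' t) (%t. b r t + d' t))
   \<longlongrightarrow> cm_inner T c' (d s) + cm_inner T (c s) d' + (s - s) * cm_inner T c' d') (at s)"
  by (intro tendsto_add tendsto_mult tendsto_diff tendsto_ident_at tendsto_const cm_inner_tendsto[OF T] evab la lb z c' d' c d S)
 from Lim_transform_eventually[OF this eventually_mono[OF ev]] key show ?thesis unfolding has_field_derivative_iff by simp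
qed

section \<open>The energy under the endpoint constraint\<close>

context control_problem
begin

text \<open>The Hessian of the Lagrangian, energy minus \<open>rho \<bullet> phi_T\<close>: the
  energy contributes \<open>ip\<close>, the endpoint \<open>Rb\<close>. The embedding
  \<open>emb0\<close> leaves the weight of the drift unchanged.\<close>

definition Qb :: "(real => real^('m option)) => 'd rvec => (real => real^'m) => (real => real^'m) => real" where
 "Qb w rho u v = ip T u v - Rb w rho (emb0 u) (emb0 v)"

lemma Qb_commute: "Qb w rho u v = Qb w rho v u"
 unfolding Qb_def using ip_commute[of T u v] Rb_commute by simp

lemma Qb_add: "L2 T w ==> L2 T u ==> L2 T u' ==> L2 T v ==> Qb w rho (%s. u s + u' s) v = Qb w rho u v + Qb w rho u' v"
 unfolding Qb_def emb0_add by (simp add: ip_add_left Rb_add L2_emb0)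

lemma Qb_scaleR: "Qb w rho (%s. c *R u s) v = c * Qb w rho u v"
 unfolding Qb_def emb0_scaleR Rb_scaleR ip_scaleR_left by (simp add: algebra_simps)

lemma Qb_aeq: "aeq T u u' ==> aeq T v v' ==> Qb w rho u v = Qb w rho u' v'"
 unfolding Qb_def using ip_aeq[of T u u' v v'] Rb_aeq[OF aeq_emb0 aeq_emb0, of u u' v v' w rho] by simp

lemma Qb_bound:
 assumes w: "L2 T w"
 obtains C where "C > 0" "!!u v. L2 T u ==> L2 T v ==> \<bar>Qb w rho u v\<bar> <= C * n2 T u * n2 T v"
proof -
 obtain C where C: "C > 0" "!!eta th. L2 T eta ==> L2 T th ==> \<bar>Rb w rho eta th\<bar> <= C * n2 T eta * n2 T th"
  by (rule Rb_bound[OF w, of rho]) blast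
 have "\<bar>Qb w rho u v\<bar> <= (C + 1) * n2 T u * n2 T v" if "L2 T u" "L2 T v" for u v
  using ip_le[OF that] C(2)[OF L2_emb0[OF that(1)] L2_emb0[OF that(2)]] unfolding Qb_def n2_emb0
  by (simp add: algebra_simps)
 then show ?thesis using that[of "C + 1"] C by simp
qed

lemma ip_emb0_G0: "ip T (emb0 u) (G0 w rho) = ip T u (gradc w rho)"
 unfolding ip_def inner_vec_def sum_option by (simp add: emb0_def G0_def gradc_def)

text \<open>The hypothesis on \<open>kap\<close> makes the increment of
  \<open>rho \<bullet> phi_T\<close> vanish, so its expansion can be subtracted for free. The
  criticality condition cancels the first-order terms and leaves \<open>Qb\<close> up to a cubic
  error.\<close>

lemma energy_second_order:
 assumes h: "h : CM T" and w: "w = emb1 (path_deriv h)" and crit: "aeq T (path_deriv h) (gradc w rho)"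
 obtains C where "C > 0" "!!kap. kap : CM T ==>
  rho \<bullet> control_flow sg0 sg T x0 T (%t. h t + kap t) = rho \<bullet> control_flow sg0 sg T x0 T h ==>
  \<bar>energy T (%t. h t + kap t) - energy T h - Qb w rho (path_deriv kap) (path_deriv kap) / 2\<bar> <= C * (cm_norm T kap)^3"
proof -
 note h' = CM_imp(1)[OF T0 h]
 have Lw: "L2 T w" unfolding w by (intro L2_emb1 h')
 have T': "T : {0..T}" using T by simp
 obtain C where C: "C > 0" "!!eta. L2 T eta ==>
  \<bar>rho \<bullet> (Xp (%s. w s + eta s) T - Xp w T) - ip T eta (G0 w rho) - Rb w rho eta eta / 2\<bar> <= C * (n2 T eta)^3"
  by (rule endpoint_second_order[OF Lw, of rho]) blast
 show ?thesis
 proof (rule that[OF C(1)])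
  fix kap assume kap: "kap : CM T"
   "rho \<bullet> control_flow sg0 sg T x0 T (%t. h t + kap t) = rho \<bullet> control_flow sg0 sg T x0 T h"
  note k' = CM_imp(1)[OF T0 kap(1)]
  have "rho \<bullet> (Xp (%s. w s + emb0 (path_deriv kap) s) T - Xp w T) = 0"
   using kap(2) unfolding control_flow_add[OF h kap(1) T'] control_flow_eq[OF h T'] w by (simp add: inner_diff_right)
  then have *: "\<bar>- ip T (path_deriv kap) (gradc w rho) - Rb w rho (emb0 (path_deriv kap)) (emb0 (path_deriv kap)) / 2\<bar> <= C * (cm_norm T kap)^3"
   using C(2)[OF L2_emb0[OF k']] unfolding ip_emb0_G0 n2_emb0 cm_norm_eq_n2 by simp
  have "(n2 T (path_deriv (%t. h t + kap t)))^2 = ip T (%t. path_deriv h t + path_deriv kap t) (%t. path_deriv h t + path_deriv kap t)"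
   using aeq_n2[OF CM_add(2)[OF T0 h kap(1)]] by (simp add: ip_self)
  also have "... = (n2 T (path_deriv h))^2 + 2 * ip T (path_deriv kap) (path_deriv h) + ip T (path_deriv kap) (path_deriv kap)"
   unfolding ip_self[symmetric] using ip_commute[of T "path_deriv h" "path_deriv kap"]
   by (simp add: ip_add_left ip_add_right L2_add h' k')
  also have "ip T (path_deriv kap) (path_deriv h) = ip T (path_deriv kap) (gradc w rho)" by (rule ip_aeq[OF aeq_refl crit])
  finally have "energy T (%t. h t + kap t) - energy T h - Qb w rho (path_deriv kap) (path_deriv kap) / 2 =
   - (- ip T (path_deriv kap) (gradc w rho) - Rb w rho (emb0 (path_deriv kap)) (emb0 (path_deriv kap)) / 2)"
   unfolding energy_eq Qb_def by (simp add: field_simps)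
  then show "\<bar>energy T (%t. h t + kap t) - energy T h - Qb w rho (path_deriv kap) (path_deriv kap) / 2\<bar> <= C * (cm_norm T kap)^3"
   using * by (simp only: abs_minus_cancel)
 qed
qed

text \<open>The increment of the curve is \<open>r (k + a r)\<close> with \<open>a r\<close> tending
  to 0. Homogeneity and continuity of \<open>Qb\<close> give the limit, and only the velocity of the
  curve matters.\<close>

lemma energy_curve_limit:
 assumes h: "h : CM T" and w: "w = emb1 (path_deriv h)" and crit: "aeq T (path_deriv h) (gradc w rho)"
  and k: "k : CM T" and ep: "ep > 0" and c0: "c 0 = h" and dc: "cm_curve_has_derivative T c k 0"
  and c: "!!s. \<bar>s\<bar> < ep ==> c s : CM T"
  and adm: "!!s. \<bar>s\<bar> < ep ==> rho \<bullet> control_flow sg0 sg T x0 T (c s) = rho \<bullet> control_flow sg0 sg T x0 T h"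
 shows "((%s. (energy T (c s) - energy T (c 0)) / s^2) \<longlongrightarrow> Qb w rho (path_deriv k) (path_deriv k) / 2) (at 0)"
proof -
 note h' = CM_imp(1)[OF T0 h] and k' = CM_imp(1)[OF T0 k]
 have Lw: "L2 T w" unfolding w by (intro L2_emb1 h')
 obtain C where C: "C > 0" "!!kap. kap : CM T ==>
  rho \<bullet> control_flow sg0 sg T x0 T (%t. h t + kap t) = rho \<bullet> control_flow sg0 sg T x0 T h ==>
  \<bar>energy T (%t. h t + kap t) - energy T h - Qb w rho (path_deriv kap) (path_deriv kap) / 2\<bar> <= C * (cm_norm T kap)^3"
  by (rule energy_second_order[OF h w crit]) blast
 obtain B where B: "B > 0" "!!u v. L2 T u ==> L2 T v ==> \<bar>Qb w rho u v\<bar> <= B * n2 T u * n2 T v"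
  by (rule Qb_bound[OF Lw, of rho]) blast
 define a where "a r = (%t. (1 / (r - 0)) *R (c r t - c 0 t) - k t)" for r
 have la: "((%r. cm_norm T (a r)) \<longlongrightarrow> 0) (at 0)" using dc unfolding cm_curve_has_derivative_def a_def .
 define K where "K = cm_norm T k"
 define q where "q r = Qb w rho (%t. path_deriv (a r) t + path_deriv k t) (%t. path_deriv (a r) t + path_deriv k t)" for r
 have ev: "\<forall>\<^sub>F r in at 0. r ~= 0 & \<bar>r\<bar> < ep"
  unfolding eventually_at using ep by (auto simp: dist_real_def intro!: exI[of _ ep])
 have aCM: "a r : CM T" if "\<bar>r\<bar> < ep" for r
  unfolding a_def c0 by (intro CM_diff(1)[OF T0] CM_scaleR(1)[OF T0] c that h k)
 have "((%s. (energy T (c s) - energy T (c 0)) / s^2 - q s / 2) \<longlongrightarrow> 0) (at 0)"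
 proof (rule Lim_null_comparison)
  have "((%r. C * \<bar>r\<bar> * (cm_norm T (a r) + K)^3) \<longlongrightarrow> C * \<bar>0\<bar> * (0 + K)^3) (at 0)" by (intro tendsto_intros la)
  then show "((%r. C * \<bar>r\<bar> * (cm_norm T (a r) + K)^3) \<longlongrightarrow> 0) (at 0)" by simp
  show "\<forall>\<^sub>F r in at 0. norm ((energy T (c r) - energy T (c 0)) / r^2 - q r / 2) <= C * \<bar>r\<bar> * (cm_norm T (a r) + K)^3"
   using ev
  proof eventually_elim
   case (elim r)
   then have r: "r ~= 0" "\<bar>r\<bar> < ep" by auto
   define kap where "kap = (%t. c r t - h t)"
   have kap: "kap : CM T" unfolding kap_def by (intro CM_diff(1)[OF T0] c r h)
   have cr: "(%t. h t + kap t) = c r" unfolding kap_def by simp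
   define al where "al = path_deriv (a r)"
   note aCM = aCM[OF r(2)]
   have al: "L2 T al" unfolding al_def by (rule CM_imp(1)[OF T0 aCM])
   define be where "be = (%t. al t + path_deriv k t)"
   have be: "L2 T be" unfolding be_def by (intro L2_add al k')
   have "kap = (%t. r *R (a r t + k t))" unfolding kap_def a_def c0 using r by (auto simp: fun_eq_iff)
   then have "aeq T (path_deriv kap) (%t. r *R path_deriv (%t. a r t + k t) t)"
    using CM_scaleR(2)[OF T0 CM_add(1)[OF T0 aCM k]] by simp
   from aeq_trans[OF this aeq_map[OF CM_add(2)[OF T0 aCM k], of "%t x. r *R x"]]
   have ae: "aeq T (path_deriv kap) (%t. r *R be t)" unfolding be_def al_def .
   have Qk: "Qb w rho (path_deriv kap) (path_deriv kap) = r^2 * Qb w rho be be"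
   proof -
    have "Qb w rho (path_deriv kap) (path_deriv kap) = Qb w rho (%t. r *R be t) (%t. r *R be t)" by (rule Qb_aeq[OF ae ae])
    also have "... = r * (r * Qb w rho be be)" using Qb_commute[of w rho be "%t. r *R be t"] by (simp only: Qb_scaleR)
    finally show ?thesis by (simp add: power2_eq_square)
   qed
   have nk: "cm_norm T kap <= \<bar>r\<bar> * (cm_norm T (a r) + K)"
   proof -
    have "cm_norm T kap = \<bar>r\<bar> * n2 T be" unfolding cm_norm_eq_n2 aeq_n2[OF ae] n2_scaleR ..
    also have "n2 T be <= cm_norm T (a r) + K" unfolding be_def K_def cm_norm_eq_n2 al_def[symmetric] by (intro n2_triangle al k')
    finally show ?thesis by (simp add: mult_left_mono)
   qed
   have "\<bar>energy T (c r) - energy T (c 0) - r^2 * Qb w rho be be / 2\<bar> <= C * (cm_norm T kap)^3"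
    using C(2)[OF kap] adm[OF r(2)] unfolding cr c0 Qk .
   also have "... <= C * (\<bar>r\<bar> * (cm_norm T (a r) + K))^3" using nk C(1) by (intro mult_left_mono power_mono) auto
   also have "... = r^2 * (C * \<bar>r\<bar> * (cm_norm T (a r) + K)^3)"
    by (simp add: power_mult_distrib power3_eq_cube power2_eq_square)
   finally have "\<bar>energy T (c r) - energy T (c 0) - r^2 * Qb w rho be be / 2\<bar> / r^2 <= C * \<bar>r\<bar> * (cm_norm T (a r) + K)^3"
    using r by (simp add: pos_divide_le_eq mult.commute)
   moreover have "\<bar>energy T (c r) - energy T (c 0) - r^2 * Qb w rho be be / 2\<bar> / r^2
     = \<bar>(energy T (c r) - energy T (c 0)) / r^2 - Qb w rho be be / 2\<bar>"
   proof -
    have "(energy T (c r) - energy T (c 0) - r^2 * Qb w rho be be / 2) / r^2 = (energy T (c r) - energy T (c 0)) / r^2 - Qb w rho be be / 2"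
     using r by (simp add: diff_divide_distrib)
    then show ?thesis using abs_divide[of "energy T (c r) - energy T (c 0) - r^2 * Qb w rho be be / 2" "r^2"] by simp
   qed
   ultimately show ?case unfolding q_def be_def al_def by simp
  qed
 qed
 moreover have "((%r. q r / 2) \<longlongrightarrow> Qb w rho (path_deriv k) (path_deriv k) / 2) (at 0)"
  unfolding q_def
 proof (intro tendsto_divide tendsto_const form_tendsto[where B=B and be="Qb w rho"])
  show "\<forall>\<^sub>F r in at 0. L2 T (path_deriv (a r)) & L2 T (path_deriv (a r))"
   using ev by eventually_elim (auto intro: CM_imp(1)[OF T0 aCM])
  show "Qb w rho u v = Qb w rho v u" for u v by (rule Qb_commute)
 qed (use B(2) k' la in \<open>auto simp: cm_norm_eq_n2 intro: Qb_add[OF Lw]\<close>)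
 ultimately show ?thesis using tendsto_add by fastforce
qed

text \<open>Smoothness of the curve supplies the existence of the second derivative, the limit of
  the quotients its value.\<close>

lemma hessian_along_curve:
 assumes h: "h : CM T" and w: "w = emb1 (path_deriv h)" and crit: "aeq T (path_deriv h) (gradc w rho)"
  and k: "k : CM T" and ep: "ep > 0" and c0: "c 0 = h" and dc: "cm_curve_has_derivative T c k 0"
  and sm: "cm_smooth_curve T {-ep<..<ep} c"
  and adm: "!!s. \<bar>s\<bar> < ep ==> rho \<bullet> control_flow sg0 sg T x0 T (c s) = rho \<bullet> control_flow sg0 sg T x0 T h"
 shows "deriv (deriv (%s. energy T (c s))) 0 = Qb w rho (path_deriv k) (path_deriv k)"
proof -
 obtain C where C: "C 0 = c" "!!n s. s : {-ep<..<ep} ==> C n s : CM T"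
  "!!n s. s : {-ep<..<ep} ==> cm_curve_has_derivative T (C n) (C (Suc n) s) s"
  using sm unfolding cm_smooth_curve_def by blast
 have op: "open {-ep<..<ep}" by simp
 have "deriv (deriv (%s. energy T (c s))) 0 = 2 * (Qb w rho (path_deriv k) (path_deriv k) / 2)"
 proof (rule second_derivative_of_quadratic_limit[OF ep])
  fix s :: real assume "\<bar>s\<bar> < ep"
  then have s: "s : {-ep<..<ep}" by auto
  have "((%r. cm_inner T (c r) (c r)) has_real_derivative (cm_inner T (C 1 s) (c s) + cm_inner T (c s) (C 1 s))) (at s)"
   using C(2)[of _ 0] C(2)[OF s, of 1] C(3)[OF s, of 0] unfolding C(1)
   by (intro cm_inner_curve_derivative[OF T0 op s]) auto
  then have "((%r. cm_inner T (c r) (c r) / 2) has_real_derivative ((cm_inner T (C 1 s) (c s) + cm_inner T (c s) (C 1 s)) / 2)) (at s)"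
   by (rule DERIV_cdivide)
  then show "((%s. energy T (c s)) has_real_derivative cm_inner T (C 1 s) (c s)) (at s)"
   unfolding energy_def cm_inner_self[symmetric] using cm_inner_commute[of T "c s" "C 1 s"] by simp
 next
  have s: "0 : {-ep<..<ep}" using ep by auto
  show "((%s. cm_inner T (C 1 s) (c s)) has_real_derivative (cm_inner T (C 2 0) (c 0) + cm_inner T (C 1 0) (C 1 0))) (at 0)"
   using C(2)[of _ 0] C(2)[of _ 1] C(2)[OF s] C(3)[OF s, of 0] C(3)[OF s, of 1] unfolding C(1) numeral_2_eq_2
   by (intro cm_inner_curve_derivative[OF T0 op s]) auto
 next
  show "((%s. (energy T (c s) - energy T (c 0)) / s^2) \<longlongrightarrow> Qb w rho (path_deriv k) (path_deriv k) / 2) (at 0)"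
   by (rule energy_curve_limit[OF h w crit k ep c0 dc _ adm]) (use C(2)[of _ 0] C(1) in \<open>auto simp: abs_less_iff\<close>)
 qed
 then show ?thesis by simp
qed

end

section \<open>Continuous dependence on the control\<close>

lemma uniform_limit_bound:
 fixes f :: "'a => 'b => 'c::real_normed_vector"
 assumes b: "(b \<longlongrightarrow> 0) F" and le: "\<forall>\<^sub>F r in F. ALL t:A. norm (f r t - l t) <= b r"
 shows "uniform_limit A f l F"
proof (rule uniform_limitI)
 fix e :: real assume "e > 0"
 then have "\<forall>\<^sub>F r in F. dist (b r) 0 < e" using b unfolding tendsto_iff by blast
 with le show "\<forall>\<^sub>F r in F. ALL t:A. dist (f r t) (l t) < e"
  by eventually_elim (fastforce simp: dist_norm)
qed

lemma uniform_limit_sum: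
 fixes f :: "'i => 'b => 'a => 'c::real_normed_vector"
 shows "(!!i. i : I ==> uniform_limit A (f i) (l i) F) ==>
  uniform_limit A (%r t. SUM i:I. f i r t) (%t. SUM i:I. l i t) F"
 by (induction I rule: infinite_finite_induct) (auto intro!: uniform_limit_add uniform_limit_const)

text \<open>Uniform convergence survives integration against a square-integrable weight. For this
  reason rough controls are split off as weights from factors that are continuous in time.\<close>

lemma uniform_limit_weighted_integral:
 fixes q :: "'b => real => 'a::euclidean_space" and om :: "real => real"
 assumes om: "L2 T om" and T: "T >= 0" and q: "uniform_limit {0..T} q d F"
  and cq: "\<forall>\<^sub>F r in F. continuous_on {0..T} (q r)" and cd: "continuous_on {0..T} d"
 shows "uniform_limit {0..T} (%r t. integral {0..t} (%tau. om tau *R q r tau)) (%t. integral {0..t} (%tau. om tau *R d tau)) F"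
proof (rule uniform_limitI)
 fix e :: real assume e: "e > 0"
 have i: "(%s. norm (om s)) integrable_on {0..T}"
  using L2_abs_integrable[OF om] by (auto simp: absolutely_integrable_on_def)
 define B where "B = integral {0..T} (%s. norm (om s)) + 1"
 have B: "B > 0" unfolding B_def using Henstock_Kurzweil_Integration.integral_nonneg[OF i] by (simp add: add_nonneg_pos)
 have ii: "(%tau. om tau *R p tau) integrable_on {0..t}" if "continuous_on {0..T} p" "t : {0..T}" for t and p :: "real => 'a"
  using L2_abs_integrable[OF L2_scaleR_fun[OF om that(1)]] that(2)
  by (auto simp: absolutely_integrable_on_def intro: integrable_on_subinterval)
 have "\<forall>\<^sub>F r in F. ALL t:{0..T}. dist (q r t) (d t) < e / B" using uniform_limitD[OF q, of "e / B"] e B by simp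
 with cq show "\<forall>\<^sub>F r in F. ALL t:{0..T}. dist (integral {0..t} (%tau. om tau *R q r tau)) (integral {0..t} (%tau. om tau *R d tau)) < e"
 proof eventually_elim
  case (elim r)
  show ?case
  proof
   fix t assume t: "t : {0..T}"
   have it: "(%s. norm (om s)) integrable_on {0..t}" using i t by (auto intro: integrable_on_subinterval)
   have "integral {0..t} (%tau. om tau *R q r tau) - integral {0..t} (%tau. om tau *R d tau) = integral {0..t} (%tau. om tau *R q r tau - om tau *R d tau)"
    by (rule Henstock_Kurzweil_Integration.integral_diff[symmetric]) (intro ii elim cd t)+
   also have "norm ... <= integral {0..t} (%s. (e / B) * norm (om s))"
   proof (rule integral_norm_bound_integral)
    show "(%tau. om tau *R q r tau - om tau *R d tau) integrable_on {0..t}" by (intro integrable_diff ii elim cd t)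
    show "(%s. (e / B) * norm (om s)) integrable_on {0..t}" by (intro integrable_on_mult_right it)
    fix tau assume "tau : {0..t}"
    then have "norm (q r tau - d tau) <= e / B" using elim(2) t by (force simp: dist_norm)
    then have "norm (om tau) * norm (q r tau - d tau) <= norm (om tau) * (e / B)" by (intro mult_left_mono) auto
    then show "norm (om tau *R q r tau - om tau *R d tau) <= (e / B) * norm (om tau)"
     by (simp add: mult.commute flip: scaleR_diff_right)
   qed
   also have "... = (e / B) * integral {0..t} (%s. norm (om s))" by simp
   also have "... <= (e / B) * integral {0..T} (%s. norm (om s))"
    using e B t i it by (intro mult_left_mono integral_subset_le) auto
   also have "... < (e / B) * B" using e B unfolding B_def by (intro mult_strict_left_mono) auto
   also have "... = e" using B by simp
   finally show "dist (integral {0..t} (%tau. om tau *R q r tau)) (integral {0..t} (%tau. om tau *R d tau)) < e"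
    unfolding dist_norm .
  qed
 qed
qed

lemma continuous_on_imp_bounded_image:
 fixes f :: "real => 'a::real_normed_vector"
 shows "continuous_on {a..b} f ==> bounded (f ` {a..b})"
 by (intro compact_imp_bounded compact_continuous_image) auto

lemma uniform_limit_bilinear:
 assumes "bounded_bilinear B" "uniform_limit {a..b} f l F" "uniform_limit {a..b} g m F"
  "continuous_on {a..b::real} l" "continuous_on {a..b} m"
 shows "uniform_limit {a..b} (%r t. B (f r t) (g r t)) (%t. B (l t) (m t)) F"
 by (intro bounded_bilinear.bounded_uniform_limit[OF assms(1)] assms(2,3) continuous_on_imp_bounded_image assms(4,5))

context control_system
begin

lemma fld_expand_mult: "K *v fld eta s x = (SUM j:UNIV. eta s $ j *R (K *v S j x))" for K :: "real^'d^'d"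
 unfolding fld_def by (simp add: bounded_bilinear.sum_right[OF bilinear_mv]
  bounded_bilinear.scaleR_right[OF bilinear_mv])

lemma KS_continuous_on: "L2 T w ==> continuous_on {0..T} (%s. Km w s *v S j (Xp w s))"
 by (intro bounded_bilinear.continuous_on[OF bilinear_mv] Km_continuous_on S_compose_continuous_on Xp_continuous_on)

text \<open>Separates the components of \<open>eta\<close>, as scalar weights, from factors
  continuous in time: the form in which limits and parameter derivatives can be taken.\<close>

lemma Vp_expand:
 assumes w: "L2 T w" and eta: "L2 T eta" and t: "t : {0..T}"
 shows "Vp w eta t = Jm w t *v (SUM j:UNIV. integral {0..t} (%s. eta s $ j *R (Km w s *v S j (Xp w s))))"
proof -
 have "(%s. eta s $ j *R (Km w s *v S j (Xp w s))) integrable_on {0..t}" for j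
  by (rule integrable_on_subinterval[OF set_lebesgue_integral_eq_integral(1)[OF
    L2_abs_integrable[OF L2_scaleR_fun[OF L2_vec_nth[OF eta] KS_continuous_on[OF w]]]]])
   (use t in auto)
 then show ?thesis unfolding Vp_def fld_expand_mult by (subst Henstock_Kurzweil_Integration.integral_sum) auto
qed

lemma uniform_limit_of_diff_bound:
 assumes bnd: "EX C>0. ALL eta t. L2 T eta --> n2 T eta <= 1 --> t : {0..T} --> norm (Y (%s. w s + eta s) t - Y w t) <= C * n2 T eta"
  and th: "!!r. L2 T (th r)" "((%r. n2 T (th r)) \<longlongrightarrow> 0) F"
 shows "uniform_limit {0..T} (%r. Y (%s. w s + th r s)) (Y w) F"
proof -
 obtain C where C: "C > 0" "!!eta t. L2 T eta ==> n2 T eta <= 1 ==> t : {0..T} ==> norm (Y (%s. w s + eta s) t - Y w t) <= C * n2 T eta"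
  using bnd by blast
 have l: "((%r. C * n2 T (th r)) \<longlongrightarrow> 0) F" using tendsto_mult_left[OF th(2), of C] by simp
 have "\<forall>\<^sub>F r in F. n2 T (th r) < 1" using order_tendstoD(2)[OF th(2), of 1] by simp
 then have "\<forall>\<^sub>F r in F. ALL t:{0..T}. norm (Y (%s. w s + th r s) t - Y w t) <= C * n2 T (th r)"
  by eventually_elim (auto intro!: C(2) th(1))
 then show ?thesis by (rule uniform_limit_bound[OF l])
qed

lemma Xp_uniform_limit:
 assumes w: "L2 T w" and th: "!!r. L2 T (th r)" "((%r. n2 T (th r)) \<longlongrightarrow> 0) F"
 shows "uniform_limit {0..T} (%r. Xp (%s. w s + th r s)) (Xp w) F"
proof (rule uniform_limit_of_diff_bound[OF _ th])
 have "norm (Xp (%s. w s + eta s) t - Xp w t) <= (XL w + 1) * n2 T eta" if "L2 T eta" "t : {0..T}" for eta t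
  unfolding distrib_right mult_1 using Xp_diff_bound[OF w that] n2_nonneg[of T eta] by linarith
 then show "EX C>0. ALL eta t. L2 T eta --> n2 T eta <= 1 --> t : {0..T} --> norm (Xp (%s. w s + eta s) t - Xp w t) <= C * n2 T eta"
  using XL_nonneg[of w] by (intro exI[of _ "XL w + 1"]) auto
qed

lemma Jm_uniform_limit:
 assumes w: "L2 T w" and th: "!!r. L2 T (th r)" "((%r. n2 T (th r)) \<longlongrightarrow> 0) F"
 shows "uniform_limit {0..T} (%r. Jm (%s. w s + th r s)) (Jm w) F"
 by (rule uniform_limit_of_diff_bound[OF Jm_diff_bound[OF w] th])

lemma Km_uniform_limit:
 assumes w: "L2 T w" and th: "!!r. L2 T (th r)" "((%r. n2 T (th r)) \<longlongrightarrow> 0) F"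
 shows "uniform_limit {0..T} (%r. Km (%s. w s + th r s)) (Km w) F"
 by (rule uniform_limit_of_diff_bound[OF Km_diff_bound[OF w] th])

lemma Vp_uniform_limit:
 assumes w: "L2 T w" and th: "!!r. L2 T (th r)" "((%r. n2 T (th r)) \<longlongrightarrow> 0) F" and eta: "L2 T eta"
 shows "uniform_limit {0..T} (%r. Vp (%s. w s + th r s) eta) (Vp w eta) F"
proof -
 note wth = L2_add[OF w th(1)]
 have S: "uniform_limit {0..T} (%r t. S j (Xp (%s. w s + th r s) t)) (%t. S j (Xp w t)) F" for j
 proof (rule uniform_limitI)
  fix e :: real assume e: "e > 0"
  have "\<forall>\<^sub>F r in F. ALL t:{0..T}. dist (Xp (%s. w s + th r s) t) (Xp w t) < e / CS"
   using uniform_limitD[OF Xp_uniform_limit[OF w th], of "e / CS"] e CS_pos by simp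
  then show "\<forall>\<^sub>F r in F. ALL t:{0..T}. dist (S j (Xp (%s. w s + th r s) t)) (S j (Xp w t)) < e"
  proof eventually_elim
   case (elim r)
   show ?case
   proof
    fix t assume "t : {0..T}"
    then have "CS * norm (Xp (%s. w s + th r s) t - Xp w t) < e"
     using elim CS_pos by (fastforce simp: dist_norm field_simps)
    then show "dist (S j (Xp (%s. w s + th r s) t)) (S j (Xp w t)) < e"
     using S_lipschitz[of j "Xp (%s. w s + th r s) t" "Xp w t"] by (simp add: dist_norm)
   qed
  qed
 qed
 have KS: "uniform_limit {0..T} (%r t. Km (%s. w s + th r s) t *v S j (Xp (%s. w s + th r s) t)) (%t. Km w t *v S j (Xp w t)) F" for j
  by (intro uniform_limit_bilinear[OF bilinear_mv Km_uniform_limit[OF w th] S]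
   Km_continuous_on[OF w] S_compose_continuous_on[OF Xp_continuous_on[OF w]])
 have "uniform_limit {0..T} (%r t. SUM j:UNIV. integral {0..t} (%s. eta s $ j *R (Km (%s. w s + th r s) s *v S j (Xp (%s. w s + th r s) s))))
   (%t. SUM j:UNIV. integral {0..t} (%s. eta s $ j *R (Km w s *v S j (Xp w s)))) F"
  by (intro uniform_limit_sum uniform_limit_weighted_integral[OF L2_vec_nth[OF eta] T0 KS] always_eventually allI
   KS_continuous_on w wth)
 then have "uniform_limit {0..T} (%r t. Jm (%s. w s + th r s) t *v (SUM j:UNIV. integral {0..t} (%s. eta s $ j *R (Km (%s. w s + th r s) s *v S j (Xp (%s. w s + th r s) s)))))
   (%t. Jm w t *v (SUM j:UNIV. integral {0..t} (%s. eta s $ j *R (Km w s *v S j (Xp w s))))) F"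
  by (intro uniform_limit_bilinear[OF bilinear_mv Jm_uniform_limit[OF w th]] Jm_continuous_on[OF w]
   continuous_on_sum indefinite_integral_continuous_1
   L2_abs_integrable[OF L2_scaleR_fun[OF L2_vec_nth[OF eta] KS_continuous_on[OF w]], THEN set_lebesgue_integral_eq_integral(1)])
 then show ?thesis
  by (rule uniform_limit_cong'[THEN iffD1, rotated 2]) (simp_all add: Vp_expand w wth eta)
qed

end

section \<open>Solving the endpoint constraint\<close>

lemma has_derivative_quadratic_remainder:
 fixes f :: "'a::euclidean_space => 'b::real_normed_vector"
 assumes f': "bounded_linear f'" and de: "de > 0"
  and le: "!!h. norm h < de ==> norm (f (x + h) - f x - f' h) <= C * (norm h)^2"
 shows "(f has_derivative f') (at x)"
 unfolding has_derivative_at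
proof (intro conjI f')
 show "(%h. norm (f (x + h) - f x - f' h) / norm h) \<midarrow>0\<rightarrow> 0"
 proof (rule Lim_null_comparison)
  have "((%h::'a. C * norm h) \<longlongrightarrow> C * norm (0::'a)) (at 0)" by (intro tendsto_intros)
  then show "((%h::'a. C * norm h) \<longlongrightarrow> 0) (at 0)" by simp
  have "\<forall>\<^sub>F h in at (0::'a). norm h < de"
   using de unfolding eventually_at by (auto intro!: exI[of _ de])
  then show "\<forall>\<^sub>F h in at 0. norm (norm (f (x + h) - f x - f' h) / norm h) <= C * norm h"
  proof eventually_elim
   case (elim h)
   show ?case
   proof (cases "h = 0")
    case False
    then show ?thesis using divide_right_mono[OF le[OF elim], of "norm h"] by (simp add: power2_eq_square)
   qed simp
  qed
 qed
qed

lemma n2_sum_le: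
 fixes f :: "'i => real => 'a::euclidean_space"
 shows "(!!i. i : I ==> L2 T (f i)) ==> n2 T (%t. SUM i:I. f i t) <= (SUM i:I. n2 T (f i))"
proof (induction I rule: infinite_finite_induct)
 case (insert i I)
 then show ?case using n2_triangle[of T "f i" "%t. SUM i:I. f i t"] by (simp add: L2_sum)
qed (simp_all add: n2_def)

text \<open>\<open>kap\<close> is tangent to the constraint and the directions \<open>ga l\<close>
  move the constrained endpoint along the axes. The problem is thereby reduced to the
  finite-dimensional family \<open>w0 + s kap + sum_l y_l ga_l\<close>.\<close>

locale constrained_variation = control_system S x0 T
 for S :: "'j::finite => 'd::finite vfield" and x0 :: "'d rvec" and T :: real +
 fixes w0 kap :: "real => real^'j" and ga :: "'l::finite => real => real^'j" and P :: "'d rvec => 'l rvec"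
 assumes L2w0: "L2 T w0" and L2kap: "L2 T kap" and L2ga: "!!l. L2 T (ga l)" and P: "bounded_linear P"
  and Pkap: "P (Vp w0 kap T) = 0" and Pga: "!!l. P (Vp w0 (ga l) T) = axis l 1"
begin

definition dW :: "real \<times> 'l rvec => real => real^'j" where
 "dW h t = fst h *R kap t + (SUM l:UNIV. snd h $ l *R ga l t)"

definition W :: "real \<times> 'l rvec => real => real^'j" where
 "W h t = w0 t + dW h t"

lemma L2_dW: "L2 T (dW h)"
 unfolding dW_def[abs_def] by (intro L2_add L2_scaleR L2_sum L2kap L2ga)

lemma L2_W: "L2 T (W h)"
 unfolding W_def[abs_def] by (intro L2_add L2w0 L2_dW)

lemma W_add: "W (h + k) = (%t. W h t + dW k t)"
 unfolding W_def dW_def by (simp add: fun_eq_iff scaleR_add_left sum.distrib algebra_simps)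

lemma W_0: "W 0 = w0"
 unfolding W_def dW_def by (simp add: fun_eq_iff)

definition cW :: real where "cW = n2 T kap + (SUM l:UNIV. n2 T (ga l))"

lemma n2_dW: "n2 T (dW h) <= cW * norm h"
proof -
 have f: "\<bar>fst h\<bar> <= norm h" "\<bar>snd h $ l\<bar> <= norm h" for l
  using norm_fst_le[of "fst h" "snd h"] norm_snd_le[of "snd h" "fst h"] component_le_norm_cart[of "snd h" l] by auto
 have "n2 T (dW h) <= n2 T (%t. fst h *R kap t) + n2 T (%t. SUM l:UNIV. snd h $ l *R ga l t)"
  unfolding dW_def[abs_def] by (intro n2_triangle L2_scaleR L2_sum L2kap L2ga)
 also have "... <= \<bar>fst h\<bar> * n2 T kap + (SUM l:UNIV. \<bar>snd h $ l\<bar> * n2 T (ga l))"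
  using n2_sum_le[of UNIV T "%l t. snd h $ l *R ga l t"] by (simp add: n2_scaleR L2_scaleR L2ga)
 also have "... <= norm h * n2 T kap + (SUM l:UNIV. norm h * n2 T (ga l))"
  using f by (intro add_mono mult_right_mono sum_mono) auto
 also have "... = cW * norm h" unfolding cW_def by (simp add: algebra_simps sum_distrib_left)
 finally show ?thesis .
qed

definition Ph :: "real \<times> 'l rvec => real^'l" where "Ph h = P (Xp (W h) T)"

lemma Vp_dW: "L2 T w ==> Vp w (dW h) T = fst h *R Vp w kap T + (SUM l:UNIV. snd h $ l *R Vp w (ga l) T)"
 unfolding dW_def[abs_def]
 by (simp add: Vp_add Vp_sum Vp_scaleR L2_scaleR L2_sum L2kap L2ga T0)

lemma bounded_linear_Vp_dW: "L2 T w ==> bounded_linear (%h. P (Vp w (dW h) T))"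
proof -
 assume w: "L2 T w"
 have "linear (%h. Vp w (dW h) T)"
  unfolding Vp_dW[OF w] by (rule linearI) (simp_all add: scaleR_add_left sum.distrib algebra_simps scaleR_sum_right)
 then have "bounded_linear (%h. Vp w (dW h) T)" by (simp add: linear_conv_bounded_linear)
 then show ?thesis by (rule bounded_linear_compose[OF P])
qed

lemma Ph_has_derivative: "(Ph has_derivative (%h. P (Vp (W z) (dW h) T))) (at z)"
proof -
 have T': "T : {0..T}" using T by simp
 obtain C where C: "C > 0" "!!eta t. L2 T eta ==> t : {0..T} ==>
  norm (Xp (%s. W z s + eta s) t - Xp (W z) t - Vp (W z) eta t) <= C * (n2 T eta)^2"
  using Xp_derivative_bound[OF L2_W[of z]] by blast
 obtain K where K: "K > 0" "!!x. norm (P x) <= norm x * K" using bounded_linear.pos_bounded[OF P] by blast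
 interpret P: bounded_linear P by (rule P)
 show ?thesis
 proof (rule has_derivative_quadratic_remainder[OF bounded_linear_Vp_dW[OF L2_W] zero_less_one])
  fix h
  have "norm (Ph (z + h) - Ph z - P (Vp (W z) (dW h) T)) = norm (P (Xp (%s. W z s + dW h s) T - Xp (W z) T - Vp (W z) (dW h) T))"
   unfolding Ph_def W_add by (simp add: P.diff)
  also have "... <= norm (Xp (%s. W z s + dW h s) T - Xp (W z) T - Vp (W z) (dW h) T) * K" by (rule K)
  also have "... <= C * (n2 T (dW h))^2 * K" using C(2)[OF L2_dW T'] K by (intro mult_right_mono) auto
  also have "... <= C * (cW * norm h)^2 * K" using C K n2_dW by (intro mult_right_mono mult_left_mono power_mono) auto
  finally show "norm (Ph (z + h) - Ph z - P (Vp (W z) (dW h) T)) <= (C * cW^2 * K) * (norm h)^2"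
   by (simp add: power_mult_distrib mult_ac)
 qed
qed

lemma Vp_W_continuous:
 assumes eta: "L2 T eta"
 shows "continuous_on UNIV (%z. Vp (W z) eta T)"
 unfolding continuous_on_def
proof
 fix z
 have T': "T : {0..T}" using T by simp
 have "((%r. n2 T (dW (r - z))) \<longlongrightarrow> 0) (at z)"
 proof (rule Lim_null_comparison)
  have "((%r. cW * norm (r - z)) \<longlongrightarrow> cW * norm (z - z)) (at z)" by (intro tendsto_intros)
  then show "((%r. cW * norm (r - z)) \<longlongrightarrow> 0) (at z)" by simp
  show "\<forall>\<^sub>F r in at z. norm (n2 T (dW (r - z))) <= cW * norm (r - z)" using n2_dW by (intro always_eventually) auto
 qed
 from Vp_uniform_limit[OF L2_W[of z] L2_dW this eta]
 have "((%r. Vp (%s. W z s + dW (r - z) s) eta T) \<longlongrightarrow> Vp (W z) eta T) (at z)"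
  by (rule tendsto_uniform_limitI) (rule T')
 then show "((%z. Vp (W z) eta T) \<longlongrightarrow> Vp (W z) eta T) (at z within UNIV)"
  unfolding W_add[symmetric] by simp
qed

definition Fm :: "real \<times> 'l rvec => real \<times> 'l rvec" where "Fm z = (fst z, Ph z)"
definition Fm' :: "real \<times> 'l rvec => (real \<times> 'l rvec) \<Rightarrow>\<^sub>L (real \<times> 'l rvec)" where
 "Fm' z = Blinfun (%h. (fst h, P (Vp (W z) (dW h) T)))"

lemma Fm': "blinfun_apply (Fm' z) h = (fst h, P (Vp (W z) (dW h) T))"
 unfolding Fm'_def
 by (subst bounded_linear_Blinfun_apply) (auto intro!: bounded_linear_Pair bounded_linear_fst bounded_linear_Vp_dW L2_W)

text \<open>Inverse function theorem for \<open>Fm (s, y) = (s, Ph (s, y))\<close>, whose derivative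
  at the origin is the identity by the normalisations \<open>Pkap\<close> and \<open>Pga\<close>.
  Injectivity of the partial derivative in \<open>y\<close> is recorded at every \<open>s\<close>,
  because \<open>y'\<close> is later solved for from the linear system of the second to last
  clause.\<close>

lemma implicit_curve:
 obtains ep y where "ep > 0" "y 0 = 0" "!!s. \<bar>s\<bar> < ep ==> Ph (s, y s) = P (Xp w0 T)"
  "!!s. \<bar>s\<bar> < ep ==> EX y'. (y has_vector_derivative y') (at s) &
    P (Vp (W (s, y s)) kap T) + (SUM l:UNIV. y' $ l *R P (Vp (W (s, y s)) (ga l) T)) = 0"
  "!!s v. \<bar>s\<bar> < ep ==> (SUM l:UNIV. v $ l *R P (Vp (W (s, y s)) (ga l) T)) = 0 ==> v = 0"
proof -
 interpret P: bounded_linear P by (rule P)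
 have PV: "P (Vp (W z) (dW h) T) = fst h *R P (Vp (W z) kap T) + (SUM l:UNIV. snd h $ l *R P (Vp (W z) (ga l) T))" for z h
  unfolding Vp_dW[OF L2_W] by (simp add: P.add P.scaleR P.sum)
 have der: "(Fm has_derivative blinfun_apply (Fm' z)) (at z)" for z
  unfolding Fm_def[abs_def] Fm'[abs_def]
  by (intro has_derivative_Pair has_derivative_fst has_derivative_ident Ph_has_derivative)
 have cont: "continuous_on UNIV Fm'"
 proof (rule continuous_on_blinfun_componentwise)
  fix i :: "real \<times> 'l rvec"
  show "continuous_on UNIV (%z. blinfun_apply (Fm' z) i)"
   unfolding Fm' PV
   by (intro continuous_intros bounded_linear.continuous_on[OF P] Vp_W_continuous L2kap L2ga)
 qed
 have id: "id_blinfun o\<^sub>L Fm' 0 = id_blinfun"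
 proof (rule blinfun_eqI)
  fix h :: "real \<times> 'l rvec"
  have "(SUM l:UNIV. snd h $ l *R axis l (1::real)) = snd h" using basis_expansion[of "snd h"] by (simp add: scalar_mult_eq_scaleR)
  then show "blinfun_apply (id_blinfun o\<^sub>L Fm' 0) h = blinfun_apply id_blinfun h"
   using PV[of 0 h] by (simp add: Fm' W_0 Pkap Pga prod_eq_iff)
 qed
 obtain U' V g g' where ift: "open U'" "U' \<subseteq> UNIV" "0 : U'" "open V" "Fm 0 : V" "homeomorphism U' V Fm g"
  "!!y. y : V ==> (g has_derivative (g' y)) (at y)"
  "!!y. y : V ==> g' y = inv (blinfun_apply (Fm' (g y)))"
  "!!y. y : V ==> bij (blinfun_apply (Fm' (g y)))"
  using inverse_function_theorem[OF open_UNIV der cont UNIV_I id] by (metis (no_types))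
 define a where "a = P (Xp w0 T)"
 have F0: "Fm 0 = (0, a)" unfolding Fm_def Ph_def W_0 a_def by simp
 \<comment> \<open>The line of points whose constrained endpoint is held at \<open>a\<close>; its
   preimage under \<open>Fm\<close> is the curve.\<close>
 define e where "e s = (s, a)" for s :: real
 have "open (e -` V)" unfolding e_def by (intro open_vimage ift continuous_intros)
 moreover have "0 : e -` V" using ift(5) F0 unfolding e_def by simp
 ultimately obtain ep where ep: "ep > 0" "ball 0 ep \<subseteq> e -` V" by (meson open_contains_ball)
 then have V: "(s, a) : V" if "\<bar>s\<bar> < ep" for s using that unfolding e_def by (force simp: subset_iff)
 define y where "y s = snd (g (s, a))" for s
 have Fg: "Fm (g z) = z" if "z : V" for z using ift(6) that by (simp add: homeomorphism_apply2)
 have gs: "g (s, a) = (s, y s)" and Phs: "Ph (s, y s) = a" if "\<bar>s\<bar> < ep" for s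
 proof -
  have F: "Fm (g (s, a)) = (s, a)" by (rule Fg[OF V[OF that]])
  then have "fst (g (s, a)) = s" unfolding Fm_def by simp
  then show g: "g (s, a) = (s, y s)" unfolding y_def by (simp add: prod_eq_iff)
  show "Ph (s, y s) = a" using F unfolding g Fm_def by simp
 qed
 show ?thesis
 proof (rule that[of ep y])
  show "ep > 0" by (rule ep)
  have "g (Fm 0) = 0" using ift(3,6) by (simp add: homeomorphism_apply1)
  then show "y 0 = 0" unfolding F0 y_def by simp
  show "Ph (s, y s) = P (Xp w0 T)" if "\<bar>s\<bar> < ep" for s using Phs[OF that] unfolding a_def .
  fix s assume s: "\<bar>s\<bar> < ep"
  have bij: "bij (blinfun_apply (Fm' (s, y s)))" using ift(9)[OF V[OF s]] gs[OF s] by simp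
  define u where "u = g' (s, a) (1, 0)"
  have "((%s. g (s, a)) has_derivative (%h. g' (s, a) (h, 0))) (at s)"
   by (rule has_derivative_compose[of "%s. (s, a)" "%h. (h, 0)" s UNIV g "g' (s, a)"])
    (auto intro!: derivative_eq_intros ift(7) V s)
  then have "(y has_derivative (%h. snd (g' (s, a) (h, 0)))) (at s)"
   unfolding y_def[abs_def] by (rule has_derivative_snd)
  moreover have "g' (s, a) (h, 0) = h *R u" for h
   unfolding u_def using linear_scale[OF has_derivative_linear[OF ift(7)[OF V[OF s]]], of h "(1, 0)"] by simp
  ultimately have dy: "(y has_vector_derivative snd u) (at s)" unfolding has_vector_derivative_def by simp
  have "blinfun_apply (Fm' (s, y s)) u = (1, 0)"
   unfolding u_def ift(8)[OF V[OF s]] gs[OF s] using bij by (simp add: bij_is_surj surj_f_inv_f)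
  then have "fst u = 1" "P (Vp (W (s, y s)) kap T) + (SUM l:UNIV. snd u $ l *R P (Vp (W (s, y s)) (ga l) T)) = 0"
   unfolding Fm' PV by auto
  then show "EX y'. (y has_vector_derivative y') (at s) &
    P (Vp (W (s, y s)) kap T) + (SUM l:UNIV. y' $ l *R P (Vp (W (s, y s)) (ga l) T)) = 0" using dy by blast
  fix v assume v: "(SUM l:UNIV. v $ l *R P (Vp (W (s, y s)) (ga l) T)) = 0"
  have "blinfun_apply (Fm' (s, y s)) (0, v) = blinfun_apply (Fm' (s, y s)) 0"
   unfolding Fm' PV using v by simp
  then have "(0, v) = (0 :: real \<times> 'l rvec)" using bij by (metis bij_is_inj injD)
  then show "v = 0" by (simp add: zero_prod_def)
 qed
qed

end

section \<open>Smooth one-parameter families of controls\<close>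

lemma Dm_as_sum:
 fixes f :: "real^'n::finite => real^'m::finite"
 shows "Dm f x = (SUM b:UNIV. (\<chi> a b'. if b' = b then frechet_derivative f (at x) (axis b 1) $ a else 0))"
proof -
 have "(SUM b:UNIV. (\<chi> a b'. if b' = b then frechet_derivative f (at x) (axis b 1) $ a else 0)) $ a $ b' = Dm f x $ a $ b'" for a b'
 proof -
  have "(SUM b:UNIV. (\<chi> a b'. if b' = b then frechet_derivative f (at x) (axis b 1) $ a else 0)) $ a $ b' =
    (SUM b:UNIV. if b' = b then frechet_derivative f (at x) (axis b 1) $ a else 0)"
   by simp
  also have "... = Dm f x $ a $ b'" by (simp add: Dm_nth)
  finally show ?thesis .
 qed
 then show ?thesis by (simp add: vec_eq_iff)
qed

lemma bounded_linear_column_embedding: "bounded_linear (%y::real^'m::finite. (\<chi> a b'. if b' = b then y $ a else 0) :: real^'n::finite^'m)"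
proof -
 have "linear (%y::real^'m::finite. (\<chi> a b'. if b' = b then y $ a else 0) :: real^'n::finite^'m)"
  by (rule linearI) (auto simp: vec_eq_iff)
 then show ?thesis by (simp add: linear_conv_bounded_linear)
qed

text \<open>Reduces a bilinear operation to sums of products of real coordinates, under which the
  class of smooth families will be closed.\<close>

lemma bounded_bilinear_expand:
 fixes B :: "'a::euclidean_space => 'b::euclidean_space => 'c::euclidean_space"
 assumes "bounded_bilinear B"
 shows "B x y \<bullet> k = (SUM i:Basis. SUM j:Basis. (B i j \<bullet> k) * ((x \<bullet> i) * (y \<bullet> j)))"
proof -
 interpret bounded_bilinear B by (rule assms)
 have "B x y = B (SUM i:Basis. (x \<bullet> i) *R i) (SUM j:Basis. (y \<bullet> j) *R j)" by (simp add: euclidean_representation)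
 also have "... = (SUM i:Basis. SUM j:Basis. ((x \<bullet> i) * (y \<bullet> j)) *R B i j)"
  by (subst sum.swap) (simp add: sum_left sum_right scaleR_left scaleR_right scaleR_sum_right mult.commute)
 finally show ?thesis by (simp add: inner_sum_left mult.commute)
qed

lemma has_vector_derivative_iff_quotient:
 "(f has_vector_derivative d) (at s) \<longleftrightarrow> ((%r. (1 / (r - s)) *R (f r - f s)) \<longlongrightarrow> d) (at s)"
proof -
 have "(f has_vector_derivative d) (at s) \<longleftrightarrow> ((%r. norm ((f r - f s) - (r - s) *R d) / norm (r - s)) \<longlongrightarrow> 0) (at s)"
  unfolding has_vector_derivative_def has_derivative_iff_norm by (simp add: bounded_linear_scaleR_left)
 also have "... \<longleftrightarrow> ((%r. norm ((1 / (r - s)) *R (f r - f s) - d)) \<longlongrightarrow> 0) (at s)"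
 proof (rule filterlim_cong[OF refl refl])
  have "norm ((f r - f s) - (r - s) *R d) / norm (r - s) = norm ((1 / (r - s)) *R (f r - f s) - d)" if "r ~= s" for r
  proof -
   have "(f r - f s) - (r - s) *R d = (r - s) *R ((1 / (r - s)) *R (f r - f s) - d)"
    using that by (simp add: scaleR_diff_right)
   then show ?thesis using that by simp
  qed
  then show "\<forall>\<^sub>F r in at s. norm ((f r - f s) - (r - s) *R d) / norm (r - s) = norm ((1 / (r - s)) *R (f r - f s) - d)"
   unfolding eventually_at_filter by (auto intro: always_eventually)
 qed
 also have "... \<longleftrightarrow> ((%r. (1 / (r - s)) *R (f r - f s)) \<longlongrightarrow> d) (at s)"
  unfolding tendsto_norm_zero_iff by (rule Lim_null[symmetric])
 finally show ?thesis .
qed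

text \<open>The identity \<open>B r - B s = - B r (A r - A s) B s\<close> serves three times: for
  local boundedness of \<open>B\<close>, for its continuity, and for the difference
  quotient.\<close>

lemma matrix_inverse_has_vector_derivative:
 fixes A B :: "real => real^'n::finite^'n"
 assumes A: "(A has_vector_derivative A') (at s)" and S: "open S" "s : S"
  and inv: "!!r. r : S ==> B r ** A r = mat 1" "!!r. r : S ==> A r ** B r = mat 1"
 shows "(B has_vector_derivative - (B s ** A' ** B s)) (at s)"
proof -
 obtain K where K: "K > 0" "!!(X::real^'n^'n) (Y::real^'n^'n). norm (X ** Y) <= norm X * norm Y * K"
  using bounded_bilinear.pos_bounded[OF bilinear_mm] by blast
 have diff: "B r - B s = - (B r ** (A r - A s) ** B s)" if "r : S" for r
 proof -
  have "B r ** (A r - A s) ** B s = (B r ** A r - B r ** A s) ** B s"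
   by (simp add: bounded_bilinear.diff_right[OF bilinear_mm])
  also have "... = B r ** A r ** B s - B r ** (A s ** B s)"
   by (simp add: bounded_bilinear.diff_left[OF bilinear_mm] matrix_mul_assoc)
  also have "... = B s - B r" using inv that S by simp
  finally show ?thesis by simp
 qed
 have evS: "\<forall>\<^sub>F r in at s. r : S" using S eventually_at_topological by blast
 have contA: "(A \<longlongrightarrow> A s) (at s)"
  using has_vector_derivative_continuous[OF A] by (simp add: continuous_at)
 then have dA: "((%r. norm (A r - A s)) \<longlongrightarrow> 0) (at s)" using tendsto_norm_zero[OF LIM_zero] by blast
 have l0: "((%r. K * K * norm (B s) * norm (A r - A s)) \<longlongrightarrow> 0) (at s)"
  using tendsto_mult_left[OF dA, of "K * K * norm (B s)"] by simp
 have "\<forall>\<^sub>F r in at s. K * K * norm (B s) * norm (A r - A s) < 1/2" using order_tendstoD(2)[OF l0, of "1/2"] by simp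
 \<comment> \<open>With the factor below 1/2 the identity bounds \<open>norm (B r - B s)\<close> by
   half of \<open>norm (B r)\<close>, which is absorbed on the left.\<close>
 with evS have bnd: "\<forall>\<^sub>F r in at s. norm (B r) <= 2 * norm (B s)"
 proof eventually_elim
  case (elim r)
  have "norm (B r - B s) <= norm (B r ** (A r - A s)) * norm (B s) * K"
   unfolding diff[OF elim(1)] norm_minus_cancel by (rule K)
  also have "... <= (norm (B r) * norm (A r - A s) * K) * norm (B s) * K"
   using K by (intro mult_right_mono) auto
  also have "... = norm (B r) * (K * K * norm (B s) * norm (A r - A s))" by simp
  also have "... <= norm (B r) * (1/2)" using elim(2) by (intro mult_left_mono) auto
  finally show ?case using norm_triangle_ineq2[of "B r" "B s"] by linarith
 qed
 have contB: "(B \<longlongrightarrow> B s) (at s)"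
 proof (rule LIM_zero_cancel, rule Lim_null_comparison)
  have "((%r. (2 * norm (B s)) * (K * K * norm (B s) * norm (A r - A s))) \<longlongrightarrow> (2 * norm (B s)) * 0) (at s)"
   by (intro tendsto_mult_left l0)
  then show "((%r. (2 * norm (B s)) * (K * K * norm (B s) * norm (A r - A s))) \<longlongrightarrow> 0) (at s)" by simp
  from evS bnd show "\<forall>\<^sub>F r in at s. norm (B r - B s) <= (2 * norm (B s)) * (K * K * norm (B s) * norm (A r - A s))"
  proof eventually_elim
   case (elim r)
   have "norm (B r - B s) <= norm (B r ** (A r - A s)) * norm (B s) * K"
    unfolding diff[OF elim(1)] norm_minus_cancel by (rule K)
   also have "... <= (norm (B r) * norm (A r - A s) * K) * norm (B s) * K"
    using K by (intro mult_right_mono) auto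
   also have "... = norm (B r) * (K * K * norm (B s) * norm (A r - A s))" by simp
   also have "... <= (2 * norm (B s)) * (K * K * norm (B s) * norm (A r - A s))"
    using elim(2) K by (intro mult_right_mono) auto
   finally show ?case .
  qed
 qed
 have "((%r. (1 / (r - s)) *R (A r - A s)) \<longlongrightarrow> A') (at s)"
  using A unfolding has_vector_derivative_iff_quotient .
 then have "((%r. - (B r ** ((1 / (r - s)) *R (A r - A s)) ** B s)) \<longlongrightarrow> - (B s ** A' ** B s)) (at s)"
  by (intro tendsto_minus bounded_bilinear.tendsto[OF bilinear_mm] contB tendsto_const)
 moreover have "\<forall>\<^sub>F r in at s. - (B r ** ((1 / (r - s)) *R (A r - A s)) ** B s) = (1 / (r - s)) *R (B r - B s)"
  using evS
 proof eventually_elim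
  case (elim r)
  show ?case
   unfolding diff[OF elim] bounded_bilinear.scaleR_right[OF bilinear_mm]
    bounded_bilinear.scaleR_left[OF bilinear_mm] scaleR_minus_right ..
 qed
 ultimately have "((%r. (1 / (r - s)) *R (B r - B s)) \<longlongrightarrow> - (B s ** A' ** B s)) (at s)"
  by (rule Lim_transform_eventually)
 then show ?thesis unfolding has_vector_derivative_iff_quotient .
qed

text \<open>Controls \<open>sum_m cf_m(s) om_m\<close> with fixed time profiles and scalar
  coefficients. \<open>Gen\<close> collects the functions of \<open>s\<close> taken as primitive in
  the class below; it is left open because differentiability of the primitives inside the class is a
  property of the concrete correction curve.\<close>

locale smooth_family = control_system S x0 T
 for S :: "'j::finite => 'd::finite vfield" and x0 :: "'d rvec" and T :: real +
 fixes om :: "'n::finite => real => real^'j" and cf cf' :: "'n => real => real" and Gen :: "(real => real) set" and I :: "real set"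
 assumes L2om: "!!m. L2 T (om m)" and openI: "open I" and cf_Gen: "!!m. cf m : Gen"
  and cf': "!!m s. s : I ==> (cf m has_real_derivative cf' m s) (at s)"
begin

definition wf :: "real => real => real^'j" where
 "wf s = (%t. SUM m:UNIV. cf m s *R om m t)"

lemma L2_wf: "L2 T (wf s)"
 unfolding wf_def by (intro L2_sum L2_scaleR L2om)

text \<open>A class of functions of the parameter \<open>s\<close> and the time \<open>t\<close> that contains the flow and its
 Jacobian and is closed under differentiation in \<open>s\<close>: this gives derivatives of all orders without
 iterating the variational equation.\<close>

inductive_set Ac :: "(real => real => real) set" where
 gen: "g : Gen ==> (%s t. g s) : Ac"
| const: "(%s t. c) : Ac"
| iter: "(%s t. iter_dir_deriv vs (S j) (Xp (wf s) t) \<bullet> i) : Ac"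
| jac: "(%s t. Jm (wf s) t \<bullet> k) : Ac"
| cojac: "(%s t. Km (wf s) t \<bullet> k) : Ac"
| add: "X : Ac ==> Y : Ac ==> (%s t. X s t + Y s t) : Ac"
| mult: "X : Ac ==> Y : Ac ==> (%s t. X s t * Y s t) : Ac"
| int: "X : Ac ==> L2 T q ==> (%s t. integral {0..t} (%tau. q tau * X s tau)) : Ac"
| endp: "X : Ac ==> (%s t. X s T) : Ac"
| agree: "X : Ac ==> (!!s t. s : I ==> t : {0..T} ==> X s t = Y s t) ==> Y : Ac"

definition memb :: "(real => real => 'a::euclidean_space) => bool" where
 "memb X \<longleftrightarrow> (ALL i:Basis. (%s t. X s t \<bullet> i) : Ac)"

text \<open>Differentiability in \<open>s\<close>, uniform in time and with continuous time slices:
  uniformity is what allows differentiation under a time integral.\<close>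

definition D :: "(real => real => 'a::euclidean_space) => (real => real => 'a) => bool" where
 "D X X' \<longleftrightarrow> (ALL s:I. continuous_on {0..T} (X s) & continuous_on {0..T} (X' s) &
  uniform_limit {0..T} (%r t. (1 / (r - s)) *R (X r t - X s t)) (X' s) (at s))"

section \<open>Algebraic closure of the class\<close>

lemma A_sum: "(!!i. i : J ==> f i : Ac) ==> (%s t. SUM i:J. f i s t) : Ac"
 by (induction J rule: infinite_finite_induct) (auto intro: Ac.const Ac.add)

lemma A_cmult: "X : Ac ==> (%s t. c * X s t) : Ac"
 by (rule Ac.mult[OF Ac.const])

lemma memb_real: "memb X \<longleftrightarrow> X : Ac" for X :: "real => real => real"
 unfolding memb_def by simp

lemma memb_cong: "memb X ==> (!!s t. s : I ==> t : {0..T} ==> X s t = Y s t) ==> memb Y"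
 unfolding memb_def by (auto intro: Ac.agree)

lemma memb_const: "memb (%s t. c)"
 unfolding memb_def by (auto intro: Ac.const)

lemma memb_add: "memb X ==> memb Y ==> memb (%s t. X s t + Y s t)"
 unfolding memb_def by (auto simp: inner_add_left intro: Ac.add)

lemma memb_sum: "(!!i. i : J ==> memb (f i)) ==> memb (%s t. SUM i:J. f i s t)"
 unfolding memb_def by (auto simp: inner_sum_left intro!: A_sum)

lemma memb_bilinear:
 fixes B :: "'a::euclidean_space => 'b::euclidean_space => 'c::euclidean_space"
 assumes "bounded_bilinear B" "memb X" "memb Y"
 shows "memb (%s t. B (X s t) (Y s t))"
 unfolding memb_def
proof
 fix k :: 'c
 show "(%s t. B (X s t) (Y s t) \<bullet> k) : Ac"
  by (subst bounded_bilinear_expand[OF assms(1)])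
   (use assms(2,3) in \<open>unfold memb_def, intro A_sum A_cmult Ac.mult, auto\<close>)
qed

lemma memb_scaleR: "memb X ==> memb Y ==> memb (%s t. X s t *R Y s t)"
 by (rule memb_bilinear[OF bounded_bilinear_scaleR])

lemma memb_linear:
 fixes L :: "'a::euclidean_space => 'b::euclidean_space"
 assumes "bounded_linear L" "memb X"
 shows "memb (%s t. L (X s t))"
proof -
 have "bounded_bilinear (%c x. c *R L x)" for c :: real
  by (rule bounded_bilinear.comp[OF bounded_bilinear_scaleR bounded_linear_ident assms(1)])
 from memb_bilinear[OF this memb_const[of 1] assms(2)] show ?thesis by simp
qed

lemma memb_minus: "memb X ==> memb (%s t. - X s t)"
 by (rule memb_linear[OF bounded_linear_minus[OF bounded_linear_ident]])

lemma memb_endp: "memb X ==> memb (%s t. X s T)"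
 unfolding memb_def by (auto intro: Ac.endp)

lemma memb_gen: "g : Gen ==> memb (%s t. g s)"
 unfolding memb_real by (rule Ac.gen)

lemma memb_iter: "memb (%s t. iter_dir_deriv vs (S j) (Xp (wf s) t))"
 unfolding memb_def by (auto intro: Ac.iter)

lemma memb_S: "memb (%s t. S j (Xp (wf s) t))"
 using memb_iter[of "[]" j] by simp

lemma memb_J: "memb (%s t. Jm (wf s) t)"
 unfolding memb_def by (auto intro: Ac.jac)

lemma memb_K: "memb (%s t. Km (wf s) t)"
 unfolding memb_def by (auto intro: Ac.cojac)

lemma weighted_integrable:
 fixes q :: "real => real" and f :: "real => 'a::euclidean_space"
 assumes "L2 T q" "continuous_on {0..T} f" "t : {0..T}"
 shows "(%tau. q tau *R f tau) integrable_on {0..t}"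
 by (rule integrable_on_subinterval[OF set_lebesgue_integral_eq_integral(1)[OF
    L2_abs_integrable[OF L2_scaleR_fun[OF assms(1,2)]]]]) (use assms(3) in auto)

text \<open>Continuity in time makes the vector-valued integrand integrable, so that taking
  components commutes with the integral.\<close>

lemma memb_int:
 fixes X :: "real => real => 'a::euclidean_space"
 assumes X: "memb X" and q: "L2 T q" and c: "!!s. s : I ==> continuous_on {0..T} (X s)"
 shows "memb (%s t. integral {0..t} (%tau. q tau *R X s tau))"
 unfolding memb_def
proof
 fix i :: 'a assume i: "i : Basis"
 have "(%s t. integral {0..t} (%tau. q tau * (X s tau \<bullet> i))) : Ac"
  using X i unfolding memb_def by (intro Ac.int q) auto
 then show "(%s t. integral {0..t} (%tau. q tau *R X s tau) \<bullet> i) : Ac"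
 proof (rule Ac.agree)
  fix s t assume st: "s : I" "t : {0..T}"
  show "integral {0..t} (%tau. q tau * (X s tau \<bullet> i)) = integral {0..t} (%tau. q tau *R X s tau) \<bullet> i"
   using integral_component_eq[OF weighted_integrable[OF q c[OF st(1)] st(2)], of i] by simp
 qed
qed

subsection \<open>Differentiation in the parameter\<close>

lemma D_continuous: "D X X' ==> s : I ==> continuous_on {0..T} (X s)" "D X X' ==> s : I ==> continuous_on {0..T} (X' s)"
 and D_limit: "D X X' ==> s : I ==> uniform_limit {0..T} (%r t. (1 / (r - s)) *R (X r t - X s t)) (X' s) (at s)"
 unfolding D_def by auto

lemma eventually_I: "s : I ==> \<forall>\<^sub>F r in at s. r : I & r ~= s"
 using openI unfolding eventually_at_topological by auto

lemma uniform_limit_transform: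
 "uniform_limit A f l F ==> \<forall>\<^sub>F r in F. ALL t:A. f r t = g r t ==> uniform_limit A g l F"
 by (rule iffD1[OF uniform_limit_cong]) (assumption, rule refl, assumption)

text \<open>The increment is \<open>r - s\<close> times the difference quotient, and the quotient
  converges uniformly to a bounded limit.\<close>

lemma D_tendsto:
 assumes D: "D X X'" and s: "s : I"
 shows "uniform_limit {0..T} X (X s) (at s)"
proof -
 have r0: "uniform_limit {0..T} (%r t. r - s) (%t. 0) (at s)"
 proof (rule uniform_limit_bound)
  have "((%r. \<bar>r - s\<bar>) \<longlongrightarrow> \<bar>s - s\<bar>) (at s)" by (intro tendsto_intros)
  then show "((%r. \<bar>r - s\<bar>) \<longlongrightarrow> 0) (at s)" by simp
 qed auto
 have "uniform_limit {0..T} (%r t. (r - s) *R ((1 / (r - s)) *R (X r t - X s t))) (%t. 0 *R X' s t) (at s)"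
  by (rule uniform_limit_bilinear[OF bounded_bilinear_scaleR r0 D_limit[OF D s]]) (auto intro: D_continuous[OF D s])
 from uniform_limit_add[OF this uniform_limit_const, of "X s"]
 have "uniform_limit {0..T} (%r t. (r - s) *R ((1 / (r - s)) *R (X r t - X s t)) + X s t) (X s) (at s)" by simp
 then show ?thesis
 proof (rule uniform_limit_transform)
  show "\<forall>\<^sub>F r in at s. ALL t:{0..T}. (r - s) *R ((1 / (r - s)) *R (X r t - X s t)) + X s t = X r t"
   using eventually_I[OF s] by eventually_elim auto
 qed
qed

lemma D_cong:
 assumes D: "D X X'" and eq: "!!s t. s : I ==> t : {0..T} ==> X s t = Y s t"
 shows "D Y X'"
 unfolding D_def
proof (intro ballI conjI)
 fix s assume s: "s : I"
 show "continuous_on {0..T} (Y s)" using D_continuous(1)[OF D s] by (rule continuous_on_eq) (simp add: eq s)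
 show "continuous_on {0..T} (X' s)" by (rule D_continuous(2)[OF D s])
 show "uniform_limit {0..T} (%r t. (1 / (r - s)) *R (Y r t - Y s t)) (X' s) (at s)"
  by (rule uniform_limit_transform[OF D_limit[OF D s]])
   (use eventually_I[OF s] in \<open>eventually_elim, simp add: eq s\<close>)
qed

lemma D_const: "D (%s t. c) (%s t. 0)"
 unfolding D_def by (auto intro!: uniform_limit_const)

lemma D_fun:
 assumes "!!s. s : I ==> (g has_vector_derivative g' s) (at s)"
 shows "D (%s t. g s) (%s t. g' s)"
 unfolding D_def
proof (intro ballI conjI)
 fix s assume s: "s : I"
 show "uniform_limit {0..T} (%r t. (1 / (r - s)) *R (g r - g s)) (%t. g' s) (at s)"
 proof (rule uniform_limitI)
  fix e :: real assume "e > 0"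
  then have "\<forall>\<^sub>F r in at s. dist ((1 / (r - s)) *R (g r - g s)) (g' s) < e"
   using assms[OF s] unfolding has_vector_derivative_iff_quotient tendsto_iff by blast
  then show "\<forall>\<^sub>F r in at s. ALL t:{0..T}. dist ((1 / (r - s)) *R (g r - g s)) (g' s) < e"
   by eventually_elim auto
 qed
qed auto

lemma D_imp_derivative:
 assumes "D X X'" "s : I" "t : {0..T}"
 shows "((%s. X s t) has_vector_derivative X' s t) (at s)"
 unfolding has_vector_derivative_iff_quotient
 by (rule tendsto_uniform_limitI[OF D_limit[OF assms(1,2)] assms(3)])

lemma D_sum:
 assumes "!!i. i : J ==> D (f i) (f' i)"
 shows "D (%s t. SUM i:J. f i s t) (%s t. SUM i:J. f' i s t)"
 unfolding D_def
proof (intro ballI conjI)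
 fix s assume s: "s : I"
 have "uniform_limit {0..T} (%r t. SUM i:J. (1 / (r - s)) *R (f i r t - f i s t)) (%t. SUM i:J. f' i s t) (at s)"
  by (intro uniform_limit_sum D_limit[OF assms s])
 then show "uniform_limit {0..T} (%r t. (1 / (r - s)) *R ((SUM i:J. f i r t) - (SUM i:J. f i s t))) (%t. SUM i:J. f' i s t) (at s)"
  by (simp only: scaleR_sum_right sum_subtractf[symmetric])
qed (auto intro!: continuous_on_sum D_continuous[OF assms])

lemma D_add:
 assumes "D X X'" "D Y Y'"
 shows "D (%s t. X s t + Y s t) (%s t. X' s t + Y' s t)"
 using D_sum[of "UNIV::bool set" "%b. if b then X else Y" "%b. if b then X' else Y'"] assms by (simp add: UNIV_bool add.commute)

lemma D_bilinear:
 fixes B :: "'a::euclidean_space => 'b::euclidean_space => 'c::euclidean_space"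
 assumes B: "bounded_bilinear B" and X: "D X X'" and Y: "D Y Y'"
 shows "D (%s t. B (X s t) (Y s t)) (%s t. B (X' s t) (Y s t) + B (X s t) (Y' s t))"
 unfolding D_def
proof (intro ballI conjI)
 interpret B: bounded_bilinear B by (rule B)
 fix s assume s: "s : I"
 note cX = D_continuous[OF X s] and cY = D_continuous[OF Y s]
 show "continuous_on {0..T} (%t. B (X s t) (Y s t))" "continuous_on {0..T} (%t. B (X' s t) (Y s t) + B (X s t) (Y' s t))"
  by (intro B.continuous_on continuous_on_add cX cY)+
 have "uniform_limit {0..T} (%r t. B ((1 / (r - s)) *R (X r t - X s t)) (Y r t) + B (X s t) ((1 / (r - s)) *R (Y r t - Y s t)))
   (%t. B (X' s t) (Y s t) + B (X s t) (Y' s t)) (at s)"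
  by (intro uniform_limit_add uniform_limit_bilinear[OF B] D_limit[OF X s] D_limit[OF Y s] D_tendsto[OF Y s] uniform_limit_const cX cY)
 then show "uniform_limit {0..T} (%r t. (1 / (r - s)) *R (B (X r t) (Y r t) - B (X s t) (Y s t)))
   (%t. B (X' s t) (Y s t) + B (X s t) (Y' s t)) (at s)"
  by (simp add: B.scaleR_left B.scaleR_right B.diff_left B.diff_right flip: scaleR_add_right)
qed

lemma D_linear:
 fixes L :: "'a::euclidean_space => 'b::euclidean_space"
 assumes L: "bounded_linear L" and X: "D X X'"
 shows "D (%s t. L (X s t)) (%s t. L (X' s t))"
proof -
 have "bounded_bilinear (%(c::real) x. c *R L x)"
  by (rule bounded_bilinear.comp[OF bounded_bilinear_scaleR bounded_linear_ident L])
 from D_bilinear[OF this D_const[of 1] X] show ?thesis by simp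
qed

lemma D_int:
 fixes X :: "real => real => 'a::euclidean_space"
 assumes X: "D X X'" and q: "L2 T q"
 shows "D (%s t. integral {0..t} (%tau. q tau *R X s tau)) (%s t. integral {0..t} (%tau. q tau *R X' s tau))"
 unfolding D_def
proof (intro ballI conjI)
 fix s assume s: "s : I"
 have T': "T : {0..T}" using T by simp
 show "continuous_on {0..T} (%t. integral {0..t} (%tau. q tau *R X s tau))" "continuous_on {0..T} (%t. integral {0..t} (%tau. q tau *R X' s tau))"
  by (intro indefinite_integral_continuous_1 weighted_integrable[OF q _ T'] D_continuous[OF X s])+
 have cq: "\<forall>\<^sub>F r in at s. continuous_on {0..T} (%t. (1 / (r - s)) *R (X r t - X s t))"
  using eventually_I[OF s] by eventually_elim (intro continuous_intros D_continuous(1)[OF X] s, auto)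
 have "uniform_limit {0..T} (%r t. integral {0..t} (%tau. q tau *R ((1 / (r - s)) *R (X r tau - X s tau))))
   (%t. integral {0..t} (%tau. q tau *R X' s tau)) (at s)"
  by (rule uniform_limit_weighted_integral[OF q T0 D_limit[OF X s] cq D_continuous(2)[OF X s]])
 then show "uniform_limit {0..T} (%r t. (1 / (r - s)) *R (integral {0..t} (%tau. q tau *R X r tau) - integral {0..t} (%tau. q tau *R X s tau)))
   (%t. integral {0..t} (%tau. q tau *R X' s tau)) (at s)"
 proof (rule uniform_limit_transform)
  show "\<forall>\<^sub>F r in at s. ALL t:{0..T}. integral {0..t} (%tau. q tau *R ((1 / (r - s)) *R (X r tau - X s tau))) =
    (1 / (r - s)) *R (integral {0..t} (%tau. q tau *R X r tau) - integral {0..t} (%tau. q tau *R X s tau))"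
   using eventually_I[OF s]
  proof eventually_elim
   case (elim r)
   show ?case
   proof
    fix t assume t: "t : {0..T}"
    have "integral {0..t} (%tau. q tau *R X r tau) - integral {0..t} (%tau. q tau *R X s tau) = integral {0..t} (%tau. q tau *R X r tau - q tau *R X s tau)"
     using elim by (intro Henstock_Kurzweil_Integration.integral_diff[symmetric] weighted_integrable[OF q _ t] D_continuous(1)[OF X] s) auto
    moreover have "(%tau. q tau *R ((1 / (r - s)) *R (X r tau - X s tau))) = (%tau. (1 / (r - s)) *R (q tau *R X r tau - q tau *R X s tau))"
     by (simp add: fun_eq_iff scaleR_diff_right mult.commute)
    ultimately show "integral {0..t} (%tau. q tau *R ((1 / (r - s)) *R (X r tau - X s tau))) =
     (1 / (r - s)) *R (integral {0..t} (%tau. q tau *R X r tau) - integral {0..t} (%tau. q tau *R X s tau))"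
     by simp
   qed
  qed
 qed
qed

lemma D_endp: "D X X' ==> D (%s t. X s T) (%s t. X' s T)"
 by (rule D_fun) (rule D_imp_derivative, use T in auto)

section \<open>Parameter derivatives of the flow and of its Jacobian\<close>

definition th :: "real => real => real => real^'j" where
 "th s r = (%t. SUM m:UNIV. (cf m r - cf m s) *R om m t)"

lemma L2_th: "L2 T (th s r)"
 unfolding th_def by (intro L2_sum L2_scaleR L2om)

lemma wf_th: "(%t. wf s t + th s r t) = wf r"
 unfolding th_def wf_def by (simp add: fun_eq_iff scaleR_diff_left sum_subtractf)

text \<open>A scalar majorant of the norm of \<open>th s r\<close>. It tends to 0 and its quotient
  by the distance from \<open>r\<close> to \<open>s\<close> converges, so remainders quadratic in it
  are of smaller order than \<open>r - s\<close>.\<close>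

definition dl :: "real => real => real" where "dl s r = (SUM m:UNIV. \<bar>cf m r - cf m s\<bar> * n2 T (om m))"

lemma n2_th: "n2 T (th s r) <= dl s r"
proof -
 have "n2 T (th s r) <= (SUM m:UNIV. n2 T (%t. (cf m r - cf m s) *R om m t))"
  unfolding th_def by (intro n2_sum_le L2_scaleR L2om)
 then show ?thesis unfolding dl_def n2_scaleR .
qed

lemma cf_quotient: "s : I ==> ((%r. (cf m r - cf m s) / (r - s)) \<longlongrightarrow> cf' m s) (at s)"
 using cf' unfolding has_field_derivative_iff by blast

lemma cf_tendsto: "s : I ==> (cf m \<longlongrightarrow> cf m s) (at s)"
 using DERIV_isCont[OF cf'] by (simp add: isCont_def)

lemma dl_tendsto: "s : I ==> (dl s \<longlongrightarrow> 0) (at s)"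
proof -
 assume s: "s : I"
 have "((%r. SUM m:UNIV. \<bar>cf m r - cf m s\<bar> * n2 T (om m)) \<longlongrightarrow> (SUM m:UNIV. \<bar>cf m s - cf m s\<bar> * n2 T (om m))) (at s)"
  by (intro tendsto_intros cf_tendsto s)
 then show ?thesis unfolding dl_def by simp
qed

lemma dl_quotient: "s : I ==> ((%r. dl s r / \<bar>r - s\<bar>) \<longlongrightarrow> (SUM m:UNIV. \<bar>cf' m s\<bar> * n2 T (om m))) (at s)"
proof -
 assume s: "s : I"
 have "((%r. SUM m:UNIV. \<bar>(cf m r - cf m s) / (r - s)\<bar> * n2 T (om m)) \<longlongrightarrow> (SUM m:UNIV. \<bar>cf' m s\<bar> * n2 T (om m))) (at s)"
  by (intro tendsto_intros cf_quotient s)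
 moreover have "(SUM m:UNIV. \<bar>(cf m r - cf m s) / (r - s)\<bar> * n2 T (om m)) = dl s r / \<bar>r - s\<bar>" for r
  unfolding dl_def by (simp add: sum_divide_distrib)
 ultimately show ?thesis by simp
qed

lemma n2_th_tendsto: "s : I ==> ((%r. n2 T (th s r)) \<longlongrightarrow> 0) (at s)"
 by (rule Lim_null_comparison[OF always_eventually dl_tendsto]) (simp_all add: n2_th)

definition X' :: "real => real => 'd rvec" where
 "X' s t = (SUM m:UNIV. cf' m s *R Vp (wf s) (om m) t)"

lemma Vp_continuous: "continuous_on {0..T} (Vp (wf s) (om m))"
 by (rule Vp_continuous_on[OF L2_wf L2om])

lemma Xp_continuous: "continuous_on {0..T} (Xp (wf s))"
 by (rule Xp_continuous_on[OF L2_wf])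

text \<open>The remainder of the first variation is quadratic in the control increment; after
  division by \<open>r - s\<close> it is bounded by \<open>dl s r\<close> times a convergent
  quotient. The linear part splits along the profiles \<open>om m\<close>.\<close>

lemma D_X: "D (%s. Xp (wf s)) X'"
 unfolding D_def
proof (intro ballI conjI)
 fix s assume s: "s : I"
 show "continuous_on {0..T} (Xp (wf s))" by (rule Xp_continuous)
 show cX': "continuous_on {0..T} (X' s)" unfolding X'_def[abs_def] by (intro continuous_intros Vp_continuous)
 obtain C where C: "C > 0" "!!eta t. L2 T eta ==> t : {0..T} ==>
  norm (Xp (%t. wf s t + eta t) t - Xp (wf s) t - Vp (wf s) eta t) <= C * (n2 T eta)^2"
  using Xp_derivative_bound[OF L2_wf[of s]] by blast
 have rem: "uniform_limit {0..T} (%r t. (1 / (r - s)) *R (Xp (wf r) t - Xp (wf s) t - Vp (wf s) (th s r) t)) (%t. 0) (at s)"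
 proof (rule uniform_limit_bound)
  have "((%r. C * (dl s r * (dl s r / \<bar>r - s\<bar>))) \<longlongrightarrow> C * (0 * (SUM m:UNIV. \<bar>cf' m s\<bar> * n2 T (om m)))) (at s)"
   by (intro tendsto_mult_left tendsto_mult dl_tendsto dl_quotient s)
  then show "((%r. C * (dl s r * (dl s r / \<bar>r - s\<bar>))) \<longlongrightarrow> 0) (at s)" by simp
  show "\<forall>\<^sub>F r in at s. ALL t:{0..T}. norm ((1 / (r - s)) *R (Xp (wf r) t - Xp (wf s) t - Vp (wf s) (th s r) t) - 0) <= C * (dl s r * (dl s r / \<bar>r - s\<bar>))"
  proof (intro always_eventually allI ballI)
   fix r t assume t: "t : {0..T}"
   have "norm (Xp (wf r) t - Xp (wf s) t - Vp (wf s) (th s r) t) <= C * (n2 T (th s r))^2"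
    using C(2)[OF L2_th[of s r] t] unfolding wf_th .
   also have "... <= C * (dl s r)^2" using C(1) n2_th by (intro mult_left_mono power_mono) auto
   finally have "norm (Xp (wf r) t - Xp (wf s) t - Vp (wf s) (th s r) t) / \<bar>r - s\<bar> <= C * (dl s r)^2 / \<bar>r - s\<bar>"
    by (intro divide_right_mono) auto
   then show "norm ((1 / (r - s)) *R (Xp (wf r) t - Xp (wf s) t - Vp (wf s) (th s r) t) - 0) <= C * (dl s r * (dl s r / \<bar>r - s\<bar>))"
    by (simp add: power2_eq_square)
  qed
 qed
 have lin: "uniform_limit {0..T} (%r t. SUM m:UNIV. ((cf m r - cf m s) / (r - s)) *R Vp (wf s) (om m) t) (X' s) (at s)"
  unfolding X'_def[abs_def]
 proof (intro uniform_limit_sum uniform_limit_bilinear[OF bounded_bilinear_scaleR] uniform_limit_const Vp_continuous continuous_on_const)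
  fix m
  show "uniform_limit {0..T} (%r t. (cf m r - cf m s) / (r - s)) (%t. cf' m s) (at s)"
  proof (rule uniform_limitI)
   fix e :: real assume "e > 0"
   then have "\<forall>\<^sub>F r in at s. dist ((cf m r - cf m s) / (r - s)) (cf' m s) < e"
    using cf_quotient[OF s, of m] unfolding tendsto_iff by blast
   then show "\<forall>\<^sub>F r in at s. ALL t:{0..T}. dist ((cf m r - cf m s) / (r - s)) (cf' m s) < e" by eventually_elim auto
  qed
 qed
 from uniform_limit_add[OF rem lin]
 show "uniform_limit {0..T} (%r t. (1 / (r - s)) *R (Xp (wf r) t - Xp (wf s) t)) (X' s) (at s)"
  unfolding add_0
 proof (rule uniform_limit_transform)
  have V: "Vp (wf s) (th s r) t = (SUM m:UNIV. (cf m r - cf m s) *R Vp (wf s) (om m) t)" if "t : {0..T}" for r t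
   unfolding th_def by (simp add: Vp_sum L2_wf that L2_scaleR L2om Vp_scaleR del: atLeastAtMost_iff)
  have S: "(SUM m:UNIV. ((cf m r - cf m s) / (r - s)) *R v m) = (1 / (r - s)) *R (SUM m:UNIV. (cf m r - cf m s) *R v m)"
   for r and v :: "'n => 'd rvec" by (simp add: scaleR_sum_right)
  show "\<forall>\<^sub>F r in at s. ALL t:{0..T}. (1 / (r - s)) *R (Xp (wf r) t - Xp (wf s) t - Vp (wf s) (th s r) t) +
    (SUM m:UNIV. ((cf m r - cf m s) / (r - s)) *R Vp (wf s) (om m) t) = (1 / (r - s)) *R (Xp (wf r) t - Xp (wf s) t)"
   by (intro always_eventually allI ballI) (simp add: V S flip: scaleR_add_right del: atLeastAtMost_iff)
 qed
qed

text \<open>Chain rule uniformly in time: the quotients \<open>q\<close> are uniformly bounded near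
  \<open>s\<close>, so the second-order remainder of \<open>f\<close> carries a factor
  \<open>(r - s)^2\<close>.\<close>

lemma D_compose:
 fixes f :: "'d rvec => 'e::euclidean_space"
 assumes f: "Cb_infinity f"
 shows "D (%s t. f (Xp (wf s) t)) (%s t. frechet_derivative f (at (Xp (wf s) t)) (X' s t))"
 unfolding D_def
proof (intro ballI conjI)
 fix s assume s: "s : I"
 note cX' = D_continuous(2)[OF D_X s]
 show "continuous_on {0..T} (%t. f (Xp (wf s) t))"
  by (rule continuous_on_compose2[OF Cb_infinity_continuous_on[OF f, of UNIV] Xp_continuous]) auto
 show "continuous_on {0..T} (%t. frechet_derivative f (at (Xp (wf s) t)) (X' s t))"
  by (subst Cb_infinity_expand[OF f])
   (intro continuous_intros cX' continuous_on_compose2[OF Cb_infinity_continuous_on[OF Cb_infinity_dir[OF f], of UNIV] Xp_continuous], auto)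
 obtain C1 where C1: "C1 > 0" "!!x v. norm (frechet_derivative f (at x) v) <= C1 * norm v"
  using Cb_infinity_derivative_bound[OF f] by blast
 obtain C2 where C2: "C2 > 0" "!!x z. norm (f z - f x - frechet_derivative f (at x) (z - x)) <= C2 * (norm (z - x))^2"
  using Cb_infinity_taylor1[OF f] by blast
 define q where "q r t = (1 / (r - s)) *R (Xp (wf r) t - Xp (wf s) t)" for r t
 have q: "uniform_limit {0..T} q (X' s) (at s)" unfolding q_def using D_limit[OF D_X s] .
 obtain M where M: "M > 0" "!!t. t : {0..T} ==> norm (X' s t) <= M"
  using continuous_on_imp_bounded_image[OF cX'] unfolding bounded_pos by blast
 have lin: "uniform_limit {0..T} (%r t. frechet_derivative f (at (Xp (wf s) t)) (q r t)) (%t. frechet_derivative f (at (Xp (wf s) t)) (X' s t)) (at s)"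
 proof (rule uniform_limitI)
  fix e :: real assume e: "e > 0"
  have "\<forall>\<^sub>F r in at s. ALL t:{0..T}. dist (q r t) (X' s t) < e / C1" using uniform_limitD[OF q, of "e / C1"] e C1 by simp
  then show "\<forall>\<^sub>F r in at s. ALL t:{0..T}. dist (frechet_derivative f (at (Xp (wf s) t)) (q r t)) (frechet_derivative f (at (Xp (wf s) t)) (X' s t)) < e"
  proof eventually_elim
   case (elim r)
   show ?case
   proof
    fix t assume "t : {0..T}"
    then have "C1 * norm (q r t - X' s t) < e" using elim C1(1) by (fastforce simp: dist_norm field_simps)
    then show "dist (frechet_derivative f (at (Xp (wf s) t)) (q r t)) (frechet_derivative f (at (Xp (wf s) t)) (X' s t)) < e"
     using C1(2)[of "Xp (wf s) t" "q r t - X' s t"] linear_diff[OF Cb_infinity_linear[OF f]] by (simp add: dist_norm)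
   qed
  qed
 qed
 have rem: "uniform_limit {0..T} (%r t. (1 / (r - s)) *R (f (Xp (wf r) t) - f (Xp (wf s) t) - frechet_derivative f (at (Xp (wf s) t)) (Xp (wf r) t - Xp (wf s) t))) (%t. 0) (at s)"
 proof (rule uniform_limit_bound)
  have "((%r. C2 * \<bar>r - s\<bar> * (M + 1)^2) \<longlongrightarrow> C2 * \<bar>s - s\<bar> * (M + 1)^2) (at s)" by (intro tendsto_intros)
  then show "((%r. C2 * \<bar>r - s\<bar> * (M + 1)^2) \<longlongrightarrow> 0) (at s)" by simp
  have "\<forall>\<^sub>F r in at s. ALL t:{0..T}. dist (q r t) (X' s t) < 1" using uniform_limitD[OF q, of 1] by simp
  with eventually_I[OF s]
  show "\<forall>\<^sub>F r in at s. ALL t:{0..T}. norm ((1 / (r - s)) *R (f (Xp (wf r) t) - f (Xp (wf s) t) - frechet_derivative f (at (Xp (wf s) t)) (Xp (wf r) t - Xp (wf s) t)) - 0)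
   <= C2 * \<bar>r - s\<bar> * (M + 1)^2"
  proof eventually_elim
   case (elim r)
   show ?case
   proof
    fix t assume t: "t : {0..T}"
    have "norm (q r t) <= norm (q r t - X' s t) + norm (X' s t)" using norm_triangle_sub by (metis add.commute)
    then have qb: "norm (q r t) <= M + 1" using elim(2) M(2)[OF t] t by (fastforce simp: dist_norm)
    have eq: "Xp (wf r) t - Xp (wf s) t = (r - s) *R q r t" unfolding q_def using elim by simp
    have "norm (f (Xp (wf r) t) - f (Xp (wf s) t) - frechet_derivative f (at (Xp (wf s) t)) (Xp (wf r) t - Xp (wf s) t)) <= C2 * (norm ((r - s) *R q r t))^2"
     using C2(2)[of "Xp (wf r) t" "Xp (wf s) t"] unfolding eq .
    also have "... <= C2 * (\<bar>r - s\<bar> * (M + 1))^2"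
     using C2(1) qb by (intro mult_left_mono power_mono) (auto intro: mult_left_mono)
    finally have "norm (f (Xp (wf r) t) - f (Xp (wf s) t) - frechet_derivative f (at (Xp (wf s) t)) (Xp (wf r) t - Xp (wf s) t)) / \<bar>r - s\<bar>
      <= C2 * (\<bar>r - s\<bar> * (M + 1))^2 / \<bar>r - s\<bar>" by (intro divide_right_mono) auto
    also have "C2 * (\<bar>r - s\<bar> * (M + 1))^2 / \<bar>r - s\<bar> = C2 * \<bar>r - s\<bar> * (M + 1)^2"
     using elim by (simp add: power_mult_distrib power2_eq_square)
    finally show "norm ((1 / (r - s)) *R (f (Xp (wf r) t) - f (Xp (wf s) t) - frechet_derivative f (at (Xp (wf s) t)) (Xp (wf r) t - Xp (wf s) t)) - 0)
     <= C2 * \<bar>r - s\<bar> * (M + 1)^2" by simp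
   qed
  qed
 qed
 from uniform_limit_add[OF rem lin]
 show "uniform_limit {0..T} (%r t. (1 / (r - s)) *R (f (Xp (wf r) t) - f (Xp (wf s) t))) (%t. frechet_derivative f (at (Xp (wf s) t)) (X' s t)) (at s)"
  unfolding add_0
  by (rule uniform_limit_transform)
   (simp add: q_def linear_scale[OF Cb_infinity_linear[OF f]] flip: scaleR_add_right)
qed

text \<open>The part of the linearised coefficient \<open>Am\<close> that multiplies the rough
  weight \<open>om m t $ j\<close>; it is continuous in time and differentiable in
  \<open>s\<close>.\<close>

definition DZ :: "'n => 'j => real => real => real^'d^'d" where
 "DZ m j s t = cf m s *R Dm (S j) (Xp (wf s) t)"

definition DZ' :: "'n => 'j => real => real => real^'d^'d" where
 "DZ' m j s t = cf' m s *R Dm (S j) (Xp (wf s) t) + cf m s *R frechet_derivative (Dm (S j)) (at (Xp (wf s) t)) (X' s t)"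

lemma D_cf: "D (%s t. cf m s) (%s t. cf' m s)"
 by (rule D_fun) (use cf' in \<open>simp add: has_real_derivative_iff_has_vector_derivative\<close>)

lemma D_DZ: "D (DZ m j) (DZ' m j)"
 unfolding DZ_def[abs_def] DZ'_def[abs_def]
 by (rule D_bilinear[OF bounded_bilinear_scaleR D_cf D_compose[OF Cb_infinity_Dm[OF Cb]]])

lemma Am_wf: "Am (wf s) t = (SUM m:UNIV. SUM j:UNIV. om m t $ j *R DZ m j s t)"
proof -
 have "Am (wf s) t = (SUM j:UNIV. SUM m:UNIV. om m t $ j *R DZ m j s t)"
  unfolding Am_def dfld_def DZ_def by (simp add: wf_def scaleR_sum_left mult.commute)
 then show ?thesis using sum.swap by simp
qed

text \<open>Variation of constants for the differentiated Jacobian equation: the limit of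
  \<open>Jm_difference\<close> after division by \<open>r - s\<close>.\<close>

definition J' :: "real => real => real^'d^'d" where
 "J' s t = Jm (wf s) t ** (SUM m:UNIV. SUM j:UNIV. integral {0..t} (%tau. om m tau $ j *R (Km (wf s) tau ** DZ' m j s tau ** Jm (wf s) tau)))"

lemma Jm_continuous: "continuous_on {0..T} (Jm (wf s))"
 by (rule Jm_continuous_on[OF L2_wf])

lemma Km_continuous: "continuous_on {0..T} (Km (wf s))"
 by (rule Km_continuous_on[OF L2_wf])

lemmas matrix_mult_continuous = bounded_bilinear.continuous_on[OF bilinear_mm]

text \<open>Product rule for \<open>Km (wf s) ** Jm (wf r)\<close> with different parameters: its
  density contains the coefficients only through their difference. The identity is exact, which
  leaves a division and a limit to take.\<close>

lemma Jm_difference: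
 assumes t: "t : {0..T}" and sr: "s : I" "r : I"
 shows "Jm (wf r) t - Jm (wf s) t = Jm (wf s) t ** (SUM m:UNIV. SUM j:UNIV.
  integral {0..t} (%tau. om m tau $ j *R (Km (wf s) tau ** (DZ m j r tau - DZ m j s tau) ** Jm (wf r) tau)))"
proof -
 note bb = bilinear_mm
 define E where "E m j tau = Km (wf s) tau ** (DZ m j r tau - DZ m j s tau) ** Jm (wf r) tau" for m j tau
 have cE: "continuous_on {0..T} (E m j)" for m j
  unfolding E_def by (intro matrix_mult_continuous continuous_on_diff Km_continuous Jm_continuous D_continuous(1)[OF D_DZ] sr)
 have "indef T (%tau. - (Km (wf s) tau ** Am (wf s) tau) ** Jm (wf r) tau + Km (wf s) tau ** (Am (wf r) tau ** Jm (wf r) tau)) (%tau. Km (wf s) tau ** Jm (wf r) tau)"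
  by (rule indef_bilinear[OF bb Km(1)[OF L2_wf] Jm(1)[OF L2_wf]])
 from indefD[OF this t] have "Km (wf s) t ** Jm (wf r) t = mat 1 + integral {0..t} (%tau. - (Km (wf s) tau ** Am (wf s) tau) ** Jm (wf r) tau + Km (wf s) tau ** (Am (wf r) tau ** Jm (wf r) tau))"
  using Km(2)[OF L2_wf] Jm(2)[OF L2_wf] by simp
 also have "(%tau. - (Km (wf s) tau ** Am (wf s) tau) ** Jm (wf r) tau + Km (wf s) tau ** (Am (wf r) tau ** Jm (wf r) tau)) =
  (%tau. SUM m:UNIV. SUM j:UNIV. om m tau $ j *R E m j tau)"
 proof
  fix tau
  have "- (Km (wf s) tau ** Am (wf s) tau) ** Jm (wf r) tau + Km (wf s) tau ** (Am (wf r) tau ** Jm (wf r) tau) = Km (wf s) tau ** (Am (wf r) tau - Am (wf s) tau) ** Jm (wf r) tau"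
   by (simp add: bounded_bilinear.diff_left[OF bb] bounded_bilinear.diff_right[OF bb] matrix_minus_left matrix_mul_assoc)
  also have "Am (wf r) tau - Am (wf s) tau = (SUM m:UNIV. SUM j:UNIV. om m tau $ j *R (DZ m j r tau - DZ m j s tau))"
   unfolding Am_wf by (simp add: scaleR_diff_right sum_subtractf)
  also have "Km (wf s) tau ** ... ** Jm (wf r) tau = (SUM m:UNIV. SUM j:UNIV. om m tau $ j *R E m j tau)"
   unfolding E_def by (simp add: bounded_bilinear.sum_left[OF bb] bounded_bilinear.sum_right[OF bb]
    bounded_bilinear.scaleR_left[OF bb] bounded_bilinear.scaleR_right[OF bb])
  finally show "- (Km (wf s) tau ** Am (wf s) tau) ** Jm (wf r) tau + Km (wf s) tau ** (Am (wf r) tau ** Jm (wf r) tau) = (SUM m:UNIV. SUM j:UNIV. om m tau $ j *R E m j tau)" .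
 qed
 also have "integral {0..t} (%tau. SUM m:UNIV. SUM j:UNIV. om m tau $ j *R E m j tau) = (SUM m:UNIV. SUM j:UNIV. integral {0..t} (%tau. om m tau $ j *R E m j tau))"
  by (subst Henstock_Kurzweil_Integration.integral_sum)
   (auto intro!: integrable_sum weighted_integrable[OF L2_vec_nth[OF L2om] cE] sum.cong Henstock_Kurzweil_Integration.integral_sum simp del: atLeastAtMost_iff simp: t)
 finally have "Km (wf s) t ** Jm (wf r) t = mat 1 + (SUM m:UNIV. SUM j:UNIV. integral {0..t} (%tau. om m tau $ j *R E m j tau))" .
 then have "Jm (wf s) t ** (Km (wf s) t ** Jm (wf r) t) = Jm (wf s) t + Jm (wf s) t ** (SUM m:UNIV. SUM j:UNIV. integral {0..t} (%tau. om m tau $ j *R E m j tau))"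
  by (simp add: bounded_bilinear.add_right[OF bb])
 moreover have "Jm (wf s) t ** (Km (wf s) t ** Jm (wf r) t) = Jm (wf r) t"
  by (simp add: matrix_mul_assoc Jm_Km[OF L2_wf t])
 ultimately show ?thesis unfolding E_def by (simp add: algebra_simps)
qed

lemma J_tendsto: "s : I ==> uniform_limit {0..T} (%r. Jm (wf r)) (Jm (wf s)) (at s)"
 using Jm_uniform_limit[OF L2_wf[of s] L2_th[of s] n2_th_tendsto] unfolding wf_th by blast

lemma K_tendsto: "s : I ==> uniform_limit {0..T} (%r. Km (wf r)) (Km (wf s)) (at s)"
 using Km_uniform_limit[OF L2_wf[of s] L2_th[of s] n2_th_tendsto] unfolding wf_th by blast

lemma J'_integrand_continuous: "s : I ==> continuous_on {0..T} (%tau. Km (wf s) tau ** DZ' m j s tau ** Jm (wf s) tau)"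
 by (intro matrix_mult_continuous Km_continuous Jm_continuous D_continuous(2)[OF D_DZ])

lemma J'_continuous: "s : I ==> continuous_on {0..T} (J' s)"
 unfolding J'_def[abs_def]
 by (intro matrix_mult_continuous Jm_continuous continuous_on_sum indefinite_integral_continuous_1
  weighted_integrable[OF L2_vec_nth[OF L2om] J'_integrand_continuous]) (use T in auto)

lemma D_J: "D (%s. Jm (wf s)) J'"
 unfolding D_def
proof (intro ballI conjI)
 note bb = bilinear_mm
 fix s assume s: "s : I"
 show "continuous_on {0..T} (Jm (wf s))" by (rule Jm_continuous)
 show "continuous_on {0..T} (J' s)" by (rule J'_continuous[OF s])
 define q where "q m j r tau = Km (wf s) tau ** ((1 / (r - s)) *R (DZ m j r tau - DZ m j s tau)) ** Jm (wf r) tau" for m j r tau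
 have uq: "uniform_limit {0..T} (q m j) (%tau. Km (wf s) tau ** DZ' m j s tau ** Jm (wf s) tau) (at s)" for m j
  unfolding q_def[abs_def]
  by (intro uniform_limit_bilinear[OF bb] uniform_limit_const D_limit[OF D_DZ s] J_tendsto[OF s] matrix_mult_continuous
   Km_continuous Jm_continuous D_continuous(2)[OF D_DZ s])
 have cq: "\<forall>\<^sub>F r in at s. continuous_on {0..T} (q m j r)" for m j
  using eventually_I[OF s] unfolding q_def
  by eventually_elim (intro matrix_mult_continuous continuous_intros Km_continuous Jm_continuous D_continuous(1)[OF D_DZ] s, auto)
 have "uniform_limit {0..T} (%r t. Jm (wf s) t ** (SUM m:UNIV. SUM j:UNIV. integral {0..t} (%tau. om m tau $ j *R q m j r tau))) (J' s) (at s)"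
  unfolding J'_def[abs_def]
  by (intro uniform_limit_bilinear[OF bb] uniform_limit_const uniform_limit_sum uniform_limit_weighted_integral[OF L2_vec_nth[OF L2om] T0 uq cq]
   J'_integrand_continuous[OF s] Jm_continuous continuous_on_sum indefinite_integral_continuous_1
   weighted_integrable[OF L2_vec_nth[OF L2om] J'_integrand_continuous[OF s]]) (use T in auto)
 then show "uniform_limit {0..T} (%r t. (1 / (r - s)) *R (Jm (wf r) t - Jm (wf s) t)) (J' s) (at s)"
 proof (rule uniform_limit_transform)
  show "\<forall>\<^sub>F r in at s. ALL t:{0..T}. Jm (wf s) t ** (SUM m:UNIV. SUM j:UNIV. integral {0..t} (%tau. om m tau $ j *R q m j r tau)) = (1 / (r - s)) *R (Jm (wf r) t - Jm (wf s) t)"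
   using eventually_I[OF s]
  proof eventually_elim
   case (elim r)
   have q: "om m tau $ j *R q m j r tau = (1 / (r - s)) *R (om m tau $ j *R (Km (wf s) tau ** (DZ m j r tau - DZ m j s tau) ** Jm (wf r) tau))" for m j tau
    unfolding q_def by (simp add: bounded_bilinear.scaleR_left[OF bb] bounded_bilinear.scaleR_right[OF bb])
   show ?case
   proof
    fix t assume t: "t : {0..T}"
    show "Jm (wf s) t ** (SUM m:UNIV. SUM j:UNIV. integral {0..t} (%tau. om m tau $ j *R q m j r tau)) = (1 / (r - s)) *R (Jm (wf r) t - Jm (wf s) t)"
     unfolding Jm_difference[OF t s conjunct1[OF elim]] q integral_cmul scaleR_sum_right[symmetric]
      bounded_bilinear.scaleR_right[OF bb] ..
   qed
  qed
 qed
qed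

text \<open>\<open>Km\<close> is the inverse of \<open>Jm\<close>, and the difference of two
  inverses is expressed through the difference of the matrices.\<close>

lemma D_K: "D (%s. Km (wf s)) (%s t. - (Km (wf s) t ** J' s t ** Km (wf s) t))"
 unfolding D_def
proof (intro ballI conjI)
 note bb = bilinear_mm
 fix s assume s: "s : I"
 show "continuous_on {0..T} (Km (wf s))" by (rule Km_continuous)
 show "continuous_on {0..T} (%t. - (Km (wf s) t ** J' s t ** Km (wf s) t))"
  by (intro continuous_on_minus matrix_mult_continuous Km_continuous J'_continuous[OF s])
 have "uniform_limit {0..T} (%r t. - (Km (wf r) t ** ((1 / (r - s)) *R (Jm (wf r) t - Jm (wf s) t)) ** Km (wf s) t))
   (%t. - (Km (wf s) t ** J' s t ** Km (wf s) t)) (at s)"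
  by (intro uniform_limit_uminus uniform_limit_bilinear[OF bb] uniform_limit_const D_limit[OF D_J s] K_tendsto[OF s]
   matrix_mult_continuous Km_continuous J'_continuous[OF s])
 then show "uniform_limit {0..T} (%r t. (1 / (r - s)) *R (Km (wf r) t - Km (wf s) t)) (%t. - (Km (wf s) t ** J' s t ** Km (wf s) t)) (at s)"
 proof (rule uniform_limit_transform, intro always_eventually allI ballI)
  fix r t assume t: "t : {0..T}"
  have "Km (wf r) t ** (Jm (wf r) t - Jm (wf s) t) ** Km (wf s) t = Km (wf s) t - Km (wf r) t"
  proof -
   have "Km (wf r) t ** (Jm (wf r) t - Jm (wf s) t) ** Km (wf s) t = Km (wf r) t ** Jm (wf r) t ** Km (wf s) t - Km (wf r) t ** (Jm (wf s) t ** Km (wf s) t)"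
    by (simp add: bounded_bilinear.diff_left[OF bb] bounded_bilinear.diff_right[OF bb] matrix_mul_assoc)
   then show ?thesis by (simp add: Km_Jm[OF L2_wf t] Jm_Km[OF L2_wf t])
  qed
  then show "- (Km (wf r) t ** ((1 / (r - s)) *R (Jm (wf r) t - Jm (wf s) t)) ** Km (wf s) t) = (1 / (r - s)) *R (Km (wf r) t - Km (wf s) t)"
   by (simp add: bounded_bilinear.scaleR_left[OF bb] bounded_bilinear.scaleR_right[OF bb] flip: scaleR_minus_right)
 qed
qed

section \<open>Closure of the class under differentiation\<close>

lemma memb_Vp: "L2 T eta ==> memb (%s t. Vp (wf s) eta t)"
proof -
 assume eta: "L2 T eta"
 have "memb (%s t. Jm (wf s) t *v (SUM j:UNIV. integral {0..t} (%tau. eta tau $ j *R (Km (wf s) tau *v S j (Xp (wf s) tau)))))"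
  by (intro memb_bilinear[OF bilinear_mv] memb_J memb_sum memb_int memb_K memb_S L2_vec_nth eta KS_continuous_on L2_wf)
 then show ?thesis by (rule memb_cong) (simp add: Vp_expand L2_wf eta)
qed

lemma memb_DS: "memb (%s t. Dm (S j) (Xp (wf s) t))"
proof -
 have "memb (%s t. frechet_derivative (S j) (at (Xp (wf s) t)) v)" for v using memb_iter[of "[v]" j] by simp
 then show ?thesis unfolding Dm_as_sum by (intro memb_sum memb_linear[OF bounded_linear_column_embedding])
qed

text \<open>The derivatives of the coefficients are now taken from the class. For the correction
  curve this will hold because \<open>y'\<close> solves a linear system whose coefficients belong to
  it.\<close>

context
 assumes cf'_memb: "!!m. memb (%s t. cf' m s)"
begin

lemma memb_X': "memb X'"
 unfolding X'_def[abs_def] by (intro memb_sum memb_scaleR cf'_memb memb_Vp L2om)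

lemma memb_iter': "memb (%s t. frechet_derivative (iter_dir_deriv vs (S j)) (at (Xp (wf s) t)) (X' s t))"
proof -
 have "memb (%s t. frechet_derivative (iter_dir_deriv vs (S j)) (at (Xp (wf s) t)) b)" for b using memb_iter[of "b # vs" j] by simp
 moreover have "memb (%s t. X' s t \<bullet> b)" if "b : Basis" for b using memb_X' that unfolding memb_def[of X'] memb_real by blast
 ultimately show ?thesis by (subst Cb_infinity_expand[OF Cb_infinity_iter[OF Cb]]) (intro memb_sum memb_scaleR)
qed

text \<open>The derivative of the matrix-valued \<open>Dm (S j)\<close> is assembled column by
  column from derivatives of \<open>iter_dir_deriv\<close>, to which \<open>memb_iter'\<close>
  applies.\<close>

lemma memb_DZ': "memb (DZ' m j)"
proof -
 have f: "memb (%s t. frechet_derivative (Dm (S j)) (at (Xp (wf s) t)) (X' s t))"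
 proof -
  define L :: "'d => 'd rvec => real^'d^'d" where "L b = (%y. \<chi> a b'. if b' = b then y $ a else 0)" for b
  have L: "bounded_linear (L b)" for b unfolding L_def by (rule bounded_linear_column_embedding)
  have fd: "frechet_derivative (Dm (S j)) (at x) = (%v. SUM b:UNIV. L b (frechet_derivative (iter_dir_deriv [axis b 1] (S j)) (at x) v))" for x
  proof (rule frechet_derivative_at[symmetric])
   have "Dm (S j) = (%x. SUM b:UNIV. L b (iter_dir_deriv [axis b 1] (S j) x))"
    unfolding Dm_as_sum[abs_def] L_def iter_dir_deriv.simps ..
   then show "(Dm (S j) has_derivative (%v. SUM b:UNIV. L b (frechet_derivative (iter_dir_deriv [axis b 1] (S j)) (at x) v))) (at x)"
    by (elim ssubst) (intro has_derivative_sum bounded_linear.has_derivative[OF L] Cb_infinity_has_derivative Cb_infinity_iter Cb)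
  qed
  show ?thesis unfolding fd by (intro memb_sum memb_linear[OF L] memb_iter')
 qed
 show ?thesis unfolding DZ'_def[abs_def]
  by (intro memb_add memb_scaleR cf'_memb memb_DS f memb_gen cf_Gen)
qed

lemma memb_J': "memb J'"
 unfolding J'_def[abs_def]
 by (intro memb_bilinear[OF bilinear_mm] memb_J memb_K memb_sum memb_int memb_DZ' L2_vec_nth L2om J'_integrand_continuous)

lemma memb_K': "memb (%s t. - (Km (wf s) t ** J' s t ** Km (wf s) t))"
 by (intro memb_minus memb_bilinear[OF bilinear_mm] memb_K memb_J')

text \<open>Each generating operation has a derivative formula that stays in the class; the
  primitive functions are covered by the hypothesis on \<open>Gen\<close>.\<close>

lemma A_closed_under_differentiation:
 assumes Gen: "!!g. g : Gen ==> EX g'. memb (%s t. g' s) & (ALL s:I. (g has_real_derivative g' s) (at s))"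
 shows "X : Ac ==> EX X':Ac. D X X'"
proof (induction rule: Ac.induct)
 case (gen g)
 then obtain g' where g': "memb (%s t. g' s)" "!!s. s : I ==> (g has_real_derivative g' s) (at s)" using Gen by blast
 then have "D (%s t. g s) (%s t. g' s)" by (intro D_fun) (simp add: has_real_derivative_iff_has_vector_derivative)
 then show ?case using g'(1) unfolding memb_real by blast
next
 case (const c)
 then show ?case using D_const Ac.const by blast
next
 case (iter vs j i)
 have "D (%s t. iter_dir_deriv vs (S j) (Xp (wf s) t) \<bullet> i) (%s t. frechet_derivative (iter_dir_deriv vs (S j)) (at (Xp (wf s) t)) (X' s t) \<bullet> i)"
  by (rule D_linear[OF bounded_linear_inner_left D_compose[OF Cb_infinity_iter[OF Cb]]])
 moreover have "memb (%s t. frechet_derivative (iter_dir_deriv vs (S j)) (at (Xp (wf s) t)) (X' s t) \<bullet> i)"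
  by (rule memb_linear[OF bounded_linear_inner_left memb_iter'])
 ultimately show ?case unfolding memb_real by blast
next
 case (jac k)
 have "D (%s t. Jm (wf s) t \<bullet> k) (%s t. J' s t \<bullet> k)" by (rule D_linear[OF bounded_linear_inner_left D_J])
 moreover have "memb (%s t. J' s t \<bullet> k)" by (rule memb_linear[OF bounded_linear_inner_left memb_J'])
 ultimately show ?case unfolding memb_real by blast
next
 case (cojac k)
 have "D (%s t. Km (wf s) t \<bullet> k) (%s t. - (Km (wf s) t ** J' s t ** Km (wf s) t) \<bullet> k)" by (rule D_linear[OF bounded_linear_inner_left D_K])
 moreover have "memb (%s t. - (Km (wf s) t ** J' s t ** Km (wf s) t) \<bullet> k)" by (rule memb_linear[OF bounded_linear_inner_left memb_K'])
 ultimately show ?case unfolding memb_real by blast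
next
 case (add X Y)
 then show ?case using D_add Ac.add by blast
next
 case (mult X Y)
 then obtain X' Y' where *: "X' : Ac" "D X X'" "Y' : Ac" "D Y Y'" by blast
 have "D (%s t. X s t * Y s t) (%s t. X' s t * Y s t + X s t * Y' s t)" by (rule D_bilinear[OF bounded_bilinear_mult *(2,4)])
 moreover have "(%s t. X' s t * Y s t + X s t * Y' s t) : Ac" by (intro Ac.add Ac.mult * mult)
 ultimately show ?case by blast
next
 case (int X q)
 then obtain X' where "X' : Ac" "D X X'" by blast
 then show ?case using D_int[of X X' q] Ac.int[of X' q] int(2) by auto
next
 case (endp X)
 then show ?case using D_endp Ac.endp by blast
next
 case (agree X Y)
 then show ?case using D_cong by blast
qed

lemma memb_derivative:
 fixes X :: "real => real => 'a::euclidean_space"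
 assumes Gen: "!!g. g : Gen ==> EX g'. memb (%s t. g' s) & (ALL s:I. (g has_real_derivative g' s) (at s))"
  and X: "memb X"
 shows "EX X'. memb X' & D X X'"
proof -
 have "ALL i:Basis. EX Y. Y : Ac & D (%s t. X s t \<bullet> i) Y"
  using A_closed_under_differentiation[OF Gen] X unfolding memb_def by blast
 then obtain Y where Y: "!!i. i : Basis ==> Y i : Ac" "!!i. i : Basis ==> D (%s t. X s t \<bullet> i) (Y i)" by metis
 have "D (%s t. SUM i:Basis. (X s t \<bullet> i) *R i) (%s t. SUM i:Basis. Y i s t *R i)"
  by (intro D_sum D_linear[OF bounded_linear_scaleR_left Y(2)])
 moreover have "memb (%s t. SUM i:Basis. Y i s t *R i)"
  by (intro memb_sum memb_linear[OF bounded_linear_scaleR_left]) (simp add: memb_real Y)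
 ultimately show ?thesis by (auto simp: euclidean_representation)
qed

text \<open>An explicit derivative of \<open>Vp\<close> inside the class, without appeal to the
  general closure result: the hypothesis on \<open>Gen\<close> in that result is itself verified
  with its help.\<close>

lemma D_Vp:
 assumes eta: "L2 T eta"
 obtains V' where "memb V'" "D (%s t. Vp (wf s) eta t) V'"
proof -
 note mv = bilinear_mv
 define k' where "k' j s t = - (Km (wf s) t ** J' s t ** Km (wf s) t) *v S j (Xp (wf s) t) + Km (wf s) t *v frechet_derivative (S j) (at (Xp (wf s) t)) (X' s t)" for j s t
 have k': "D (%s t. Km (wf s) t *v S j (Xp (wf s) t)) (k' j)" for j
  unfolding k'_def[abs_def] by (rule D_bilinear[OF mv D_K D_compose[OF Cb]])
 have mk': "memb (k' j)" for j
  unfolding k'_def[abs_def] using memb_iter'[of "[]" j] by (intro memb_add memb_bilinear[OF mv] memb_K' memb_S memb_K) simp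
 define V' where "V' s t = J' s t *v (SUM j:UNIV. integral {0..t} (%tau. eta tau $ j *R (Km (wf s) tau *v S j (Xp (wf s) tau)))) +
  Jm (wf s) t *v (SUM j:UNIV. integral {0..t} (%tau. eta tau $ j *R k' j s tau))" for s t
 have "D (%s t. Jm (wf s) t *v (SUM j:UNIV. integral {0..t} (%tau. eta tau $ j *R (Km (wf s) tau *v S j (Xp (wf s) tau))))) V'"
  unfolding V'_def[abs_def] by (intro D_bilinear[OF mv D_J] D_sum D_int k' L2_vec_nth eta)
 then have "D (%s t. Vp (wf s) eta t) V'" by (rule D_cong) (simp add: Vp_expand L2_wf eta)
 moreover have "memb V'"
  unfolding V'_def[abs_def]
  by (intro memb_add memb_bilinear[OF mv] memb_J memb_J' memb_sum memb_int memb_K memb_S L2_vec_nth eta KS_continuous_on L2_wf mk' D_continuous(2)[OF k'])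
 ultimately show ?thesis using that by blast
qed

end

end

section \<open>Smooth curves of admissible controls\<close>

context constrained_variation
begin

text \<open>Bootstrapping. Differentiating the constraint gives \<open>y' = - N b\<close>, with
  \<open>N\<close> the inverse of the matrix \<open>M\<close> of constrained variations. The
  functions \<open>b\<close> and \<open>M\<close> depend on \<open>s\<close> through first
  variations of the flow and lie in the class; adjoining the entries of \<open>N\<close>, with
  \<open>N' = - N M' N\<close>, keeps it closed under differentiation. \<open>Y 1 0 = 0\<close>
  because \<open>kap\<close> is tangent.\<close>

lemma smooth_correction:
 obtains ep and Y :: "nat => real => 'l rvec" where "ep > 0" "Y 0 0 = 0" "Y 1 0 = 0"
  "!!n s. \<bar>s\<bar> < ep ==> (Y n has_vector_derivative Y (Suc n) s) (at s)"
  "!!s. \<bar>s\<bar> < ep ==> Ph (s, Y 0 s) = P (Xp w0 T)"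
proof -
 obtain ep y where ep: "ep > 0" and y0: "y 0 = 0" and Phy: "!!s. \<bar>s\<bar> < ep ==> Ph (s, y s) = P (Xp w0 T)"
  and dy: "!!s. \<bar>s\<bar> < ep ==> EX y'. (y has_vector_derivative y') (at s) &
    P (Vp (W (s, y s)) kap T) + (SUM l:UNIV. y' $ l *R P (Vp (W (s, y s)) (ga l) T)) = 0"
  and inj: "!!s v. \<bar>s\<bar> < ep ==> (SUM l:UNIV. v $ l *R P (Vp (W (s, y s)) (ga l) T)) = 0 ==> v = 0"
  by (rule implicit_curve) blast
 define I where "I = {-ep<..<ep}"
 have I: "s : I \<longleftrightarrow> \<bar>s\<bar> < ep" for s unfolding I_def by auto
 have openI: "open I" unfolding I_def by simp
 have T': "T : {0..T}" using T by simp
 define b where "b s = P (Vp (W (s, y s)) kap T)" for s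
 define M :: "real => real^'l^'l" where "M s = (\<chi> i l. P (Vp (W (s, y s)) (ga l) T) $ i)" for s
 have Mv: "M s *v v = (SUM l:UNIV. v $ l *R P (Vp (W (s, y s)) (ga l) T))" for s v
  unfolding M_def by (simp add: vec_eq_iff matrix_vector_mult_def mult.commute)
 have "invertible (M s)" if "s : I" for s
 proof -
  have "inj ((*v) (M s))"
  proof (rule injI)
   fix u v assume "M s *v u = M s *v v"
   then have "M s *v (u - v) = 0" by (simp add: matrix_vector_mult_diff_distrib)
   then show "u = v" using inj[of s "u - v"] that unfolding Mv I by simp
  qed
  then show ?thesis
   using matrix_left_invertible_injective[of "M s"] invertible_left_inverse[of "M s"] by blast
 qed
 then have "ALL s. EX B. s : I --> B ** M s = mat 1 & M s ** B = mat 1" unfolding invertible_def by blast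
 then obtain N where N: "!!s. s : I ==> N s ** M s = mat 1" "!!s. s : I ==> M s ** N s = mat 1" by metis
 define y' where "y' s = - (N s *v b s)" for s
 have y': "(y has_vector_derivative y' s) (at s)" if s: "s : I" for s
 proof -
  obtain z where z: "(y has_vector_derivative z) (at s)" "b s + M s *v z = 0"
   using dy[of s] s unfolding I Mv b_def by blast
  have "M s *v z = - b s" using z(2) by (simp add: eq_neg_iff_add_eq_0 add.commute)
  then have "N s *v (M s *v z) = - (N s *v b s)" by (simp add: vec.neg)
  then have "z = y' s" unfolding y'_def by (simp add: matrix_vector_mul_assoc N s)
  then show ?thesis using z(1) by simp
 qed
 define om where "om m = (case m of None => w0 | Some None => kap | Some (Some l) => ga l)" for m
 define cf where "cf m s = (case m of None => 1 | Some None => s | Some (Some l) => y s $ l)" for m s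
 define cf' where "cf' m s = (case m of None => 0 | Some None => 1 | Some (Some l) => y' s $ l)" for m s
 \<comment> \<open>Primitive functions: the coefficients of the control, among them the components
   of \<open>y\<close>, and the entries of the inverse matrix.\<close>
 define Gen where "Gen = range cf \<union> (\<Union>i l. {%s. N s $ i $ l})"
 interpret F: smooth_family S x0 T om cf cf' Gen I
 proof unfold_locales
  show "L2 T (om m)" for m unfolding om_def using L2w0 L2kap L2ga by (auto split: option.split)
  show "open I" by (rule openI)
  show "cf m : Gen" for m unfolding Gen_def by auto
  show "(cf m has_real_derivative cf' m s) (at s)" if "s : I" for m s
   using bounded_linear.has_vector_derivative[OF bounded_linear_vec_nth y'[OF that]]
   by (cases m rule: option.exhaust; cases "the m")
    (auto simp: cf_def[abs_def] cf'_def has_real_derivative_iff_has_vector_derivative intro: has_vector_derivative_id)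
 qed
 have wf: "F.wf s = W (s, y s)" for s
  unfolding F.wf_def W_def[abs_def] dW_def sum_option by (simp add: om_def cf_def fun_eq_iff)
 have memb_V: "F.memb (%s t. P (Vp (W (s, y s)) eta T))" if "L2 T eta" for eta
  using F.memb_linear[OF P F.memb_endp[OF F.memb_Vp[OF that]]] unfolding wf .
 have memb_N: "F.memb (%s t. N s)"
  unfolding F.memb_def
 proof
  fix i :: "real^'l^'l" assume "i : Basis"
  then obtain j l where "i = axis j (axis l 1)" by (auto simp: Basis_vec_def)
  then have "(%s (t::real). N s \<bullet> i) = (%s t. N s $ j $ l)" by (simp add: inner_axis)
  moreover have "(%s t. N s $ j $ l) : F.Ac" by (rule F.Ac.gen) (auto simp: Gen_def)
  ultimately show "(%s t. N s \<bullet> i) : F.Ac" by simp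
 qed
 have memb_y': "F.memb (%s t. y' s)"
  unfolding y'_def b_def by (intro F.memb_minus F.memb_bilinear[OF bilinear_mv] memb_N memb_V L2kap)
 have memb_cf': "F.memb (%s t. cf' m s)" for m
 proof -
  consider "m = None" | "m = Some None" | l where "m = Some (Some l)" by (metis not_None_eq)
  then show ?thesis
  proof cases
   case 3
   then show ?thesis using F.memb_linear[OF bounded_linear_vec_nth memb_y'] by (simp add: cf'_def)
  qed (simp_all add: cf'_def F.memb_const)
 qed
 have Gen: "EX g'. F.memb (%s t. g' s) & (ALL s:I. (g has_real_derivative g' s) (at s))" if g: "g : Gen" for g
 proof -
  consider m where "g = cf m" | i l where "g = (%s. N s $ i $ l)" using g unfolding Gen_def by blast
  then show ?thesis
  proof cases
   case 1
   then show ?thesis using memb_cf'[of m] F.cf'[of _ m] by blast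
  next
   case (2 i l)
   have "EX V'. F.memb V' & F.D (%s t. Vp (F.wf s) (ga l) t) V'" for l
    by (rule F.D_Vp[OF memb_cf' L2ga[of l]]) blast
   then obtain V' where V': "!!l. F.memb (V' l)" "!!l. F.D (%s t. Vp (F.wf s) (ga l) t) (V' l)" by metis
   define L :: "'l => real^'l => real^'l^'l" where "L l = (%x. \<chi> a b. if b = l then x $ a else 0)" for l
   have L: "bounded_linear (L l)" for l unfolding L_def by (rule bounded_linear_column_embedding)
   have "M s = (SUM l:UNIV. L l (P (Vp (F.wf s) (ga l) T)))" for s
    unfolding wf M_def L_def by (simp add: vec_eq_iff)
   then have M: "M = (%s. SUM l:UNIV. L l (P (Vp (F.wf s) (ga l) T)))" by blast
   define M' where "M' s = (SUM l:UNIV. L l (P (V' l s T)))" for s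
   have "F.D (%s t. M s) (%s t. M' s)"
    unfolding M M'_def by (intro F.D_sum F.D_linear[OF L] F.D_linear[OF P] F.D_endp V')
   then have M': "(M has_vector_derivative M' s) (at s)" if "s : I" for s
    using F.D_imp_derivative[OF _ that T'] by blast
   have memb_M': "F.memb (%s t. M' s)"
    unfolding M'_def by (intro F.memb_sum F.memb_linear[OF L] F.memb_linear[OF P] F.memb_endp V')
   define N' where "N' s = - (N s ** M' s ** N s)" for s
   have "(N has_vector_derivative N' s) (at s)" if "s : I" for s
    unfolding N'_def by (rule matrix_inverse_has_vector_derivative[OF M'[OF that] openI that N])
   then have "(g has_real_derivative N' s $ i $ l) (at s)" if "s : I" for s
    unfolding 2 has_real_derivative_iff_has_vector_derivative using that
    by (intro bounded_linear.has_vector_derivative[OF bounded_linear_vec_nth]) auto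
   moreover have "F.memb (%s t. N' s $ i $ l)"
    unfolding N'_def
    by (intro F.memb_linear[OF bounded_linear_vec_nth] F.memb_minus F.memb_bilinear[OF bilinear_mm] memb_N memb_M')
   ultimately show ?thesis by (intro exI[of _ "%s. N' s $ i $ l"] conjI ballI) auto
  qed
 qed
 have memb_y: "F.memb (%s t. y s)"
  unfolding F.memb_def
 proof
  fix i :: "'l rvec" assume "i : Basis"
  then obtain l where i: "i = axis l 1" by (auto simp: Basis_vec_def)
  have "(%s t. cf (Some (Some l)) s) : F.Ac" using F.memb_gen[OF F.cf_Gen] unfolding F.memb_real .
  then show "(%s t. y s \<bullet> i) : F.Ac" unfolding i cf_def by (simp add: inner_axis)
 qed
 \<comment> \<open>Iterating differentiation inside the class fixes a whole sequence of derivatives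
   that starts with \<open>y\<close>.\<close>
 have "EX Z. ALL n. (F.memb (Z n) & (n = 0 --> Z n = (%s t. y s))) & F.D (Z n) (Z (Suc n))"
  by (rule dependent_nat_choice) (use memb_y F.memb_derivative[OF memb_cf' Gen] in auto)
 then obtain Z where Z: "!!n. F.D (Z n) (Z (Suc n))" "Z 0 = (%s t. y s)" by blast
 \<comment> \<open>Members of the class carry a time argument; any time in \<open>{0..T}\<close>
   would do, and \<open>T\<close> is used.\<close>
 define Y where "Y n s = Z n s T" for n s
 have Y: "(Y n has_vector_derivative Y (Suc n) s) (at s)" if "\<bar>s\<bar> < ep" for n s
  unfolding Y_def[abs_def] using F.D_imp_derivative[OF Z(1) _ T'] that I by blast
 have Y0: "Y 0 = y" unfolding Y_def[abs_def] Z(2) ..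
 have "W (0, y 0) = w0" using W_0 unfolding y0 by (simp add: zero_prod_def)
 then have "y' 0 = 0" unfolding y'_def b_def by (simp add: Pkap)
 moreover have "Y 1 0 = y' 0"
  using vector_derivative_unique_at[OF _ y'[of 0]] Y[of 0 0] ep unfolding Y0 I by simp
 ultimately show ?thesis
  using that[of ep Y] ep Y y0 Phy unfolding Y0 by simp
qed

end

section \<open>Linear combinations of Cameron-Martin paths\<close>

lemma CM_linear_combination:
 fixes k :: "'i::finite => 'm::finite rpath"
 assumes T: "T >= 0" and h: "h : CM T" and k: "!!i. k i : CM T"
 shows "(%t. h t + (SUM i:UNIV. c i *R k i t)) : CM T"
  "aeq T (path_deriv (%t. h t + (SUM i:UNIV. c i *R k i t))) (%t. path_deriv h t + (SUM i:UNIV. c i *R path_deriv (k i) t))"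
proof -
 have s: "(%t. SUM i:UNIV. c i *R k i t) : CM T" "aeq T (path_deriv (%t. SUM i:UNIV. c i *R k i t)) (%t. SUM i:UNIV. path_deriv (%t. c i *R k i t) t)"
  using CM_sum[where h="%i t. c i *R k i t", OF T finite CM_scaleR(1)[OF T k], of UNIV] by auto
 then show "(%t. h t + (SUM i:UNIV. c i *R k i t)) : CM T" by (intro CM_add T h)
 have a: "aeq T (%t. SUM i:J. path_deriv (%t. c i *R k i t) t) (%t. SUM i:J. c i *R path_deriv (k i) t)" for J
 proof (induction J rule: infinite_finite_induct)
  case (insert i J)
  then show ?case using aeq_map2[OF CM_scaleR(2)[OF T k, of "c i" i] insert.IH, of "%t x y. x + y"] by simp
 qed (simp_all add: aeq_refl)
 show "aeq T (path_deriv (%t. h t + (SUM i:UNIV. c i *R k i t))) (%t. path_deriv h t + (SUM i:UNIV. c i *R path_deriv (k i) t))"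
  by (rule aeq_trans[OF CM_add(2)[OF T h s(1)] aeq_map[OF aeq_trans[OF s(2) a], of "%t x. path_deriv h t + x"]])
qed

lemma cm_curve_linear_combination:
 fixes k :: "'i::finite => 'm::finite rpath"
 assumes T: "T >= 0" and k: "!!i. k i : CM T" and f: "!!i. (f i has_real_derivative f' i) (at s)"
 shows "cm_curve_has_derivative T (%r t. h t + (SUM i:UNIV. f i r *R k i t)) (%t. SUM i:UNIV. f' i *R k i t) s"
 unfolding cm_curve_has_derivative_def
proof (rule Lim_null_comparison[OF always_eventually])
 define q where "q i r = (f i r - f i s) / (r - s) - f' i" for i r
 have "((%r. q i r) \<longlongrightarrow> f' i - f' i) (at s)" for i
  using f[of i] unfolding has_field_derivative_iff q_def by (intro tendsto_diff tendsto_const)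
 then have "((%r. SUM i:UNIV. \<bar>q i r\<bar> * cm_norm T (k i)) \<longlongrightarrow> (SUM i:UNIV. \<bar>f' i - f' i\<bar> * cm_norm T (k i))) (at s)"
  by (intro tendsto_intros)
 then show "((%r. SUM i:UNIV. \<bar>q i r\<bar> * cm_norm T (k i)) \<longlongrightarrow> 0) (at s)" by simp
 show "ALL r. norm (cm_norm T (%t. (1 / (r - s)) *R (h t + (SUM i:UNIV. f i r *R k i t) - (h t + (SUM i:UNIV. f i s *R k i t))) - (SUM i:UNIV. f' i *R k i t)))
   <= (SUM i:UNIV. \<bar>q i r\<bar> * cm_norm T (k i))"
 proof
  fix r
  have "(%t. (1 / (r - s)) *R (h t + (SUM i:UNIV. f i r *R k i t) - (h t + (SUM i:UNIV. f i s *R k i t))) - (SUM i:UNIV. f' i *R k i t))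
   = (%t. SUM i:UNIV. q i r *R k i t)"
   by (simp add: fun_eq_iff q_def scaleR_sum_right sum_subtractf[symmetric] scaleR_diff_right scaleR_diff_left diff_divide_distrib)
  moreover have "cm_norm T (%t. SUM i:UNIV. q i r *R k i t) <= (SUM i:UNIV. \<bar>q i r\<bar> * cm_norm T (k i))"
  proof -
   have "cm_norm T (%t. SUM i:UNIV. q i r *R k i t) = n2 T (%t. SUM i:UNIV. path_deriv (%t. q i r *R k i t) t)"
    unfolding cm_norm_eq_n2 using CM_sum[where h="%i t. q i r *R k i t", OF T finite CM_scaleR(1)[OF T k], of UNIV] by (intro aeq_n2) auto
   also have "... <= (SUM i:UNIV. n2 T (path_deriv (%t. q i r *R k i t)))"
    by (intro n2_sum_le CM_imp(1)[OF T] CM_scaleR(1)[OF T] k)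
   also have "... = (SUM i:UNIV. \<bar>q i r\<bar> * cm_norm T (k i))"
    unfolding cm_norm_eq_n2[symmetric] cm_norm_scaleR[OF T k] ..
   finally show ?thesis .
  qed
  ultimately show "norm (cm_norm T (%t. (1 / (r - s)) *R (h t + (SUM i:UNIV. f i r *R k i t) - (h t + (SUM i:UNIV. f i s *R k i t))) - (SUM i:UNIV. f' i *R k i t)))
   <= (SUM i:UNIV. \<bar>q i r\<bar> * cm_norm T (k i))" by simp
 qed
qed

section \<open>The Hessian at a minimizing control\<close>

text \<open>Invertibility of the Malliavin matrix is present in the form of the directions
  \<open>G b\<close>, which move the endpoint along the coordinate axes.\<close>

locale minimizing_control = control_problem sg0 sg x0 T
 for sg0 :: "'d::{finite,linorder} vfield" and sg :: "'m::finite => 'd vfield" and x0 :: "'d rvec" and T :: real +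
 fixes a :: "'l::{finite,linorder} rvec" and h :: "'m rpath" and G :: "'d => real => real^'m"
 assumes card: "CARD('l) <= CARD('d)" and minimizing: "h : minimizing sg0 sg T x0 a"
  and L2G: "!!b. L2 T (G b)" and VpG: "!!b. Vp (emb1 (path_deriv h)) (emb0 (G b)) T = axis b 1"
begin

abbreviation K where "K == admissible sg0 sg T x0 a"
abbreviation pr :: "'d rvec => 'l rvec" where "pr == proj_lead"
abbreviation io :: "'l => 'd" where "io == lead_index"
abbreviation w where "w == emb1 (path_deriv h)"
abbreviation V where "V u == Vp w (emb0 u)"

lemma hCM: "h : CM T" and h_end: "pr (control_flow sg0 sg T x0 T h) = a"
 and energy_min: "k : K ==> energy T h <= energy T k"
 using minimizing unfolding minimizing_def admissible_def by auto

lemma L2h: "L2 T (path_deriv h)"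
 by (rule CM_imp(1)[OF T0 hCM])

lemma L2w: "L2 T w"
 by (intro L2_emb1 L2h)

lemma T': "T : {0..T}" using T0 by simp

lemma inj_io: "inj io"
 by (rule inj_lead_index[OF card])

lemma pr_axis: "pr (axis (io l) 1) = axis l 1"
 unfolding proj_lead_def using inj_io by (auto simp: vec_eq_iff axis_def inj_eq)

definition tangent :: "'m rpath set" where
 "tangent = {k : CM T. pr (V (path_deriv k) T) = 0}"

lemma admissible_tangent_eq: "admissible_tangent sg0 sg T x0 a h = tangent"
proof -
 have "cm_has_derivative T (%h. pr (control_flow sg0 sg T x0 T h)) (%k. pr (V (path_deriv k) T)) h"
  by (rule cm_has_derivative_bounded_linear[OF flow_has_derivative[OF hCM] bounded_linear_proj_lead])
 from cm_derivative_eq[OF T0 this] show ?thesis unfolding admissible_tangent_def tangent_def by auto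
qed

lemma V_add: "L2 T u ==> L2 T v ==> V (%s. u s + v s) T = V u T + V v T"
 unfolding emb0_add by (intro Vp_add L2w L2_emb0 T')

lemma V_scaleR: "V (%s. c *R u s) T = c *R V u T"
 unfolding emb0_scaleR by (rule Vp_scaleR)

lemma V_aeq: "aeq T u v ==> V u T = V v T"
 by (intro Vp_aeq aeq_emb0) auto

text \<open>Subtracting from \<open>u\<close> the combination of the \<open>G (io l)\<close> with
  the same projected endpoint leaves a tangent vector, so \<open>ph\<close> is determined by its
  values on these directions. Applied to the first variation of the energy it yields
  \<open>rho\<close>; applied to a null vector of the second variation it yields the terminal value
  \<open>tau\<close> of the adjoint equation.\<close>

lemma multiplier:
 fixes ph :: "(real => real^'m) => real"
 assumes add: "!!u v. L2 T u ==> L2 T v ==> ph (%s. u s + v s) = ph u + ph v"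
  and sc: "!!c u. L2 T u ==> ph (%s. c *R u s) = c * ph u" and ae: "!!u v. aeq T u v ==> ph u = ph v"
  and tan: "!!k. k : tangent ==> ph (path_deriv k) = 0"
  and u: "L2 T u"
 shows "ph u = (SUM l:UNIV. ph (G (io l)) *R axis (io l) 1) \<bullet> V u T"
proof -
 define c where "c l = V u T $ io l" for l
 have sum: "L2 T (%s. SUM l:J. c l *R G (io l) s) & ph (%s. SUM l:J. c l *R G (io l) s) = (SUM l:J. c l * ph (G (io l)))
  & V (%s. SUM l:J. c l *R G (io l) s) T = (SUM l:J. c l *R axis (io l) 1)" for J
 proof (induction J rule: infinite_finite_induct)
  case (insert l J)
  have "ph (%s. c l *R G (io l) s + (SUM l:J. c l *R G (io l) s)) = c l * ph (G (io l)) + ph (%s. SUM l:J. c l *R G (io l) s)"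
   using insert.IH by (subst add) (auto simp: L2_scaleR L2G sc)
  moreover have "V (%s. c l *R G (io l) s + (SUM l:J. c l *R G (io l) s)) T = c l *R axis (io l) 1 + V (%s. SUM l:J. c l *R G (io l) s) T"
   using insert.IH by (subst V_add) (auto simp: L2_scaleR L2G V_scaleR VpG)
  ultimately show ?case using insert by (simp add: L2_add L2_scaleR L2G)
 qed (use sc[of "%s. 0" 0] V_scaleR[of 0 "%s. 0"] L2_const[of T 0] in auto)
 define v where "v s = (SUM l:UNIV. c l *R G (io l) s)" for s
 have v: "L2 T v" "ph v = (SUM l:UNIV. c l * ph (G (io l)))" "V v T = (SUM l:UNIV. c l *R axis (io l) 1)"
  unfolding v_def[abs_def] using sum by auto
 define d where "d = (%s. u s + (-1) *R v s)"
 have d: "L2 T d" unfolding d_def by (intro L2_add L2_scaleR u v)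
 interpret pr: bounded_linear pr by (rule bounded_linear_proj_lead)
 have "pr (V v T) = (SUM l:UNIV. c l *R axis l 1)" unfolding v(3) by (simp add: pr.sum pr.scaleR pr_axis)
 also have "... = pr (V u T)"
  using basis_expansion[of "pr (V u T)"] by (simp add: c_def proj_lead_def scalar_mult_eq_scaleR)
 finally have "pr (V v T) = pr (V u T)" .
 moreover have "V d T = V u T + (-1) *R V v T"
  unfolding d_def V_add[OF u L2_scaleR[OF v(1)]] V_scaleR ..
 ultimately have "pr (V d T) = 0" by (simp add: pr.diff)
 then have "mk T d : tangent"
  unfolding tangent_def using mk_CM[OF d] V_aeq[OF mk_path_deriv[OF d]] by simp
 then have "ph (path_deriv (mk T d)) = 0" by (rule tan)
 then have "ph d = 0" using ae[OF mk_path_deriv[OF d]] by simp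
 then have "ph u = ph v" unfolding d_def using add[OF u L2_scaleR[OF v(1), of "-1"]] sc[OF v(1), of "-1"] by simp
 then show ?thesis unfolding v(2) c_def
  by (simp add: inner_sum_left inner_axis' mult.commute)
qed

lemma L2_aeq_eqI:
 fixes u v :: "real => real^'m"
 assumes u: "L2 T u" and v: "L2 T v" and eq: "!!z. L2 T z ==> ip T z u = ip T z v"
 shows "aeq T u v"
proof -
 have d: "L2 T (%s. u s - v s)" by (intro L2_diff u v)
 have "ip T (%s. u s - v s) (%s. u s - v s) = ip T u (%s. u s - v s) - ip T v (%s. u s - v s)"
  by (rule ip_diff_left[OF u v d])
 also have "... = 0" using eq[OF d] by (simp add: ip_commute[of T u] ip_commute[of T v])
 finally have "n2 T (%s. u s - v s) = 0" by (simp add: ip_self)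
 from aeq_map[OF n2_zero_imp_aeq[OF d this], of "%t x. x + v t"] show ?thesis by simp
qed

text \<open>The curve is \<open>h + s k + sum_l Y_l(s) mk T (G (io l))\<close>. Its velocity at 0 is
  \<open>k\<close>, since the correction vanishes to first order.\<close>

lemma admissible_curve:
 assumes k: "k : tangent"
 obtains ep c where "ep > 0" "cm_smooth_curve T {-ep<..<ep} c" "c ` {-ep<..<ep} \<subseteq> K" "c 0 = h"
  "cm_curve_has_derivative T c k 0"
proof -
 have kCM: "k : CM T" and kt: "pr (V (path_deriv k) T) = 0" using k unfolding tangent_def by auto
 define kap where "kap = emb0 (path_deriv k)"
 define ga where "ga l = emb0 (G (io l))" for l
 interpret cv: constrained_variation "case_option sg0 sg" x0 T w kap ga pr
 proof (intro constrained_variation.intro constrained_variation_axioms.intro control_system_axioms)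
  show "bounded_linear (proj_lead :: 'd rvec => 'l rvec)" by (rule bounded_linear_proj_lead)
  show "L2 T w" by (rule L2w)
  show "L2 T kap" unfolding kap_def by (intro L2_emb0 CM_imp(1)[OF T0 kCM])
  show "L2 T (ga l)" for l unfolding ga_def by (intro L2_emb0 L2G)
  show "pr (Vp w kap T) = 0" unfolding kap_def by (rule kt)
  show "pr (Vp w (ga l) T) = axis l 1" for l unfolding ga_def VpG by (rule pr_axis)
 qed
 obtain ep and Y :: "nat => real => 'l rvec" where ep: "ep > 0" and Y0: "Y 0 0 = 0" "Y 1 0 = 0"
  and Y: "!!n s. \<bar>s\<bar> < ep ==> (Y n has_vector_derivative Y (Suc n) s) (at s)"
  and PhY: "!!s. \<bar>s\<bar> < ep ==> cv.Ph (s, Y 0 s) = pr (Xp w T)"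
  by (rule cv.smooth_correction) blast
 define b where "b j = (case j of None => k | Some l => mk T (G (io l)))" for j
 \<comment> \<open>Coefficient of the path \<open>b j\<close> in the derivative of order
   \<open>n\<close>; the tangent vector \<open>k\<close> carries the index
   \<open>None\<close>.\<close>
 define f where "f n j s = (case j of None => (if n = 0 then s else if n = 1 then 1 else 0) | Some l => Y n s $ l)" for n :: nat and j s
 define C where "C n s = (%t. (if n = 0 then h t else 0) + (SUM j:UNIV. f n j s *R b j t))" for n :: nat and s
 have bCM: "b j : CM T" for j unfolding b_def using kCM mk_CM[OF L2G] by (auto split: option.split)
 have f: "(f n j has_real_derivative f (Suc n) j s) (at s)" if "\<bar>s\<bar> < ep" for n j s
 proof (cases j)
  case None
  then show ?thesis unfolding f_def by (auto intro!: derivative_eq_intros)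
 next
  case (Some l)
  then show ?thesis
   unfolding f_def has_real_derivative_iff_has_vector_derivative
   using bounded_linear.has_vector_derivative[OF bounded_linear_vec_nth Y[OF that, of n]] by simp
 qed
 have CCM: "C n s : CM T" for n s
  unfolding C_def by (rule CM_linear_combination(1)[where k=b, OF T0 _ bCM]) (cases "n = 0"; simp add: hCM CM_zero[OF T0])
 have dC: "cm_curve_has_derivative T (C n) (C (Suc n) s) s" if "\<bar>s\<bar> < ep" for n s
  using cm_curve_linear_combination[where h="%t. if n = 0 then h t else 0" and k=b, OF T0 bCM f[OF that, of n]]
  unfolding C_def[abs_def] by simp
 have smooth: "cm_smooth_curve T {-ep<..<ep} (C 0)"
  unfolding cm_smooth_curve_def using CCM dC by (auto simp: abs_less_iff)
 have "f 0 j 0 = 0" "f 1 j 0 = (case j of None => 1 | Some l => 0)" for j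
  unfolding f_def using Y0 by (auto split: option.split)
 then have C0: "C 0 0 = h" and C1: "C 1 0 = k"
  unfolding C_def by (simp_all add: sum_option b_def)
 have "C 0 s : K" if s: "\<bar>s\<bar> < ep" for s
 proof -
  have "aeq T (path_deriv (C 0 s)) (%t. path_deriv h t + (SUM j:UNIV. f 0 j s *R path_deriv (b j) t))"
   unfolding C_def using CM_linear_combination(2)[OF T0 hCM bCM] by simp
  moreover have "aeq T (%t. path_deriv h t + (SUM j:J. f 0 j s *R path_deriv (b j) t))
   (%t. path_deriv h t + (SUM j:J. f 0 j s *R (case j of None => path_deriv k t | Some l => G (io l) t)))" for J
  proof (induction J rule: infinite_finite_induct)
   case (insert j J)
   have "aeq T (path_deriv (b j)) (%t. case j of None => path_deriv k t | Some l => G (io l) t)"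
    unfolding b_def using mk_path_deriv[OF L2G] by (auto split: option.split intro: aeq_refl)
   from aeq_map2[OF this insert.IH, of "%t x y. y + f 0 j s *R x"] show ?case
    using insert.hyps by (simp add: add_ac)
  qed (auto intro: aeq_refl)
  ultimately have "aeq T (path_deriv (C 0 s))
   (%t. path_deriv h t + (SUM j:UNIV. f 0 j s *R (case j of None => path_deriv k t | Some l => G (io l) t)))"
   by (rule aeq_trans)
  from aeq_emb1[OF this]
  have "aeq T (emb1 (path_deriv (C 0 s))) (cv.W (s, Y 0 s))"
   unfolding sum_option cv.W_def[abs_def] cv.dW_def unfolding kap_def ga_def f_def emb1_def emb0_def
   by (elim back_subst[where P="aeq T _"])
    (auto simp: fun_eq_iff vec_eq_iff split: option.split)
  then have "Xp (emb1 (path_deriv (C 0 s))) T = Xp (cv.W (s, Y 0 s)) T"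
   by (intro Xp_aeq T' L2_emb1 CM_imp(1)[OF T0 CCM])
  then have "pr (control_flow sg0 sg T x0 T (C 0 s)) = pr (Xp w T)"
   using PhY[OF s] unfolding control_flow_eq[OF CCM T'] cv.Ph_def by simp
  also have "... = a" using h_end unfolding control_flow_eq[OF hCM T'] .
  finally show ?thesis unfolding admissible_def using CCM by simp
 qed
 then have "C 0 ` {-ep<..<ep} \<subseteq> K" by auto
 then show ?thesis using that[OF ep smooth _ C0] dC[of 0 0] ep C1 by simp
qed

section \<open>First and second order conditions at the minimum\<close>

lemma first_variation:
 assumes k: "k : tangent"
 shows "ip T (path_deriv h) (path_deriv k) = 0"
proof -
 obtain ep c where c: "ep > 0" "cm_smooth_curve T {-ep<..<ep} c" "c ` {-ep<..<ep} \<subseteq> K" "c 0 = h"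
  "cm_curve_has_derivative T c k 0" by (rule admissible_curve[OF k])
 have kCM: "k : CM T" using k unfolding tangent_def by simp
 have cCM: "c r : CM T" if "r : {-ep<..<ep}" for r
  using c(3) that unfolding admissible_def by blast
 have 0: "0 : {-ep<..<ep}" using c(1) by auto
 have "((%r. cm_inner T (c r) (c r)) has_real_derivative (cm_inner T k (c 0) + cm_inner T (c 0) k)) (at 0)"
  by (rule cm_inner_curve_derivative[OF T0 _ 0 cCM cCM kCM kCM c(5,5)]) auto
 moreover have "ALL r. \<bar>0 - r\<bar> < ep --> cm_inner T (c 0) (c 0) <= cm_inner T (c r) (c r)"
 proof (intro allI impI)
  fix r assume "\<bar>0 - r\<bar> < ep"
  then have "c r : K" using c(3) by (auto simp: abs_less_iff)
  from energy_min[OF this] show "cm_inner T (c 0) (c 0) <= cm_inner T (c r) (c r)"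
   unfolding energy_def c(4) cm_inner_self by simp
 qed
 ultimately have "cm_inner T k (c 0) + cm_inner T (c 0) k = 0" by (rule DERIV_local_min[OF _ c(1)])
 then show ?thesis unfolding c(4) cm_inner_commute[of T k] by (simp add: cm_inner_eq_ip)
qed

text \<open>The multiplier, supported on the leading coordinates; therefore
  \<open>rho \<bullet> phi_T\<close> depends on the projected endpoint only and is constant on
  \<open>K\<close>.\<close>

definition rho :: "'d rvec" where
 "rho = (SUM l:UNIV. ip T (path_deriv h) (G (io l)) *R axis (io l) 1)"

lemma inner_lead: "(SUM l:UNIV. q l *R axis (io l) 1) \<bullet> x = (SUM l:UNIV. q l * pr x $ l)"
 by (simp add: inner_sum_left inner_axis' proj_lead_def)

text \<open>The functional \<open>ip T (path_deriv h)\<close> vanishes on tangent vectors, so it is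
  \<open>rho\<close> paired with the endpoint variation, whose gradient is
  \<open>gradc w rho\<close>. This is the relation between optimal control and covector in the
  maximum principle.\<close>

lemma critical: "aeq T (path_deriv h) (gradc w rho)"
proof (rule L2_aeq_eqI[OF L2h L2_gradc[OF L2w]])
 fix z :: "real => real^'m" assume z: "L2 T z"
 have "ip T (path_deriv h) z = rho \<bullet> V z T"
  unfolding rho_def
 proof (rule multiplier[where ph="ip T (path_deriv h)", OF _ _ _ first_variation z])
  show "ip T (path_deriv h) (%s. u s + v s) = ip T (path_deriv h) u + ip T (path_deriv h) v" if "L2 T u" "L2 T v" for u v
   by (rule ip_add_right[OF that L2h])
  show "ip T (path_deriv h) (%s. c *R u s) = c * ip T (path_deriv h) u" for c u
   by (rule ip_scaleR_right)
  show "ip T (path_deriv h) u = ip T (path_deriv h) v" if "aeq T u v" for u v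
   by (rule ip_aeq[OF aeq_refl that])
 qed
 then show "ip T z (path_deriv h) = ip T z (gradc w rho)"
  using Vp_T_inner[OF L2w z, of rho] by (simp add: ip_commute)
qed

definition Q :: "(real => real^'m) => (real => real^'m) => real" where
 "Q u v = Qb w rho u v"

lemma rho_admissible: "k : K ==> rho \<bullet> control_flow sg0 sg T x0 T k = rho \<bullet> control_flow sg0 sg T x0 T h"
 unfolding rho_def inner_lead h_end admissible_def by simp

text \<open>All curves give the same value by the second-order expansion; the existence of at least
  one curve makes this value unique.\<close>

lemma energy_hessian_eq:
 assumes k: "k : tangent"
 shows "energy_hessian T K h k = Q (path_deriv k) (path_deriv k)"
 unfolding energy_hessian_def
proof (rule the_equality)
 have kCM: "k : CM T" using k unfolding tangent_def by simp
 have all: "deriv (deriv (%s. energy T (c s))) 0 = Q (path_deriv k) (path_deriv k)"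
  if "ep > 0" "cm_smooth_curve T {-ep<..<ep} c" "c ` {-ep<..<ep} \<subseteq> K" "c 0 = h" "cm_curve_has_derivative T c k 0" for c ep
  unfolding Q_def by (rule hessian_along_curve[OF hCM refl critical kCM that(1,4,5,2)])
   (rule rho_admissible, use that(3) in \<open>auto simp: abs_less_iff\<close>)
 then show "ALL c. (EX ep>0. cm_smooth_curve T {-ep<..<ep} c & c ` {-ep<..<ep} \<subseteq> K) & c 0 = h & cm_curve_has_derivative T c k 0 -->
   deriv (deriv (%s. energy T (c s))) 0 = Q (path_deriv k) (path_deriv k)" by blast
 fix r
 assume r: "ALL c. (EX ep>0. cm_smooth_curve T {-ep<..<ep} c & c ` {-ep<..<ep} \<subseteq> K) & c 0 = h & cm_curve_has_derivative T c k 0 -->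
   deriv (deriv (%s. energy T (c s))) 0 = r"
 obtain ep c where c: "ep > 0" "cm_smooth_curve T {-ep<..<ep} c" "c ` {-ep<..<ep} \<subseteq> K" "c 0 = h"
  "cm_curve_has_derivative T c k 0" by (rule admissible_curve[OF k])
 then have "deriv (deriv (%s. energy T (c s))) 0 = r" using r by blast
 then show "r = Q (path_deriv k) (path_deriv k)" using all[OF c] by simp
qed

text \<open>Along an admissible curve the quotients of the energy increment by \<open>s^2\<close>
  are nonnegative and converge to half of the form.\<close>

lemma second_variation_nonneg:
 assumes k: "k : tangent"
 shows "Q (path_deriv k) (path_deriv k) >= 0"
proof -
 have kCM: "k : CM T" using k unfolding tangent_def by simp
 obtain ep c where c: "ep > 0" "cm_smooth_curve T {-ep<..<ep} c" "c ` {-ep<..<ep} \<subseteq> K" "c 0 = h"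
  "cm_curve_has_derivative T c k 0" by (rule admissible_curve[OF k])
 have cK: "c s : K" if "\<bar>s\<bar> < ep" for s using c(3) that by (auto simp: abs_less_iff)
 have "((%s. (energy T (c s) - energy T (c 0)) / s^2) \<longlongrightarrow> Q (path_deriv k) (path_deriv k) / 2) (at 0)"
  unfolding Q_def by (rule energy_curve_limit[OF hCM refl critical kCM c(1,4,5) _ rho_admissible[OF cK]]) (use cK in \<open>auto simp: admissible_def\<close>)
 moreover have "\<forall>\<^sub>F s in at 0. \<bar>s\<bar> < ep"
  unfolding eventually_at using c(1) by (auto simp: dist_real_def intro!: exI[of _ ep])
 then have "\<forall>\<^sub>F s in at 0. 0 <= (energy T (c s) - energy T (c 0)) / s^2"
  by eventually_elim (use energy_min[OF cK] c(4) in auto)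
 ultimately have "0 <= Q (path_deriv k) (path_deriv k) / 2" by (rule tendsto_lowerbound) simp
 then show ?thesis by simp
qed

end

section \<open>Differentiability of flows in the initial value\<close>

text \<open>Continuity of the derivative is asked for each fixed direction, which is easily checked
  and in finite dimension amounts to continuity of the derivative. No global Lipschitz bound is
  included, as the Hamiltonian field is quadratic in the covector.\<close>

definition C1 :: "('a::euclidean_space => 'b::euclidean_space) => ('a => 'a => 'b) => bool" where
 "C1 f f' \<longleftrightarrow> (ALL x. (f has_derivative f' x) (at x)) & (ALL v. continuous_on UNIV (%x. f' x v))"

lemma C1_has_derivative: "C1 f f' ==> (f has_derivative f' x) (at x)"
 and C1_derivative_continuous: "C1 f f' ==> continuous_on UNIV (%x. f' x v)"
 unfolding C1_def by auto

lemma C1_linear: "C1 f f' ==> linear (f' x)"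
 using C1_has_derivative has_derivative_linear by blast

lemma C1_continuous: "C1 f f' ==> continuous_on UNIV f"
 by (meson C1_has_derivative has_derivative_continuous continuous_at_imp_continuous_on)

lemma C1_continuous_compose: "C1 f f' ==> continuous_on A y ==> continuous_on A (%s. f (y s))"
 by (rule continuous_on_compose2[OF C1_continuous[of f f']]) auto

lemma C1_derivative_continuous_compose:
 assumes f: "C1 f f'" and y: "continuous_on A y" and v: "continuous_on A v"
 shows "continuous_on A (%s. f' (y s) (v s))"
proof -
 have eq: "f' x u = (SUM b:Basis. (u \<bullet> b) *R f' x b)" for x u
 proof -
  have "f' x (SUM b:Basis. (u \<bullet> b) *R b) = (SUM b:Basis. (u \<bullet> b) *R f' x b)"
   by (simp only: linear_sum[OF C1_linear[OF f]] linear_scale[OF C1_linear[OF f]])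
  then show ?thesis by (simp only: euclidean_representation)
 qed
 have "(%s. f' (y s) (v s)) = (%s. SUM b:Basis. (v s \<bullet> b) *R f' (y s) b)" by (rule ext) (rule eq)
 then show ?thesis
  by (elim ssubst) (intro continuous_intros v continuous_on_compose2[OF C1_derivative_continuous[OF f] y], auto)
qed

text \<open>All bounds live on a ball. The last one, a remainder uniform in the base point, comes
  from uniform continuity of the map sending \<open>(x, v)\<close> to \<open>f' x v\<close> on the
  compact product of that ball with the unit ball.\<close>

lemma C1_bounds:
 fixes f :: "'a::euclidean_space => 'b::euclidean_space"
 assumes f: "C1 f f'"
 obtains C where "C > 0" "!!x v. x : cball 0 R ==> norm (f' x v) <= C * norm v"
  "!!x y. x : cball 0 R ==> y : cball 0 R ==> norm (f y - f x) <= C * norm (y - x)"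
  "!!e. e > 0 ==> EX d>0. ALL x y. x : cball 0 R --> y : cball 0 R --> norm (y - x) < d -->
    norm (f y - f x - f' x (y - x)) <= e * norm (y - x)"
proof -
 define D where "D = cball (0::'a) R \<times> cball (0::'a) 1"
 define G where "G z = f' (fst z) (snd z)" for z
 have G: "continuous_on D G" unfolding G_def[abs_def]
  by (intro C1_derivative_continuous_compose[OF f] continuous_intros)
 have D: "compact D" unfolding D_def by (intro compact_Times compact_cball)
 note lin = C1_linear[OF f]
 have unit: "norm (L v) <= C * norm v" if "linear L" "!!u. u : cball 0 1 ==> norm (L u) <= C" for L :: "'a => 'b" and C v
 proof (cases "v = 0")
  case False
  then have "norm (L v) = norm v * norm (L (v /\<^sub>R norm v))" using linear_scale[OF that(1)] by simp
  also have "... <= norm v * C" using False by (intro mult_left_mono that(2)) auto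
  finally show ?thesis by (simp add: mult.commute)
 qed (use linear_0[OF that(1)] in simp)
 have seg: "norm (g y - g x) <= B * norm (y - x)"
  if "!!z. z : closed_segment x y ==> (g has_derivative g' z) (at z)"
   "!!z v. z : closed_segment x y ==> norm (g' z v) <= B * norm v" for g :: "'a => 'b" and g' x y B
  by (rule differentiable_bound[of "closed_segment x y" g g'])
   (auto intro: has_derivative_at_withinI that onorm_le)
 have sub: "closed_segment x y \<subseteq> cball 0 R" if "x : cball 0 R" "y : cball 0 R" for x y :: 'a
  by (rule closed_segment_subset[OF that convex_cball])
 obtain C where C: "C > 0" "!!z. z : D ==> norm (G z) <= C"
  using compact_imp_bounded[OF compact_continuous_image[OF G D]] unfolding bounded_pos by blast
 have bnd: "norm (f' x v) <= C * norm v" if "x : cball 0 R" for x v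
  by (rule unit[OF lin]) (use C(2)[of "(x, _)"] that in \<open>simp add: D_def G_def\<close>)
 show ?thesis
 proof (rule that[OF C(1) bnd])
  show "norm (f y - f x) <= C * norm (y - x)" if "x : cball 0 R" "y : cball 0 R" for x y
   by (rule seg[OF C1_has_derivative[OF f]]) (use bnd sub[OF that] in blast)
  fix e :: real assume e: "e > 0"
  obtain d where d: "d > 0" "!!z z'. z : D ==> z' : D ==> dist z' z < d ==> dist (G z') (G z) < e"
   using compact_uniformly_continuous[OF G D] e unfolding uniformly_continuous_on_def by metis
  have "norm (f y - f x - f' x (y - x)) <= e * norm (y - x)"
   if xy: "x : cball 0 R" "y : cball 0 R" "norm (y - x) < d" for x y
  proof -
   have "norm ((f y - f' x y) - (f x - f' x x)) <= e * norm (y - x)"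
   proof (rule seg)
    fix z assume z: "z : closed_segment x y"
    show "((%z. f z - f' x z) has_derivative (%v. f' z v - f' x v)) (at z)"
     by (intro has_derivative_diff C1_has_derivative[OF f] linear_imp_has_derivative lin)
    have "norm (z - x) < d" using segment_bound(1)[OF z] xy(3) by simp
    then have "norm (f' z u - f' x u) <= e" if "u : cball 0 1" for u
     using d(2)[of "(x, u)" "(z, u)"] sub[OF xy(1,2)] z xy(1) that
     by (force simp: D_def G_def dist_norm norm_prod_def intro: less_imp_le)
    then show "norm (f' z v - f' x v) <= e * norm v" for v
     by (intro unit linear_compose_sub lin)
   qed
   then show ?thesis by (simp add: linear_diff[OF lin] algebra_simps)
  qed
  then show "EX d>0. ALL x y. x : cball 0 R --> y : cball 0 R --> norm (y - x) < d -->
    norm (f y - f x - f' x (y - x)) <= e * norm (y - x)" using d(1) by blast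
 qed
qed

section \<open>Integral and differential form of an equation, and time reversal\<close>

lemma indef_continuous_integrand:
 fixes f :: "real => 'a::euclidean_space"
 assumes f: "continuous_on {0..T} f" and F: "!!t. t : {0..T} ==> F t = c + integral {0..t} f"
 shows "indef T f F"
 by (rule indefI[OF _ F]) (intro absolutely_integrable_continuous_real f)

lemma indef_iff_derivative:
 fixes f :: "real => 'a::euclidean_space"
 assumes T: "T >= 0" and f: "continuous_on {0..T} f"
 shows "indef T f F \<longleftrightarrow> (ALL t:{0..T}. (F has_vector_derivative f t) (at t within {0..T}))"
proof
 assume F: "indef T f F"
 show "ALL t:{0..T}. (F has_vector_derivative f t) (at t within {0..T})"
 proof
  fix t assume t: "t : {0..T}"
  have "((%t. F 0 + integral {0..t} f) has_vector_derivative 0 + f t) (at t within {0..T})"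
   by (intro has_vector_derivative_add has_vector_derivative_const integral_has_vector_derivative f t)
  then have "((%t. F 0 + integral {0..t} f) has_vector_derivative f t) (at t within {0..T})" by simp
  then show "(F has_vector_derivative f t) (at t within {0..T})"
   by (rule has_vector_derivative_transform[OF t, rotated]) (rule indefD[OF F])
 qed
next
 assume d: "ALL t:{0..T}. (F has_vector_derivative f t) (at t within {0..T})"
 show "indef T f F" unfolding indef_def
 proof (intro conjI ballI absolutely_integrable_continuous_real f)
  fix t assume t: "t : {0..T}"
  show "(f has_integral F t - F 0) {0..t}"
  proof (rule fundamental_theorem_of_calculus)
   show "0 <= t" using t by simp
   fix s assume "s : {0..t}"
   then show "(F has_vector_derivative f s) (at s within {0..t})"
    using has_vector_derivative_within_subset[of F "f s" s "{0..T}" "{0..t}"] d t by auto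
  qed
 qed
qed

lemma reverse_derivative:
 assumes d: "ALL t:{0..T}. (F has_vector_derivative f t) (at t within {0..T})"
 shows "ALL t:{0..T::real}. ((%s. F (T - s)) has_vector_derivative - f (T - t)) (at t within {0..T})"
proof
 fix t assume t: "t : {0..T}"
 have im: "(%s. T - s) ` {0..T} = {0..T}" by (auto simp: image_def intro!: bexI[of _ "T - _"])
 have "((%s. T - s) has_vector_derivative 0 - 1) (at t within {0..T})"
  by (intro has_vector_derivative_diff has_vector_derivative_const has_vector_derivative_id)
 moreover have "(F has_vector_derivative f (T - t)) (at (T - t) within (%s. T - s) ` {0..T})"
  unfolding im using d t by auto
 ultimately have "(F \<circ> (%s. T - s) has_vector_derivative (0 - 1) *R f (T - t)) (at t within {0..T})"
  by (rule vector_diff_chain_within)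
 then show "((%s. F (T - s)) has_vector_derivative - f (T - t)) (at t within {0..T})" by (simp add: o_def)
qed

lemma continuous_on_imp_cball:
 fixes f :: "real => 'a::euclidean_space"
 assumes "continuous_on {a..b} f"
 obtains M where "!!t. t : {a..b} ==> f t : cball 0 M"
proof -
 obtain M where "!!t. t : {a..b} ==> norm (f t) <= M"
  using continuous_on_imp_bounded_image[OF assms] unfolding bounded_iff by blast
 then show ?thesis using that[of M] by simp
qed

section \<open>The linearised equation and uniqueness of orbits\<close>

lemma linearized_exists:
 assumes f: "C1 f f'" and T: "T >= 0" and zet: "continuous_on {0..T} zet"
 obtains v where "indef T (%s. f' (zet s) (v s)) v" "v 0 = v0"
proof -
 obtain M where M: "!!t. t : {0..T} ==> zet t : cball 0 M" by (rule continuous_on_imp_cball[OF zet]) blast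
 obtain C where C: "C > 0" "!!x v. x : cball 0 M ==> norm (f' x v) <= C * norm v" by (rule C1_bounds[OF f, of M]) blast
 obtain v where v: "continuous_on {0..T} v" "!!t. t : {0..T} ==> v t = v0 + integral {0..t} (%s. f' (zet s) (v s))"
 proof (rule picard_L2[where ?y0.0="%_. v0", OF T L2_const[of T C] continuous_on_const])
  show "(%s. f' (zet s) (y s)) absolutely_integrable_on {0..T}" if "continuous_on {0..T} y" for y
   by (intro absolutely_integrable_continuous_real C1_derivative_continuous_compose[OF f] zet that)
  show "norm (f' (zet s) x - f' (zet s) y) <= C * norm (x - y)" if "s : {0..T}" for s x y
   using C(2)[OF M[OF that], of "x - y"] by (simp add: linear_diff[OF C1_linear[OF f]])
 qed blast
 show ?thesis
 proof (rule that[of v])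
  show "indef T (%s. f' (zet s) (v s)) v"
   by (rule indef_continuous_integrand[OF C1_derivative_continuous_compose[OF f zet v(1)] v(2)])
  show "v 0 = v0" using v(2)[of 0] T by simp
 qed
qed

lemma linearized_unique:
 assumes f: "C1 f f'" and zet: "continuous_on {0..T} zet"
  and v: "indef T (%s. f' (zet s) (v s)) v" and u: "indef T (%s. f' (zet s) (u s)) u" and 0: "v 0 = u 0" and t: "t : {0..T}"
 shows "v t = u t"
proof -
 obtain M where M: "!!t. t : {0..T} ==> zet t : cball 0 M" by (rule continuous_on_imp_cball[OF zet]) blast
 obtain C where C: "C > 0" "!!x v. x : cball 0 M ==> norm (f' x v) <= C * norm v" by (rule C1_bounds[OF f, of M]) blast
 have "norm (v t - u t) <= 0 * gw T (%s. C)"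
 proof (rule gronwall_indef[where m="%s. 0", OF L2_const indef_diff[OF v u] _ _ _ _ t])
  show "norm (f' (zet s) (v s) - f' (zet s) (u s)) <= C * norm (v s - u s) + 0" if "s : {0..T}" for s
   using C(2)[OF M[OF that], of "v s - u s"] by (simp add: linear_diff[OF C1_linear[OF f]])
 qed (use 0 in auto)
 then show ?thesis by simp
qed

lemma flow_unique:
 assumes f: "C1 f f'" and y: "indef T (%s. f (y s)) y" and z: "indef T (%s. f (z s)) z" and 0: "y 0 = z 0" and t: "t : {0..T}"
 shows "y t = z t"
proof -
 obtain M1 M2 where "!!t. t : {0..T} ==> y t : cball 0 M1" "!!t. t : {0..T} ==> z t : cball 0 M2"
  using continuous_on_imp_cball[OF indef_continuous_on[OF y]] continuous_on_imp_cball[OF indef_continuous_on[OF z]] by metis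
 then have M: "y t : cball 0 (max M1 M2)" "z t : cball 0 (max M1 M2)" if "t : {0..T}" for t
  using that by (meson le_max_iff_disj mem_cball)+
 obtain C where C: "C > 0" "!!x y. x : cball 0 (max M1 M2) ==> y : cball 0 (max M1 M2) ==> norm (f y - f x) <= C * norm (y - x)" by (rule C1_bounds[OF f, of "max M1 M2"]) blast
 have "norm (y t - z t) <= 0 * gw T (%s. C)"
 proof (rule gronwall_indef[where m="%s. 0", OF L2_const indef_diff[OF y z] _ _ _ _ t])
  show "norm (f (y s) - f (z s)) <= C * norm (y s - z s) + 0" if "s : {0..T}" for s
   using C(2)[OF M(2)[OF that] M(1)[OF that]] by simp
 qed (use 0 in auto)
 then show ?thesis by simp
qed

text \<open>The field is composed with the projection onto a ball that contains the reference orbit in its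
 interior; it becomes globally Lipschitz, and orbits that start nearby do not notice.\<close>

lemma flow_differentiable:
 fixes f :: "'e::euclidean_space => 'e"
 assumes f: "C1 f f'" and T: "T >= 0" and zet: "indef T (%s. f (zet s)) zet"
 obtains de y La where "de > 0" "!!z. norm (z - zet 0) < de ==> indef T (%s. f (y z s)) (y z) & y z 0 = z"
  "((%z. y z T) has_derivative La) (at (zet 0))"
  "!!v. indef T (%s. f' (zet s) (v s)) v ==> La (v 0) = v T"
proof -
 have czet: "continuous_on {0..T} zet" by (rule indef_continuous_on[OF zet])
 have T': "T : {0..T}" using T by simp
 obtain M where M: "M > 0" "!!t. t : {0..T} ==> norm (zet t) <= M"
  using continuous_on_imp_bounded_image[OF czet] unfolding bounded_pos by blast
 \<comment> \<open>Leaves one unit of room around the reference orbit.\<close>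
 define R where "R = M + 1"
 have zetR: "zet t : cball 0 R" if "t : {0..T}" for t using M(2)[OF that] unfolding R_def by simp
 obtain C where C: "C > 0" "!!x v. x : cball 0 R ==> norm (f' x v) <= C * norm v"
  "!!x y. x : cball 0 R ==> y : cball 0 R ==> norm (f y - f x) <= C * norm (y - x)"
  and rem: "!!e. e > 0 ==> EX d>0. ALL x y. x : cball 0 R --> y : cball 0 R --> norm (y - x) < d -->
    norm (f y - f x - f' x (y - x)) <= e * norm (y - x)" by (rule C1_bounds[OF f, of R]) blast
 define P where "P = closest_point (cball (0::'e) R)"
 have ne: "cball (0::'e) R ~= {}" using M(1) unfolding R_def by simp
 have P: "P x : cball 0 R" for x unfolding P_def by (rule closest_point_in_set[OF closed_cball ne])
 have Pid: "P x = x" if "x : cball 0 R" for x unfolding P_def by (rule closest_point_self[OF that])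
 have PL: "norm (P x - P y) <= norm (x - y)" for x y
  using closest_point_lipschitz[OF convex_cball closed_cball ne, of x y] unfolding P_def dist_norm .
 have lip: "norm (f (P x) - f (P y)) <= C * norm (x - y)" for x y
  using C(3)[OF P P, of x y] mult_left_mono[OF PL[of x y] less_imp_le[OF C(1)]] by linarith
 have cP: "continuous_on UNIV P"
  unfolding P_def by (rule continuous_on_closest_point[OF convex_cball closed_cball ne])
 have "EX y. indef T (%s. f (P (y s))) y & y 0 = z" for z
 proof -
  obtain y where y: "continuous_on {0..T} y" "!!t. t : {0..T} ==> y t = z + integral {0..t} (%s. f (P (y s)))"
  proof (rule picard_L2[where ?y0.0="%_. z", OF T L2_const[of T C] continuous_on_const])
   show "(%s. f (P (y s))) absolutely_integrable_on {0..T}" if "continuous_on {0..T} y" for y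
    by (intro absolutely_integrable_continuous_real C1_continuous_compose[OF f] continuous_on_compose2[OF cP that]) auto
  qed (rule lip, blast)
  have "continuous_on {0..T} (%s. f (P (y s)))"
   by (intro C1_continuous_compose[OF f] continuous_on_compose2[OF cP y(1)]) auto
  then have "indef T (%s. f (P (y s))) y" by (rule indef_continuous_integrand) (rule y(2))
  moreover have "y 0 = z" using y(2)[of 0] T by simp
  ultimately show ?thesis by blast
 qed
 then obtain y where y: "!!z. indef T (%s. f (P (y z s))) (y z)" "!!z. y z 0 = z" by metis
 define g where "g = gw T (%s. C)"
 have g: "g > 0" unfolding g_def by (rule gw_pos)
 have diff: "norm (y z t - zet t) <= norm (z - zet 0) * g" if t: "t : {0..T}" for z t
  unfolding g_def
 proof (rule gronwall_indef[where m="%s. 0", OF L2_const indef_diff[OF y(1) zet] _ _ _ _ t])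
  show "norm (f (P (y z s)) - f (zet s)) <= C * norm (y z s - zet s) + 0" if "s : {0..T}" for s
   using lip[of "y z s" "zet s"] Pid[OF zetR[OF that]] by simp
 qed (auto simp: y)
 \<comment> \<open>By \<open>diff\<close>, an orbit that starts closer than \<open>1 / g\<close>
   stays within distance 1 of the reference orbit, where \<open>P\<close> is the identity.\<close>
 define de where "de = 1 / g"
 have de: "de > 0" unfolding de_def using g by simp
 have yR: "y z t : cball 0 R" if z: "norm (z - zet 0) < de" and t: "t : {0..T}" for z t
 proof -
  have "norm (z - zet 0) * g <= 1" using z g unfolding de_def by (simp add: field_simps)
  then show ?thesis using diff[OF t, of z] M(2)[OF t] norm_triangle_sub[of "y z t" "zet t"] unfolding R_def by simp
 qed
 have yo: "indef T (%s. f (y z s)) (y z)" if "norm (z - zet 0) < de" for z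
  by (rule indef_cong[OF y(1)]) (use Pid[OF yR[OF that]] in auto)
 have "EX v. indef T (%s. f' (zet s) (v s)) v & v 0 = v0" for v0
  by (rule linearized_exists[OF f T czet]) blast
 then obtain V where V: "!!v0. indef T (%s. f' (zet s) (V v0 s)) (V v0)" "!!v0. V v0 0 = v0" by metis
 note lf = C1_linear[OF f]
 have La: "linear (%v0. V v0 T)"
 proof (rule linearI)
  fix a b
  have "indef T (%s. f' (zet s) (V a s + V b s)) (%s. V a s + V b s)"
   using indef_add[OF V(1)[of a] V(1)[of b]] by (simp add: linear_add[OF lf])
  from linearized_unique[OF f czet V(1) this _ T'] show "V (a + b) T = V a T + V b T" by (simp add: V)
 next
  fix c a
  have "indef T (%s. f' (zet s) (c *R V a s)) (%s. c *R V a s)"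
   using indef_scaleR[OF V(1)[of a]] by (simp add: linear_scale[OF lf])
  from linearized_unique[OF f czet V(1) this _ T'] show "V (c *R a) T = c *R V a T" by (simp add: V)
 qed
 show ?thesis
 proof (rule that[of de y "%v0. V v0 T"])
  show "de > 0" by (rule de)
  show "indef T (%s. f (y z s)) (y z) & y z 0 = z" if "norm (z - zet 0) < de" for z using yo[OF that] y(2) by blast
  show "V (v 0) T = v T" if "indef T (%s. f' (zet s) (v s)) v" for v
   by (rule linearized_unique[OF f czet V(1) that _ T']) (rule V)
  show "((%z. y z T) has_derivative (%v0. V v0 T)) (at (zet 0))"
   unfolding has_derivative_at_alt
  proof (intro conjI allI impI)
   show "bounded_linear (%v0. V v0 T)" using La by (simp add: linear_conv_bounded_linear)
   fix e :: real assume e: "e > 0"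
   \<comment> \<open>Compensates the two Gronwall factors and the length of the interval; the added
     1 covers \<open>T = 0\<close>.\<close>
   define e' where "e' = e / (T * g * g + 1)"
   have p: "T * g * g + 1 > 0" using T g by (simp add: add_nonneg_pos)
   then have e': "e' > 0" "e' * (T * g * g) <= e" unfolding e'_def using e T g by (auto simp: field_simps)
   obtain d where d: "d > 0" "!!x y. x : cball 0 R ==> y : cball 0 R ==> norm (y - x) < d ==>
    norm (f y - f x - f' x (y - x)) <= e' * norm (y - x)" using rem[OF e'(1)] by blast
   show "EX d>0. ALL z. norm (z - zet 0) < d --> norm (y z T - y (zet 0) T - V (z - zet 0) T) <= e * norm (z - zet 0)"
   proof (intro exI conjI allI impI)
    show "min de (d / g) > 0" using de d(1) g by simp
    fix z assume "norm (z - zet 0) < min de (d / g)"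
    then have z: "norm (z - zet 0) < de" "norm (z - zet 0) * g < d" using g by (auto simp: field_simps)
    define h where "h = z - zet 0"
    define m where "m = e' * (norm h * g)"
    have e: "indef T (%s. f (y z s) - f (zet s) - f' (zet s) (V h s)) (%s. y z s - zet s - V h s)"
     by (intro indef_diff yo z zet V(1))
    have "norm (y z T - zet T - V h T) <= (T * m) * g"
     unfolding g_def
    proof (rule gronwall_indef[where m="%s. m", OF L2_const e _ _ _ _ T'])
     fix s assume s: "s : {0..T}"
     have "f (y z s) - f (zet s) - f' (zet s) (V h s) =
       (f (y z s) - f (zet s) - f' (zet s) (y z s - zet s)) + f' (zet s) (y z s - zet s - V h s)"
      by (simp add: linear_diff[OF lf])
     also have "norm ... <= e' * norm (y z s - zet s) + C * norm (y z s - zet s - V h s)"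
      by (intro norm_triangle_mono C(2) d(2) zetR yR z(1) s le_less_trans[OF diff[OF s] z(2)])
     also have "... <= m + C * norm (y z s - zet s - V h s)"
      unfolding m_def h_def using diff[OF s, of z] e'(1) by (intro add_right_mono mult_left_mono) auto
     finally show "norm (f (y z s) - f (zet s) - f' (zet s) (V h s)) <= C * norm (y z s - zet s - V h s) + m" by simp
     show "0 <= m" unfolding m_def using e'(1) g by simp
    qed (use T in \<open>auto simp: y V h_def\<close>)
    also have "(T * m) * g = e' * (T * g * g) * norm h" unfolding m_def by (simp add: mult_ac)
    also have "... <= e * norm h" by (rule mult_right_mono[OF e'(2)]) simp
    finally have "norm (y z T - zet T - V h T) <= e * norm h" .
    moreover have "y (zet 0) T = zet T" using diff[OF T', of "zet 0"] by simp
    ultimately show "norm (y z T - y (zet 0) T - V (z - zet 0) T) <= e * norm (z - zet 0)" unfolding h_def by simp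
   qed
  qed
 qed
qed

section \<open>The Hamiltonian flow\<close>

lemma indef_restrict: "indef T f F ==> t <= T ==> indef t f F"
 unfolding indef_def by (auto intro: absolutely_integrable_on_subinterval)

lemma indef_Pair:
 assumes "indef T f F" "indef T g G"
 shows "indef T (%t. (f t, g t)) (%t. (F t, G t))"
proof -
 have "bounded_linear (%x. (x, 0))" "bounded_linear (%x. (0, x))"
  by (intro bounded_linear_Pair bounded_linear_ident bounded_linear_zero)+
 from indef_add[OF indef_bounded_linear[OF this(1) assms(1)] indef_bounded_linear[OF this(2) assms(2)]]
 show ?thesis by simp
qed

lemma indef_reverse:
 fixes f :: "real => 'a::euclidean_space"
 assumes T: "T >= 0" and f: "continuous_on {0..T} f" and F: "indef T f F"
 shows "indef T (%s. - f (T - s)) (%s. F (T - s))"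
proof -
 have "continuous_on {0..T} (%s. - f (T - s))"
  by (intro continuous_on_minus continuous_on_compose2[OF f] continuous_intros) auto
 then show ?thesis
  using reverse_derivative F by (simp only: indef_iff_derivative[OF T] f)
qed

lemma indef_iff_orbit:
 fixes f :: "'a::euclidean_space => 'a"
 assumes f: "C1 f f'" and T: "T >= 0"
 shows "indef T (%s. f (zet s)) zet \<longleftrightarrow> (ALL t:{0..T}. (zet has_vector_derivative f (zet t)) (at t within {0..T}))" (is "?I \<longleftrightarrow> ?D")
proof -
 have "continuous_on {0..T} zet" if "?I | ?D"
  using that indef_continuous_on has_vector_derivative_continuous
  by (metis continuous_on_eq_continuous_within)
 then show ?thesis using indef_iff_derivative[OF T C1_continuous_compose[OF f]] by blast
qed

lemma grad_eqI: "GDERIV f x :> v ==> grad f x = v"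
proof -
 assume v: "GDERIV f x :> v"
 have "u = v" if "GDERIV f x :> u" for u
 proof -
  have "(%h. h \<bullet> u) = (%h. h \<bullet> v)" using that v unfolding gderiv_def by (rule has_derivative_unique)
  then have "(u - v) \<bullet> u = (u - v) \<bullet> v" by meson
  then have "(u - v) \<bullet> (u - v) = 0" by (simp only: inner_diff_right)
  then show ?thesis by simp
 qed
 then show ?thesis unfolding grad_def using v by blast
qed

context control_problem
begin

text \<open>Explicit form of the Hamiltonian field, free of the description operator in
  \<open>grad\<close>, so that it can be differentiated.\<close>

definition HX :: "'d rvec \<times> 'd rvec => 'd rvec \<times> 'd rvec" where
 "HX z = (sg0 (fst z) + (SUM i:UNIV. (snd z \<bullet> sg i (fst z)) *R sg i (fst z)),
  - (snd z v* Dm sg0 (fst z) + (SUM i:UNIV. (snd z \<bullet> sg i (fst z)) *R (snd z v* Dm (sg i) (fst z)))))"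

text \<open>Right-hand side of the Jacobi equation: \<open>fst v\<close> is the variation of the
  position, \<open>snd v\<close> that of the covector.\<close>

definition HX' :: "'d rvec \<times> 'd rvec => 'd rvec \<times> 'd rvec => 'd rvec \<times> 'd rvec" where
 "HX' z v = (Dm sg0 (fst z) *v fst v + (SUM i:UNIV. (snd v \<bullet> sg i (fst z) + snd z \<bullet> (Dm (sg i) (fst z) *v fst v)) *R sg i (fst z)
    + (snd z \<bullet> sg i (fst z)) *R (Dm (sg i) (fst z) *v fst v)),
  - ((snd v v* Dm sg0 (fst z) + snd z v* D2m sg0 (fst z) (fst v)) +
    (SUM i:UNIV. (snd v \<bullet> sg i (fst z) + snd z \<bullet> (Dm (sg i) (fst z) *v fst v)) *R (snd z v* Dm (sg i) (fst z))
    + (snd z \<bullet> sg i (fst z)) *R (snd v v* Dm (sg i) (fst z) + snd z v* D2m (sg i) (fst z) (fst v)))))"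

lemma hamiltonian_field_eq: "hamiltonian_field sg0 sg = HX"
proof
 fix z :: "'d rvec \<times> 'd rvec"
 obtain x p where z: "z = (x, p)" by (cases z)
 have adj: "k \<bullet> (p v* A) = p \<bullet> (A *v k)" for k and A :: "real^'d^'d"
  by (subst inner_commute) (rule dot_lmul_matrix)
 have "GDERIV (%q. hamiltonian sg0 sg x q) p :> sg0 x + (SUM i:UNIV. (p \<bullet> sg i x) *R sg i x)"
  unfolding gderiv_def hamiltonian_def
  by (auto intro!: derivative_eq_intros simp: fun_eq_iff inner_add_right inner_sum_right sum_divide_distrib mult_ac)
 moreover have "GDERIV (%y. hamiltonian sg0 sg y p) x :> p v* Dm sg0 x + (SUM i:UNIV. (p \<bullet> sg i x) *R (p v* Dm (sg i) x))"
  unfolding gderiv_def hamiltonian_def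
  by (auto intro!: derivative_eq_intros Dm_has_derivative Cb0 Cbi
   simp: fun_eq_iff inner_add_right inner_sum_right sum_divide_distrib mult_ac adj)
 ultimately show "hamiltonian_field sg0 sg z = HX z"
  unfolding hamiltonian_field_def HX_def z by (simp add: grad_eqI)
qed

lemma C1_HX: "C1 HX HX'"
 unfolding C1_def
proof (intro conjI allI)
 note vm = bilinear_vm and mv = bilinear_mv
 note fst = has_derivative_fst[OF has_derivative_ident] and snd = has_derivative_snd[OF has_derivative_ident]
 have S: "((%z::'d rvec \<times> 'd rvec. f (fst z)) has_derivative (%v. Dm f (fst z) *v fst v)) (at z)"
  if "Cb_infinity f" for f :: "'d vfield" and z
  by (rule has_derivative_compose[OF fst Dm_has_derivative[OF that]])
 have S1: "((%z::'d rvec \<times> 'd rvec. Dm f (fst z)) has_derivative (%v. D2m f (fst z) (fst v))) (at z)"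
  if "Cb_infinity f" for f :: "'d vfield" and z
  by (rule has_derivative_compose[OF fst D2m_has_derivative[OF that]])
 have c: "continuous_on UNIV (%z::'d rvec \<times> 'd rvec. f (fst z))" "continuous_on UNIV (%z::'d rvec \<times> 'd rvec. Dm f (fst z))"
  "continuous_on UNIV (%z::'d rvec \<times> 'd rvec. D2m f (fst z) v)" if "Cb_infinity f" for f :: "'d vfield" and v
  by (rule continuous_on_compose2[of UNIV]; (intro Cb_infinity_continuous_on that Cb_infinity_Dm Cb_infinity_D2m continuous_intros | simp))+
 show "(HX has_derivative HX' z) (at z)" for z
  unfolding HX_def[abs_def] HX'_def[abs_def]
  by (rule has_derivative_eq_rhs, rule has_derivative_Pair[OF has_derivative_add[OF S[OF Cb0] has_derivative_sum]
     has_derivative_minus[OF has_derivative_add[OF bounded_bilinear.FDERIV[OF vm snd S1[OF Cb0]] has_derivative_sum]]],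
    rule bounded_bilinear.FDERIV[OF bounded_bilinear_scaleR bounded_bilinear.FDERIV[OF bounded_bilinear_inner snd S[OF Cbi]] S[OF Cbi]],
    rule bounded_bilinear.FDERIV[OF bounded_bilinear_scaleR bounded_bilinear.FDERIV[OF bounded_bilinear_inner snd S[OF Cbi]]
     bounded_bilinear.FDERIV[OF vm snd S1[OF Cbi]]]) (simp add: fun_eq_iff add.commute)
 show "continuous_on UNIV (%z. HX' z v)" for v
  unfolding HX'_def
  by (intro continuous_on_Pair continuous_on_minus continuous_on_add continuous_on_sum continuous_on_scaleR continuous_on_inner
   bounded_bilinear.continuous_on[OF vm] bounded_bilinear.continuous_on[OF mv] c[OF Cb0] c[OF Cbi] continuous_on_fst continuous_on_snd
   continuous_on_id continuous_on_const)
qed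

lemma C1_minus_HX: "C1 (%z. - HX z) (%z v. - HX' z v)"
 using C1_HX unfolding C1_def by (auto intro: has_derivative_minus continuous_on_minus)

lemma HX'_continuous: "indef T (%s. HX (Z s)) Z ==> indef T f V ==> continuous_on {0..T} (%s. HX' (Z s) (V s))"
 by (intro C1_derivative_continuous_compose[OF C1_HX] indef_continuous_on)

lemma orbit_forward:
 assumes "t >= 0"
 shows "hamiltonian_orbit sg0 sg t 0 z zet \<longleftrightarrow> zet 0 = z & indef t (%s. HX (zet s)) zet"
 using assms unfolding hamiltonian_orbit_def hamiltonian_field_eq indef_iff_orbit[OF C1_HX assms]
 by (simp add: closed_segment_eq_real_ivl)

text \<open>The substitution of \<open>T - s\<close> for \<open>s\<close> turns a backward orbit
  into a forward orbit of \<open>- HX\<close>, so the results on initial value problems apply from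
  time \<open>T\<close>.\<close>

lemma orbit_backward:
 "hamiltonian_orbit sg0 sg 0 T z zet \<longleftrightarrow> zet T = z & indef T (%s. - HX (zet (T - s))) (%s. zet (T - s))"
proof -
 have "(ALL t:{0..T}. (zet has_vector_derivative HX (zet t)) (at t within {0..T})) \<longleftrightarrow>
  (ALL t:{0..T}. ((%s. zet (T - s)) has_vector_derivative - HX (zet (T - t))) (at t within {0..T}))" (is "?L \<longleftrightarrow> ?R")
 proof
  assume ?L
  then show ?R by (rule reverse_derivative)
 next
  assume ?R
  from reverse_derivative[OF this] show ?L by simp
 qed
 then show ?thesis
  using T unfolding hamiltonian_orbit_def hamiltonian_field_eq indef_iff_orbit[OF C1_minus_HX T0, of "%s. zet (T - s)"]
  by (simp add: closed_segment_eq_real_ivl)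
qed

lemma flow_forward:
 assumes zet: "indef T (%s. HX (zet s)) zet" and t: "t : {0..T}"
 shows "zet 0 : hamiltonian_dom sg0 sg t 0" "hamiltonian_flow sg0 sg t 0 (zet 0) = zet t"
proof -
 have t0: "t >= 0" using t by simp
 have zett: "indef t (%s. HX (zet s)) zet" using indef_restrict[OF zet] t by simp
 then have o: "hamiltonian_orbit sg0 sg t 0 (zet 0) zet" unfolding orbit_forward[OF t0] by simp
 then show "zet 0 : hamiltonian_dom sg0 sg t 0" unfolding hamiltonian_dom_def by blast
 show "hamiltonian_flow sg0 sg t 0 (zet 0) = zet t" unfolding hamiltonian_flow_def
 proof (rule the_equality)
  show "EX zet'. hamiltonian_orbit sg0 sg t 0 (zet 0) zet' & zet t = zet' t" using o by blast
  fix z assume "EX zet'. hamiltonian_orbit sg0 sg t 0 (zet 0) zet' & z = zet' t"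
  then obtain zet' where zet': "zet' 0 = zet 0" "indef t (%s. HX (zet' s)) zet'" "z = zet' t" unfolding orbit_forward[OF t0] by blast
  show "z = zet t" unfolding zet'(3) by (rule flow_unique[OF C1_HX zet'(2) zett zet'(1)]) (use t0 in simp)
 qed
qed

lemma flow_backward:
 assumes eta: "indef T (%s. - HX (eta s)) eta"
 shows "hamiltonian_flow sg0 sg 0 T (eta 0) = eta T"
 unfolding hamiltonian_flow_def
proof (rule the_equality)
 have "hamiltonian_orbit sg0 sg 0 T (eta 0) (%s. eta (T - s))" unfolding orbit_backward using eta by simp
 then show "EX zet. hamiltonian_orbit sg0 sg 0 T (eta 0) zet & eta T = zet 0" by (intro exI[of _ "%s. eta (T - s)"]) simp
 fix z assume "EX zet. hamiltonian_orbit sg0 sg 0 T (eta 0) zet & z = zet 0"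
 then obtain zet where zet: "zet T = eta 0" "indef T (%s. - HX (zet (T - s))) (%s. zet (T - s))" "z = zet 0" unfolding orbit_backward by blast
 have "zet (T - T) = eta T" by (rule flow_unique[OF C1_minus_HX zet(2) eta]) (use zet(1) T0 in auto)
 then show "z = eta T" using zet(3) by simp
qed

lemma reversed_orbit: "indef T (%s. HX (Z s)) Z ==> indef T (%s. - HX (Z (T - s))) (%s. Z (T - s))"
 by (rule indef_reverse[OF T0 C1_continuous_compose[OF C1_HX]]) (auto intro: indef_continuous_on)

lemma reversed_linearized:
 "indef T (%s. HX (Z s)) Z ==> indef T (%s. HX' (Z s) (V s)) V ==>
 indef T (%s. - HX' (Z (T - s)) (V (T - s))) (%s. V (T - s))"
 by (rule indef_reverse[OF T0 HX'_continuous])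

lemma reversed_path_continuous: "continuous_on {0..T} Z ==> continuous_on {0..T} (%s. Z (T - s))"
 by (rule continuous_on_compose2[of "{0..T}"]) (auto intro!: continuous_intros)

lemma linearized_terminal_exists:
 assumes Z: "indef T (%s. HX (Z s)) Z"
 obtains V where "indef T (%s. HX' (Z s) (V s)) V" "V T = z"
proof -
 have c: "continuous_on {0..T} (%s. Z (T - s))" by (rule reversed_path_continuous[OF indef_continuous_on[OF Z]])
 obtain v where v: "indef T (%s. - HX' (Z (T - s)) (v s)) v" "v 0 = z"
  by (rule linearized_exists[OF C1_minus_HX T0 c]) blast
 have "indef T (%s. - (- HX' (Z (T - (T - s))) (v (T - s)))) (%s. v (T - s))"
  by (rule indef_reverse[OF T0 C1_derivative_continuous_compose[OF C1_minus_HX c indef_continuous_on[OF v(1)]] v(1)])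
 then have "indef T (%s. HX' (Z s) (v (T - s))) (%s. v (T - s))" by simp
 moreover have "v (T - T) = z" using v(2) by simp
 ultimately show ?thesis by (rule that[of "%s. v (T - s)"])
qed

lemma linearized_terminal_unique:
 assumes Z: "indef T (%s. HX (Z s)) Z" and V: "indef T (%s. HX' (Z s) (V s)) V" and U: "indef T (%s. HX' (Z s) (U s)) U"
  and eq: "V T = U T" and t: "t : {0..T}"
 shows "V t = U t"
proof -
 have c: "continuous_on {0..T} (%s. Z (T - s))" by (rule reversed_path_continuous[OF indef_continuous_on[OF Z]])
 have "V (T - (T - t)) = U (T - (T - t))"
  by (rule linearized_unique[OF C1_minus_HX c reversed_linearized[OF Z V] reversed_linearized[OF Z U]]) (use eq t in auto)
 then show ?thesis by simp
qed

text \<open>The focal matrix sends \<open>u\<close> to the position part at time 0 of the Jacobi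
  field whose terminal value is the encoding of \<open>u\<close>: the derivative of the flow is the
  flow of the linearised equation.\<close>

lemma focal_matrix_mult:
 assumes Z: "indef T (%s. HX (Z s)) Z" and V: "indef T (%s. HX' (Z s) (V s)) V"
  and VT: "V T = (restrict_coords (- L) u, restrict_coords L u)"
 shows "focal_matrix sg0 sg T L (Z T) *v u = fst (V 0)"
proof -
 define E where "E u = (restrict_coords (- L) u, restrict_coords L u)" for u :: "'d rvec"
 have E: "bounded_linear E"
 proof -
  have "linear E" unfolding E_def restrict_coords_def by (rule linearI) (auto simp: vec_eq_iff)
  then show ?thesis by (simp add: linear_conv_bounded_linear)
 qed
 interpret E: bounded_linear E by (rule E)
 define eta where "eta s = Z (T - s)" for s
 have eta: "indef T (%s. - HX (eta s)) eta" unfolding eta_def[abs_def] by (rule reversed_orbit[OF Z])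
 obtain de y La where de: "de > 0" and y: "!!z. norm (z - eta 0) < de ==> indef T (%s. - HX (y z s)) (y z) & y z 0 = z"
  and dy: "((%z. y z T) has_derivative La) (at (eta 0))"
  and La: "!!v. indef T (%s. - HX' (eta s) (v s)) v ==> La (v 0) = v T"
  by (rule flow_differentiable[OF C1_minus_HX T0 eta]) blast
 define F where "F w = fst (hamiltonian_flow sg0 sg 0 T (Z T + E w))" for w
 have "((%w. Z T + E w) has_derivative E) (at 0)"
  using has_derivative_add[OF has_derivative_const[of "Z T"] E.has_derivative[OF has_derivative_ident]] by simp
 moreover have "((%z. y z T) has_derivative La) (at (Z T + E 0))" using dy unfolding eta_def E.zero by simp
 ultimately have "((%w. y (Z T + E w) T) has_derivative (%w. La (E w))) (at 0)"
  by (rule has_derivative_compose)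
 then have d: "((%w. fst (y (Z T + E w) T)) has_derivative (%w. fst (La (E w)))) (at 0)"
  by (rule has_derivative_fst)
 have "open {w. norm (E w) < de}"
  by (intro open_Collect_less continuous_intros E.continuous_on)
 \<comment> \<open>Near 0 the perturbed terminal points lie where orbits are known to exist, so
   \<open>F\<close> agrees there with the differentiable family.\<close>
 then have "(F has_derivative (%w. fst (La (E w)))) (at 0)"
 proof (rule has_derivative_transform_within_open[OF d])
  show "0 : {w. norm (E w) < de}" using de by (simp add: E.zero)
  fix w assume "w : {w. norm (E w) < de}"
  then have "norm ((Z T + E w) - eta 0) < de" unfolding eta_def by simp
  from y[OF this] show "fst (y (Z T + E w) T) = F w" unfolding F_def using flow_backward by force
 qed
 then have fd: "frechet_derivative F (at 0) = (%w. fst (La (E w)))" and lin: "linear (%w. fst (La (E w)))"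
  using frechet_derivative_at has_derivative_linear by metis+
 have "focal_matrix sg0 sg T L (Z T) = matrix (frechet_derivative F (at 0))"
  unfolding focal_matrix_def jacobian_def F_def E_def by (cases "Z T") simp
 then have "focal_matrix sg0 sg T L (Z T) *v u = fst (La (E u))"
  unfolding fd by (elim ssubst) (rule matrix_vector_mul(2)[OF lin, THEN fun_cong])
 also have "La (E u) = V 0"
 proof -
  have "indef T (%s. - HX' (eta s) (V (T - s))) (%s. V (T - s))" unfolding eta_def by (rule reversed_linearized[OF Z V])
  from La[OF this] show ?thesis using VT unfolding E_def by simp
 qed
 finally show ?thesis .
qed

lemma Am_emb1: "Am (emb1 u) s = Dm sg0 (Xp (emb1 u) s) + (SUM i:UNIV. u s $ i *R Dm (sg i) (Xp (emb1 u) s))"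
 unfolding Am_def dfld_def sum_option by (simp add: emb1_def)

end

section \<open>The extremal of the minimizing control\<close>

context minimizing_control
begin

definition Z :: "real => 'd rvec \<times> 'd rvec" where "Z s = (Xp w s, cov w rho s)"

text \<open>Inserting the critical control \<open>gradc w rho\<close> turns the controlled equation
  and its adjoint into the autonomous Hamiltonian system. The two right-hand sides agree almost
  everywhere, which suffices in integrated form.\<close>

lemma Z_indef: "indef T (%s. HX (Z s)) Z"
proof -
 have "indef T (%s. (fld w s (Xp w s), - (cov w rho s v* Am w s))) Z"
  unfolding Z_def[abs_def] by (intro indef_Pair Xp(1)[OF L2w] cov_indef[OF L2w])
 moreover have "aeq T (%s. (fld w s (Xp w s), - (cov w rho s v* Am w s))) (%s. HX (Z s))"
  using aeq_map[OF critical, of "%s u. (sg0 (Xp w s) + (SUM i:UNIV. u $ i *R sg i (Xp w s)),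
   - (cov w rho s v* (Dm sg0 (Xp w s) + (SUM i:UNIV. u $ i *R Dm (sg i) (Xp w s)))))"]
  unfolding fld_emb1 Am_emb1
  by (simp add: HX_def Z_def gradc_def bounded_bilinear.add_right[OF bilinear_vm]
   bounded_bilinear.sum_right[OF bilinear_vm] bounded_bilinear.scaleR_right[OF bilinear_vm])
 ultimately show ?thesis by (rule aeq_indef[rotated])
qed

text \<open>Pairing the gradient with \<open>G b\<close> returns the component
  \<open>tau $ b\<close>, so a covector is determined by its gradient.\<close>

lemma covector_zero:
 assumes "aeq T (gradc w tau) (%s. 0)"
 shows "tau = 0"
proof -
 have "tau $ b = 0" for b
 proof -
  have "tau \<bullet> V (G b) T = ip T (G b) (gradc w tau)" by (rule Vp_T_inner[OF L2w L2G])
  also have "... = ip T (G b) (%s. 0)" by (rule ip_aeq[OF aeq_refl assms])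
  also have "... = 0" unfolding ip_def by simp
  finally show ?thesis unfolding VpG by (simp add: inner_axis)
 qed
 then show ?thesis by (simp add: vec_eq_iff)
qed

text \<open>\<open>r v* Jm\<close> is constant by the product rule, so an adjoint solution is fixed
  by its terminal value.\<close>

lemma cov_unique:
 assumes r: "indef T (%s. - (r s v* Am w s)) r" and t: "t : {0..T}"
 shows "r t = cov w (r T) t"
proof -
 have "indef T (%s. - (r s v* Am w s) v* Jm w s + r s v* (Am w s ** Jm w s)) (%s. r s v* Jm w s)"
  by (rule indef_bilinear[OF bilinear_vm r Jm(1)[OF L2w]])
 moreover have "- (r s v* Am w s) v* Jm w s + r s v* (Am w s ** Jm w s) = 0" for s
  by (simp add: bounded_bilinear.minus_left[OF bilinear_vm] vector_matrix_mul_assoc)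
 ultimately have "indef T (%s. 0) (%s. r s v* Jm w s)" by simp
 then have "r s v* Jm w s = r 0 v* Jm w 0" if "s : {0..T}" for s using indefD[OF _ that] by fastforce
 then have "r t v* Jm w t = r T v* Jm w T" using t T' by metis
 then have "(r t v* Jm w t) v* Km w t = cov w (r T) t" unfolding cov_def by simp
 then show ?thesis unfolding vector_matrix_mul_assoc Jm_Km[OF L2w t] by simp
qed

text \<open>Existence is the orbit \<open>Z\<close>. For uniqueness let \<open>r\<close> be the
  difference of two covector paths over the same positions. The position equations give
  \<open>sum_i (r \<bullet> sigma_i) sigma_i = 0\<close>, hence
  \<open>r \<bullet> sigma_i = 0\<close>. Both paths then generate the same control, so
  \<open>r\<close> solves the homogeneous adjoint equation; its terminal value has zero gradient and
  is therefore zero.\<close>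

lemma associated_covector_eq: "associated_covector sg0 sg T x0 h = cov w rho 0"
 unfolding associated_covector_def
proof (rule the_equality)
 have Z0: "Z 0 = (x0, cov w rho 0)" unfolding Z_def Xp(2)[OF L2w] ..
 show "ALL t:{0..T}. (x0, cov w rho 0) : hamiltonian_dom sg0 sg t 0 &
   control_flow sg0 sg T x0 t h = fst (hamiltonian_flow sg0 sg t 0 (x0, cov w rho 0))"
  using flow_forward[OF Z_indef] control_flow_eq[OF hCM] unfolding Z0[symmetric] by (simp add: Z_def)
 fix p assume p: "ALL t:{0..T}. (x0, p) : hamiltonian_dom sg0 sg t 0 &
   control_flow sg0 sg T x0 t h = fst (hamiltonian_flow sg0 sg t 0 (x0, p))"
 have "(x0, p) : hamiltonian_dom sg0 sg T 0" using bspec[OF p T'] by (rule conjunct1)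
 then obtain zet where zet0: "zet 0 = (x0, p)" and zet: "indef T (%s. HX (zet s)) zet"
  unfolding hamiltonian_dom_def mem_Collect_eq orbit_forward[OF T0] by (elim exE conjE) (rule that)
 have fst: "fst (zet t) = Xp w t" if t: "t : {0..T}" for t
  using bspec[OF p t] flow_forward(2)[OF zet t] control_flow_eq[OF hCM t] unfolding zet0 by simp
 define q where "q t = snd (zet t)" for t
 define r where "r t = q t - cov w rho t" for t
 have rsg: "r t \<bullet> sg i (Xp w t) = 0" if t: "t : {0..T}" for t i
 proof -
  have d: "(zet has_vector_derivative HX (zet t)) (at t within {0..T})" "(Z has_vector_derivative HX (Z t)) (at t within {0..T})"
   using indef_iff_orbit[OF C1_HX T0] zet Z_indef t by blast+
  have "((%s. fst (zet s)) has_vector_derivative fst (HX (zet t))) (at t within {0..T})"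
   by (rule bounded_linear.has_vector_derivative[OF bounded_linear_fst d(1)])
  then have "((%s. fst (Z s)) has_vector_derivative fst (HX (zet t))) (at t within {0..T})"
   by (rule has_vector_derivative_transform[OF t, rotated]) (simp add: fst Z_def)
  moreover have "((%s. fst (Z s)) has_vector_derivative fst (HX (Z t))) (at t within {0..T})"
   by (rule bounded_linear.has_vector_derivative[OF bounded_linear_fst d(2)])
  ultimately have "fst (HX (zet t)) = fst (HX (Z t))"
   using vector_derivative_unique_within_closed_interval[OF T_pos, unfolded cbox_interval, OF t] by blast
  then have "(SUM i:UNIV. (q t \<bullet> sg i (Xp w t)) *R sg i (Xp w t)) = (SUM i:UNIV. (cov w rho t \<bullet> sg i (Xp w t)) *R sg i (Xp w t))"
   unfolding HX_def fst_conv fst[OF t] q_def[symmetric] by (simp add: Z_def)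
  then have "(SUM i:UNIV. (r t \<bullet> sg i (Xp w t)) *R sg i (Xp w t)) = 0"
   unfolding r_def by (simp add: inner_diff_left scaleR_diff_left sum_subtractf)
  \<comment> \<open>Pairing with \<open>r t\<close> turns the vector identity into a sum of
    squares.\<close>
  then have "r t \<bullet> (SUM i:UNIV. (r t \<bullet> sg i (Xp w t)) *R sg i (Xp w t)) = 0" by simp
  then have "(SUM i:UNIV. (r t \<bullet> sg i (Xp w t)) * (r t \<bullet> sg i (Xp w t))) = 0" by (simp add: inner_sum_right)
  then have "(r t \<bullet> sg i (Xp w t)) * (r t \<bullet> sg i (Xp w t)) = 0"
   using sum_nonneg_eq_0_iff[of UNIV "%i. (r t \<bullet> sg i (Xp w t)) * (r t \<bullet> sg i (Xp w t))"] by simp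
  then show ?thesis by simp
 qed
 have "indef T (%s. snd (HX (zet s)) - snd (HX (Z s))) r"
  using indef_diff[OF indef_bounded_linear[OF bounded_linear_snd zet] indef_bounded_linear[OF bounded_linear_snd Z_indef]]
  unfolding r_def[abs_def] q_def by (simp add: Z_def)
 moreover have "aeq T (%s. snd (HX (zet s)) - snd (HX (Z s))) (%s. - (r s v* Am w s))"
 proof -
  note vm = bilinear_vm
  have "snd (HX (zet s)) - snd (HX (Z s)) = - (r s v* (Dm sg0 (Xp w s) + (SUM i:UNIV. gradc w rho s $ i *R Dm (sg i) (Xp w s))))"
   if s: "s : {0..T}" for s
  proof -
   have qi: "q s \<bullet> sg i (Xp w s) = gradc w rho s $ i" for i
    using rsg[OF s, of i] unfolding r_def gradc_def by (simp add: inner_diff_left)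
   have "snd (HX (zet s)) = - (q s v* (Dm sg0 (Xp w s) + (SUM i:UNIV. gradc w rho s $ i *R Dm (sg i) (Xp w s))))"
    unfolding HX_def snd_conv fst[OF s] q_def[symmetric] qi
    by (simp add: bounded_bilinear.add_right[OF vm] bounded_bilinear.sum_right[OF vm] bounded_bilinear.scaleR_right[OF vm])
   moreover have "snd (HX (Z s)) = - (cov w rho s v* (Dm sg0 (Xp w s) + (SUM i:UNIV. gradc w rho s $ i *R Dm (sg i) (Xp w s))))"
    unfolding HX_def snd_conv Z_def fst_conv gradc_def
    by (simp add: bounded_bilinear.add_right[OF vm] bounded_bilinear.sum_right[OF vm] bounded_bilinear.scaleR_right[OF vm])
   ultimately show ?thesis unfolding r_def by (simp add: bounded_bilinear.diff_left[OF vm])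
  qed
  then have "aeq T (%s. snd (HX (zet s)) - snd (HX (Z s))) (%s. - (r s v* (Dm sg0 (Xp w s) + (SUM i:UNIV. gradc w rho s $ i *R Dm (sg i) (Xp w s)))))"
   by (intro aeqI[of "{}"]) auto
  from aeq_trans[OF this aeq_map[OF aeq_sym[OF critical], of "%s u. - (r s v* (Dm sg0 (Xp w s) + (SUM i:UNIV. u $ i *R Dm (sg i) (Xp w s))))"]]
  show ?thesis unfolding Am_emb1 .
 qed
 ultimately have r: "indef T (%s. - (r s v* Am w s)) r" by (rule aeq_indef[rotated])
 have "gradc w (r T) s = 0" if "s : {0..T}" for s
  unfolding gradc_def cov_unique[OF r that, symmetric] using rsg[OF that] by (simp add: vec_eq_iff)
 then have "r T = 0" by (intro covector_zero aeqI[of "{}"]) auto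
 then have "r 0 = cov w 0 0" using cov_unique[OF r, of 0] T by simp
 then have "r 0 = 0" unfolding cov_def by simp
 then show "p = cov w rho 0" unfolding r_def q_def zet0 by simp
qed

lemma hamiltonian_flow_eq: "hamiltonian_flow sg0 sg T 0 (x0, associated_covector sg0 sg T x0 h) = Z T"
 using flow_forward(2)[OF Z_indef T'] unfolding associated_covector_eq by (simp add: Z_def Xp(2)[OF L2w])

end

section \<open>Null vectors of the Hessian and Jacobi fields\<close>

context minimizing_control
begin

abbreviation S where "S == case_option sg0 sg"
abbreviation X where "X == Xp w"

text \<open>Variation of the adjoint right-hand side with the covector held fixed: the first sum
  comes from the variation \<open>v\<close> of the position, the second from the variation
  \<open>k\<close> of the control.\<close>

definition src :: "(real => real^'m) => (real => 'd rvec) => real => 'd rvec" where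
 "src k v s = (SUM j:UNIV. w s $ j *R (cov w rho s v* D2m (S j) (X s) (v s))) + (SUM i:UNIV. k s $ i *R (cov w rho s v* Dm (sg i) (X s)))"

text \<open>Variation of the feedback \<open><p, sigma_i(x)>\<close> under a variation
  \<open>(v, r)\<close> of position and covector. The relation \<open>k = fb v r\<close> is the
  linearised critical point equation.\<close>

definition fb :: "(real => 'd rvec) => (real => 'd rvec) => real => real^'m" where
 "fb v r s = (\<chi> i. r s \<bullet> sg i (X s) + cov w rho s \<bullet> (Dm (sg i) (X s) *v v s))"

lemma X_continuous: "continuous_on {0..T} X" and p_continuous: "continuous_on {0..T} (cov w rho)"
 using Xp_continuous_on[OF L2w] cov_continuous_on[OF L2w] by auto

lemma Dmsg_continuous: "continuous_on {0..T} (%s. Dm (sg i) (X s))"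
 using DS_compose_continuous_on[OF X_continuous, of "Some i"] by simp

lemma V_continuous: "L2 T k ==> continuous_on {0..T} (V k)"
 by (rule Vp_continuous_on[OF L2w L2_emb0])

lemma sg_continuous: "continuous_on {0..T} (%s. sg i (X s))"
 using S_compose_continuous_on[OF X_continuous, of "Some i"] by simp

lemma fb_continuous:
 assumes "continuous_on {0..T} v" "continuous_on {0..T} r"
 shows "continuous_on {0..T} (fb v r)"
 unfolding fb_def[abs_def]
 by (intro continuous_on_vec_lambda continuous_on_add continuous_on_inner assms p_continuous sg_continuous
  bounded_bilinear.continuous_on[OF bilinear_mv] Dmsg_continuous)

lemma L2_src:
 assumes k: "L2 T k" and v: "continuous_on {0..T} v"
 shows "L2 T (src k v)"
 unfolding src_def[abs_def]
 by (intro L2_add L2_sum L2_scaleR_fun L2_vec_nth L2w k bounded_bilinear.continuous_on[OF bilinear_vm]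
  p_continuous D2S_continuous_on X_continuous v Dmsg_continuous)

text \<open>The second variation in terms of the adjoint equation: integrate \<open>r \<bullet> V u\<close> by parts.\<close>

lemma second_variation_adjoint:
 assumes k: "L2 T k" and u: "L2 T u" and r: "indef T (%s. - (r s v* Am w s + src k (V k) s)) r"
 shows "Q k u = ip T u (%s. k s - fb (V k) r s) + r T \<bullet> V u T"
proof -
 note cV = V_continuous[OF k] V_continuous[OF u] and cr = indef_continuous_on[OF r]
 have L: "L2 T (%s. \<chi> i. r s \<bullet> sg i (X s))"
  by (intro L2_continuous_on continuous_on_vec_lambda continuous_on_inner cr sg_continuous)
 have LF: "L2 T (F2 w rho (V k) (V u))" "L2 T (F1 w rho (V u))" "L2 T (F1 w rho (V k))"
  by (intro L2_continuous_on F2_continuous_on F1_continuous_on L2w cV)+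
 have src: "src k (V k) s \<bullet> V u s = w s \<bullet> F2 w rho (V k) (V u) s + emb0 k s \<bullet> F1 w rho (V u) s" for s
  unfolding src_def F1_def F2_def inner_vec_def[of "w s"] inner_vec_def[of "emb0 k s"] sum_option[of "%j. emb0 k s $ j \<bullet> _ j"]
  by (simp add: inner_add_left inner_sum_left dot_lmul_matrix emb0_def)
 have isrc: "((%s. src k (V k) s \<bullet> V u s) has_integral ip T w (F2 w rho (V k) (V u)) + ip T (emb0 k) (F1 w rho (V u))) {0..T}"
  unfolding src ip_def by (intro has_integral_add integrable_integral ip_integrable L2w L2_emb0 k LF)
 have "indef T (%s. - (r s v* Am w s + src k (V k) s) \<bullet> V u s + r s \<bullet> (Am w s *v V u s + fld (emb0 u) s (X s))) (%s. r s \<bullet> V u s)"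
  by (rule indef_bilinear[OF bounded_bilinear_inner r Vp(1)[OF L2w L2_emb0[OF u]]])
 moreover have "- (r s v* Am w s + src k (V k) s) \<bullet> V u s + r s \<bullet> (Am w s *v V u s + fld (emb0 u) s (X s))
  = u s \<bullet> (\<chi> i. r s \<bullet> sg i (X s)) - src k (V k) s \<bullet> V u s" for s
 proof -
  have "r s \<bullet> fld (emb0 u) s (X s) = u s \<bullet> (\<chi> i. r s \<bullet> sg i (X s))"
   unfolding fld_emb0 inner_vec_def[of "u s"] by (simp add: inner_sum_right)
  then show ?thesis by (simp add: inner_add_right inner_add_left inner_diff_left dot_lmul_matrix)
 qed
 ultimately have "indef T (%s. u s \<bullet> (\<chi> i. r s \<bullet> sg i (X s)) - src k (V k) s \<bullet> V u s) (%s. r s \<bullet> V u s)" by simp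
 from indef_has_integral[OF this T']
 have "((%s. u s \<bullet> (\<chi> i. r s \<bullet> sg i (X s)) - src k (V k) s \<bullet> V u s) has_integral r T \<bullet> V u T) {0..T}"
  using Vp(2)[OF L2w L2_emb0[OF u]] by simp
 moreover have "((%s. u s \<bullet> (\<chi> i. r s \<bullet> sg i (X s)) - src k (V k) s \<bullet> V u s) has_integral
   ip T u (%s. \<chi> i. r s \<bullet> sg i (X s)) - (ip T w (F2 w rho (V k) (V u)) + ip T (emb0 k) (F1 w rho (V u)))) {0..T}"
  by (rule has_integral_diff[OF _ isrc]) (unfold ip_def, intro integrable_integral ip_integrable u L)
 ultimately have *: "r T \<bullet> V u T = ip T u (%s. \<chi> i. r s \<bullet> sg i (X s)) - (ip T w (F2 w rho (V k) (V u)) + ip T (emb0 k) (F1 w rho (V u)))"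
  by (rule has_integral_unique)
 define b where "b s = (\<chi> i. cov w rho s \<bullet> (Dm (sg i) (X s) *v V k s))" for s
 have Lb: "L2 T b" unfolding b_def[abs_def]
  by (intro L2_continuous_on continuous_on_vec_lambda continuous_on_inner p_continuous
   bounded_bilinear.continuous_on[OF bilinear_mv] Dmsg_continuous cV)
 have "emb0 u s \<bullet> F1 w rho (V k) s = u s \<bullet> b s" for s
  unfolding inner_vec_def[of "emb0 u s"] sum_option by (simp add: F1_def b_def emb0_def inner_vec_def)
 then have "ip T (emb0 u) (F1 w rho (V k)) = ip T u b" unfolding ip_def by simp
 moreover have "(%s. k s - fb (V k) r s) = (%s. k s - ((\<chi> i. r s \<bullet> sg i (X s)) + b s))"
  unfolding fb_def b_def by (simp add: fun_eq_iff vec_eq_iff)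
 then have "ip T u (%s. k s - fb (V k) r s) = ip T u k - (ip T u (%s. \<chi> i. r s \<bullet> sg i (X s)) + ip T u b)"
  using ip_diff_left[OF k L2_add[OF L Lb] u] ip_add_left[OF L Lb u] by (simp add: ip_commute[of T u])
 ultimately show ?thesis
  unfolding * Q_def Qb_def Rb_def ip_commute[of T k] by simp
qed

text \<open>Variation of constants from the terminal time: \<open>N\<close> integrates the
  transported source, and \<open>c\<close> is set so that \<open>(c - N T) v* Km w T\<close> equals
  \<open>tau\<close>.\<close>

lemma adjoint_exists:
 assumes k: "L2 T k"
 obtains r where "indef T (%s. - (r s v* Am w s + src k (V k) s)) r" "r T = tau"
proof -
 note vm = bilinear_vm
 define m where "m = src k (V k)"
 define N where "N t = integral {0..t} (%s. m s v* Jm w s)" for t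
 have "L2 T (%s. m s v* Jm w s)"
  unfolding m_def by (intro L2_bilinear_continuous[OF vm] L2_src k V_continuous Jm_continuous_on L2w)
 then have N: "indef T (%s. m s v* Jm w s) N"
  by (intro indefI[of _ _ _ 0]) (auto simp: N_def intro: L2_abs_integrable)
 define c where "c = tau v* Jm w T + N T"
 define r where "r s = (c - N s) v* Km w s" for s
 have "indef T (%s. (0 - m s v* Jm w s) v* Km w s + (c - N s) v* (- (Km w s ** Am w s))) r"
  unfolding r_def[abs_def] by (intro indef_bilinear[OF vm] indef_diff indef_const N Km(1)[OF L2w])
 then have "indef T (%s. - (r s v* Am w s + m s)) r"
 proof (rule indef_cong)
  fix s assume s: "s : {0..T}"
  have "(m s v* Jm w s) v* Km w s = m s" unfolding vector_matrix_mul_assoc Jm_Km[OF L2w s] by simp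
  moreover have "(c - N s) v* (Km w s ** Am w s) = r s v* Am w s" unfolding r_def vector_matrix_mul_assoc ..
  ultimately show "(0 - m s v* Jm w s) v* Km w s + (c - N s) v* (- (Km w s ** Am w s)) = - (r s v* Am w s + m s)"
   by (simp add: bounded_bilinear.minus_left[OF vm] bounded_bilinear.minus_right[OF vm])
 qed simp
 moreover have "r T = tau" unfolding r_def c_def using Jm_Km[OF L2w T'] by (simp add: vector_matrix_mul_assoc)
 ultimately show ?thesis using that unfolding m_def by blast
qed

text \<open>With \<open>k\<close> equal to the feedback variation, the linearised state equation and
  the adjoint equation with source form the linearised Hamiltonian system. In \<open>f s a b\<close>
  the control \<open>a\<close> and its variation \<open>b\<close> are placeholders, exchanged almost
  everywhere for \<open>gradc\<close> and \<open>fb\<close>.\<close>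

lemma linearized_aeq:
 assumes k: "aeq T k (fb v r)"
 shows "aeq T (%s. (Am w s *v v s + fld (emb0 k) s (X s), - (r s v* Am w s + src k v s))) (%s. HX' (Z s) (v s, r s))"
proof -
 note vm = bilinear_vm
 define f where "f s a b = (Dm sg0 (X s) *v v s + (SUM i:UNIV. b $ i *R sg i (X s) + a $ i *R (Dm (sg i) (X s) *v v s)),
  - ((r s v* Dm sg0 (X s) + cov w rho s v* D2m sg0 (X s) (v s)) + (SUM i:UNIV. b $ i *R (cov w rho s v* Dm (sg i) (X s))
    + a $ i *R (r s v* Dm (sg i) (X s) + cov w rho s v* D2m (sg i) (X s) (v s)))))" for s and a b :: "real^'m"
 have "HX' (Z s) (v s, r s) = f s (gradc w rho s) (fb v r s)" for s
  unfolding HX'_def f_def Z_def fst_conv snd_conv by (simp add: gradc_def fb_def)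
 moreover have "(Am w s *v v s + fld (emb0 k) s (X s), - (r s v* Am w s + src k v s)) = f s (path_deriv h s) (k s)" for s
 proof -
  have "Am w s *v v s + fld (emb0 k) s (X s) = fst (f s (path_deriv h s) (k s))"
   unfolding Am_emb1 fld_emb0 f_def fst_conv
   by (simp add: matrix_vector_mult_add_rdistrib bounded_bilinear.sum_left[OF bilinear_mv]
    bounded_bilinear.scaleR_left[OF bilinear_mv] sum.distrib)
  moreover have "r s v* Am w s + src k v s = - snd (f s (path_deriv h s) (k s))"
   unfolding Am_emb1 src_def f_def snd_conv sum_option
   by (simp add: emb1_def bounded_bilinear.add_right[OF vm] bounded_bilinear.sum_right[OF vm] bounded_bilinear.scaleR_right[OF vm]
    sum.distrib scaleR_add_right)
  ultimately show ?thesis by (simp add: prod_eq_iff)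
 qed
 moreover have "aeq T (%s. f s (path_deriv h s) (k s)) (%s. f s (gradc w rho s) (fb v r s))"
  by (rule aeq_map2[OF critical k])
 ultimately show ?thesis by simp
qed

section \<open>Null vectors of the second variation\<close>

lemma tangent_mk: "L2 T u ==> pr (V u T) = 0 ==> mk T u : tangent"
 unfolding tangent_def using mk_CM V_aeq[OF mk_path_deriv] by simp

lemma Q_commute: "Q u v = Q v u"
 unfolding Q_def by (rule Qb_commute)

lemma Q_add_right: "L2 T u ==> L2 T v ==> L2 T z ==> Q z (%s. u s + v s) = Q z u + Q z v"
 using Qb_add[OF L2w, of u v z rho] unfolding Q_commute[of z] unfolding Q_def by simp

lemma Q_scaleR_right: "Q z (%s. c *R u s) = c * Q z u"
 unfolding Q_commute[of z] unfolding Q_def by (rule Qb_scaleR)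

lemma Q_aeq: "aeq T u u' ==> aeq T v v' ==> Q u v = Q u' v'"
 unfolding Q_def by (rule Qb_aeq)

lemma Q_nonneg:
 assumes u: "L2 T u" and t: "pr (V u T) = 0"
 shows "Q u u >= 0"
 using second_variation_nonneg[OF tangent_mk[OF u t]] Q_aeq[OF mk_path_deriv[OF u] mk_path_deriv[OF u]] by simp

text \<open>Nonnegativity at \<open>u + c k\<close> reads \<open>0 <= Q u u + 2 c Q k u\<close> for
  every real \<open>c\<close>, and an affine function bounded below is constant.\<close>

lemma null_vector:
 assumes k: "L2 T k" "pr (V k T) = 0" "Q k k = 0" and u: "L2 T u" "pr (V u T) = 0"
 shows "Q k u = 0"
proof -
 interpret pr: bounded_linear pr by (rule bounded_linear_proj_lead)
 have "0 <= Q u u + 2 * c * Q k u" for c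
 proof -
  have ck: "L2 T (%s. c *R k s)" by (rule L2_scaleR[OF k(1)])
  have uc: "L2 T (%s. u s + c *R k s)" by (intro L2_add u ck)
  have "V (%s. u s + c *R k s) T = V u T + c *R V k T"
   unfolding V_add[OF u(1) ck] V_scaleR ..
  then have "pr (V (%s. u s + c *R k s) T) = 0" using k(2) u(2) by (simp add: pr.add pr.scaleR)
  from Q_nonneg[OF uc this] have "0 <= Q (%s. u s + c *R k s) (%s. u s + c *R k s)" .
  also have "... = (Q u u + c * Q u k) + c * (Q k u + c * Q k k)"
   unfolding Q_add_right[OF u(1) ck uc] Q_scaleR_right
   by (simp only: Q_commute[of "%s. u s + c *R k s" u] Q_commute[of "%s. u s + c *R k s" k]
    Q_add_right[OF u(1) ck u(1)] Q_add_right[OF u(1) ck k(1)] Q_scaleR_right)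
  also have "Q u k = Q k u" by (rule Q_commute)
  finally show ?thesis using k(3) by (simp add: algebra_simps)
 qed
 \<comment> \<open>This \<open>c\<close> would make the affine function equal to -1.\<close>
 from this[of "- (Q u u + 1) / (2 * Q k u)"] show ?thesis by (cases "Q k u = 0") (auto simp: field_simps)
qed

text \<open>The multiplier argument gives \<open>Q k' u = tau \<bullet> V u T\<close>. Solving the
  adjoint equation with terminal value \<open>tau\<close> and comparing with the second variation
  yields \<open>k' = fb (V k') r\<close>, so \<open>(V k', r)\<close> is a Jacobi field, and its
  position part vanishes at time 0.\<close>

lemma degenerate_imp_focal:
 assumes k: "k : tangent" "k ~= (%t. 0)" and Qk: "Q (path_deriv k) (path_deriv k) = 0"
 obtains u where "u ~= 0" "focal_matrix sg0 sg T (range io) (Z T) *v u = 0"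
proof -
 have kCM: "k : CM T" and prk: "pr (V (path_deriv k) T) = 0" using k(1) unfolding tangent_def by auto
 define k' where "k' = path_deriv k"
 have k': "L2 T k'" unfolding k'_def by (rule CM_imp(1)[OF T0 kCM])
 define tau where "tau = (SUM l:UNIV. Q k' (G (io l)) *R axis (io l) (1::real))"
 have mult: "Q k' u = tau \<bullet> V u T" if u: "L2 T u" for u
  unfolding tau_def
 proof (rule multiplier[where ph="Q k'", OF _ _ _ _ u])
  show "Q k' (%s. u s + v s) = Q k' u + Q k' v" if "L2 T u" "L2 T v" for u v
   by (rule Q_add_right[OF that k'])
  show "Q k' (%s. c *R u s) = c * Q k' u" for c u
   by (rule Q_scaleR_right)
  show "Q k' u = Q k' v" if "aeq T u v" for u v
   by (rule Q_aeq[OF aeq_refl that])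
  show "Q k' (path_deriv z) = 0" if "z : tangent" for z
  proof -
   have z: "z : CM T" "pr (V (path_deriv z) T) = 0" using that unfolding tangent_def by auto
   show ?thesis
    by (rule null_vector[OF k' prk[folded k'_def] Qk[folded k'_def] CM_imp(1)[OF T0 z(1)] z(2)])
  qed
 qed
 obtain r where r: "indef T (%s. - (r s v* Am w s + src k' (V k') s)) r" "r T = tau"
  by (rule adjoint_exists[OF k'])
 have fbL: "L2 T (fb (V k') r)"
  by (intro L2_continuous_on fb_continuous V_continuous k' indef_continuous_on[OF r(1)])
 have kfb: "aeq T k' (fb (V k') r)"
 proof (rule L2_aeq_eqI[OF k' fbL])
  fix z :: "real => real^'m" assume z: "L2 T z"
  have "ip T z (%s. k' s - fb (V k') r s) = 0"
   using second_variation_adjoint[OF k' z r(1)] mult[OF z] unfolding r(2) by simp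
  then show "ip T z k' = ip T z (fb (V k') r)"
   using ip_diff_left[OF k' fbL z] by (simp add: ip_commute[of T z])
 qed
 define W where "W s = (V k' s, r s)" for s
 have W: "indef T (%s. HX' (Z s) (W s)) W"
  unfolding W_def[abs_def] by (rule aeq_indef[OF linearized_aeq[OF kfb]]) (intro indef_Pair Vp(1)[OF L2w L2_emb0[OF k']] r(1))
 \<comment> \<open>\<open>V k' T\<close> vanishes on the leading coordinates and \<open>tau\<close>
   on the others, so the sum encodes both.\<close>
 define u where "u = V k' T + tau"
 have tauL: "tau $ j = 0" if "j ~: range io" for j
  unfolding tau_def using that by (auto simp: axis_def intro!: sum.neutral)
 have VL: "V k' T $ j = 0" if "j : range io" for j
  using prk that unfolding k'_def proj_lead_def by (auto simp: vec_eq_iff)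
 have WT: "W T = (restrict_coords (- range io) u, restrict_coords (range io) u)"
  unfolding W_def r(2) u_def restrict_coords_def using tauL VL by (auto simp: vec_eq_iff)
 have "focal_matrix sg0 sg T (range io) (Z T) *v u = fst (W 0)" by (rule focal_matrix_mult[OF Z_indef W WT])
 also have "... = 0" unfolding W_def using Vp(2)[OF L2w L2_emb0[OF k']] by simp
 finally have "focal_matrix sg0 sg T (range io) (Z T) *v u = 0" .
 \<comment> \<open>Vanishing terminal data would make the Jacobi field vanish, hence the feedback
   variation, hence \<open>k\<close>.\<close>
 moreover have "u ~= 0"
 proof
  assume "u = 0"
  then have "W T = 0" unfolding WT restrict_coords_def by (simp add: vec_eq_iff zero_prod_def)
  moreover have "indef T (%s. HX' (Z s) 0) (%s. 0)"
   using indef_const[of T 0] by (simp add: linear_0[OF C1_linear[OF C1_HX]])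
  ultimately have W0: "W s = 0" if "s : {0..T}" for s
   using linearized_terminal_unique[OF Z_indef W _ _ that, of "%s. 0"] by simp
  have "fb (V k') r s = 0" if "s : {0..T}" for s
  proof -
   have 0: "V k' s = 0" "r s = 0" using W0[OF that] unfolding W_def zero_prod_def by auto
   show ?thesis unfolding fb_def 0 by (simp add: vec_eq_iff)
  qed
  then have "aeq T (fb (V k') r) (%s. 0)" by (intro aeqI[of "{}"]) auto
  from aeq_mk[OF aeq_trans[OF kfb this]] have "k = mk T (%s. 0)" unfolding k'_def CM_imp(3)[OF T0 kCM] .
  then show False using k(2) by (auto simp: mk_def fun_eq_iff split: if_splits)
 qed
 ultimately show ?thesis using that by blast
qed

text \<open>The kernel vector provides terminal data of a Jacobi field \<open>(v, r)\<close> with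
  \<open>v 0 = 0\<close>; its feedback variation is the degenerate direction.\<close>

lemma focal_imp_degenerate:
 assumes u: "u ~= 0" "focal_matrix sg0 sg T (range io) (Z T) *v u = 0"
 obtains k where "k : tangent" "k ~= (%t. 0)" "Q (path_deriv k) (path_deriv k) = 0"
proof -
 obtain W where W: "indef T (%s. HX' (Z s) (W s)) W" "W T = (restrict_coords (- range io) u, restrict_coords (range io) u)"
  by (rule linearized_terminal_exists[OF Z_indef]) blast
 define v where "v s = fst (W s)" for s
 define r where "r s = snd (W s)" for s
 have Wvr: "W s = (v s, r s)" for s unfolding v_def r_def by simp
 have v0: "v 0 = 0" using focal_matrix_mult[OF Z_indef W] u(2) unfolding v_def by simp
 have vT: "v T = restrict_coords (- range io) u" and rT: "r T = restrict_coords (range io) u" unfolding v_def r_def W(2) by auto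
 define k where "k = fb v r"
 have c: "continuous_on {0..T} v" "continuous_on {0..T} r"
  using indef_continuous_on[OF W(1)] unfolding v_def[abs_def] r_def[abs_def] by (auto intro: continuous_intros)
 have k: "L2 T k" unfolding k_def by (intro L2_continuous_on fb_continuous c)
 have kfb: "aeq T k (fb v r)" unfolding k_def by (rule aeq_refl)
 have pair: "indef T (%s. (Am w s *v v s + fld (emb0 k) s (X s), - (r s v* Am w s + src k v s))) W"
  by (rule aeq_indef[OF aeq_sym[OF linearized_aeq[OF kfb]]]) (use W(1) in \<open>simp add: Wvr\<close>)
 have v: "indef T (%s. Am w s *v v s + fld (emb0 k) s (X s)) v"
  using indef_bounded_linear[OF bounded_linear_fst pair] unfolding v_def[abs_def] by simp
 have r: "indef T (%s. - (r s v* Am w s + src k v s)) r"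
  using indef_bounded_linear[OF bounded_linear_snd pair] unfolding r_def[abs_def] by simp
 \<comment> \<open>Once \<open>k\<close> is fixed the position equation decouples: \<open>v\<close>
   and \<open>V k\<close> solve the same linear equation with forcing \<open>k\<close> and both
   start at 0.\<close>
 have "indef T (%s. Am w s *v (V k s - v s)) (%s. V k s - v s)"
  using indef_diff[OF Vp(1)[OF L2w L2_emb0[OF k]] v] by (simp add: matrix_vector_mult_diff_distrib)
 moreover have "indef T (%s. Am w s *v 0) (%s. 0 :: 'd rvec)" using indef_const[of T 0] by simp
 ultimately have vV: "V k s = v s" if "s : {0..T}" for s
  using linear_ode_unique[where Z="%s. 0", OF bilinear_mv L2_Am[OF L2w] _ _ _ that] v0 Vp(2)[OF L2w L2_emb0[OF k]] by force
 have "src k (V k) s = src k v s" "fb (V k) r s = k s" if "s : {0..T}" for s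
  unfolding src_def k_def fb_def vV[OF that, unfolded k_def] by auto
 note eq = this
 have rV: "indef T (%s. - (r s v* Am w s + src k (V k) s)) r"
  by (rule indef_cong[OF r]) (simp_all add: eq)
 have "Q k k = ip T k (%s. k s - fb (V k) r s) + r T \<bullet> V k T" by (rule second_variation_adjoint[OF k k rV])
 also have "ip T k (%s. k s - fb (V k) r s) = ip T k (%s. 0)" by (rule ip_cong) (simp add: eq)
 also have "... = 0" unfolding ip_def by simp
 \<comment> \<open>The two vectors are supported on complementary sets of coordinates.\<close>
 also have "r T \<bullet> V k T = 0"
  unfolding vV[OF T'] rT vT restrict_coords_def inner_vec_def by (intro sum.neutral) auto
 finally have Qk: "Q k k = 0" by simp
 have prk: "pr (V k T) = 0" unfolding vV[OF T'] vT restrict_coords_def proj_lead_def by (simp add: vec_eq_iff)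
 show ?thesis
 proof (rule that[of "mk T k"])
  show "mk T k : tangent" by (rule tangent_mk[OF k prk])
  show "Q (path_deriv (mk T k)) (path_deriv (mk T k)) = 0"
   using Qk Q_aeq[OF mk_path_deriv[OF k] mk_path_deriv[OF k]] by simp
  \<comment> \<open>If \<open>k\<close> were zero almost everywhere, \<open>v\<close> would vanish
    and \<open>r\<close> would solve the homogeneous adjoint equation with gradient
    \<open>k\<close>. By \<open>covector_zero\<close> the terminal value of \<open>r\<close> is then
    zero, and \<open>u\<close>, which is shared between \<open>v T\<close> and \<open>r T\<close>,
    would be zero.\<close>
  show "mk T k ~= (%t. 0)"
  proof
   assume "mk T k = (%t. 0)"
   then have "mk T k = mk T (%t. 0)" by (simp add: mk_def fun_eq_iff)
   then have "cm_norm T (mk T k) = cm_norm T (mk T (%t. 0::real^'m))" by simp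
   then have "n2 T k = 0" unfolding cm_norm_mk[OF k] cm_norm_mk[OF L2_const] by (simp add: n2_def)
   from n2_zero_imp_aeq[OF k this] have k0: "aeq T k (%s. 0)" .
   have vz: "v s = 0" if s: "s : {0..T}" for s
   proof -
    have "V k s = V (%s. 0) s" using Vp_aeq[OF aeq_emb0[OF k0]] s by simp
    also have "... = 0" using Vp_scaleR[of w 0 "emb0 (%s. 0)" s] emb0_scaleR[of 0 "%s. 0::real^'m"] by simp
    finally show ?thesis using vV[OF s] by simp
   qed
   have src0: "aeq T (%s. - (r s v* Am w s + src k v s)) (%s. - (r s v* Am w s))"
   proof -
    have "aeq T (%s. - (r s v* Am w s + src k v s)) (%s. - (r s v* Am w s + src (%s. 0) v s))"
     unfolding src_def by (rule aeq_map[OF k0, of "%s x. - (r s v* Am w s + ((SUM j:UNIV. w s $ j *R (cov w rho s v* D2m (S j) (X s) (v s))) + (SUM i:UNIV. x $ i *R (cov w rho s v* Dm (sg i) (X s)))))"])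
    moreover have "aeq T (%s. - (r s v* Am w s + src (%s. 0) v s)) (%s. - (r s v* Am w s))"
     by (rule aeqI[of "{}"])
      (auto simp: src_def vz linear_0[OF D2m_linear[OF Cb]] bounded_bilinear.zero_right[OF bilinear_vm])
    ultimately show ?thesis by (rule aeq_trans)
   qed
   have r': "indef T (%s. - (r s v* Am w s)) r" by (rule aeq_indef[OF src0 r])
   have "gradc w (r T) s = k s" if s: "s : {0..T}" for s
    unfolding gradc_def k_def fb_def cov_unique[OF r' s, symmetric] vz[OF s] by (simp add: vec_eq_iff)
   then have "aeq T (gradc w (r T)) k" by (intro aeqI[of "{}"]) auto
   from covector_zero[OF aeq_trans[OF this k0]] have "r T = 0" .
   moreover have "v T = 0" by (rule vz[OF T'])
   ultimately have "u $ j = 0" for j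
    unfolding rT vT restrict_coords_def vec_eq_iff by (cases "j : range io") (auto split: if_splits dest: spec[of _ j])
   then show False using u(1) by (simp add: vec_eq_iff)
  qed
 qed
qed

text \<open>Since the second variation is nonnegative, being positive means being nonzero on each
  nonzero tangent vector; for a square matrix, invertibility means a trivial kernel.\<close>

lemma nondegenerate_iff_nonfocal:
 "(ALL k:admissible_tangent sg0 sg T x0 a h. k ~= (%t. 0) --> energy_hessian T K h k > 0) \<longleftrightarrow>
  invertible (focal_matrix sg0 sg T (range io) (Z T))"
proof -
 have inv: "invertible (focal_matrix sg0 sg T (range io) (Z T)) \<longleftrightarrow> (ALL u. focal_matrix sg0 sg T (range io) (Z T) *v u = 0 --> u = 0)"
  unfolding invertible_left_inverse matrix_left_invertible_ker ..
 show ?thesis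
  unfolding inv admissible_tangent_eq
 proof (intro iffI ballI allI impI)
  fix u
  assume pos: "ALL k:tangent. k ~= (%t. 0) --> energy_hessian T K h k > 0" and u: "focal_matrix sg0 sg T (range io) (Z T) *v u = 0"
  show "u = 0"
  proof (rule ccontr)
   assume "u ~= 0"
   then obtain k where k: "k : tangent" "k ~= (%t. 0)" "Q (path_deriv k) (path_deriv k) = 0"
    using u by (rule focal_imp_degenerate)
   then show False using bspec[OF pos k(1)] energy_hessian_eq[OF k(1)] by simp
  qed
 next
  fix k
  assume ker: "ALL u. focal_matrix sg0 sg T (range io) (Z T) *v u = 0 --> u = 0" and k: "k : tangent" "k ~= (%t. 0)"
  have "Q (path_deriv k) (path_deriv k) ~= 0"
  proof
   assume "Q (path_deriv k) (path_deriv k) = 0"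
   from degenerate_imp_focal[OF k this] show False using ker by blast
  qed
  then show "energy_hessian T K h k > 0" unfolding energy_hessian_eq[OF k(1)] using second_variation_nonneg[OF k(1)] by simp
 qed
qed

end

theorem proposition6:
 fixes \<sigma>\<^sub>0 :: "'d::{finite,linorder} vfield"
  and \<sigma> :: "'m::finite \<Rightarrow> 'd vfield"
  and T :: real
  and x\<^sub>0 p\<^sub>0 x\<^sub>T p\<^sub>T :: "'d rvec"
  and a :: "'l::{finite,linorder} rvec"
  and h\<^sub>0 :: "'m rpath"
 assumes "CARD('l) \<le> CARD('d)"
  and "T > 0"
  and "Cb_infinity \<sigma>\<^sub>0"
  and "\<And>i. Cb_infinity (\<sigma> i)"
  and "weak_hoermander \<sigma>\<^sub>0 \<sigma> x\<^sub>0"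
  and "h\<^sub>0 \<in> minimizing \<sigma>\<^sub>0 \<sigma> T x\<^sub>0 a"
  and "invertible (malliavin_matrix \<sigma>\<^sub>0 \<sigma> T x\<^sub>0 h\<^sub>0)"
  and "p\<^sub>0 = associated_covector \<sigma>\<^sub>0 \<sigma> T x\<^sub>0 h\<^sub>0"
  and "(x\<^sub>T, p\<^sub>T) = hamiltonian_flow \<sigma>\<^sub>0 \<sigma> T 0 (x\<^sub>0, p\<^sub>0)"
 shows "(\<forall>k\<in>admissible_tangent \<sigma>\<^sub>0 \<sigma> T x\<^sub>0 a h\<^sub>0. k \<noteq> (\<lambda>t. 0) \<longrightarrow>
      energy_hessian T (admissible \<sigma>\<^sub>0 \<sigma> T x\<^sub>0 a) h\<^sub>0 k > 0) \<longleftrightarrow>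
    invertible (focal_matrix \<sigma>\<^sub>0 \<sigma> T (range (lead_index :: 'l \<Rightarrow> 'd)) (x\<^sub>T, p\<^sub>T))"
proof -
 interpret control_problem \<sigma>\<^sub>0 \<sigma> x\<^sub>0 T by unfold_locales (use assms(2-4) in auto)
 have h: "h\<^sub>0 : CM T" using assms(6) unfolding minimizing_def admissible_def by simp
 obtain G where G: "!!b. L2 T (G b)" "!!b. Vp (emb1 (path_deriv h\<^sub>0)) (emb0 (G b)) T = axis b 1"
  by (rule malliavin_surjective[OF h assms(7)]) blast
 interpret minimizing_control \<sigma>\<^sub>0 \<sigma> x\<^sub>0 T a h\<^sub>0 G
  by unfold_locales (use assms(1,6) G in auto)
 have "(x\<^sub>T, p\<^sub>T) = Z T" unfolding assms(8,9) by (rule hamiltonian_flow_eq)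
 then show ?thesis using nondegenerate_iff_nonfocal by simp
qed

end
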